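(* Let $K=\mathbb R$ or $\mathbb C$. Let $W\subset K^2$ be an open neighborhood of $w_0\in K^2$, and let $F:W\to K^2$ be a $K$-analytic mapping with $w_0$ as a regular critical point. Then: 1. (Critical value order-pair) Let $j$ be the order at $F(w_0)$ of the critical value curve in its natural parametrization. This curve has an order-pair of the form $(1,\infty)$ if $j=1$, and $(j,j+1)$ if $1<j<\infty$. 2. (Critical value order and multiplicity) $j+1=\mu(F,w_0)$. 3. (Topological model in the reals) In the case $K=\mathbb R$ and $\mu(F,w_0)<\infty$: $\mu(F,w_0)$ is even (respectively, odd) if and only if there is a pair of topological local changes of coordinates $h,H$ of $\mathbb R^2$ such that $H\circ F\circ h$ takes the standard fold form $(x,y)\mapsto(x,y^2)$ (respectively, the standard cusp form $(x,y)\mapsto(x,xy+y^3)$). In particular, outside the critical value set, the number of preimages (under $F$ restricted to a suitable small neighborhood of $w_0$, of points near $F(w_0)$) is either $0$ or $2$ in the fold case, and $1$ or $3$ in the cusp case.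
   Context: A map $F:W\to K^2$ is $K$-analytic if each component is locally a convergent power series over $K$. $J_F$ is its Jacobian determinant, $\mathcal C_F=\{J_F=0\}$ the critical set, $F(\mathcal C_F)$ the critical value set. A point $w_0\in\mathcal C_F$ is a regular critical point if $\nabla J_F(w_0)\ne(0,0)$. Natural parametrization at a regular critical point $w_0$: $\Gamma$ is the unique curve (for $t\in K$ near $0$) with $\Gamma'(t)=(-\partial_yJ_F(\Gamma(t)),\partial_xJ_F(\Gamma(t)))$, $\Gamma(0)=w_0$; it parametrizes $\mathcal C_F$ near $w_0$. The critical value curve in its natural parametrization is $\Sigma(t)=F(\Gamma(t))$, and its order $j$ is the lowest exponent occurring in the Taylor expansion of $\Sigma(t)-\Sigma(0)$ at $t=0$ ($j=\infty$ if $\Sigma$ is constant; $\infty+1=\infty$). Order-pair: a planar $K$-analytic curve $s\mapsto\beta(s)\in K^2$ has order-pair $(j,k)$ at $\beta(0)$, $1\le j<k\le\infty$, if up to reparametrization in the source and an analytic change of coordinates in the range $K^2$ it takes the form $\beta(s)=\beta(0)+(Cs^j+R_{\ge j+1}(s),\,C's^k+R_{\ge k+1}(s))$ with $CC'\neq0$, where $R_{\ge l}(s)$ is a convergent power series whose lowest power is at least $l$ (for $k=\infty$ the second component of $\beta(s)-\beta(0)$ is identically $0$). Multiplicity: for holomorphic $F:W\to\mathbb C^n$, $W\subset\mathbb C^n$ open, $\mu(F,w_0)=\limsup_{w\to w_0}\#(F^{-1}F(w)\cap X)$ with $X$ an open neighborhood of $w_0$ relatively compact in $W$ such that $F^{-1}F(w_0)\cap\overline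 X=\{w_0\}$ ($\infty$ if no such $X$ exists). For $K=\mathbb R$, $\mu(F,w_0)$ is the multiplicity at $w_0$ of the holomorphic extension of $F$ to a neighborhood of $w_0$ in $\mathbb C^2$. *)

theory Defs
  imports "HOL-Analysis.Analysis"
begin

text \<open>
  The field \<open>K\<close> is \<^typ>\<open>real\<close> or \<^typ>\<open>complex\<close>. Notions that make sense over both are
  polymorphic in \<^class>\<open>real_normed_field\<close>, and \<open>K\<close>-space of dimension two is the product
  type. Maps are total functions; only their values on the given open domain \<open>W\<close> matter.
\<close>

subsection \<open>Analytic functions and maps\<close>

definition K_analytic1 :: "('k::real_normed_field \<Rightarrow> 'k) \<Rightarrow> 'k set \<Rightarrow> bool" where
  "K_analytic1 f U \<longleftrightarrow>
     (\<forall>w\<in>U. \<exists>a. \<exists>r>0. \<forall>z. norm (z - w) < r \<longrightarrow> (\<lambda>n. a n * (z - w) ^ n) sums f z)"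

definition K_analytic2 :: "('k::real_normed_field \<times> 'k \<Rightarrow> 'k) \<Rightarrow> ('k \<times> 'k) set \<Rightarrow> bool" where
  "K_analytic2 f U \<longleftrightarrow>
     (\<forall>(x0, y0)\<in>U. \<exists>a :: nat \<Rightarrow> nat \<Rightarrow> 'k. \<exists>r>0. \<forall>x y. norm (x - x0) < r \<and> norm (y - y0) < r \<longrightarrow>
        ((\<lambda>(m, n). a m n * (x - x0) ^ m * (y - y0) ^ n) has_sum f (x, y)) UNIV)"

definition K_analytic_map ::
    "('k::real_normed_field \<times> 'k \<Rightarrow> 'k \<times> 'k) \<Rightarrow> ('k \<times> 'k) set \<Rightarrow> bool" where
  "K_analytic_map F U \<longleftrightarrow> K_analytic2 (\<lambda>w. fst (F w)) U \<and> K_analytic2 (\<lambda>w. snd (F w)) U"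

subsection \<open>Critical points\<close>

definition partial_x :: "('k::real_normed_field \<times> 'k \<Rightarrow> 'k) \<Rightarrow> 'k \<times> 'k \<Rightarrow> 'k" where
  "partial_x f w = deriv (\<lambda>x. f (x, snd w)) (fst w)"

definition partial_y :: "('k::real_normed_field \<times> 'k \<Rightarrow> 'k) \<Rightarrow> 'k \<times> 'k \<Rightarrow> 'k" where
  "partial_y f w = deriv (\<lambda>y. f (fst w, y)) (snd w)"

definition jacobian :: "('k::real_normed_field \<times> 'k \<Rightarrow> 'k \<times> 'k) \<Rightarrow> 'k \<times> 'k \<Rightarrow> 'k" where
  "jacobian F w =
     partial_x (\<lambda>p. fst (F p)) w * partial_y (\<lambda>p. snd (F p)) w
     - partial_y (\<lambda>p. fst (F p)) w * partial_x (\<lambda>p. snd (F p)) w"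

definition critical_set ::
    "('k::real_normed_field \<times> 'k) set \<Rightarrow> ('k \<times> 'k \<Rightarrow> 'k \<times> 'k) \<Rightarrow> ('k \<times> 'k) set" where
  "critical_set W F = {w\<in>W. jacobian F w = 0}"

definition regular_critical_point ::
    "('k::real_normed_field \<times> 'k) set \<Rightarrow> ('k \<times> 'k \<Rightarrow> 'k \<times> 'k) \<Rightarrow> 'k \<times> 'k \<Rightarrow> bool" where
  "regular_critical_point W F w0 \<longleftrightarrow>
     w0 \<in> critical_set W F \<and>
     (partial_x (jacobian F) w0, partial_y (jacobian F) w0) \<noteq> (0, 0)"

text \<open>
  Only the germ at \<open>0\<close> of the parametrization is determined, so it is rendered as a predicate
  on curves defined near \<open>0\<close>.
\<close>

definition natural_parametrization ::
    "('k::real_normed_field \<times> 'k) set \<Rightarrow> ('k \<times> 'k \<Rightarrow> 'k \<times> 'k) \<Rightarrow> 'k \<times> 'k \<Rightarrow> ('k \<Rightarrow> 'k \<times> 'k) \<Rightarrow> bool" where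
  "natural_parametrization W F w0 \<Gamma> \<longleftrightarrow>
     \<Gamma> 0 = w0 \<and>
     (\<exists>r>0. \<forall>t\<in>ball 0 r.
        \<Gamma> t \<in> W \<and>
        ((\<lambda>s. fst (\<Gamma> s)) has_field_derivative - partial_y (jacobian F) (\<Gamma> t)) (at t) \<and>
        ((\<lambda>s. snd (\<Gamma> s)) has_field_derivative partial_x (jacobian F) (\<Gamma> t)) (at t))"

subsection \<open>Order and order-pair of a planar curve\<close>

text \<open>The infimum of the empty set in \<^typ>\<open>enat\<close> is \<open>\<infinity>\<close>.\<close>

definition curve_order :: "('k::real_normed_field \<Rightarrow> 'k \<times> 'k) \<Rightarrow> enat" where
  "curve_order \<Sigma> = Inf {enat n |n. n \<ge> 1 \<and>
     ((deriv ^^ n) (\<lambda>t. fst (\<Sigma> t)) 0 / fact n \<noteq> 0 \<or>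
      (deriv ^^ n) (\<lambda>t. snd (\<Sigma> t)) 0 / fact n \<noteq> 0)}"

definition power_series_from :: "nat \<Rightarrow> ('k::real_normed_field \<Rightarrow> 'k) \<Rightarrow> bool" where
  "power_series_from l R \<longleftrightarrow>
     (\<exists>a. \<exists>r>0. (\<forall>n<l. a n = 0) \<and> (\<forall>s. norm s < r \<longrightarrow> (\<lambda>n. a n * s ^ n) sums R s))"

fun has_lowest_power :: "enat \<Rightarrow> ('k::real_normed_field \<Rightarrow> 'k) \<Rightarrow> bool" where
  "has_lowest_power (enat l) u \<longleftrightarrow>
     (\<exists>C R. C \<noteq> 0 \<and> power_series_from (l + 1) R \<and> (\<forall>\<^sub>F s in nhds 0. u s = C * s ^ l + R s))"
| "has_lowest_power \<infinity> u \<longleftrightarrow> (\<forall>\<^sub>F s in nhds 0. u s = 0)"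

text \<open>
  A change of coordinates near \<open>p\<close>, of the regularity expressed by the predicate \<open>A\<close>.
\<close>

definition coordinate_change ::
    "(('a::topological_space \<Rightarrow> 'a) \<Rightarrow> 'a set \<Rightarrow> bool) \<Rightarrow> 'a \<Rightarrow> ('a \<Rightarrow> 'a) \<Rightarrow> bool" where
  "coordinate_change A p f \<longleftrightarrow>
     (\<exists>U g. open U \<and> p \<in> U \<and> open (f ` U) \<and> A f U \<and> A g (f ` U) \<and> (\<forall>u\<in>U. g (f u) = u))"

definition has_order_pair :: "('k::real_normed_field \<Rightarrow> 'k \<times> 'k) \<Rightarrow> nat \<Rightarrow> enat \<Rightarrow> bool" where
  "has_order_pair \<beta> j k \<longleftrightarrow>
     1 \<le> j \<and> enat j < k \<and>
     (\<exists>r>0. K_analytic1 (\<lambda>s. fst (\<beta> s)) (ball 0 r) \<and> K_analytic1 (\<lambda>s. snd (\<beta> s)) (ball 0 r)) \<and>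
     (\<exists>\<phi> \<psi>. coordinate_change K_analytic1 0 \<phi> \<and> \<phi> 0 = 0 \<and>
        coordinate_change K_analytic_map (\<beta> 0) \<psi> \<and>
        has_lowest_power (enat j) (\<lambda>s. fst (\<psi> (\<beta> (\<phi> s)) - \<psi> (\<beta> 0))) \<and>
        has_lowest_power k (\<lambda>s. snd (\<psi> (\<beta> (\<phi> s)) - \<psi> (\<beta> 0))))"

subsection \<open>Multiplicity\<close>

definition ecard :: "'a set \<Rightarrow> enat" where
  "ecard A = (if finite A then enat (card A) else \<infinity>)"

definition isolating_nbhd ::
    "(complex \<times> complex) set \<Rightarrow> (complex \<times> complex \<Rightarrow> complex \<times> complex) \<Rightarrow>
     complex \<times> complex \<Rightarrow> (complex \<times> complex) set \<Rightarrow> bool" where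
  "isolating_nbhd W F w0 X \<longleftrightarrow>
     open X \<and> w0 \<in> X \<and> compact (closure X) \<and> closure X \<subseteq> W \<and>
     {w\<in>closure X. F w = F w0} = {w0}"

text \<open>The upper limit below does not depend on the isolating neighbourhood \<open>X\<close>.\<close>

definition map_multiplicity ::
    "(complex \<times> complex) set \<Rightarrow> (complex \<times> complex \<Rightarrow> complex \<times> complex) \<Rightarrow>
     complex \<times> complex \<Rightarrow> enat" where
  "map_multiplicity W F w0 =
     (if \<exists>X. isolating_nbhd W F w0 X
      then THE m. \<exists>X. isolating_nbhd W F w0 X \<and>
             m = Limsup (at w0) (\<lambda>w. ecard {x\<in>X. F x = F w})
      else \<infinity>)"

definition complexify :: "real \<times> real \<Rightarrow> complex \<times> complex" where
  "complexify w = (of_real (fst w), of_real (snd w))"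

definition holomorphic_extension ::
    "(real \<times> real \<Rightarrow> real \<times> real) \<Rightarrow> real \<times> real \<Rightarrow>
     (complex \<times> complex) set \<Rightarrow> (complex \<times> complex \<Rightarrow> complex \<times> complex) \<Rightarrow> bool" where
  "holomorphic_extension F w0 U G \<longleftrightarrow>
     open U \<and> complexify w0 \<in> U \<and> K_analytic_map G U \<and>
     (\<forall>\<^sub>F w in nhds w0. G (complexify w) = complexify (F w))"

text \<open>Two holomorphic extensions agree near the point, so they have the same multiplicity.\<close>

definition real_map_multiplicity ::
    "(real \<times> real \<Rightarrow> real \<times> real) \<Rightarrow> real \<times> real \<Rightarrow> enat" where
  "real_map_multiplicity F w0 =
     (THE m. \<exists>U G. holomorphic_extension F w0 U G \<and> m = map_multiplicity U G (complexify w0))"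

subsection \<open>Topological normal forms\<close>

definition fold_form :: "real \<times> real \<Rightarrow> real \<times> real" where
  "fold_form = (\<lambda>(x, y). (x, y ^ 2))"

definition cusp_form :: "real \<times> real \<Rightarrow> real \<times> real" where
  "cusp_form = (\<lambda>(x, y). (x, x * y + y ^ 3))"

text \<open>
  The coordinate change \<open>h\<close> in the source sends the origin to \<open>w0\<close>: the model is the germ of
  \<open>G\<close> at the origin, not at an arbitrary point.
\<close>

definition topological_model ::
    "(real \<times> real) set \<Rightarrow> (real \<times> real \<Rightarrow> real \<times> real) \<Rightarrow> real \<times> real \<Rightarrow>
     (real \<times> real \<Rightarrow> real \<times> real) \<Rightarrow> bool" where
  "topological_model W F w0 G \<longleftrightarrow>
     (\<exists>U h h' N H H'.
        open U \<and> (0, 0) \<in> U \<and> open (h ` U) \<and> h ` U \<subseteq> W \<and> homeomorphism U (h ` U) h h' \<and>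
        h (0, 0) = w0 \<and>
        open N \<and> F ` h ` U \<subseteq> N \<and> open (H ` N) \<and> homeomorphism N (H ` N) H H' \<and>
        (\<forall>p\<in>U. H (F (h p)) = G p))"

text \<open>
  The critical values that are excluded are those of the restriction of \<open>F\<close> to the small
  neighbourhood \<open>N\<close>.
\<close>

definition local_preimage_counts ::
    "(real \<times> real) set \<Rightarrow> (real \<times> real \<Rightarrow> real \<times> real) \<Rightarrow> real \<times> real \<Rightarrow> enat set \<Rightarrow> bool" where
  "local_preimage_counts W F w0 S \<longleftrightarrow>
     (\<forall>O'. open O' \<and> w0 \<in> O' \<longrightarrow>
        (\<exists>N M. open N \<and> w0 \<in> N \<and> N \<subseteq> W \<inter> O' \<and> open M \<and> F w0 \<in> M \<and>
           (\<forall>z\<in>M - F ` critical_set N F. ecard {w\<in>N. F w = z} \<in> S)))"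

end

theory Submission
  imports Defs "HOL-Complex_Analysis.Complex_Analysis"
begin

text \<open>
  Some component \<open>f\<close> of \<open>F = (f, g)\<close> has nonzero gradient at \<open>w\<^sub>0\<close>. In coordinates \<open>(u, s)\<close>
  with \<open>u = f\<close> and \<open>s\<close> linear, \<open>F\<close> becomes \<open>(u, s) \<mapsto> (u, h (u, s))\<close>, and \<open>\<partial>h/\<partial>s\<close> is the Jacobian
  determinant up to a unit. The components of \<open>\<Sigma>'\<close> satisfy \<open>\<Sigma>\<^sub>2' = k \<Sigma>\<^sub>1'\<close>, and regularity of
  \<open>w\<^sub>0\<close> gives \<open>k' \<noteq> 0\<close> at \<open>0\<close> if \<open>j > 1\<close>; this yields the order-pair \<open>(j, j + 1)\<close>.
  The critical curve touches the line \<open>u = u\<^sub>0\<close> to order \<open>j\<close>, so \<open>h (u\<^sub>0, \<cdot>)\<close> has order \<open>j + 1\<close>.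
  Hence \<open>F\<close> takes some values \<open>j + 1\<close> times near \<open>w\<^sub>0\<close>, and none more often, because a holomorphic
  function whose \<open>N\<close>-th derivative is close to a nonzero constant has at most \<open>N\<close> zeros.
  Over the reals \<open>\<partial>h/\<partial>s\<close> changes sign once on each line \<open>u = c\<close> if \<open>j\<close> is odd; if \<open>j\<close> is even
  it does so twice for \<open>c\<close> on one side of \<open>u\<^sub>0\<close> and never on the other. Matching the monotone
  branches of \<open>h (c, \<cdot>)\<close> with those of the fold or the cusp gives the topological model.
\<close>

section \<open>Holomorphic functions of two variables\<close>

text \<open>Working with functions that are continuous and separately holomorphic, rather than with
  power series, keeps sums, quotients, partial derivatives and compositions with inverse maps
  simple; Cauchy's estimates lead back to double power series. For a real map all derivatives are
  computed on a holomorphic extension and read off at real points. This requires that the real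
  natural parametrization be the restriction of the complex one, so uniqueness for the Hamiltonian
  system is proved for complex curves with real time. Regularity enters through a dichotomy. If
  \<open>j = 1\<close>, the critical curve crosses the line \<open>u = u0\<close> transversally and
  \<open>h\<close> has nonzero second derivative in \<open>s\<close>. If \<open>j > 1\<close>, it is
  tangent to that line; the gradients of \<open>f\<close> and of the Jacobian are then dependent and
  nonzero, which makes the mixed derivative of \<open>h\<close> nonzero and \<open>s\<close> a
  parameter on the curve. The factor \<open>k\<close> is \<open>\<partial>h/\<partial>u\<close>
  along the curve, so for \<open>j > 1\<close> its derivative at \<open>0\<close> is this mixed
  derivative times the velocity of \<open>s\<close>.\<close>

definition holo2 :: "(complex \<times> complex \<Rightarrow> complex) \<Rightarrow> (complex \<times> complex) set \<Rightarrow> bool" where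
  "holo2 f S \<longleftrightarrow> open S \<and> continuous_on S f \<and>
     (\<forall>p\<in>S. (\<lambda>x. f (x, snd p)) field_differentiable at (fst p) \<and>
            (\<lambda>y. f (fst p, y)) field_differentiable at (snd p))"

lemma holo2_open: "holo2 f S \<Longrightarrow> open S"
  and holo2_continuous: "holo2 f S \<Longrightarrow> continuous_on S f"
  by (auto simp: holo2_def)

lemma holo2_slice_x: "holo2 f S \<Longrightarrow> (\<And>x. x \<in> A \<Longrightarrow> (x, y) \<in> S) \<Longrightarrow> (\<lambda>x. f (x, y)) holomorphic_on A"
  unfolding holomorphic_on_def holo2_def by (metis field_differentiable_at_within fst_conv snd_conv)

lemma holo2_slice_y: "holo2 f S \<Longrightarrow> (\<And>y. y \<in> A \<Longrightarrow> (x, y) \<in> S) \<Longrightarrow> (\<lambda>y. f (x, y)) holomorphic_on A"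
  unfolding holomorphic_on_def holo2_def by (metis field_differentiable_at_within fst_conv snd_conv)

lemma holo2_subset: "holo2 f S \<Longrightarrow> open T \<Longrightarrow> T \<subseteq> S \<Longrightarrow> holo2 f T"
  by (auto simp: holo2_def intro: continuous_on_subset)

lemma open_swap_image: "open S \<Longrightarrow> open (prod.swap ` S :: ('a::topological_space \<times> 'b::topological_space) set)"
proof -
  assume "open S"
  have "prod.swap ` S = prod.swap -` S" by (auto simp: image_iff intro!: bexI[where x="prod.swap _"])
  moreover have "open (prod.swap -` S)"
    using \<open>open S\<close> by (rule open_vimage) (rule continuous_on_swap)
  ultimately show ?thesis by simp
qed

lemma holo2_swap: "holo2 f S \<Longrightarrow> holo2 (f \<circ> prod.swap) (prod.swap ` S)"
  unfolding holo2_def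
  by (auto simp: open_swap_image image_image intro!: continuous_on_compose2[of S f _ prod.swap] continuous_on_swap)

lemma open_bidisc:
  fixes S :: "('a::metric_space \<times> 'a) set"
  assumes "open S" "(x0, y0) \<in> S"
  obtains r where "r > 0" "cball x0 r \<times> cball y0 r \<subseteq> S"
proof -
  obtain A B where AB: "open A" "open B" "x0 \<in> A" "y0 \<in> B" "A \<times> B \<subseteq> S"
    using open_prod_elim[OF assms] by (metis mem_Times_iff fst_conv snd_conv)
  obtain r1 where r1: "r1 > 0" "cball x0 r1 \<subseteq> A" using AB open_contains_cball by meson
  obtain r2 where r2: "r2 > 0" "cball y0 r2 \<subseteq> B" using AB open_contains_cball by meson
  show ?thesis
    by (rule that[of "min r1 r2"]) (use r1 r2 AB in force)+
qed

section \<open>Double power series are separately holomorphic\<close>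

lemma holomorphic_uniform_limit':
  assumes "uniform_limit (cball z r) f g F" "F \<noteq> bot"
    and "\<And>n. continuous_on (cball z r) (f n)" "\<And>n. f n holomorphic_on ball z r"
  shows "g holomorphic_on ball z r"
  by (rule holomorphic_uniform_limit[OF _ assms(1,2)]) (use assms in auto)

text \<open>On each smaller closed bidisc of radius \<rho> the series converges uniformly by the
  Weierstrass M-test; the majorant is the absolutely summable series at the point
  \<open>(x0 + \<rho>, y0 + \<rho>)\<close>. Continuity and holomorphy in each variable pass to the
  uniform limit.\<close>

lemma power_series2_holo2:
  fixes a :: "nat \<Rightarrow> nat \<Rightarrow> complex"
  assumes "\<And>x y. norm (x - x0) < r \<Longrightarrow> norm (y - y0) < r \<Longrightarrow>
             ((\<lambda>(m, n). a m n * (x - x0) ^ m * (y - y0) ^ n) has_sum f (x, y)) UNIV"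
  shows "holo2 f (ball x0 r \<times> ball y0 r)"
proof -
  define q where "q = (\<lambda>(m, n) (x, y). a m n * (x - x0) ^ m * (y - y0) ^ n)"
  have M: "uniform_limit (cball x0 \<rho> \<times> cball y0 \<rho>) (\<lambda>X p. \<Sum>mn\<in>X. q mn p) f (finite_subsets_at_top UNIV)"
    if \<rho>: "0 \<le> \<rho>" "\<rho> < r" for \<rho>
  proof (rule Weierstrass_m_test_general')
    have "(\<lambda>(m, n). a m n * of_real \<rho> ^ m * of_real \<rho> ^ n) summable_on UNIV"
      using assms[of "x0 + of_real \<rho>" "y0 + of_real \<rho>"] \<rho> by (auto simp: summable_on_def)
    then show "(\<lambda>mn. norm (case mn of (m, n) \<Rightarrow> a m n * of_real \<rho> ^ m * of_real \<rho> ^ n)) summable_on UNIV"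
      by (simp add: summable_on_iff_abs_summable_on_complex)
    show "norm (q mn p) \<le> norm (case mn of (m, n) \<Rightarrow> a m n * of_real \<rho> ^ m * of_real \<rho> ^ n)"
      if "p \<in> cball x0 \<rho> \<times> cball y0 \<rho>" for mn p
      using that \<rho> by (auto simp: q_def norm_mult norm_power dist_norm norm_minus_commute
        split: prod.splits intro!: mult_mono power_mono)
    show "((\<lambda>mn. q mn p) has_sum f p) UNIV" if "p \<in> cball x0 \<rho> \<times> cball y0 \<rho>" for p
      using that \<rho> assms[of "fst p" "snd p"]
      by (auto simp: q_def case_prod_unfold dist_norm norm_minus_commute)
  qed
  have cont: "continuous_on T (\<lambda>p. \<Sum>mn\<in>X. q mn p)" for T X
    unfolding q_def case_prod_unfold by (intro continuous_intros)
  have *: "\<exists>\<rho>. norm (fst p - x0) < \<rho> \<and> norm (snd p - y0) < \<rho> \<and> 0 \<le> \<rho> \<and> \<rho> < r"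
    if "p \<in> ball x0 r \<times> ball y0 r" for p
  proof -
    have "max (norm (fst p - x0)) (norm (snd p - y0)) < r"
      using that by (auto simp: dist_norm norm_minus_commute)
    from dense[OF this] obtain \<rho> where "max (norm (fst p - x0)) (norm (snd p - y0)) < \<rho>" "\<rho> < r" by blast
    then show ?thesis by (intro exI[of _ \<rho>]) (auto intro: order.trans[OF norm_ge_zero less_imp_le])
  qed
  show ?thesis unfolding holo2_def
  proof (intro conjI ballI)
    show "open (ball x0 r \<times> ball y0 r)" by (simp add: open_Times)
    show "continuous_on (ball x0 r \<times> ball y0 r) f"
    proof (rule continuous_at_imp_continuous_on, rule ballI)
      fix p assume "p \<in> ball x0 r \<times> ball y0 r"
      then obtain \<rho> where \<rho>: "norm (fst p - x0) < \<rho>" "norm (snd p - y0) < \<rho>" "0 \<le> \<rho>" "\<rho> < r" using * by blast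
      have "continuous_on (cball x0 \<rho> \<times> cball y0 \<rho>) f"
        by (rule uniform_limit_theorem[OF _ M]) (use \<rho> cont in auto)
      then have "continuous_on (ball x0 \<rho> \<times> ball y0 \<rho>) f"
        by (rule continuous_on_subset) auto
      then show "isCont f p" using \<rho>
        by (subst (asm) continuous_on_eq_continuous_at)
          (force simp: open_Times dist_norm norm_minus_commute mem_Times_iff)+
    qed
  next
    fix p assume p: "p \<in> ball x0 r \<times> ball y0 r"
    then obtain \<rho> where \<rho>: "norm (fst p - x0) < \<rho>" "norm (snd p - y0) < \<rho>" "0 \<le> \<rho>" "\<rho> < r" using * by blast
    have "uniform_limit (cball x0 \<rho>) (\<lambda>X x. \<Sum>mn\<in>X. q mn (x, snd p)) (\<lambda>x. f (x, snd p)) (finite_subsets_at_top UNIV)"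
      using M[OF \<rho>(3,4)] \<rho>(2) unfolding uniform_limit_iff
      by (fastforce elim!: eventually_mono simp: dist_norm norm_minus_commute)
    then have "(\<lambda>x. f (x, snd p)) holomorphic_on ball x0 \<rho>"
      by (rule holomorphic_uniform_limit')
         (auto simp: q_def case_prod_unfold intro!: continuous_intros holomorphic_intros)
    then show "(\<lambda>x. f (x, snd p)) field_differentiable at (fst p)"
      using \<rho> by (auto simp: holomorphic_on_open field_differentiable_def dist_norm norm_minus_commute)
    have "uniform_limit (cball y0 \<rho>) (\<lambda>X y. \<Sum>mn\<in>X. q mn (fst p, y)) (\<lambda>y. f (fst p, y)) (finite_subsets_at_top UNIV)"
      using M[OF \<rho>(3,4)] \<rho>(1) unfolding uniform_limit_iff
      by (fastforce elim!: eventually_mono simp: dist_norm norm_minus_commute)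
    then have "(\<lambda>y. f (fst p, y)) holomorphic_on ball y0 \<rho>"
      by (rule holomorphic_uniform_limit')
         (auto simp: q_def case_prod_unfold intro!: continuous_intros holomorphic_intros)
    then show "(\<lambda>y. f (fst p, y)) field_differentiable at (snd p)"
      using \<rho> by (auto simp: holomorphic_on_open field_differentiable_def dist_norm norm_minus_commute)
  qed
qed

lemma holo2_local:
  assumes "\<And>p. p \<in> S \<Longrightarrow> \<exists>T. p \<in> T \<and> holo2 f T \<and> T \<subseteq> S"
  shows "holo2 f S"
proof -
  have "open S" by (subst open_subopen) (use assms holo2_open in blast)
  moreover have "isCont f p" if "p \<in> S" for p
    using assms[OF that] holo2_open holo2_continuous continuous_on_eq_continuous_at by blast
  moreover have "(\<lambda>x. f (x, snd p)) field_differentiable at (fst p) \<and> (\<lambda>y. f (fst p, y)) field_differentiable at (snd p)"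
    if "p \<in> S" for p
    using assms[OF that] unfolding holo2_def by blast
  ultimately show ?thesis unfolding holo2_def
    by (auto intro: continuous_at_imp_continuous_on)
qed

lemma K_analytic2_imp_holo2:
  assumes "K_analytic2 f U" "open U"
  shows "holo2 f U"
proof (rule holo2_local)
  fix p assume "p \<in> U"
  obtain x0 y0 where p: "p = (x0, y0)" by fastforce
  obtain a r where r: "r > 0" and a: "\<And>x y. norm (x - x0) < r \<Longrightarrow> norm (y - y0) < r \<Longrightarrow>
             ((\<lambda>(m, n). a m n * (x - x0) ^ m * (y - y0) ^ n) has_sum f (x, y)) UNIV"
    using assms(1) \<open>p \<in> U\<close> unfolding K_analytic2_def p by fast
  have "holo2 f (ball x0 r \<times> ball y0 r)" by (rule power_series2_holo2[OF a])
  then have "holo2 f ((ball x0 r \<times> ball y0 r) \<inter> U)"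
    by (rule holo2_subset) (auto simp: open_Times open_Int assms)
  then show "\<exists>T. p \<in> T \<and> holo2 f T \<and> T \<subseteq> U"
    using \<open>p \<in> U\<close> r by (intro exI[of _ "(ball x0 r \<times> ball y0 r) \<inter> U"]) (auto simp: p)
qed

text \<open>Taylor's formula of first order, with the second derivative bounded by Cauchy's
  inequality on discs of radius \<rho>: \<open>x\<close> and \<open>x + h\<close> lie within
  \<open>2 * \<rho>\<close> of \<open>c\<close>, and discs of radius \<rho> about such points stay
  inside \<open>ball c (4 * \<rho>)\<close>. The bound sees \<open>g\<close> only through
  \<open>M\<close>, which makes it uniform when \<open>g\<close> depends on a parameter.\<close>

lemma difference_quotient_bound:
  fixes g :: "complex \<Rightarrow> complex"
  assumes g: "g holomorphic_on ball c (4 * \<rho>)" and \<rho>: "\<rho> > 0"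
    and M: "\<And>z. z \<in> ball c (4 * \<rho>) \<Longrightarrow> norm (g z) < M"
    and x: "x \<in> cball c \<rho>" and h: "norm h \<le> \<rho>" "h \<noteq> 0"
  shows "norm ((g (x + h) - g x) / h - deriv g x) \<le> 2 * M / \<rho> ^ 2 * norm h"
proof -
  have d: "((deriv ^^ i) g has_field_derivative (deriv ^^ Suc i) g z) (at z)" if "z \<in> ball c (4 * \<rho>)" for z i
    using holomorphic_higher_deriv[OF g, of i] that
    by (auto simp: holomorphic_derivI)
  have "norm (g (x + h) - (\<Sum>i\<le>1. (deriv ^^ i) g x * (x + h - x) ^ i / fact i))
      \<le> 2 * M / \<rho>\<^sup>2 * norm (x + h - x) ^ Suc 1 / fact 1"
  proof (rule complex_Taylor[of "cball c (2 * \<rho>)" 1 "\<lambda>i. (deriv ^^ i) g", simplified funpow_0])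
    show "((deriv ^^ i) g has_field_derivative (deriv ^^ Suc i) g z) (at z within cball c (2 * \<rho>))"
      if "z \<in> cball c (2 * \<rho>)" for i z
      by (rule has_field_derivative_at_within[OF d]) (use that \<rho> in auto)
    show "cmod ((deriv ^^ Suc 1) g z) \<le> 2 * M / \<rho>\<^sup>2" if z: "z \<in> cball c (2 * \<rho>)" for z
    proof -
      have sub: "cball z \<rho> \<subseteq> ball c (4 * \<rho>)"
      proof
        fix w assume "w \<in> cball z \<rho>"
        then show "w \<in> ball c (4 * \<rho>)" using z \<rho> dist_triangle[of c w z] by auto
      qed
      have "cmod ((deriv ^^ 2) g z) \<le> fact 2 * M / \<rho>\<^sup>2"
      proof (rule Cauchy_inequality)
        show "g holomorphic_on ball z \<rho>"
          using sub ball_subset_cball by (blast intro: holomorphic_on_subset[OF g])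
        show "continuous_on (cball z \<rho>) g"
          using sub by (intro holomorphic_on_imp_continuous_on holomorphic_on_subset[OF g])
        show "norm (g w) \<le> M" if "norm (z - w) = \<rho>" for w
        proof -
          have "w \<in> cball z \<rho>" using that by (simp add: dist_norm)
          then show ?thesis using sub M[of w] by (meson less_imp_le subsetD)
        qed
      qed (use \<rho> in auto)
      then show ?thesis by (simp add: numeral_2_eq_2)
    qed
    have "dist c (x + h) \<le> dist c x + norm h"
      using dist_triangle[of c "x + h" x] by (simp add: dist_norm)
    then show "x \<in> cball c (2 * \<rho>)" "x + h \<in> cball c (2 * \<rho>)"
      using x h \<rho> by auto
  qed auto
  then have "norm (g (x + h) - g x - deriv g x * h) \<le> 2 * M / \<rho>\<^sup>2 * norm h ^ 2"
    by (simp add: algebra_simps power2_eq_square)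
  then have "norm (g (x + h) - g x - deriv g x * h) / norm h \<le> 2 * M / \<rho>\<^sup>2 * norm h"
    using h by (subst pos_divide_le_eq) (simp_all add: power2_eq_square mult.assoc)
  moreover have "(g (x + h) - g x) / h - deriv g x = (g (x + h) - g x - deriv g x * h) / h"
    using h by (simp add: field_simps)
  ultimately show ?thesis by (simp add: norm_divide)
qed

text \<open>In \<open>x\<close> this is a derivative of a holomorphic function. For continuity and
  for holomorphy in \<open>y\<close>, the difference quotients with steps tending to
  \<open>0\<close> have both properties and converge uniformly near the point, by
  \<open>difference_quotient_bound\<close> with a common bound of \<open>f\<close> on a
  bidisc.\<close>

lemma holo2_partial_x:
  assumes "holo2 f S"
  shows "holo2 (partial_x f) S"
proof (rule holo2_local)
  fix p assume "p \<in> S"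
  obtain x0 y0 where p: "p = (x0, y0)" by fastforce
  obtain r where r: "r > 0" "cball x0 r \<times> cball y0 r \<subseteq> S"
    using open_bidisc holo2_open[OF assms] \<open>p \<in> S\<close> p by metis
  define \<rho> where "\<rho> = r / 4"
  have \<rho>: "\<rho> > 0" "4 * \<rho> = r" using r by (auto simp: \<rho>_def)
  have "compact (f ` (cball x0 r \<times> cball y0 r))"
    by (intro compact_continuous_image continuous_on_subset[OF holo2_continuous[OF assms]])
      (use r in \<open>auto intro: compact_Times\<close>)
  then obtain M where M: "\<And>x y. x \<in> cball x0 r \<Longrightarrow> y \<in> cball y0 r \<Longrightarrow> norm (f (x, y)) < M"
    using bounded_pos_less[of "f ` (cball x0 r \<times> cball y0 r)"] compact_imp_bounded by blast
  define h where "h = (\<lambda>n::nat. of_real (\<rho> / (of_nat n + 1)) :: complex)"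
  have h: "h n \<noteq> 0" "norm (h n) \<le> \<rho>" for n
  proof -
    show "h n \<noteq> 0" using \<rho> by (simp add: h_def del: of_real_divide)
    have "norm (h n) = \<rho> / (real n + 1)" using \<rho> unfolding h_def norm_of_real by simp
    also have "\<dots> \<le> \<rho>" using \<rho> by (simp add: field_simps)
    finally show "norm (h n) \<le> \<rho>" .
  qed
  have h0: "h \<longlonglongrightarrow> 0"
    unfolding h_def using tendsto_mult[OF tendsto_const[of \<rho>] LIMSEQ_inverse_real_of_nat]
    by (intro tendsto_of_real[where a=0, simplified]) (simp add: divide_inverse algebra_simps)
  define q where "q n w = (f (fst w + h n, snd w) - f w) / h n" for n w
  have "\<forall>\<^sub>F n in sequentially. \<forall>w\<in>cball x0 \<rho> \<times> cball y0 \<rho>. dist (q n w) (partial_x f w) < e" if "e > 0" for e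
  proof -
    have "(\<lambda>n. 2 * M / \<rho>\<^sup>2 * norm (h n)) \<longlonglongrightarrow> 2 * M / \<rho>\<^sup>2 * 0"
      using h0 by (intro tendsto_intros) (simp add: tendsto_norm_zero)
    then have "\<forall>\<^sub>F n in sequentially. 2 * M / \<rho>\<^sup>2 * norm (h n) < e"
      using \<open>e > 0\<close> by (intro order_tendstoD(2)) auto
    then show ?thesis
    proof eventually_elim
      case (elim n)
      show ?case
      proof
        fix w assume w: "w \<in> cball x0 \<rho> \<times> cball y0 \<rho>"
        have "norm (((\<lambda>x. f (x, snd w)) (fst w + h n) - (\<lambda>x. f (x, snd w)) (fst w)) / h n
               - deriv (\<lambda>x. f (x, snd w)) (fst w)) \<le> 2 * M / \<rho>\<^sup>2 * norm (h n)"
        proof (rule difference_quotient_bound)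
          show "(\<lambda>x. f (x, snd w)) holomorphic_on ball x0 (4 * \<rho>)"
            by (rule holo2_slice_x[OF assms]) (use r \<rho> w in force)
        qed (use h w M \<rho> in auto)
        then show "dist (q n w) (partial_x f w) < e"
          using elim by (simp add: q_def partial_x_def dist_norm)
      qed
    qed
  qed
  then have U: "uniform_limit (cball x0 \<rho> \<times> cball y0 \<rho>) q (partial_x f) sequentially"
    by (auto simp: uniform_limit_iff)
  have shift: "x + h n \<in> cball x0 r" if "x \<in> cball x0 \<rho>" for n x
    using dist_triangle[of x0 "x + h n" x] that h(2)[of n] \<rho> by (auto simp: dist_norm)
  have cq: "continuous_on (cball x0 \<rho> \<times> cball y0 \<rho>) (q n)" for n
    unfolding q_def
    by (intro continuous_intros continuous_on_compose2[OF holo2_continuous[OF assms]])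
      (use h shift r \<rho> in \<open>force intro!: continuous_on_subset[OF holo2_continuous[OF assms]] continuous_intros\<close>)+
  have cont: "continuous_on (cball x0 \<rho> \<times> cball y0 \<rho>) (partial_x f)"
    by (rule uniform_limit_theorem[OF _ U]) (use cq in auto)
  have hx: "(\<lambda>x. partial_x f (x, y)) holomorphic_on ball x0 \<rho>" if "y \<in> cball y0 \<rho>" for y
    unfolding partial_x_def fst_conv snd_conv
    by (intro holomorphic_deriv holo2_slice_x[OF assms]) (use that r \<rho> in auto)
  have hy: "(\<lambda>y. partial_x f (x, y)) holomorphic_on ball y0 \<rho>" if x: "x \<in> cball x0 \<rho>" for x
  proof (rule holomorphic_uniform_limit'[where z = y0 and r = \<rho> and f = "\<lambda>n y. q n (x, y)" and g = "\<lambda>y. partial_x f (x, y)" and F = sequentially])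
    show "uniform_limit (cball y0 \<rho>) (\<lambda>n y. q n (x, y)) (\<lambda>y. partial_x f (x, y)) sequentially"
      using U x unfolding uniform_limit_iff by (fastforce elim!: eventually_mono)
    show "continuous_on (cball y0 \<rho>) (\<lambda>y. q n (x, y))" for n
      by (rule continuous_on_compose2[OF cq]) (use x in \<open>auto intro!: continuous_intros\<close>)
    show "(\<lambda>y. q n (x, y)) holomorphic_on ball y0 \<rho>" for n
      unfolding q_def fst_conv snd_conv
      by (intro holomorphic_intros holo2_slice_y[OF assms])
         (use h shift[OF x] r \<rho> x in \<open>force+\<close>)
  qed (rule sequentially_bot)
  have "holo2 (partial_x f) (ball x0 \<rho> \<times> ball y0 \<rho>)"
    unfolding holo2_def
  proof (intro conjI ballI)
    show "continuous_on (ball x0 \<rho> \<times> ball y0 \<rho>) (partial_x f)"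
      by (rule continuous_on_subset[OF cont]) auto
    fix w assume w: "w \<in> ball x0 \<rho> \<times> ball y0 \<rho>"
    then show "(\<lambda>x. partial_x f (x, snd w)) field_differentiable at (fst w)"
      "(\<lambda>y. partial_x f (fst w, y)) field_differentiable at (snd w)"
      using hx[of "snd w"] hy[of "fst w"] by (auto simp: holomorphic_on_open field_differentiable_def)
  qed (auto simp: open_Times)
  then show "\<exists>T. p \<in> T \<and> holo2 (partial_x f) T \<and> T \<subseteq> S"
    using r \<rho> by (intro exI[of _ "ball x0 \<rho> \<times> ball y0 \<rho>"]) (auto simp: p subset_iff)
qed

lemma partial_y_eq_swap: "partial_y f = partial_x (f \<circ> prod.swap) \<circ> prod.swap"
  by (auto simp: partial_x_def partial_y_def fun_eq_iff)

lemma holo2_partial_y: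
  assumes "holo2 f S"
  shows "holo2 (partial_y f) S"
  using holo2_swap[OF holo2_partial_x[OF holo2_swap[OF assms]]]
  by (simp add: partial_y_eq_swap image_image)

lemma blinfun_mult_right_apply [simp]: "blinfun_apply (blinfun_mult_right c) h = c * h"
  by (simp add: blinfun_mult_right.rep_eq)

text \<open>Two partial derivatives give a total derivative because one of them, here
  \<open>partial_y f\<close>, is continuous.\<close>

lemma has_derivative_partials:
  fixes f :: "complex \<times> complex \<Rightarrow> complex"
  assumes "holo2 f S" "p \<in> S"
  shows "(f has_derivative (\<lambda>h. partial_x f p * fst h + partial_y f p * snd h)) (at p)"
proof -
  obtain x0 y0 where p: "p = (x0, y0)" by fastforce
  obtain r where r: "r > 0" "cball x0 r \<times> cball y0 r \<subseteq> S"
    using open_bidisc holo2_open[OF assms(1)] \<open>p \<in> S\<close> p by metis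
  have x: "((\<lambda>x. f (x, y)) has_field_derivative partial_x f (x, y)) (at x)"
    and y: "((\<lambda>y. f (x, y)) has_field_derivative partial_y f (x, y)) (at y)" if "(x, y) \<in> S" for x y
    using assms(1) that unfolding holo2_def partial_x_def partial_y_def
    by (auto simp: DERIV_deriv_iff_field_differentiable)
  have c: "isCont (partial_y f) p"
    using holo2_partial_y[OF assms(1)] assms(2) by (metis holo2_def continuous_on_eq_continuous_at)
  have "((\<lambda>(x, y). f (x, y)) has_derivative (\<lambda>(tx, ty). partial_x f (x0, y0) * tx + blinfun_mult_right (partial_y f (x0, y0)) ty))
     (at (x0, y0) within ball x0 r \<times> ball y0 r)"
  proof (rule has_derivative_partialsI)
    show "((\<lambda>x. f (x, y0)) has_derivative (*) (partial_x f (x0, y0))) (at x0 within ball x0 r)"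
      by (rule has_derivative_at_withinI[OF x[unfolded has_field_derivative_def]]) (use assms(2) p in simp)
    show "((\<lambda>y. f (a, y)) has_derivative blinfun_apply (blinfun_mult_right (partial_y f (a, b)))) (at b within ball y0 r)"
      if "a \<in> ball x0 r" "b \<in> ball y0 r" for a b
      unfolding blinfun_mult_right.rep_eq
      by (rule has_derivative_at_withinI) (use y[of a b] r that in \<open>auto simp: has_field_derivative_def subset_iff\<close>)
    show "continuous (at (x0, y0) within ball x0 r \<times> ball y0 r) (\<lambda>(x, y). blinfun_mult_right (partial_y f (x, y)))"
    proof (rule continuous_at_imp_continuous_at_within)
      show "isCont (\<lambda>(x, y). blinfun_mult_right (partial_y f (x, y))) (x0, y0)"
        using c p by (auto simp: case_prod_unfold intro!: bounded_linear.continuous[OF bounded_linear_blinfun_mult_right])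
    qed
  qed (use r in auto)
  then show ?thesis
    using r by (simp add: p case_prod_unfold at_within_open[OF _ open_Times])
qed

text \<open>The derivative is asked to be complex linear; this is the form in which compositions and
  inverse maps deliver it.\<close>

lemma holo2I:
  assumes "open S" and d: "\<And>p. p \<in> S \<Longrightarrow> \<exists>a b. (f has_derivative (\<lambda>h. a * fst h + b * snd h)) (at p)"
  shows "holo2 f S"
  unfolding holo2_def
proof (intro conjI ballI)
  show "continuous_on S f"
    using d has_derivative_continuous by (blast intro: continuous_at_imp_continuous_on)
  fix p assume "p \<in> S"
  then obtain a b where ab: "(f has_derivative (\<lambda>h. a * fst h + b * snd h)) (at (fst p, snd p))"
    unfolding prod.collapse using d by blast
  have "((\<lambda>x. f (x, snd p)) has_derivative (\<lambda>h. a * fst (h, 0::complex) + b * snd (h, 0::complex))) (at (fst p))"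
    by (rule has_derivative_compose[where f = "\<lambda>x. (x, snd p)", OF _ ab])
       (auto intro!: derivative_eq_intros)
  then show "(\<lambda>x. f (x, snd p)) field_differentiable at (fst p)"
    by (auto simp: field_differentiable_def has_field_derivative_def)
  have "((\<lambda>y. f (fst p, y)) has_derivative (\<lambda>h. a * fst (0::complex, h) + b * snd (0::complex, h))) (at (snd p))"
    by (rule has_derivative_compose[where f = "\<lambda>y. (fst p, y)", OF _ ab])
       (auto intro!: derivative_eq_intros)
  then show "(\<lambda>y. f (fst p, y)) field_differentiable at (snd p)"
    by (auto simp: field_differentiable_def has_field_derivative_def)
qed (rule assms)

lemma partials_unique:
  fixes f :: "'k::real_normed_field \<times> 'k \<Rightarrow> 'k"
  assumes "(f has_derivative (\<lambda>h. a * fst h + b * snd h)) (at p)"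
  shows "partial_x f p = a" "partial_y f p = b"
proof -
  have ab: "(f has_derivative (\<lambda>h. a * fst h + b * snd h)) (at (fst p, snd p))" using assms by simp
  have "((\<lambda>x. f (x, snd p)) has_derivative (\<lambda>h. a * fst (h, 0::'k) + b * snd (h, 0::'k))) (at (fst p))"
    by (rule has_derivative_compose[where f = "\<lambda>x. (x, snd p)", OF _ ab])
       (auto intro!: derivative_eq_intros)
  then show "partial_x f p = a"
    by (auto simp: partial_x_def has_field_derivative_def intro!: DERIV_imp_deriv)
  have "((\<lambda>y. f (fst p, y)) has_derivative (\<lambda>h. a * fst (0::'k, h) + b * snd (0::'k, h))) (at (snd p))"
    by (rule has_derivative_compose[where f = "\<lambda>y. (fst p, y)", OF _ ab])
       (auto intro!: derivative_eq_intros)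
  then show "partial_y f p = b"
    by (auto simp: partial_y_def has_field_derivative_def intro!: DERIV_imp_deriv)
qed

section \<open>Taylor expansion in two variables and mixed derivatives\<close>

lemma iterate_partial_x: "(partial_x ^^ m) f (x, y) = (deriv ^^ m) (\<lambda>x. f (x, y)) x"
proof (induction m arbitrary: x)
  case (Suc m)
  then show ?case by (simp add: partial_x_def)
qed simp

lemma holo2_iterate_partial_x: "holo2 f S \<Longrightarrow> holo2 ((partial_x ^^ m) f) S"
  by (induction m) (auto intro: holo2_partial_x)

text \<open>Expand in \<open>x\<close> first, with coefficients \<open>c m y\<close>, and then each
  coefficient in \<open>y\<close>. Cauchy's estimate, applied twice, bounds the coefficient at
  \<open>(m, n)\<close> by \<open>M / R ^ m / R ^ n\<close>, so a product of two geometric series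
  dominates the double series and it may be summed one index after the other.\<close>

lemma holo2_power_series:
  assumes f: "holo2 f S" and R: "R > 0" "cball x0 R \<times> cball y0 R \<subseteq> S"
    and xy: "norm (x - x0) < R" "norm (y - y0) < R"
  shows "((\<lambda>(m, n). (deriv ^^ n) (\<lambda>y. (partial_x ^^ m) f (x0, y)) y0 / (fact m * fact n) * (x - x0) ^ m * (y - y0) ^ n) has_sum f (x, y)) UNIV"
proof -
  define c where "c m y = (partial_x ^^ m) f (x0, y) / fact m" for m y
  define a where "a m n = (deriv ^^ n) (c m) y0 / fact n" for m n
  have "compact (f ` (cball x0 R \<times> cball y0 R))"
    by (intro compact_continuous_image continuous_on_subset[OF holo2_continuous[OF f]])
      (use R in \<open>auto intro: compact_Times\<close>)
  then obtain M where M: "M > 0" "\<And>x y. x \<in> cball x0 R \<Longrightarrow> y \<in> cball y0 R \<Longrightarrow> norm (f (x, y)) < M"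
    using bounded_pos_less[of "f ` (cball x0 R \<times> cball y0 R)"] compact_imp_bounded by blast
  have hc: "c m holomorphic_on {y. (x0, y) \<in> S}" for m
    unfolding c_def by (intro holomorphic_intros holo2_slice_y[OF holo2_iterate_partial_x[OF f]]) auto
  have hcb: "c m holomorphic_on ball y0 R" "continuous_on (cball y0 R) (c m)" for m
    by (rule holomorphic_on_subset[OF hc], use R in force)
       (rule holomorphic_on_imp_continuous_on[OF holomorphic_on_subset[OF hc]], use R in force)
  have bc: "norm (c m y) \<le> M / R ^ m" if y: "y \<in> cball y0 R" for m y
  proof -
    have "(\<lambda>x. f (x, y)) holomorphic_on cball x0 R"
      by (rule holo2_slice_x[OF f]) (use R y in auto)
    then have "norm ((deriv ^^ m) (\<lambda>x. f (x, y)) x0) \<le> fact m * M / R ^ m"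
      by (intro Cauchy_inequality)
         (use R y M in \<open>auto intro: holomorphic_on_subset holomorphic_on_imp_continuous_on less_imp_le simp: dist_norm\<close>)
    then show ?thesis
      by (simp add: c_def iterate_partial_x norm_divide field_simps)
  qed
  have ba: "norm (a m n) \<le> M / R ^ m / R ^ n" for m n
  proof -
    have "norm ((deriv ^^ n) (c m) y0) \<le> fact n * (M / R ^ m) / R ^ n"
      by (intro Cauchy_inequality) (use R hcb[of m] bc[of _ m] in \<open>auto simp: dist_norm\<close>)
    then show ?thesis by (simp add: a_def norm_divide field_simps)
  qed
  define p where "p = norm (x - x0) / R"
  define q where "q = norm (y - y0) / R"
  have pq: "0 \<le> p" "p < 1" "0 \<le> q" "q < 1" using xy R by (auto simp: p_def q_def)
  define t where "t m n = a m n * (x - x0) ^ m * (y - y0) ^ n" for m n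
  have bt: "norm (t m n) \<le> M * p ^ m * q ^ n" for m n
  proof -
    have "norm (t m n) \<le> (M / R ^ m / R ^ n) * norm (x - x0) ^ m * norm (y - y0) ^ n"
      unfolding t_def norm_mult norm_power by (intro mult_right_mono ba) auto
    then show ?thesis by (simp add: p_def q_def power_divide)
  qed
  have geo: "((\<lambda>n. s ^ n) has_sum (1 / (1 - s))) UNIV" if "0 \<le> s" "s < 1" for s :: real
    using that by (intro sums_nonneg_imp_has_sum geometric_sums) auto
  have "(\<lambda>(m, n). M * p ^ m * q ^ n) summable_on (UNIV \<times> UNIV)"
  proof (rule summable_on_SigmaI)
    show "((\<lambda>n. case (m, n) of (m, n) \<Rightarrow> M * p ^ m * q ^ n) has_sum (M * p ^ m * (1 / (1 - q)))) UNIV" for m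
      using has_sum_cmult_right[OF geo[OF pq(3,4)]] by simp
    have "((\<lambda>m. (M * (1 / (1 - q))) * p ^ m) has_sum ((M * (1 / (1 - q))) * (1 / (1 - p)))) UNIV"
      by (rule has_sum_cmult_right[OF geo[OF pq(1,2)]])
    then show "(\<lambda>m. M * p ^ m * (1 / (1 - q))) summable_on UNIV"
      by (auto simp: summable_on_def mult_ac)
  qed (use pq M in auto)
  then have "(\<lambda>w. norm (case w of (m, n) \<Rightarrow> t m n)) summable_on (UNIV \<times> UNIV)"
    by (rule Infinite_Sum.abs_summable_on_comparison_test') (use bt in auto)
  then have "(\<lambda>(m, n). t m n) summable_on (UNIV \<times> UNIV)"
    by (rule abs_summable_summable)
  then obtain s where s: "((\<lambda>(m, n). t m n) has_sum s) (UNIV \<times> UNIV)" by (auto simp: summable_on_def)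
  have "((\<lambda>m. c m y * (x - x0) ^ m) has_sum s) UNIV"
  proof (rule has_sum_SigmaD[OF s])
    fix m
    have "(\<lambda>n. a m n * (y - y0) ^ n) sums c m y"
      unfolding a_def by (rule holomorphic_power_series[OF hcb(1)]) (use xy in \<open>auto simp: dist_norm norm_minus_commute\<close>)
    then have "(\<lambda>n. (x - x0) ^ m * (a m n * (y - y0) ^ n)) sums ((x - x0) ^ m * c m y)"
      by (rule sums_mult)
    moreover have "summable (\<lambda>n. norm ((x - x0) ^ m * (a m n * (y - y0) ^ n)))"
    proof (rule summable_comparison_test')
      show "summable (\<lambda>n. M * p ^ m * q ^ n)" using pq by (intro summable_mult summable_geometric) auto
      show "norm (norm ((x - x0) ^ m * (a m n * (y - y0) ^ n))) \<le> M * p ^ m * q ^ n" if "n \<ge> 0" for n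
        using bt[of m n] by (simp add: t_def mult_ac)
    qed
    ultimately have "((\<lambda>n. (x - x0) ^ m * (a m n * (y - y0) ^ n)) has_sum ((x - x0) ^ m * c m y)) UNIV"
      by (intro norm_summable_imp_has_sum)
    then show "((\<lambda>n. case (m, n) of (m, n) \<Rightarrow> t m n) has_sum (c m y * (x - x0) ^ m)) UNIV"
      by (simp add: t_def mult_ac)
  qed
  then have "(\<lambda>m. c m y * (x - x0) ^ m) sums s" by (rule has_sum_imp_sums)
  moreover have "(\<lambda>m. (deriv ^^ m) (\<lambda>x. f (x, y)) x0 / fact m * (x - x0) ^ m) sums f (x, y)"
    by (rule holomorphic_power_series[where r = R and f = "\<lambda>x. f (x, y)"])
       (use R xy in \<open>auto intro!: holo2_slice_x[OF f] simp: dist_norm norm_minus_commute subset_iff\<close>)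
  ultimately have "s = f (x, y)"
    by (auto simp: c_def iterate_partial_x dest: sums_unique2)
  moreover have "a m n = (deriv ^^ n) (\<lambda>y. (partial_x ^^ m) f (x0, y)) y0 / (fact m * fact n)" for m n
  proof -
    have o: "open {y. (x0, y) \<in> S}"
      using open_vimage[OF holo2_open[OF f], of "Pair x0"] by (simp add: vimage_def continuous_on_Pair)
    have "(deriv ^^ n) (\<lambda>y. inverse (fact m) * (partial_x ^^ m) f (x0, y)) y0
        = inverse (fact m) * (deriv ^^ n) (\<lambda>y. (partial_x ^^ m) f (x0, y)) y0"
      by (rule higher_deriv_cmult[OF _ _ o])
        (use R in \<open>auto intro!: holo2_slice_y[OF holo2_iterate_partial_x[OF f]]\<close>)
    moreover have "c m = (\<lambda>y. inverse (fact m) * (partial_x ^^ m) f (x0, y))"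
      by (auto simp: c_def divide_inverse)
    ultimately show ?thesis by (simp add: a_def divide_inverse)
  qed
  ultimately show ?thesis using s by (simp add: t_def)
qed

lemma holo2_imp_K_analytic2:
  assumes "holo2 f S"
  shows "K_analytic2 f S"
  unfolding K_analytic2_def
proof clarify
  fix x0 y0 assume "(x0, y0) \<in> S"
  then obtain R where R: "R > 0" "cball x0 R \<times> cball y0 R \<subseteq> S"
    using open_bidisc holo2_open[OF assms] by metis
  show "\<exists>a r. r > 0 \<and> (\<forall>x y. norm (x - x0) < r \<and> norm (y - y0) < r \<longrightarrow>
        ((\<lambda>(m, n). a m n * (x - x0) ^ m * (y - y0) ^ n) has_sum f (x, y)) UNIV)"
    using holo2_power_series[OF assms R] R(1)
    by (intro exI[of _ "\<lambda>m n. (deriv ^^ n) (\<lambda>y. (partial_x ^^ m) f (x0, y)) y0 / (fact m * fact n)"] exI[of _ R]) blast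
qed

text \<open>The difference quotients of \<open>f\<close> in \<open>x\<close> converge to
  \<open>partial_x f\<close> uniformly in \<open>y\<close>. By Weierstrass their
  \<open>y\<close>-derivatives converge to the \<open>y\<close>-derivative of the limit; but these
  are difference quotients of \<open>partial_y f\<close> and converge to
  \<open>partial_x (partial_y f)\<close> as well.\<close>

lemma partial_x_partial_y:
  assumes f: "holo2 f S" and p: "p \<in> S"
  shows "partial_x (partial_y f) p = partial_y (partial_x f) p"
proof -
  obtain x0 y0 where xy: "p = (x0, y0)" by fastforce
  obtain r where r: "r > 0" "cball x0 r \<times> cball y0 r \<subseteq> S"
    using open_bidisc holo2_open[OF f] p xy by metis
  have D: "((\<lambda>y. g (x, y)) has_field_derivative partial_y g (x, y)) (at y)" if "holo2 g S" "(x, y) \<in> S" for g x y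
    using that unfolding holo2_def partial_y_def by (auto simp: DERIV_deriv_iff_field_differentiable)
  have "compact (partial_x (partial_x f) ` (cball x0 r \<times> cball y0 r))"
    by (intro compact_continuous_image continuous_on_subset[OF holo2_continuous[OF holo2_partial_x[OF holo2_partial_x[OF f]]]])
      (use r in \<open>auto intro: compact_Times\<close>)
  then obtain M where M: "M > 0" "\<And>x y. x \<in> cball x0 r \<Longrightarrow> y \<in> cball y0 r \<Longrightarrow> norm (partial_x (partial_x f) (x, y)) < M"
    using bounded_pos_less[of "partial_x (partial_x f) ` (cball x0 r \<times> cball y0 r)"] compact_imp_bounded by blast
  define q where "q h y = (f (x0 + h, y) - f (x0, y)) / h" for h y
  have Dx: "((\<lambda>x. g (x, y)) has_field_derivative partial_x g (x, y)) (at x)" if "holo2 g S" "(x, y) \<in> S" for g x y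
    using that unfolding holo2_def partial_x_def by (auto simp: DERIV_deriv_iff_field_differentiable)
  have bd: "norm (q h y - partial_x f (x0, y)) \<le> M * norm h" if h: "h \<noteq> 0" "norm h \<le> r" and y: "y \<in> cball y0 r" for h y
  proof -
    have "norm (f (x0 + h, y) - (\<Sum>i\<le>1. (partial_x ^^ i) f (x0, y) * (x0 + h - x0) ^ i / fact i)) \<le> M * norm (x0 + h - x0) ^ Suc 1 / fact 1"
    proof (rule complex_Taylor[of "cball x0 r" 1 "\<lambda>i x. (partial_x ^^ i) f (x, y)", simplified funpow_0])
      show "((\<lambda>x. (partial_x ^^ i) f (x, y)) has_field_derivative (partial_x ^^ Suc i) f (x, y)) (at x within cball x0 r)"
        if "x \<in> cball x0 r" for i x
        unfolding funpow.simps o_def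
        by (rule has_field_derivative_at_within[OF Dx[OF holo2_iterate_partial_x[OF f]]]) (use that y r in auto)
      show "cmod ((partial_x ^^ Suc 1) f (x, y)) \<le> M" if "x \<in> cball x0 r" for x
        using M(2)[OF that y] by simp
    qed (use h r in \<open>auto simp: dist_norm\<close>)
    then have "norm (f (x0 + h, y) - f (x0, y) - partial_x f (x0, y) * h) \<le> M * norm h ^ 2"
      by (simp add: algebra_simps power2_eq_square)
    moreover have "f (x0 + h, y) - f (x0, y) - partial_x f (x0, y) * h = (q h y - partial_x f (x0, y)) * h"
      using h by (simp add: q_def field_simps)
    ultimately have "norm (q h y - partial_x f (x0, y)) * norm h \<le> (M * norm h) * norm h"
      by (simp add: norm_mult power2_eq_square)
    then show ?thesis using h by simp
  qed
  define h where "h n = complex_of_real (r / (real n + 1))" for n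
  have h: "h n \<noteq> 0" "norm (h n) \<le> r" for n
  proof -
    show "h n \<noteq> 0" using r by (simp add: h_def del: of_real_divide)
    have "norm (h n) = r / (real n + 1)" using r unfolding h_def norm_of_real by simp
    also have "\<dots> \<le> r" using r by (simp add: field_simps)
    finally show "norm (h n) \<le> r" .
  qed
  have h0: "h \<longlonglongrightarrow> 0"
    unfolding h_def using tendsto_mult[OF tendsto_const[of r] LIMSEQ_inverse_real_of_nat]
    by (intro tendsto_of_real[where a=0, simplified]) (simp add: divide_inverse algebra_simps)
  have ul: "uniform_limit (cball y0 r) (\<lambda>n. q (h n)) (\<lambda>y. partial_x f (x0, y)) sequentially"
    unfolding uniform_limit_iff
  proof safe
    fix e :: real assume "e > 0"
    have "(\<lambda>n. M * norm (h n)) \<longlonglongrightarrow> M * 0"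
      using h0 by (intro tendsto_intros) (simp add: tendsto_norm_zero)
    then have "\<forall>\<^sub>F n in sequentially. M * norm (h n) < e"
      using \<open>e > 0\<close> by (intro order_tendstoD(2)) auto
    then show "\<forall>\<^sub>F n in sequentially. \<forall>y\<in>cball y0 r. dist (q (h n) y) (partial_x f (x0, y)) < e"
    proof eventually_elim
      case (elim n)
      show ?case
      proof
        fix y assume "y \<in> cball y0 r"
        then show "dist (q (h n) y) (partial_x f (x0, y)) < e"
          using bd[OF h, of y n] elim by (simp add: dist_norm)
      qed
    qed
  qed
  have inS: "(x0 + h n, y) \<in> S" "(x0, y) \<in> S" if "y \<in> cball y0 r" for n y
    using r that h(2)[of n] by (auto simp: dist_norm subset_iff)
  have qd: "(q (h n) has_field_derivative (partial_y f (x0 + h n, y) - partial_y f (x0, y)) / h n) (at y)"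
    if "y \<in> cball y0 r" for n y
    unfolding q_def by (intro DERIV_cdivide derivative_intros D[OF f] inS that)
  obtain g' where g': "\<And>w. w \<in> ball y0 r \<Longrightarrow> ((\<lambda>y. partial_x f (x0, y)) has_field_derivative g' w) (at w) \<and>
      ((\<lambda>n. (partial_y f (x0 + h n, w) - partial_y f (x0, w)) / h n) \<longlongrightarrow> g' w) sequentially"
  proof (rule has_complex_derivative_uniform_limit[OF _ ul sequentially_bot r(1)])
    show "\<forall>\<^sub>F n in sequentially. continuous_on (cball y0 r) (q (h n)) \<and>
       (\<forall>w\<in>ball y0 r. (q (h n) has_field_derivative (partial_y f (x0 + h n, w) - partial_y f (x0, w)) / h n) (at w))"
      by (intro always_eventually allI conjI ballI qd continuous_at_imp_continuous_on)
         (use qd DERIV_isCont in auto, blast)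
  qed blast
  have "partial_y (partial_x f) (x0, y0) = g' y0"
    using g'[of y0] r by (auto simp: partial_y_def intro!: DERIV_imp_deriv)
  moreover have "(\<lambda>n. (partial_y f (x0 + h n, y0) - partial_y f (x0, y0)) / h n) \<longlonglongrightarrow> partial_x (partial_y f) (x0, y0)"
  proof -
    have "((\<lambda>k. (partial_y f (x0 + k, y0) - partial_y f (x0, y0)) / k) \<longlongrightarrow> partial_x (partial_y f) (x0, y0)) (at 0)"
      using Dx[OF holo2_partial_y[OF f], of x0 y0] p xy by (simp add: DERIV_def)
    moreover have "filterlim h (at 0) sequentially"
      using h0 h by (auto simp: filterlim_at)
    ultimately show ?thesis by (rule filterlim_compose)
  qed
  ultimately show ?thesis using g'[of y0] r LIMSEQ_unique by (auto simp: xy)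
qed

section \<open>Straightening a map with one nondegenerate component\<close>

lemma grad_curve:
  fixes g :: "'k::real_normed_field \<times> 'k \<Rightarrow> 'k"
  assumes "(g has_derivative (\<lambda>h. a * fst h + b * snd h)) (at (x t, y t))"
    and "(x has_field_derivative x') (at t)" "(y has_field_derivative y') (at t)"
  shows "((\<lambda>t. g (x t, y t)) has_field_derivative (a * x' + b * y')) (at t)"
proof -
  have "((\<lambda>t. (x t, y t)) has_derivative (\<lambda>h. (x' * h, y' * h))) (at t)"
    using assms(2,3) unfolding has_field_derivative_def by (rule has_derivative_Pair)
  from has_derivative_compose[OF this assms(1)] show ?thesis
    unfolding has_field_derivative_def by (rule has_derivative_eq_rhs) (simp add: fun_eq_iff algebra_simps)
qed

text \<open>Here time is real while the curve may be complex; this is the setting of the uniqueness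
  statement for the Hamiltonian system.\<close>

lemma grad_curve_real:
  fixes g :: "'k::real_normed_field \<times> 'k \<Rightarrow> 'k" and x y :: "real \<Rightarrow> 'k"
  assumes "(g has_derivative (\<lambda>h. a * fst h + b * snd h)) (at (x t, y t))"
    and "(x has_vector_derivative x') (at t)" "(y has_vector_derivative y') (at t)"
  shows "((\<lambda>t. g (x t, y t)) has_vector_derivative (a * x' + b * y')) (at t)"
proof -
  have "((\<lambda>t. (x t, y t)) has_derivative (\<lambda>h. (h *\<^sub>R x', h *\<^sub>R y'))) (at t)"
    using assms(2,3) unfolding has_vector_derivative_def by (rule has_derivative_Pair)
  from has_derivative_compose[OF this assms(1)] show ?thesis
    unfolding has_vector_derivative_def by (simp add: algebra_simps)
qed

text \<open>The inverse function theorem, made explicit by Cramer's rule: \<open>K p\<close> below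
  is the inverse of the derivative \<open>L p\<close>. The explicit matrix shows over the complex
  numbers that the inverse map again has a complex linear derivative.\<close>

lemma local_diffeomorphism:
  fixes f g :: "'k::{real_normed_field, euclidean_space} \<times> 'k \<Rightarrow> 'k"
  assumes "open W" "w0 \<in> W"
    and f: "\<And>p. p \<in> W \<Longrightarrow> (f has_derivative (\<lambda>h. fx p * fst h + fy p * snd h)) (at p)"
    and g: "\<And>p. p \<in> W \<Longrightarrow> (g has_derivative (\<lambda>h. gx p * fst h + gy p * snd h)) (at p)"
    and c: "continuous_on W fx" "continuous_on W fy" "continuous_on W gx" "continuous_on W gy"
    and D: "\<And>p. D p = fx p * gy p - fy p * gx p" and D0: "D w0 \<noteq> 0"
  obtains V B \<Psi> where "open V" "w0 \<in> V" "V \<subseteq> W" "open B" "(f w0, g w0) \<in> B"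
    "homeomorphism V B (\<lambda>p. (f p, g p)) \<Psi>"
    "\<And>p. p \<in> V \<Longrightarrow> D p \<noteq> 0"
    "\<And>q. q \<in> B \<Longrightarrow> (\<Psi> has_derivative (\<lambda>h. ((gy (\<Psi> q) * fst h - fy (\<Psi> q) * snd h) / D (\<Psi> q),
                                  (- gx (\<Psi> q) * fst h + fx (\<Psi> q) * snd h) / D (\<Psi> q)))) (at q)"
proof -
  define L where "L p = (\<lambda>h::'k\<times>'k. (fx p * fst h + fy p * snd h, gx p * fst h + gy p * snd h))" for p
  define K where "K p = (\<lambda>h::'k\<times>'k. ((gy p * fst h - fy p * snd h) / D p, (- gx p * fst h + fx p * snd h) / D p))" for p
  have bL: "bounded_linear (L p)" for p
    unfolding L_def by (intro bounded_linear_Pair bounded_linear_add bounded_linear_const_mult bounded_linear_fst bounded_linear_snd)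
  have bK: "bounded_linear (K p)" for p
    unfolding K_def by (intro bounded_linear_Pair bounded_linear_divide bounded_linear_add bounded_linear_sub bounded_linear_const_mult bounded_linear_fst bounded_linear_snd
      bounded_linear_compose[OF bounded_linear_divide])
  have KL: "K p (L p h) = h" if "D p \<noteq> 0" for p h
  proof -
    have "gy p * (fx p * fst h + fy p * snd h) - fy p * (gx p * fst h + gy p * snd h) = D p * fst h"
      "- gx p * (fx p * fst h + fy p * snd h) + fx p * (gx p * fst h + gy p * snd h) = D p * snd h"
      by (simp_all add: D algebra_simps)
    then show ?thesis using that by (simp add: K_def L_def)
  qed
  have LK: "L p (K p h) = h" if "D p \<noteq> 0" for p h
  proof -
    have "fx p * (gy p * fst h - fy p * snd h) + fy p * (- gx p * fst h + fx p * snd h) = D p * fst h"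
      "gx p * (gy p * fst h - fy p * snd h) + gy p * (- gx p * fst h + fx p * snd h) = D p * snd h"
      by (simp_all add: D algebra_simps)
    then have "fx p * ((gy p * fst h - fy p * snd h) / D p) + fy p * ((- gx p * fst h + fx p * snd h) / D p) = fst h"
      "gx p * ((gy p * fst h - fy p * snd h) / D p) + gy p * ((- gx p * fst h + fx p * snd h) / D p) = snd h"
      using that by (simp_all add: add_divide_distrib[symmetric])
    then show ?thesis by (simp add: K_def L_def)
  qed
  define f' where "f' p = Blinfun (L p)" for p
  define U where "U = {p\<in>W. D p \<noteq> 0}"
  have cD: "continuous_on W D" unfolding D by (intro continuous_intros c)
  have oU: "open U"
  proof -
    have "U = W \<inter> D -` (- {0})" by (auto simp: U_def)
    then show ?thesis using continuous_open_preimage[OF cD \<open>open W\<close>, of "- {0}"] by (simp add: open_Compl)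
  qed
  have f'L: "blinfun_apply (f' p) = L p" for p
    by (simp add: f'_def bounded_linear_Blinfun_apply bL)
  define \<Phi> where "\<Phi> = (\<lambda>p. (f p, g p))"
  have d: "(\<Phi> has_derivative blinfun_apply (f' p)) (at p)" if "p \<in> U" for p
    unfolding f'L L_def \<Phi>_def using that by (intro has_derivative_Pair f g) (auto simp: U_def)
  have c': "continuous_on U f'"
    by (rule continuous_on_blinfun_componentwise)
       (auto simp: f'L L_def U_def intro!: continuous_intros c[THEN continuous_on_subset])
  have inv: "Blinfun (K w0) o\<^sub>L f' w0 = id_blinfun"
    by (rule blinfun_eqI) (simp add: f'L bounded_linear_Blinfun_apply bK KL D0)
  have "w0 \<in> U" using \<open>w0 \<in> W\<close> D0 by (simp add: U_def)
  obtain V B \<Psi> g' where *: "open V" "V \<subseteq> U" "w0 \<in> V" "open B" "\<Phi> w0 \<in> B" "homeomorphism V B \<Phi> \<Psi>"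
    "\<And>y. y \<in> B \<Longrightarrow> (\<Psi> has_derivative (g' y)) (at y)"
    "\<And>y. y \<in> B \<Longrightarrow> g' y = inv (blinfun_apply (f'(\<Psi> y)))"
  proof (rule inverse_function_theorem[OF oU d c' \<open>w0 \<in> U\<close> inv])
    fix V B \<Psi> g'
    assume "open V" "V \<subseteq> U" "w0 \<in> V" "open B" "\<Phi> w0 \<in> B" "homeomorphism V B \<Phi> \<Psi>"
      "\<And>y. y \<in> B \<Longrightarrow> (\<Psi> has_derivative (g' y)) (at y)"
      "\<And>y. y \<in> B \<Longrightarrow> g' y = inv (blinfun_apply (f'(\<Psi> y)))"
    then show ?thesis by (rule that)
  qed
  show ?thesis
  proof (rule that[of V B \<Psi>])
    show "homeomorphism V B (\<lambda>p. (f p, g p)) \<Psi>" using *(6) by (simp add: \<Phi>_def)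
    show "(f w0, g w0) \<in> B" using *(5) by (simp add: \<Phi>_def)
    fix q assume q: "q \<in> B"
    have "\<Psi> q \<in> V" using *(6) q by (auto simp: homeomorphism_def)
    then have "D (\<Psi> q) \<noteq> 0" using *(2) by (auto simp: U_def)
    then have "inv (L (\<Psi> q)) = K (\<Psi> q)" by (intro inv_equality KL LK)
    then show "(\<Psi> has_derivative (\<lambda>h. ((gy (\<Psi> q) * fst h - fy (\<Psi> q) * snd h) / D (\<Psi> q),
                                  (- gx (\<Psi> q) * fst h + fx (\<Psi> q) * snd h) / D (\<Psi> q)))) (at q)"
      using *(7,8)[OF q] by (simp add: f'L K_def)
  qed (use * in \<open>auto simp: U_def\<close>)
qed

text \<open>The second coordinate is a linear function \<open>\<lambda>(x, y) = \<alpha> x + \<beta> y\<close> transverse to \<open>f\<close>; leaving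
  it free makes the cases \<open>\<partial>\<^sub>x f \<noteq> 0\<close> and \<open>\<partial>\<^sub>y f \<noteq> 0\<close> one.\<close>

lemma straightening:
  fixes f :: "'k::{real_normed_field, euclidean_space} \<times> 'k \<Rightarrow> 'k"
  assumes "open W" "w0 \<in> W"
    and f: "\<And>p. p \<in> W \<Longrightarrow> (f has_derivative (\<lambda>h. fx p * fst h + fy p * snd h)) (at p)"
    and c: "continuous_on W fx" "continuous_on W fy"
    and D: "\<And>p. D p = fx p * \<beta> - fy p * \<alpha>" and D0: "D w0 \<noteq> 0"
  obtains V B \<Psi> where "open V" "w0 \<in> V" "V \<subseteq> W" "open B"
    "(f w0, \<alpha> * fst w0 + \<beta> * snd w0) \<in> B"
    "homeomorphism V B (\<lambda>p. (f p, \<alpha> * fst p + \<beta> * snd p)) \<Psi>"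
    "\<And>p. p \<in> V \<Longrightarrow> D p \<noteq> 0"
    "\<And>q. q \<in> B \<Longrightarrow> (\<Psi> has_derivative (\<lambda>h. ((\<beta> * fst h - fy (\<Psi> q) * snd h) / D (\<Psi> q),
                                  (- \<alpha> * fst h + fx (\<Psi> q) * snd h) / D (\<Psi> q)))) (at q)"
  by (rule local_diffeomorphism[OF assms(1,2) f _ c continuous_on_const continuous_on_const D D0,
        where g = "\<lambda>p. \<alpha> * fst p + \<beta> * snd p"])
    (auto intro!: derivative_eq_intros intro: that)

lemma holo2_diff: "holo2 f S \<Longrightarrow> holo2 g S \<Longrightarrow> holo2 (\<lambda>p. f p - g p) S"
  and holo2_mult: "holo2 f S \<Longrightarrow> holo2 g S \<Longrightarrow> holo2 (\<lambda>p. f p * g p) S"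
  and holo2_divide: "holo2 f S \<Longrightarrow> holo2 g S \<Longrightarrow> (\<And>p. p \<in> S \<Longrightarrow> g p \<noteq> 0) \<Longrightarrow> holo2 (\<lambda>p. f p / g p) S"
  unfolding holo2_def
  by (auto intro!: continuous_intros field_differentiable_diff field_differentiable_mult field_differentiable_divide)

lemma holo2_const: "open S \<Longrightarrow> holo2 (\<lambda>p. c) S"
  unfolding holo2_def by auto

text \<open>The chain rule for a matrix-valued derivative with rows \<open>(a, b)\<close> and
  \<open>(c, d)\<close>, the shape in which the derivative of the inverse of a straightening map is
  known.\<close>

lemma holo2_grad_comp:
  assumes g: "holo2 g W" and "open B" and B: "\<And>q. q \<in> B \<Longrightarrow> \<Psi> q \<in> W"
    and \<Psi>: "\<And>q. q \<in> B \<Longrightarrow> (\<Psi> has_derivative (\<lambda>h. ((a q * fst h + b q * snd h), (c q * fst h + d q * snd h)))) (at q)"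
  shows "holo2 (\<lambda>q. g (\<Psi> q)) B"
    and "\<And>q. q \<in> B \<Longrightarrow> partial_x (\<lambda>q. g (\<Psi> q)) q = partial_x g (\<Psi> q) * a q + partial_y g (\<Psi> q) * c q"
    and "\<And>q. q \<in> B \<Longrightarrow> partial_y (\<lambda>q. g (\<Psi> q)) q = partial_x g (\<Psi> q) * b q + partial_y g (\<Psi> q) * d q"
proof -
  have *: "((\<lambda>q. g (\<Psi> q)) has_derivative (\<lambda>h. (partial_x g (\<Psi> q) * a q + partial_y g (\<Psi> q) * c q) * fst h
             + (partial_x g (\<Psi> q) * b q + partial_y g (\<Psi> q) * d q) * snd h)) (at q)" if "q \<in> B" for q
    using has_derivative_compose[OF \<Psi>[OF that] has_derivative_partials[OF g B[OF that]]]
    by (simp add: algebra_simps)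
  show "holo2 (\<lambda>q. g (\<Psi> q)) B" by (rule holo2I[OF \<open>open B\<close>]) (use * in blast)
  show "\<And>q. q \<in> B \<Longrightarrow> partial_x (\<lambda>q. g (\<Psi> q)) q = partial_x g (\<Psi> q) * a q + partial_y g (\<Psi> q) * c q"
    and "\<And>q. q \<in> B \<Longrightarrow> partial_y (\<lambda>q. g (\<Psi> q)) q = partial_x g (\<Psi> q) * b q + partial_y g (\<Psi> q) * d q"
    using partials_unique[OF *] by auto
qed

lemma isCont_eventually_nhds:
  "isCont f a \<Longrightarrow> open V \<Longrightarrow> f a \<in> V \<Longrightarrow> \<forall>\<^sub>F t in nhds a. f t \<in> V"
  by (simp add: isCont_def tendsto_at_iff_tendsto_nhds topological_tendstoD)

section \<open>The natural parametrization\<close>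

text \<open>Straightening \<open>J\<close> itself parametrizes \<open>{J = 0}\<close> by a curve \<open>P\<close> with
  \<open>P' = (- \<partial>\<^sub>y J, \<partial>\<^sub>x J) / D\<close>, so the Hamiltonian field only asks for the time change
  \<open>s' = D (P s)\<close>, which is solved by inverting a primitive of \<open>1 / D (P s)\<close>.\<close>

lemma hamiltonian_curve:
  assumes J: "holo2 J W" and w0: "w0 \<in> W" "J w0 = 0" and reg: "(partial_x J w0, partial_y J w0) \<noteq> (0, 0)"
  obtains \<Gamma> r where "r > 0" "\<Gamma> 0 = w0"
    "\<And>t. t \<in> ball 0 r \<Longrightarrow> \<Gamma> t \<in> W \<and> J (\<Gamma> t) = 0
       \<and> ((\<lambda>s. fst (\<Gamma> s)) has_field_derivative - partial_y J (\<Gamma> t)) (at t)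
       \<and> ((\<lambda>s. snd (\<Gamma> s)) has_field_derivative partial_x J (\<Gamma> t)) (at t)"
    "\<And>(x :: real \<Rightarrow> complex) y e. e > 0 \<Longrightarrow> (x 0, y 0) = w0 \<Longrightarrow>
       (\<And>t. \<bar>t\<bar> < e \<Longrightarrow> (x t, y t) \<in> W \<and> (x has_vector_derivative - partial_y J (x t, y t)) (at t)
           \<and> (y has_vector_derivative partial_x J (x t, y t)) (at t)) \<Longrightarrow>
       \<forall>\<^sub>F t in nhds 0. (x t, y t) = \<Gamma> (of_real t)"
proof -
  \<comment> \<open>One of the two coordinate functions serves, namely one whose level lines are
    transverse to the zero set of \<open>J\<close>.\<close>
  obtain \<alpha> \<beta> :: complex where ab: "partial_x J w0 * \<beta> - partial_y J w0 * \<alpha> \<noteq> 0"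
  proof (cases "partial_x J w0 = 0")
    case True then show ?thesis using that[of 0 1] reg that[of 1 0] by auto
  next
    case False then show ?thesis using that[of 1 0] by auto
  qed
  define D where "D p = partial_x J p * \<beta> - partial_y J p * \<alpha>" for p
  have D0: "D w0 \<noteq> 0" using ab by (simp add: D_def)
  note Jx = holo2_partial_x[OF J] and Jy = holo2_partial_y[OF J]
  obtain V B \<Psi> where V: "open V" "w0 \<in> V" "V \<subseteq> W" "open B"
    "(J w0, \<alpha> * fst w0 + \<beta> * snd w0) \<in> B"
    and hom: "homeomorphism V B (\<lambda>p. (J p, \<alpha> * fst p + \<beta> * snd p)) \<Psi>"
    and DV: "\<And>p. p \<in> V \<Longrightarrow> D p \<noteq> 0"
    and d\<Psi>: "\<And>q. q \<in> B \<Longrightarrow> (\<Psi> has_derivative (\<lambda>h. ((\<beta> * fst h - partial_y J (\<Psi> q) * snd h) / D (\<Psi> q),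
                                  (- \<alpha> * fst h + partial_x J (\<Psi> q) * snd h) / D (\<Psi> q)))) (at q)"
  proof (rule straightening[OF holo2_open[OF J] w0(1) has_derivative_partials[OF J] holo2_continuous[OF Jx] holo2_continuous[OF Jy] D_def D0])
    fix V B \<Psi>
    assume "open V" "w0 \<in> V" "V \<subseteq> W" "open B" "(J w0, \<alpha> * fst w0 + \<beta> * snd w0) \<in> B"
      "homeomorphism V B (\<lambda>p. (J p, \<alpha> * fst p + \<beta> * snd p)) \<Psi>" "\<And>p. p \<in> V \<Longrightarrow> D p \<noteq> 0"
      "\<And>q. q \<in> B \<Longrightarrow> (\<Psi> has_derivative (\<lambda>h. ((\<beta> * fst h - partial_y J (\<Psi> q) * snd h) / D (\<Psi> q),
                                  (- \<alpha> * fst h + partial_x J (\<Psi> q) * snd h) / D (\<Psi> q)))) (at q)"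
    then show ?thesis by (rule that)
  qed
  define s0 where "s0 = \<alpha> * fst w0 + \<beta> * snd w0"
  have "(0, s0) \<in> B" using V(5) w0 by (simp add: s0_def)
  from open_bidisc[OF V(4) this] obtain \<rho> where \<rho>: "\<rho> > 0" "cball 0 \<rho> \<times> cball s0 \<rho> \<subseteq> B" by blast
  define P where "P s = \<Psi> (0, s)" for s
  have PV: "P s \<in> V" "J (P s) = 0" "\<alpha> * fst (P s) + \<beta> * snd (P s) = s" if "s \<in> ball s0 \<rho>" for s
  proof -
    have "(0, s) \<in> B" using \<rho> that by auto
    then have "P s \<in> V" "(J (P s), \<alpha> * fst (P s) + \<beta> * snd (P s)) = (0, s)"
      using hom unfolding P_def homeomorphism_def by (auto simp del: Pair_inject)
    then show "P s \<in> V" "J (P s) = 0" "\<alpha> * fst (P s) + \<beta> * snd (P s) = s" by auto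
  qed
  have P: "((\<lambda>s. fst (P s)) has_field_derivative - partial_y J (P s) / D (P s)) (at s)"
    "((\<lambda>s. snd (P s)) has_field_derivative partial_x J (P s) / D (P s)) (at s)" if "s \<in> ball s0 \<rho>" for s
  proof -
    have "(0, s) \<in> B" using \<rho> that by auto
    have "((\<lambda>s. (0::complex, s)) has_derivative (\<lambda>h. (0, h))) (at s)"
      by (auto intro!: derivative_eq_intros)
    from has_derivative_compose[OF this d\<Psi>[OF \<open>(0, s) \<in> B\<close>]]
    have *: "(P has_derivative (\<lambda>h. (- partial_y J (P s) / D (P s) * h, partial_x J (P s) / D (P s) * h))) (at s)"
      by (simp add: P_def[abs_def])
    show "((\<lambda>s. fst (P s)) has_field_derivative - partial_y J (P s) / D (P s)) (at s)"
      "((\<lambda>s. snd (P s)) has_field_derivative partial_x J (P s) / D (P s)) (at s)"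
      unfolding has_field_derivative_def using has_derivative_fst[OF *] has_derivative_snd[OF *]
      by (auto elim!: has_derivative_eq_rhs)
  qed
  have hD: "holo2 D W"
    unfolding D_def by (intro holo2_diff holo2_mult Jx Jy holo2_const holo2_open[OF J])
  have "(\<lambda>s. 1 / D (P s)) holomorphic_on ball s0 \<rho>"
  proof (rule holomorphic_on_divide[OF holomorphic_on_const])
    show "(\<lambda>s. D (P s)) holomorphic_on ball s0 \<rho>"
      unfolding holomorphic_on_open[OF open_ball]
    proof
      fix s assume s: "s \<in> ball s0 \<rho>"
      have "((\<lambda>s. D (fst (P s), snd (P s))) has_field_derivative
         partial_x D (P s) * (- partial_y J (P s) / D (P s)) + partial_y D (P s) * (partial_x J (P s) / D (P s))) (at s)"
        by (rule grad_curve[OF _ P[OF s]]) (use has_derivative_partials[OF hD, of "P s"] PV(1)[OF s] V(3) in auto)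
      then show "\<exists>f'. ((\<lambda>s. D (P s)) has_field_derivative f') (at s)" by auto
    qed
  qed (use DV PV in auto)
  then obtain T0 where T0: "\<And>s. s \<in> ball s0 \<rho> \<Longrightarrow> (T0 has_field_derivative 1 / D (P s)) (at s within ball s0 \<rho>)"
    using holomorphic_convex_primitive'[OF convex_ball open_ball] by metis
  \<comment> \<open>\<open>T s\<close> is the time that the flow takes from \<open>w0\<close> to
    \<open>P s\<close>; its derivative \<open>1 / D (P s)\<close> does not vanish, so
    \<open>T\<close> has a local inverse \<open>\<tau>\<close>.\<close>
  define T where "T s = T0 s - T0 s0" for s
  have T: "(T has_field_derivative 1 / D (P s)) (at s)" if "s \<in> ball s0 \<rho>" for s
    using T0[OF that] that unfolding T_def[abs_def] by (auto intro!: derivative_eq_intros simp: at_within_open[OF _ open_ball])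
  have T00: "T s0 = 0" by (simp add: T_def)
  have hT: "T holomorphic_on ball s0 \<rho>" unfolding holomorphic_on_open[OF open_ball] using T by blast
  have s0: "s0 \<in> ball s0 \<rho>" using \<rho> by simp
  have "deriv T s0 \<noteq> 0" using DERIV_imp_deriv[OF T[OF s0]] DV[OF PV(1)[OF s0]] by simp
  from has_complex_derivative_locally_invertible[OF hT s0 open_ball this]
  obtain \<sigma> where \<sigma>: "\<sigma> > 0" "ball s0 \<sigma> \<subseteq> ball s0 \<rho>" "open (T ` ball s0 \<sigma>)" "inj_on T (ball s0 \<sigma>)" .
  obtain \<tau> where \<tau>: "\<tau> holomorphic_on (T ` ball s0 \<sigma>)" "\<And>z. z \<in> ball s0 \<sigma> \<Longrightarrow> deriv T z * deriv \<tau> (T z) = 1"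
     "\<And>z. z \<in> ball s0 \<sigma> \<Longrightarrow> \<tau> (T z) = z"
    using holomorphic_has_inverse[OF holomorphic_on_subset[OF hT \<sigma>(2)] open_ball \<sigma>(4)] by metis
  have "0 \<in> T ` ball s0 \<sigma>" using T00 \<sigma>(1) by force
  then obtain r where r: "r > 0" "ball 0 r \<subseteq> T ` ball s0 \<sigma>" using \<sigma>(3) open_contains_ball by metis
  have \<tau>': "\<tau> t \<in> ball s0 \<sigma>" "(\<tau> has_field_derivative D (P (\<tau> t))) (at t)" if t: "t \<in> ball 0 r" for t
  proof -
    obtain s where s: "s \<in> ball s0 \<sigma>" "t = T s" using t r by blast
    then show "\<tau> t \<in> ball s0 \<sigma>" using \<tau>(3) by simp
    have "deriv T s = 1 / D (P s)" using s \<sigma> T by (intro DERIV_imp_deriv) auto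
    then have "deriv \<tau> t = D (P (\<tau> t))" using inverse_unique[OF \<tau>(2)[OF s(1)]] \<tau>(3)[OF s(1)] s(2) by simp
    moreover have "(\<tau> has_field_derivative deriv \<tau> t) (at t)"
      using \<tau>(1) \<sigma>(3) t r by (intro holomorphic_derivI) auto
    ultimately show "(\<tau> has_field_derivative D (P (\<tau> t))) (at t)" by simp
  qed
  define \<Gamma> where "\<Gamma> t = P (\<tau> t)" for t
  have Pw0: "P s0 = w0"
    using hom V(2) w0(2) unfolding P_def homeomorphism_def s0_def by force
  show ?thesis
  proof (rule that[of r \<Gamma>])
    show "r > 0" by fact
    have "\<tau> 0 = s0" using \<tau>(3)[of s0] T00 \<sigma> by simp
    then show "\<Gamma> 0 = w0" using Pw0 by (simp add: \<Gamma>_def)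
    show "\<Gamma> t \<in> W \<and> J (\<Gamma> t) = 0 \<and> ((\<lambda>s. fst (\<Gamma> s)) has_field_derivative - partial_y J (\<Gamma> t)) (at t)
       \<and> ((\<lambda>s. snd (\<Gamma> s)) has_field_derivative partial_x J (\<Gamma> t)) (at t)" if t: "t \<in> ball 0 r" for t
    proof -
      have s: "\<tau> t \<in> ball s0 \<rho>" using \<tau>'(1)[OF t] \<sigma> by auto
      note 1 = DERIV_chain2[OF P(1)[OF s] \<tau>'(2)[OF t]] and 2 = DERIV_chain2[OF P(2)[OF s] \<tau>'(2)[OF t]]
      show ?thesis using 1 2 DV[OF PV(1)[OF s]] PV[OF s] V(3) by (auto simp: \<Gamma>_def)
    qed
    \<comment> \<open>Uniqueness. \<open>J\<close> is constant along the solution, so the solution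
      stays on the curve \<open>P\<close> at some parameter \<open>s t\<close>; the quantity
      \<open>T (s t)\<close> grows with unit speed and hence equals \<open>t\<close>.\<close>
    fix x y :: "real \<Rightarrow> complex" and e :: real
    assume e: "e > 0" and xy0: "(x 0, y 0) = w0"
      and ode: "\<And>t. \<bar>t\<bar> < e \<Longrightarrow> (x t, y t) \<in> W \<and> (x has_vector_derivative - partial_y J (x t, y t)) (at t)
           \<and> (y has_vector_derivative partial_x J (x t, y t)) (at t)"
    have const: "\<exists>c. \<forall>t\<in>{t. \<bar>t\<bar> < d}. g t = c"
      if "\<And>t. \<bar>t\<bar> < d \<Longrightarrow> (g has_vector_derivative 0) (at t)" for g :: "real \<Rightarrow> complex" and d
    proof (rule has_derivative_zero_constant)
      have "{t. \<bar>t\<bar> < d} = ball 0 d" by (auto simp: dist_norm)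
      then show "convex {t. \<bar>t\<bar> < d}" by simp
    qed (use that in \<open>auto simp: has_vector_derivative_def intro: has_derivative_at_withinI\<close>)
    have "((\<lambda>t. J (x t, y t)) has_vector_derivative 0) (at t)" if "\<bar>t\<bar> < e" for t
    proof -
      have "((\<lambda>t. J (x t, y t)) has_vector_derivative
        (partial_x J (x t, y t) * - partial_y J (x t, y t) + partial_y J (x t, y t) * partial_x J (x t, y t))) (at t)"
        using ode[OF that] by (intro grad_curve_real has_derivative_partials[OF J]) auto
      then show ?thesis by (simp add: mult.commute)
    qed
    from const[of e, OF this] have J0: "J (x t, y t) = 0" if "\<bar>t\<bar> < e" for t
      using that e w0(2) xy0 by (metis abs_zero mem_Collect_eq)
    define s where "s t = \<alpha> * x t + \<beta> * y t" for t
    have ct: "isCont x 0" "isCont y 0" using ode[of 0] e has_vector_derivative_continuous by auto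
    then have cxy: "isCont (\<lambda>t. (x t, y t)) 0" and cs: "isCont s 0" by (auto intro!: continuous_intros simp: s_def[abs_def])
    have "s 0 = s0" using xy0 by (auto simp: s_def s0_def)
    have "\<forall>\<^sub>F t in nhds 0. (x t, y t) \<in> V"
      using isCont_eventually_nhds[OF cxy V(1)] V(2) xy0 by simp
    moreover have "\<forall>\<^sub>F t in nhds 0. s t \<in> ball s0 \<sigma>"
      using isCont_eventually_nhds[OF cs open_ball] \<open>s 0 = s0\<close> \<sigma>(1) by simp
    moreover have "\<forall>\<^sub>F t in nhds 0. \<bar>t\<bar> < e"
      using e by (auto simp: eventually_nhds_metric dist_norm intro!: exI[of _ e])
    ultimately have "\<forall>\<^sub>F t in nhds 0. (x t, y t) \<in> V \<and> s t \<in> ball s0 \<sigma> \<and> \<bar>t\<bar> < e"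
      by eventually_elim auto
    then obtain d where d: "d > 0" "\<And>t. \<bar>t\<bar> < d \<Longrightarrow> (x t, y t) \<in> V \<and> s t \<in> ball s0 \<sigma> \<and> \<bar>t\<bar> < e"
      unfolding eventually_nhds_metric by (auto simp: dist_norm)
    have xyP: "(x t, y t) = P (s t)" if "\<bar>t\<bar> < d" for t
    proof -
      have "\<Psi> (J (x t, y t), \<alpha> * x t + \<beta> * y t) = (x t, y t)"
        using hom d(2)[OF that] unfolding homeomorphism_def by force
      then show ?thesis using J0 d(2)[OF that] by (simp add: P_def s_def)
    qed
    have "((\<lambda>t. T (s t) - of_real t) has_vector_derivative 0) (at t)" if t: "\<bar>t\<bar> < d" for t
    proof -
      have "(s has_vector_derivative D (P (s t))) (at t)"
        using ode[of t] d(2)[OF t] unfolding s_def[abs_def] xyP[OF t, symmetric, unfolded s_def]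
        by (auto intro!: derivative_eq_intros simp: D_def algebra_simps)
      moreover have "s t \<in> ball s0 \<rho>" using d(2)[OF t] \<sigma>(2) by blast
      ultimately have "((T \<circ> s) has_vector_derivative D (P (s t)) * (1 / D (P (s t)))) (at t)"
        by (intro field_vector_diff_chain_at T)
      then have "((\<lambda>t. T (s t)) has_vector_derivative 1) (at t)"
        using DV[OF PV(1)[OF \<open>s t \<in> ball s0 \<rho>\<close>]] by (simp add: o_def)
      then show ?thesis
        by (auto intro!: derivative_eq_intros)
    qed
    from const[of d, OF this] have "T (s t) = of_real t" if "\<bar>t\<bar> < d" for t
      using that d(1) \<open>s 0 = s0\<close> T00 by (metis (mono_tags, lifting) abs_zero mem_Collect_eq of_real_0 right_minus_eq diff_zero)
    then have "(x t, y t) = \<Gamma> (of_real t)" if "\<bar>t\<bar> < d" for t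
      using xyP[OF that] \<tau>(3)[of "s t"] d(2)[OF that] that by (auto simp: \<Gamma>_def)
    then show "\<forall>\<^sub>F t in nhds 0. (x t, y t) = \<Gamma> (of_real t)"
      using d(1) unfolding eventually_nhds_metric by (auto simp: dist_norm intro!: exI[of _ d])
  qed
qed

section \<open>Counting zeros by derivatives\<close>

text \<open>Leibniz' rule with a linear factor leaves two terms. For \<open>n = 0\<close> the
  truncated \<open>n - 1\<close> does no harm, since its term carries the factor
  \<open>0\<close>.\<close>

lemma higher_deriv_linear_factor:
  fixes a :: complex
  assumes q: "q holomorphic_on S" and "open S" and f: "\<And>z. z \<in> S \<Longrightarrow> f z = (z - a) * q z" and "z \<in> S"
  shows "(deriv ^^ n) f z = (z - a) * (deriv ^^ n) q z + of_nat n * (deriv ^^ (n - 1)) q z"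
  using \<open>z \<in> S\<close>
proof (induction n arbitrary: z)
  case 0
  then show ?case using f by simp
next
  case (Suc n)
  have d: "((deriv ^^ m) q has_field_derivative (deriv ^^ Suc m) q z) (at z)" for m
    using holomorphic_derivI[OF holomorphic_higher_deriv[OF q \<open>open S\<close>] \<open>open S\<close> Suc.prems] by simp
  have "((\<lambda>z. (z - a) * (deriv ^^ n) q z + of_nat n * (deriv ^^ (n - 1)) q z) has_field_derivative
     (deriv ^^ n) q z + (z - a) * (deriv ^^ Suc n) q z + of_nat n * (deriv ^^ Suc (n - 1)) q z) (at z)"
    by (rule derivative_eq_intros refl d | simp)+
  moreover have "of_nat n * (deriv ^^ Suc (n - 1)) q z = of_nat n * (deriv ^^ n) q z"
    by (cases n) auto
  then have "(deriv ^^ n) q z + (z - a) * (deriv ^^ Suc n) q z + of_nat n * (deriv ^^ Suc (n - 1)) q z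
     = (z - a) * (deriv ^^ Suc n) q z + of_nat (Suc n) * (deriv ^^ n) q z"
    by (simp add: distrib_right)
  ultimately have "((\<lambda>z. (z - a) * (deriv ^^ n) q z + of_nat n * (deriv ^^ (n - 1)) q z) has_field_derivative
     (z - a) * (deriv ^^ Suc n) q z + of_nat (Suc n) * (deriv ^^ n) q z) (at z)"
    by metis
  then have "((deriv ^^ n) f has_field_derivative (z - a) * (deriv ^^ Suc n) q z + of_nat (Suc n) * (deriv ^^ n) q z) (at z)"
    by (rule has_field_derivative_transform_within_open[OF _ \<open>open S\<close> Suc.prems]) (use Suc.IH in simp)
  from DERIV_imp_deriv[OF this] show ?case by simp
qed

text \<open>Dividing out a zero \<open>a\<close> multiplies the relative oscillation of the top derivative by at most
  the order, because \<open>((z - a)^(N+1) q^(N))' = (z - a)^N f^(N+1)\<close>; whence the factorial.\<close>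

lemma card_zeros_le:
  fixes f :: "complex \<Rightarrow> complex"
  assumes "f holomorphic_on S" "open S" "convex S" "A \<noteq> 0" "\<kappa> * fact N < 1"
    and "\<And>z. z \<in> S \<Longrightarrow> norm ((deriv ^^ N) f z - A) \<le> \<kappa> * norm A"
    and "finite T" "T \<subseteq> S" "\<And>z. z \<in> T \<Longrightarrow> f z = 0"
  shows "card T \<le> N"
  using assms
proof (induction N arbitrary: f A \<kappa> T)
  case 0
  have "T = {}"
  proof (rule ccontr)
    assume "T \<noteq> {}"
    then obtain z where "z \<in> T" by blast
    with 0 have "norm A \<le> \<kappa> * norm A" by fastforce
    with 0 show False by simp
  qed
  then show ?case by simp
next
  case (Suc N)
  show ?case
  proof (cases "T = {}")
    case False
    then obtain a where a: "a \<in> T" by blast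
    have aS: "a \<in> S" "f a = 0" using a Suc.prems by auto
    define q where "q z = (if z = a then deriv f a else (f z - f a) / (z - a))" for z
    have q: "q holomorphic_on S" unfolding q_def by (rule pole_lemma_open) (use Suc.prems in auto)
    have fq: "f z = (z - a) * q z" for z using aS by (auto simp: q_def)
    define w where "w = (deriv ^^ N) q"
    have hw: "w holomorphic_on S" unfolding w_def by (intro holomorphic_higher_deriv q Suc.prems)
    have fw: "(deriv ^^ Suc N) f z = (z - a) * deriv w z + of_nat (Suc N) * w z" if "z \<in> S" for z
      using higher_deriv_linear_factor[OF q \<open>open S\<close> fq that, of "Suc N"] by (simp add: w_def)
    have \<kappa>: "0 \<le> \<kappa> * norm A" using Suc.prems(6)[OF aS(1)] norm_ge_zero order_trans by blast
    have key: "norm (w z - A / of_nat (Suc N)) \<le> \<kappa> * norm A" if z: "z \<in> S" for z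
    proof (cases "z = a")
      case True
      have "(deriv ^^ Suc N) f a = of_nat (Suc N) * w a" using fw[OF aS(1)] by simp
      then have "(deriv ^^ Suc N) f a - A = of_nat (Suc N) * (w a - A / of_nat (Suc N))"
        by (simp add: right_diff_distrib del: of_nat_Suc)
      then have "of_nat (Suc N) * norm (w a - A / of_nat (Suc N)) \<le> \<kappa> * norm A"
        using Suc.prems(6)[OF aS(1)] by (metis norm_mult norm_of_nat)
      moreover have "1 * norm (w a - A / of_nat (Suc N)) \<le> of_nat (Suc N) * norm (w a - A / of_nat (Suc N))"
        by (intro mult_right_mono) auto
      ultimately show ?thesis using True by simp
    next
      case False
      \<comment> \<open>The derivative of \<phi> is \<open>(x - a) ^ N\<close> times the deviation
        of the top derivative of \<open>f\<close> from \<open>A\<close>. On the segment from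
        \<open>a\<close> to \<open>z\<close> one has \<open>norm (x - a) \<le> norm (z - a)\<close>,
        so the mean value inequality yields one more power of \<open>norm (z - a)\<close>, and
        dividing by all \<open>Suc N\<close> powers gives the bound for \<open>w\<close>.\<close>
      define \<phi> where "\<phi> z = (z - a) ^ Suc N * (w z - A / of_nat (Suc N))" for z
      have seg: "closed_segment a z \<subseteq> S" using aS z \<open>convex S\<close> closed_segment_subset by blast
      have "norm (\<phi> z - \<phi> a) \<le> (norm (z - a) ^ N * (\<kappa> * norm A)) * norm (z - a)"
      proof (rule field_differentiable_bound[OF convex_closed_segment[of a z]])
        fix x assume x: "x \<in> closed_segment a z"
        then have xS: "x \<in> S" using seg by blast
        have dw: "(w has_field_derivative deriv w x) (at x)"
          using holomorphic_derivI[OF hw \<open>open S\<close> xS] by simp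
        have "(\<phi> has_field_derivative (of_nat (Suc N) * (x - a) ^ N) * (w x - A / of_nat (Suc N)) + (x - a) ^ Suc N * deriv w x) (at x)"
          unfolding \<phi>_def by (rule derivative_eq_intros refl dw | simp)+
        moreover have "(of_nat (Suc N) * (x - a) ^ N) * (w x - A / of_nat (Suc N)) + (x - a) ^ Suc N * deriv w x
            = (x - a) ^ N * ((deriv ^^ Suc N) f x - A)"
          unfolding fw[OF xS] by (simp add: field_simps del: of_nat_Suc)
        ultimately show "(\<phi> has_field_derivative (x - a) ^ N * ((deriv ^^ Suc N) f x - A)) (at x within closed_segment a z)"
          by (simp add: has_field_derivative_at_within)
        have "norm (x - a) \<le> norm (z - a)" using segment_bound(1)[OF x] by simp
        then show "norm ((x - a) ^ N * ((deriv ^^ Suc N) f x - A)) \<le> norm (z - a) ^ N * (\<kappa> * norm A)"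
          unfolding norm_mult norm_power by (intro mult_mono power_mono Suc.prems(6) xS) auto
      qed auto
      then have "norm (z - a) ^ Suc N * norm (w z - A / of_nat (Suc N)) \<le> norm (z - a) ^ Suc N * (\<kappa> * norm A)"
        by (simp add: \<phi>_def norm_mult norm_power mult_ac)
      moreover have "norm (z - a) ^ Suc N > 0" using False by simp
      ultimately show ?thesis using mult_le_cancel_left_pos by blast
    qed
    \<comment> \<open>The absolute bound \<open>\<kappa> * norm A\<close> is inherited unchanged.
      Measured against the new constant \<open>A / of_nat (Suc N)\<close> it gains the factor
      \<open>Suc N\<close>, which is exactly what \<open>fact (Suc N)\<close> has in excess of
      \<open>fact N\<close>.\<close>
    have "card (T - {a}) \<le> N"
    proof (rule Suc.IH[of q "A / of_nat (Suc N)" "\<kappa> * of_nat (Suc N)"])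
      show "\<kappa> * of_nat (Suc N) * fact N < 1" using Suc.prems(5) by (simp add: mult_ac)
      show "norm ((deriv ^^ N) q z - A / of_nat (Suc N)) \<le> \<kappa> * of_nat (Suc N) * norm (A / of_nat (Suc N))" if "z \<in> S" for z
        using key[OF that] by (simp add: w_def norm_divide del: of_nat_Suc)
      show "q z = 0" if "z \<in> T - {a}" for z
        using that Suc.prems(9)[of z] aS by (simp add: q_def)
      show "A / of_nat (Suc N) \<noteq> 0" using \<open>A \<noteq> 0\<close> by (simp del: of_nat_Suc)
    qed (use Suc.prems q in auto)
    then show ?thesis using a \<open>finite T\<close> by (simp add: card_Diff_singleton)
  qed simp
qed

lemma holo2_iterate_partial_y: "holo2 f S \<Longrightarrow> holo2 ((partial_y ^^ m) f) S"
  by (induction m) (auto intro: holo2_partial_y)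

lemma iterate_partial_y: "(partial_y ^^ m) f (x, y) = (deriv ^^ m) (\<lambda>y. f (x, y)) y"
proof (induction m arbitrary: y)
  case (Suc m)
  then show ?case by (simp add: partial_y_def)
qed simp

text \<open>The \<open>N\<close>-th derivative in \<open>s\<close> is continuous in both variables,
  so it is close to one nonzero constant on a whole bidisc, and the same bound on zeros holds for
  all \<open>u\<close>. Subtracting \<open>v\<close> does not change that derivative because
  \<open>N > 0\<close>, so it holds for all \<open>v\<close> as well.\<close>

lemma holo2_fibre_card_le:
  assumes h: "holo2 h B" and p: "(u0, s0) \<in> B" and N: "(deriv ^^ N) (\<lambda>s. h (u0, s)) s0 \<noteq> 0" "N > 0"
  obtains \<epsilon> where "\<epsilon> > 0" "ball u0 \<epsilon> \<times> ball s0 \<epsilon> \<subseteq> B"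
    "\<And>u v. u \<in> ball u0 \<epsilon> \<Longrightarrow> finite {s\<in>ball s0 \<epsilon>. h (u, s) = v} \<and> card {s\<in>ball s0 \<epsilon>. h (u, s) = v} \<le> N"
proof -
  define A where "A = (partial_y ^^ N) h (u0, s0)"
  have A: "A \<noteq> 0" using N by (simp add: A_def iterate_partial_y)
  \<comment> \<open>Then \<open>\<kappa> * fact N = 1 / 2\<close>, below the threshold
    \<open>1\<close> of \<open>card_zeros_le\<close>.\<close>
  define \<kappa> :: real where "\<kappa> = 1 / (2 * fact N)"
  have \<kappa>: "\<kappa> > 0" "\<kappa> * fact N < 1" by (simp_all add: \<kappa>_def)
  have "isCont ((partial_y ^^ N) h) (u0, s0)"
    using holo2_iterate_partial_y[OF h, of N] p by (metis holo2_def continuous_on_eq_continuous_at)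
  then have "\<forall>\<^sub>F q in nhds (u0, s0). (partial_y ^^ N) h q \<in> ball A (\<kappa> * norm A)"
    by (rule isCont_eventually_nhds) (use A \<kappa> in \<open>auto simp: A_def\<close>)
  moreover have "\<forall>\<^sub>F q in nhds (u0, s0). q \<in> B"
    using holo2_open[OF h] p by (rule eventually_nhds_in_open)
  ultimately have "\<forall>\<^sub>F q in nhds (u0, s0). q \<in> B \<and> (partial_y ^^ N) h q \<in> ball A (\<kappa> * norm A)"
    by eventually_elim auto
  then obtain S where S: "open S" "(u0, s0) \<in> S" "\<And>q. q \<in> S \<Longrightarrow> q \<in> B \<and> (partial_y ^^ N) h q \<in> ball A (\<kappa> * norm A)"
    by (auto simp: eventually_nhds)
  from open_bidisc[OF S(1,2)] obtain \<epsilon> where \<epsilon>: "\<epsilon> > 0" "cball u0 \<epsilon> \<times> cball s0 \<epsilon> \<subseteq> S" .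
  have bound: "card T \<le> N" if u: "u \<in> ball u0 \<epsilon>" and T: "finite T" "T \<subseteq> {s\<in>ball s0 \<epsilon>. h (u, s) = v}" for u v T
  proof (rule card_zeros_le[of "\<lambda>s. h (u, s) - v" "ball s0 \<epsilon>" A \<kappa>])
    have inS: "(u, s) \<in> S" if "s \<in> ball s0 \<epsilon>" for s using u that \<epsilon> by auto
    have hol: "(\<lambda>s. h (u, s)) holomorphic_on ball s0 \<epsilon>"
      by (rule holo2_slice_y[OF h]) (use inS S in auto)
    then show "(\<lambda>s. h (u, s) - v) holomorphic_on ball s0 \<epsilon>" by (intro holomorphic_intros)
    fix z assume z: "z \<in> ball s0 \<epsilon>"
    have "(deriv ^^ N) (\<lambda>s. h (u, s) - v) z = (deriv ^^ N) (\<lambda>s. h (u, s)) z - (deriv ^^ N) (\<lambda>s. v) z"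
      by (rule higher_deriv_diff[OF hol _ open_ball z]) auto
    also have "\<dots> = (partial_y ^^ N) h (u, z)"
      using N by (simp add: iterate_partial_y)
    finally show "norm ((deriv ^^ N) (\<lambda>s. h (u, s) - v) z - A) \<le> \<kappa> * norm A"
      using S(3)[OF inS[OF z]] by (simp add: dist_norm norm_minus_commute)
  qed (use \<kappa> A T in auto)
  show ?thesis
  proof (rule that[OF \<epsilon>(1)])
    show "ball u0 \<epsilon> \<times> ball s0 \<epsilon> \<subseteq> B" using \<epsilon> S by force
    fix u v assume u: "u \<in> ball u0 \<epsilon>"
    have "finite {s\<in>ball s0 \<epsilon>. h (u, s) = v}"
    proof (rule ccontr)
      assume "infinite {s\<in>ball s0 \<epsilon>. h (u, s) = v}"
      then obtain T where "finite T" "card T = Suc N" "T \<subseteq> {s\<in>ball s0 \<epsilon>. h (u, s) = v}"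
        using infinite_arbitrarily_large by blast
      with bound[OF u this(1,3)] show False by simp
    qed
    then show "finite {s\<in>ball s0 \<epsilon>. h (u, s) = v} \<and> card {s\<in>ball s0 \<epsilon>. h (u, s) = v} \<le> N"
      using bound[OF u] by blast
  qed
qed

section \<open>Orders of vanishing\<close>

lemma higher_deriv_Suc: "(deriv ^^ Suc n) f = (deriv ^^ n) (deriv f)"
  by (simp add: funpow_swap1)

text \<open>The cofactor of \<open>(w - z) ^ n\<close> is continuous and nonzero at
  \<open>z\<close>. Stated as a limit, the order of vanishing can be followed through compositions
  and quotients by limit arithmetic.\<close>

lemma tendsto_factor_order:
  fixes f :: "complex \<Rightarrow> complex"
  assumes "f holomorphic_on S" "open S" "z \<in> S" "n > 0" "(deriv ^^ n) f z \<noteq> 0"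
    and "\<And>i. 0 < i \<Longrightarrow> i < n \<Longrightarrow> (deriv ^^ i) f z = 0"
  obtains L where "L \<noteq> 0" "((\<lambda>w. (f w - f z) / (w - z) ^ n) \<longlongrightarrow> L) (at z)"
proof -
  obtain g r where g: "0 < r" "g holomorphic_on ball z r"
    "\<And>w. w \<in> ball z r \<Longrightarrow> f w - f z = (w - z) ^ n * g w" "\<And>w. w \<in> ball z r \<Longrightarrow> g w \<noteq> 0"
    using holomorphic_factor_order_of_zero[OF assms] by metis
  have "isCont g z"
    using g(1,2) holomorphic_on_imp_continuous_on continuous_on_eq_continuous_at by (metis centre_in_ball open_ball)
  then have "(g \<longlongrightarrow> g z) (at z)" by (simp add: isCont_def)
  moreover have "\<forall>\<^sub>F w in at z. g w = (f w - f z) / (w - z) ^ n"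
    using eventually_at_ball'[OF g(1), of z UNIV] by eventually_elim (use g(3) in simp)
  ultimately have "((\<lambda>w. (f w - f z) / (w - z) ^ n) \<longlongrightarrow> g z) (at z)" by (rule Lim_transform_eventually)
  with g show ?thesis by (intro that[of "g z"]) auto
qed

text \<open>If \<open>m > n\<close>, the quotient tends to \<open>0\<close>; if
  \<open>m < n\<close>, its inverse does.\<close>

lemma power_quotient_tendsto_imp_eq:
  fixes L :: complex
  assumes "((\<lambda>t. t ^ m / t ^ n) \<longlongrightarrow> L) (at 0)" "L \<noteq> 0"
  shows "m = n"
proof (rule ccontr)
  have zero: False if "((\<lambda>t::complex. t ^ a / t ^ b) \<longlongrightarrow> M) (at 0)" "M \<noteq> 0" "b < a" for a b M
  proof -
    have "((\<lambda>t::complex. t ^ (a - b)) \<longlongrightarrow> 0 ^ (a - b)) (at 0)" by (intro tendsto_intros)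
    moreover have "\<forall>\<^sub>F t::complex in at 0. t ^ (a - b) = t ^ a / t ^ b"
      unfolding eventually_at_filter by (intro always_eventually) (use that(3) in \<open>auto simp: power_diff\<close>)
    ultimately have "((\<lambda>t::complex. t ^ a / t ^ b) \<longlongrightarrow> 0 ^ (a - b)) (at 0)" by (rule Lim_transform_eventually)
    with that(1) have "M = 0 ^ (a - b)" by (rule LIM_unique)
    then show False using that(2,3) by simp
  qed
  assume "m \<noteq> n"
  then consider "n < m" | "m < n" by linarith
  then show False
  proof cases
    case 1
    show False by (rule zero[OF assms 1])
  next
    case 2
    have "((\<lambda>t. inverse (t ^ m / t ^ n)) \<longlongrightarrow> inverse L) (at 0)" using assms by (rule tendsto_inverse)
    then have "((\<lambda>t. t ^ n / t ^ m) \<longlongrightarrow> inverse L) (at 0)" by simp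
    from zero[OF this _ 2] show False using assms(2) by simp
  qed
qed

text \<open>The zero \<open>a t\<close> of \<open>H (\<cdot>, b t)\<close> moves like \<open>- H (u0, b t) / \<partial>\<^sub>u H\<close>.\<close>

lemma implicit_zero_ratio:
  assumes H: "holo2 H B" and p: "(u0, s0) \<in> B"
    and ab: "isCont a 0" "a 0 = u0" "isCont b 0" "b 0 = s0"
    and zero: "\<forall>\<^sub>F t in nhds 0. H (a t, b t) = 0" and ne: "\<forall>\<^sub>F t in at 0. a t \<noteq> u0"
  shows "((\<lambda>t. H (u0, b t) / (a t - u0)) \<longlongrightarrow> - partial_x H (u0, s0)) (at (0::complex))"
  unfolding tendsto_iff
proof (intro allI impI)
  fix e :: real assume e: "e > 0"
  let ?A = "partial_x H (u0, s0)"
  have "isCont (partial_x H) (u0, s0)"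
    using holo2_partial_x[OF H] p by (metis holo2_def continuous_on_eq_continuous_at)
  then have "\<forall>\<^sub>F q in nhds (u0, s0). partial_x H q \<in> ball ?A (e / 2)"
    by (rule isCont_eventually_nhds) (use e in auto)
  moreover have "\<forall>\<^sub>F q in nhds (u0, s0). q \<in> B" using holo2_open[OF H] p by (rule eventually_nhds_in_open)
  ultimately have "\<forall>\<^sub>F q in nhds (u0, s0). q \<in> B \<and> partial_x H q \<in> ball ?A (e / 2)" by eventually_elim auto
  then obtain S where S: "open S" "(u0, s0) \<in> S" "\<And>q. q \<in> S \<Longrightarrow> q \<in> B \<and> partial_x H q \<in> ball ?A (e / 2)"
    by (auto simp: eventually_nhds)
  from open_bidisc[OF S(1,2)] obtain \<epsilon> where \<epsilon>: "\<epsilon> > 0" "cball u0 \<epsilon> \<times> cball s0 \<epsilon> \<subseteq> S" .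
  have bd: "norm (H (u, s) - H (u0, s) - ?A * (u - u0)) \<le> e / 2 * norm (u - u0)" if us: "u \<in> ball u0 \<epsilon>" "s \<in> ball s0 \<epsilon>" for u s
  proof -
    have "norm ((H (u, s) - ?A * u) - (H (u0, s) - ?A * u0)) \<le> e / 2 * norm (u - u0)"
    proof (rule field_differentiable_bound[OF convex_ball[of u0 \<epsilon>]])
      fix z assume z: "z \<in> ball u0 \<epsilon>"
      then have zS: "(z, s) \<in> S" using us \<epsilon> by auto
      have "((\<lambda>z. H (z, s)) has_field_derivative partial_x H (z, s)) (at z)"
        using H S(3)[OF zS] unfolding holo2_def partial_x_def by (auto simp: DERIV_deriv_iff_field_differentiable)
      from DERIV_diff[OF this DERIV_cmult_Id[of ?A]]
      show "((\<lambda>z. H (z, s) - ?A * z) has_field_derivative partial_x H (z, s) - ?A) (at z within ball u0 \<epsilon>)"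
        by (rule has_field_derivative_at_within)
      show "norm (partial_x H (z, s) - ?A) \<le> e / 2" using S(3)[OF zS] by (auto simp: dist_norm norm_minus_commute)
    qed (use us \<epsilon> in auto)
    then show ?thesis by (simp add: algebra_simps)
  qed
  have "\<forall>\<^sub>F t in at 0. a t \<in> ball u0 \<epsilon>" "\<forall>\<^sub>F t in at 0. b t \<in> ball s0 \<epsilon>"
    using isCont_eventually_nhds[OF ab(1) open_ball, of u0 \<epsilon>] isCont_eventually_nhds[OF ab(3) open_ball, of s0 \<epsilon>] ab(2,4) \<epsilon>(1)
    by (simp_all add: eventually_at_filter eventually_mono)
  moreover have "\<forall>\<^sub>F t in at 0. H (a t, b t) = 0" using zero by (auto simp: eventually_at_filter elim!: eventually_mono)
  ultimately show "\<forall>\<^sub>F t in at 0. dist (H (u0, b t) / (a t - u0)) (- ?A) < e"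
    using ne
  proof eventually_elim
    case (elim t)
    have "norm (H (u0, b t) + ?A * (a t - u0)) \<le> e / 2 * norm (a t - u0)"
      using bd[OF elim(1,2)] elim(3) by (metis diff_0 minus_add_distrib norm_minus_cancel diff_conv_add_uminus)
    moreover have "H (u0, b t) / (a t - u0) - (- ?A) = (H (u0, b t) + ?A * (a t - u0)) / (a t - u0)"
      using elim by (simp add: field_simps)
    ultimately have "norm (H (u0, b t) / (a t - u0) - (- ?A)) \<le> e / 2"
      using elim by (simp add: norm_divide divide_simps)
    then show ?case using e by (simp add: dist_norm)
  qed
qed

text \<open>It is enough to find the order of \<phi>, the restriction of \<open>partial_y h\<close>
  to the line \<open>u = u0\<close>. For \<open>n > 1\<close>, the value of \<phi> at
  \<open>b t\<close> is comparable to \<open>a t - u0\<close> by \<open>implicit_zero_ratio\<close>,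
  hence to \<open>t ^ n\<close>, while \<open>b t - s0\<close> is comparable to \<open>t\<close>; so
  \<phi> has order \<open>n\<close> at \<open>s0\<close>. For \<open>n = 1\<close> the hypothesis
  \<open>one\<close> says this directly.\<close>

lemma fibre_order:
  assumes h: "holo2 h B" and p: "(u0, s0) \<in> B"
    and a: "a holomorphic_on ball 0 r" "a 0 = u0" and b: "b holomorphic_on ball 0 r" "b 0 = s0" and r: "r > 0"
    and zero: "\<And>t. t \<in> ball 0 r \<Longrightarrow> partial_y h (a t, b t) = 0"
    and n: "n > 0" "\<And>i. 0 < i \<Longrightarrow> i < n \<Longrightarrow> (deriv ^^ i) a 0 = 0" "(deriv ^^ n) a 0 \<noteq> 0"
    and one: "n = 1 \<Longrightarrow> partial_y (partial_y h) (u0, s0) \<noteq> 0"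
    and more: "n \<noteq> 1 \<Longrightarrow> deriv b 0 \<noteq> 0 \<and> partial_x (partial_y h) (u0, s0) \<noteq> 0"
  shows "(deriv ^^ (n + 1)) (\<lambda>s. h (u0, s)) s0 \<noteq> 0"
    and "\<And>i. 0 < i \<Longrightarrow> i < n + 1 \<Longrightarrow> (deriv ^^ i) (\<lambda>s. h (u0, s)) s0 = 0"
proof -
  define \<phi> where "\<phi> s = partial_y h (u0, s)" for s
  have \<phi>h: "(deriv ^^ Suc i) (\<lambda>s. h (u0, s)) s = (deriv ^^ i) \<phi> s" for i s
    unfolding higher_deriv_Suc \<phi>_def partial_y_def[abs_def] by simp
  have \<phi>0: "\<phi> s0 = 0" using zero[of 0] r a b by (simp add: \<phi>_def)
  have H: "holo2 (partial_y h) B" by (rule holo2_partial_y[OF h])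
  have "(deriv ^^ n) \<phi> s0 \<noteq> 0 \<and> (\<forall>i. 0 < i \<longrightarrow> i < n \<longrightarrow> (deriv ^^ i) \<phi> s0 = 0)"
  proof (cases "n = 1")
    case True
    then show ?thesis using one[OF True] by (simp add: \<phi>_def[abs_def] partial_y_def)
  next
    case False
    note m = more[OF False]
    define O1 where "O1 = {s. (u0, s) \<in> B}"
    have "open O1"
      using open_vimage[OF holo2_open[OF h], of "Pair u0"] by (simp add: vimage_def continuous_on_Pair O1_def)
    then obtain \<epsilon> where \<epsilon>: "\<epsilon> > 0" "ball s0 \<epsilon> \<subseteq> O1" using p open_contains_ball[of O1] unfolding O1_def by blast
    have h\<phi>: "\<phi> holomorphic_on ball s0 \<epsilon>"
      unfolding \<phi>_def by (rule holo2_slice_y[OF H]) (use \<epsilon> in \<open>auto simp: O1_def\<close>)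
    obtain L where L: "L \<noteq> 0" "((\<lambda>t. (a t - a 0) / (t - 0) ^ n) \<longlongrightarrow> L) (at 0)"
      by (rule tendsto_factor_order[OF a(1) open_ball _ n(1) n(3) n(2)]) (use r in auto)
    have ca: "isCont a 0" "isCont b 0"
      using a b r holomorphic_on_imp_continuous_on continuous_on_eq_continuous_at by (metis centre_in_ball open_ball)+
    have ne: "\<forall>\<^sub>F t in at 0. a t \<noteq> u0"
      using tendsto_imp_eventually_ne[OF L(2), of 0] L(1) by (auto elim!: eventually_mono simp: a)
    have z: "\<forall>\<^sub>F t in nhds 0. partial_y h (a t, b t) = 0"
      using eventually_nhds_in_open[OF open_ball, of 0 0 r] r zero by (auto elim!: eventually_mono)
    have R: "((\<lambda>t. \<phi> (b t) / (a t - u0)) \<longlongrightarrow> - partial_x (partial_y h) (u0, s0)) (at 0)"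
      unfolding \<phi>_def by (rule implicit_zero_ratio[OF H p ca(1) a(2) ca(2) b(2) z ne])
    \<comment> \<open>The order of \<phi> is finite: a \<phi> vanishing near \<open>s0\<close> would
      make the ratio in \<open>R\<close> tend to \<open>0\<close> instead of to a nonzero
      number.\<close>
    have "\<exists>i>0. (deriv ^^ i) \<phi> s0 \<noteq> 0"
    proof (rule ccontr)
      assume nz: "\<not> ?thesis"
      have c: "\<phi> w = 0" if "w \<in> ball s0 \<epsilon>" for w
        unfolding \<phi>0[symmetric]
        by (rule holomorphic_fun_eq_const_on_connected[OF h\<phi> open_ball connected_ball]) (use nz in blast, use that \<epsilon> in auto)
      have "\<forall>\<^sub>F t in at 0. b t \<in> ball s0 \<epsilon>"
        using isCont_eventually_nhds[OF ca(2) open_ball, of s0 \<epsilon>] b \<epsilon> by (auto simp: eventually_at_filter elim!: eventually_mono)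
      then have "\<forall>\<^sub>F t in at 0. \<phi> (b t) / (a t - u0) = 0" by eventually_elim (use c in simp)
      then have "((\<lambda>t. \<phi> (b t) / (a t - u0)) \<longlongrightarrow> 0) (at 0)" by (rule tendsto_eventually)
      from LIM_unique[OF this R] show False using m by simp
    qed
    then obtain k where k: "k > 0" "(deriv ^^ k) \<phi> s0 \<noteq> 0" "\<And>i. 0 < i \<Longrightarrow> i < k \<Longrightarrow> (deriv ^^ i) \<phi> s0 = 0"
      using exists_least_iff[of "\<lambda>i. 0 < i \<and> (deriv ^^ i) \<phi> s0 \<noteq> 0"] by blast
    obtain M where M: "M \<noteq> 0" "((\<lambda>w. (\<phi> w - \<phi> s0) / (w - s0) ^ k) \<longlongrightarrow> M) (at s0)"
      by (rule tendsto_factor_order[OF h\<phi> open_ball _ k]) (use \<epsilon> in auto)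
    have db: "(b has_field_derivative deriv b 0) (at 0)"
      using b r by (intro holomorphic_derivI) auto
    then have bq: "((\<lambda>t. (b t - s0) / t) \<longlongrightarrow> deriv b 0) (at 0)"
      using b by (simp add: has_field_derivative_iff)
    have bne: "\<forall>\<^sub>F t in at 0. b t \<noteq> s0"
      using tendsto_imp_eventually_ne[OF bq, of 0] m by (auto elim!: eventually_mono)
    have "filterlim b (at s0) (at 0)"
      using ca(2) b(2) bne by (auto simp: filterlim_at isCont_def)
    from filterlim_compose[OF M(2) this]
    have "((\<lambda>t. \<phi> (b t) / (b t - s0) ^ k) \<longlongrightarrow> M) (at 0)" by (simp add: \<phi>0)
    then have T1: "((\<lambda>t. \<phi> (b t) / (b t - s0) ^ k * ((b t - s0) / t) ^ k) \<longlongrightarrow> M * deriv b 0 ^ k) (at 0)"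
      by (intro tendsto_intros bq)
    have T2: "((\<lambda>t. inverse (\<phi> (b t) / (a t - u0))) \<longlongrightarrow> inverse (- partial_x (partial_y h) (u0, s0))) (at 0)"
      using R m by (intro tendsto_inverse) auto
    have T3: "((\<lambda>t. inverse ((a t - u0) / t ^ n)) \<longlongrightarrow> inverse L) (at 0)"
      using L a by (intro tendsto_inverse) auto
    \<comment> \<open>The three factors are arranged so that \<open>\<phi> (b t)\<close>,
      \<open>b t - s0\<close> and \<open>a t - u0\<close> cancel and only
      \<open>t ^ k / t ^ n\<close> remains, with a nonzero limit.\<close>
    have T: "((\<lambda>t. inverse (\<phi> (b t) / (b t - s0) ^ k * ((b t - s0) / t) ^ k) * inverse (inverse (\<phi> (b t) / (a t - u0))) * inverse (inverse ((a t - u0) / t ^ n)))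
        \<longlongrightarrow> inverse (M * deriv b 0 ^ k) * inverse (inverse (- partial_x (partial_y h) (u0, s0))) * inverse (inverse L)) (at 0)"
      by (rule tendsto_mult[OF tendsto_mult[OF tendsto_inverse[OF T1] tendsto_inverse[OF T2]] tendsto_inverse[OF T3]])
         (use M m L in auto)
    have alg: "inverse (X / Y ^ k * (Y / t) ^ k) * inverse (inverse (X / Z)) * inverse (inverse (Z / t ^ n)) = t ^ k / t ^ n"
      if "X \<noteq> 0" "Y \<noteq> 0" "Z \<noteq> 0" "t \<noteq> 0" for X Y Z t :: complex
      using that by (simp add: power_divide field_simps)
    have "\<forall>\<^sub>F t::complex in at 0. t \<noteq> 0" by (simp add: eventually_at_filter)
    moreover have "\<forall>\<^sub>F t in at 0. \<phi> (b t) \<noteq> 0"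
      using tendsto_imp_eventually_ne[OF R, of 0] m by (auto elim!: eventually_mono)
    ultimately have "\<forall>\<^sub>F t in at 0. inverse (\<phi> (b t) / (b t - s0) ^ k * ((b t - s0) / t) ^ k) * inverse (inverse (\<phi> (b t) / (a t - u0))) * inverse (inverse ((a t - u0) / t ^ n)) = t ^ k / t ^ n"
      using bne ne by eventually_elim (rule alg, auto)
    from Lim_transform_eventually[OF T this]
    have "k = n" by (rule power_quotient_tendsto_imp_eq) (use M m L in auto)
    then show ?thesis using k by blast
  qed
  note * = this
  show "(deriv ^^ (n + 1)) (\<lambda>s. h (u0, s)) s0 \<noteq> 0" using * \<phi>h[of n s0] by simp
  show "(deriv ^^ i) (\<lambda>s. h (u0, s)) s0 = 0" if "0 < i" "i < n + 1" for i
  proof -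
    define k where "k = i - 1"
    have k: "i = Suc k" using that by (simp add: k_def)
    show ?thesis unfolding k \<phi>h by (cases "k = 0") (use * \<phi>0 that k in auto)
  qed
qed

section \<open>Local multiplicity\<close>

text \<open>The three clauses are an upper bound in one neighbourhood, its attainment arbitrarily
  close to \<open>w0\<close>, and isolation of \<open>w0\<close> in its fibre. No isolating
  neighbourhood is mentioned, so the notion is visibly one of germs. The witness \<open>w\<close>
  differs from \<open>w0\<close> because the upper limit in \<open>map_multiplicity\<close> is taken
  along the punctured neighbourhood.\<close>

definition local_multiplicity :: "('a::topological_space \<Rightarrow> 'b) \<Rightarrow> 'a \<Rightarrow> nat \<Rightarrow> bool" where
  "local_multiplicity F w0 N \<longleftrightarrow>
     (\<exists>U. open U \<and> w0 \<in> U \<and> (\<forall>w\<in>U. finite {x\<in>U. F x = F w} \<and> card {x\<in>U. F x = F w} \<le> N)) \<and>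
     (\<forall>U. open U \<and> w0 \<in> U \<longrightarrow>
        (\<exists>w\<in>U - {w0}. \<exists>T\<subseteq>U. finite T \<and> card T = N \<and> (\<forall>x\<in>T. F x = F w))) \<and>
     (\<exists>U. open U \<and> w0 \<in> U \<and> (\<forall>x\<in>U. F x = F w0 \<longrightarrow> x = w0))"

lemma local_multiplicity_swap:
  "local_multiplicity (\<lambda>p. (f p, g p)) w0 N \<longleftrightarrow> local_multiplicity (\<lambda>p. (g p, f p)) w0 N"
proof -
  have "(f x, g x) = (f w, g w) \<longleftrightarrow> (g x, f x) = (g w, f w)" for x w by auto
  then show ?thesis by (simp add: local_multiplicity_def)
qed

text \<open>For the upper bound, \<open>X\<close> may exceed the neighbourhood \<open>U\<close> in
  which fibres are bounded. The part of \<open>closure X\<close> outside \<open>U\<close> is compact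
  and misses the fibre of \<open>F w0\<close>, so its image stays away from \<open>F w0\<close>, and
  fibres through points near \<open>w0\<close> meet \<open>X\<close> only inside
  \<open>U\<close>.\<close>

lemma Limsup_ecard_fibre:
  assumes lm: "local_multiplicity F w0 N" and "continuous_on W F" and X: "isolating_nbhd W F w0 X"
  shows "Limsup (at w0) (\<lambda>w. ecard {x\<in>X. F x = F w}) = enat N"
proof (rule antisym)
  from lm[unfolded local_multiplicity_def, THEN conjunct1]
  obtain U where U: "open U" "w0 \<in> U" "\<forall>w\<in>U. finite {x\<in>U. F x = F w} \<and> card {x\<in>U. F x = F w} \<le> N"
    by blast
  have X': "open X" "w0 \<in> X" "compact (closure X)" "closure X \<subseteq> W" "{w\<in>closure X. F w = F w0} = {w0}"
    using X by (auto simp: isolating_nbhd_def)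
  define K where "K = closure X - U"
  have "compact K" unfolding K_def using X'(3) U(1) by (rule compact_diff)
  then have "compact (F ` K)"
    by (intro compact_continuous_image continuous_on_subset[OF assms(2)]) (use X' in \<open>auto simp: K_def\<close>)
  then have oK: "open (- (F ` K))" by (simp add: compact_imp_closed open_Compl)
  have "F w0 \<notin> F ` K" using X'(5) U(2) by (auto simp: K_def)
  moreover have "isCont F w0"
    by (rule continuous_on_interior[of X]) (use X' closure_subset[of X] assms(2) in \<open>auto simp: interior_open intro: continuous_on_subset\<close>)
  ultimately have "\<forall>\<^sub>F w in nhds w0. F w \<in> - (F ` K)" by (intro isCont_eventually_nhds oK) auto
  moreover have "\<forall>\<^sub>F w in nhds w0. w \<in> U" using U by (intro eventually_nhds_in_open)
  ultimately have "\<forall>\<^sub>F w in nhds w0. ecard {x\<in>X. F x = F w} \<le> enat N"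
  proof eventually_elim
    case (elim w)
    have sub: "{x\<in>X. F x = F w} \<subseteq> {x\<in>U. F x = F w}"
    proof
      fix x assume x: "x \<in> {x\<in>X. F x = F w}"
      then have "x \<in> closure X" using closure_subset[of X] by auto
      moreover have "x \<notin> K" using elim(1) x imageI[of x K F] by auto
      ultimately show "x \<in> {x\<in>U. F x = F w}" using x by (auto simp: K_def)
    qed
    have fin: "finite {x\<in>U. F x = F w}" "card {x\<in>U. F x = F w} \<le> N" using U(3) elim(2) by auto
    have "card {x\<in>X. F x = F w} \<le> N" using card_mono[OF fin(1) sub] fin(2) by linarith
    then show ?case using finite_subset[OF sub fin(1)] by (simp add: ecard_def)
  qed
  then show "Limsup (at w0) (\<lambda>w. ecard {x\<in>X. F x = F w}) \<le> enat N"
    by (intro Limsup_bounded) (auto simp: eventually_at_filter elim: eventually_mono)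
  show "enat N \<le> Limsup (at w0) (\<lambda>w. ecard {x\<in>X. F x = F w})"
  proof (rule ccontr)
    assume "\<not> ?thesis"
    then have "\<forall>\<^sub>F w in at w0. ecard {x\<in>X. F x = F w} < enat N" by (intro Limsup_lessD) auto
    then obtain S where S: "open S" "w0 \<in> S" "\<And>w. w \<in> S \<Longrightarrow> w \<noteq> w0 \<Longrightarrow> ecard {x\<in>X. F x = F w} < enat N"
      by (auto simp: eventually_at_topological)
    have "open (S \<inter> X)" "w0 \<in> S \<inter> X" using S X' by auto
    then obtain w T where w: "w \<in> S \<inter> X - {w0}" "T \<subseteq> S \<inter> X" "finite T" "card T = N" "\<And>x. x \<in> T \<Longrightarrow> F x = F w"
      using lm unfolding local_multiplicity_def by meson
    then have "ecard {x\<in>X. F x = F w} < enat N" "T \<subseteq> {x\<in>X. F x = F w}" using S by auto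
    then show False using card_mono[of "{x\<in>X. F x = F w}" T] w by (auto simp: ecard_def split: if_splits)
  qed
qed

text \<open>Every isolating neighbourhood gives the same upper limit, so the definite description
  has a unique solution; small balls are isolating neighbourhoods.\<close>

lemma map_multiplicity_eq:
  assumes lm: "local_multiplicity F w0 N" and "continuous_on W F" and "open W" "w0 \<in> W"
  shows "map_multiplicity W F w0 = enat N"
proof -
  obtain U where U: "open U" "w0 \<in> U" "\<And>x. x \<in> U \<Longrightarrow> F x = F w0 \<Longrightarrow> x = w0"
    using lm unfolding local_multiplicity_def by blast
  have "open (U \<inter> W)" "w0 \<in> U \<inter> W" using U assms by auto
  then obtain e where e: "e > 0" "cball w0 e \<subseteq> U \<inter> W" using open_contains_cball by blast
  have "isolating_nbhd W F w0 (ball w0 e)"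
    unfolding isolating_nbhd_def using e U by (auto simp: closure_ball)
  then show ?thesis
    unfolding map_multiplicity_def using Limsup_ecard_fibre[OF lm assms(2)] by (auto intro!: the_equality)
qed

lemma map_multiplicity_eq_infinity:
  assumes "\<And>U. open U \<Longrightarrow> w0 \<in> U \<Longrightarrow> \<exists>x\<in>U. x \<noteq> w0 \<and> F x = F w0"
  shows "map_multiplicity W F w0 = \<infinity>"
proof -
  have False if "isolating_nbhd W F w0 X" for X
  proof -
    have X: "open X" "w0 \<in> X" "{w\<in>closure X. F w = F w0} = {w0}" using that by (auto simp: isolating_nbhd_def)
    from assms[OF X(1,2)] show False using X(3) closure_subset[of X] by blast
  qed
  then show ?thesis by (auto simp: map_multiplicity_def)
qed

text \<open>After straightening, a fibre lies on one line \<open>u = c\<close> and consists of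
  solutions of \<open>h (u, s) = v\<close>. The upper bound is \<open>holo2_fibre_card_le\<close>.
  For the lower bound, \<open>h (f w0, \<cdot>)\<close> is a constant plus the \<open>N\<close>-th
  power of a local coordinate \<theta>, so the \<open>N\<close> roots of a small nonzero number give
  \<open>N\<close> points with a common value.\<close>

lemma straightened_local_multiplicity:
  fixes f g l :: "complex \<times> complex \<Rightarrow> complex"
  assumes V: "open V" "w0 \<in> V" "open B" and hom: "homeomorphism V B (\<lambda>p. (f p, l p)) \<Psi>"
    and h: "holo2 h B" and g: "\<And>p. p \<in> V \<Longrightarrow> g p = h (f p, l p)"
    and N: "N > 0" "(deriv ^^ N) (\<lambda>s. h (f w0, s)) (l w0) \<noteq> 0"
      "\<And>i. 0 < i \<Longrightarrow> i < N \<Longrightarrow> (deriv ^^ i) (\<lambda>s. h (f w0, s)) (l w0) = 0"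
  shows "local_multiplicity (\<lambda>p. (f p, g p)) w0 N"
proof -
  define \<Phi> where "\<Phi> = (\<lambda>p. (f p, l p))"
  define u0 where "u0 = f w0"
  define s0 where "s0 = l w0"
  have \<Phi>\<Psi>: "\<And>p. p \<in> V \<Longrightarrow> \<Phi> p \<in> B \<and> \<Psi> (\<Phi> p) = p" "\<And>q. q \<in> B \<Longrightarrow> \<Psi> q \<in> V \<and> \<Phi> (\<Psi> q) = q"
    "continuous_on V \<Phi>" "continuous_on B \<Psi>"
    using hom unfolding homeomorphism_def \<Phi>_def by auto
  have p0: "(u0, s0) \<in> B" "\<Psi> (u0, s0) = w0" using \<Phi>\<Psi>(1)[OF V(2)] by (auto simp: \<Phi>_def u0_def s0_def)
  have pre\<Phi>: "open {p\<in>V. \<Phi> p \<in> Q}" if "open Q" for Q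
    using continuous_open_preimage[OF \<Phi>\<Psi>(3) V(1) that] by (simp add: vimage_def Int_def)
  have pre\<Psi>: "open {q\<in>B. \<Psi> q \<in> Q}" if "open Q" for Q
    using continuous_open_preimage[OF \<Phi>\<Psi>(4) V(3) that] by (simp add: vimage_def Int_def)
  obtain \<epsilon> where \<epsilon>: "\<epsilon> > 0" "ball u0 \<epsilon> \<times> ball s0 \<epsilon> \<subseteq> B"
    "\<And>u v. u \<in> ball u0 \<epsilon> \<Longrightarrow> finite {s\<in>ball s0 \<epsilon>. h (u, s) = v} \<and> card {s\<in>ball s0 \<epsilon>. h (u, s) = v} \<le> N"
  proof (rule holo2_fibre_card_le[OF h p0(1) N(2)[folded u0_def s0_def] N(1)])
    fix \<epsilon> :: real
    assume "\<epsilon> > 0" "ball u0 \<epsilon> \<times> ball s0 \<epsilon> \<subseteq> B"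
      "\<And>u v. u \<in> ball u0 \<epsilon> \<Longrightarrow> finite {s\<in>ball s0 \<epsilon>. h (u, s) = v} \<and> card {s\<in>ball s0 \<epsilon>. h (u, s) = v} \<le> N"
    then show ?thesis by (rule that)
  qed
  have hs: "(\<lambda>s. h (u0, s)) holomorphic_on ball s0 \<epsilon>"
    by (rule holo2_slice_y[OF h]) (use \<epsilon> in auto)
  \<comment> \<open>The nonvanishing cofactor has a holomorphic \<open>N\<close>-th root, so the
    difference is an exact \<open>N\<close>-th power.\<close>
  obtain e \<rho> where e: "0 < \<rho>" "e holomorphic_on ball s0 \<rho>"
    "\<And>s. s \<in> ball s0 \<rho> \<Longrightarrow> h (u0, s) - h (u0, s0) = ((s - s0) * e s) ^ N" "\<And>s. s \<in> ball s0 \<rho> \<Longrightarrow> e s \<noteq> 0"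
    using holomorphic_factor_order_of_zero_strong[OF hs open_ball _ N(1)] N \<epsilon>(1) unfolding u0_def s0_def
    by (metis centre_in_ball)
  show ?thesis unfolding local_multiplicity_def
  proof (intro conjI allI impI)
    define U where "U = {p\<in>V. \<Phi> p \<in> ball u0 \<epsilon> \<times> ball s0 \<epsilon>}"
    show "\<exists>U. open U \<and> w0 \<in> U \<and> (\<forall>w\<in>U. finite {x\<in>U. (f x, g x) = (f w, g w)} \<and> card {x\<in>U. (f x, g x) = (f w, g w)} \<le> N)"
    proof (intro exI[of _ U] conjI ballI)
      show "open U" unfolding U_def by (intro pre\<Phi> open_Times open_ball)
      show "w0 \<in> U" using V \<epsilon> by (auto simp: U_def \<Phi>_def u0_def s0_def)
      fix w assume w: "w \<in> U"
      have fin: "finite {s\<in>ball s0 \<epsilon>. h (f w, s) = g w}" "card {s\<in>ball s0 \<epsilon>. h (f w, s) = g w} \<le> N"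
        using \<epsilon>(3)[of "f w" "g w"] w by (auto simp: U_def \<Phi>_def)
      have sub: "l ` {x\<in>U. (f x, g x) = (f w, g w)} \<subseteq> {s\<in>ball s0 \<epsilon>. h (f w, s) = g w}"
        using g by (auto simp: U_def \<Phi>_def)
      have inj: "inj_on l {x\<in>U. (f x, g x) = (f w, g w)}"
      proof (rule inj_onI)
        fix x x' assume "x \<in> {x\<in>U. (f x, g x) = (f w, g w)}" "x' \<in> {x\<in>U. (f x, g x) = (f w, g w)}" "l x = l x'"
        then have "\<Phi> x = \<Phi> x'" "x \<in> V" "x' \<in> V" by (auto simp: \<Phi>_def U_def)
        then show "x = x'" using \<Phi>\<Psi>(1) by metis
      qed
      show "finite {x\<in>U. (f x, g x) = (f w, g w)}" using inj_on_finite[OF inj sub fin(1)] .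
      show "card {x\<in>U. (f x, g x) = (f w, g w)} \<le> N" using card_inj_on_le[OF inj sub fin(1)] fin(2) by linarith
    qed
  next
    define U where "U = {p\<in>V. \<Phi> p \<in> UNIV \<times> ball s0 \<rho>}"
    show "\<exists>U. open U \<and> w0 \<in> U \<and> (\<forall>x\<in>U. (f x, g x) = (f w0, g w0) \<longrightarrow> x = w0)"
    proof (intro exI[of _ U] conjI ballI impI)
      show "open U" unfolding U_def by (intro pre\<Phi> open_Times open_ball open_UNIV)
      show "w0 \<in> U" using V e by (auto simp: U_def \<Phi>_def s0_def)
      fix x assume x: "x \<in> U" "(f x, g x) = (f w0, g w0)"
      have "h (u0, l x) = h (u0, s0)" using x g[of x] g[of w0] V by (auto simp: U_def u0_def s0_def)
      moreover have "l x \<in> ball s0 \<rho>" using x by (auto simp: U_def \<Phi>_def)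
      ultimately have "l x = s0" using e(3,4)[of "l x"] N(1) by auto
      then have "\<Phi> x = \<Phi> w0" using x by (auto simp: \<Phi>_def s0_def)
      then show "x = w0" using \<Phi>\<Psi>(1) x V by (metis (no_types, lifting) U_def mem_Collect_eq)
    qed
  next
    fix U assume U: "open U \<and> w0 \<in> U"
    have "open {q\<in>B. \<Psi> q \<in> U}" "(u0, s0) \<in> {q\<in>B. \<Psi> q \<in> U}" using pre\<Psi> U p0 by auto
    from open_bidisc[OF this] obtain \<delta> where \<delta>: "\<delta> > 0" "cball u0 \<delta> \<times> cball s0 \<delta> \<subseteq> {q\<in>B. \<Psi> q \<in> U}" .
    define R where "R = min \<delta> \<rho>"
    have R: "R > 0" "ball s0 R \<subseteq> ball s0 \<rho>" "\<And>s. s \<in> ball s0 R \<Longrightarrow> (u0, s) \<in> B \<and> \<Psi> (u0, s) \<in> U"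
      using \<delta> e(1) by (auto simp: R_def subset_iff)
    define \<theta> where "\<theta> s = (s - s0) * e s" for s
    have h\<theta>: "\<theta> holomorphic_on ball s0 R"
      unfolding \<theta>_def by (intro holomorphic_intros holomorphic_on_subset[OF e(2) R(2)])
    have "(e has_field_derivative deriv e s0) (at s0)" using e by (intro holomorphic_derivI) auto
    then have "(\<theta> has_field_derivative e s0) (at s0)"
      unfolding \<theta>_def by (auto intro!: derivative_eq_intros)
    then have "deriv \<theta> s0 \<noteq> 0" using DERIV_imp_deriv e by fastforce
    then obtain \<sigma> where \<sigma>: "\<sigma> > 0" "ball s0 \<sigma> \<subseteq> ball s0 R" "open (\<theta> ` ball s0 \<sigma>)" "inj_on \<theta> (ball s0 \<sigma>)"
      using has_complex_derivative_locally_invertible[OF h\<theta> _ open_ball, of s0] R by (metis centre_in_ball)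
    have "\<theta> s0 \<in> \<theta> ` ball s0 \<sigma>" using \<sigma>(1) by simp
    then have "0 \<in> \<theta> ` ball s0 \<sigma>" by (simp add: \<theta>_def)
    then obtain \<eta> where \<eta>: "\<eta> > 0" "ball 0 \<eta> \<subseteq> \<theta> ` ball s0 \<sigma>" using \<sigma>(3) open_contains_ball by metis
    \<comment> \<open>Any nonzero number of modulus below \<eta> would do: all \<open>N\<close>-th
      roots of \<open>z0 ^ N\<close> have the modulus of \<open>z0\<close>, so all of them lie in
      the disc covered by \<theta>.\<close>
    define z0 :: complex where "z0 = of_real (\<eta> / 2)"
    have z0: "z0 \<noteq> 0" "norm z0 = \<eta> / 2" using \<eta> unfolding z0_def norm_of_real by (auto simp del: of_real_divide)
    define Z where "Z = {z. z ^ N = z0 ^ N}"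
    have Z: "card Z = N" "z0 \<in> Z" unfolding Z_def using card_nth_roots[of "z0 ^ N" N] z0 N(1) by auto
    then have finZ: "finite Z" using N(1) card_ge_0_finite by metis
    have Zb: "z \<in> \<theta> ` ball s0 \<sigma>" if "z \<in> Z" for z
    proof -
      have "norm (z ^ N) = norm (z0 ^ N)" using that by (simp add: Z_def)
      then have "norm z ^ N = norm z0 ^ N" by (simp only: norm_power)
      then have "norm z = norm z0" using N(1) power_eq_imp_eq_base[of "norm z" N "norm z0"] by simp
      then show ?thesis using z0 \<eta> by auto
    qed
    define \<tau> where "\<tau> = inv_into (ball s0 \<sigma>) \<theta>"
    have \<tau>: "\<tau> z \<in> ball s0 \<sigma>" "\<theta> (\<tau> z) = z" if "z \<in> Z" for z
      using Zb[OF that] by (auto simp: \<tau>_def inv_into_into f_inv_into_f simp del: mem_ball)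
    have \<tau>R: "(u0, \<tau> z) \<in> B" "\<Psi> (u0, \<tau> z) \<in> U" "\<tau> z \<in> ball s0 \<rho>" if "z \<in> Z" for z
    proof -
      have s: "\<tau> z \<in> ball s0 R" using \<tau>(1)[OF that] \<sigma>(2) by (rule subsetD[rotated])
      show "(u0, \<tau> z) \<in> B" "\<Psi> (u0, \<tau> z) \<in> U" using R(3)[OF s] by auto
      show "\<tau> z \<in> ball s0 \<rho>" using s R(2) by (rule subsetD[rotated])
    qed
    define T where "T = (\<lambda>z. \<Psi> (u0, \<tau> z)) ` Z"
    have inj: "inj_on (\<lambda>z. \<Psi> (u0, \<tau> z)) Z"
    proof (rule inj_onI)
      fix z z' assume z: "z \<in> Z" "z' \<in> Z" and "\<Psi> (u0, \<tau> z) = \<Psi> (u0, \<tau> z')"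
      then have "(u0, \<tau> z) = (u0, \<tau> z')" using \<Phi>\<Psi>(2) \<tau>R(1) by metis
      then show "z = z'" using \<tau>(2) z by (metis prod.inject)
    qed
    have val: "f (\<Psi> (u0, \<tau> z)) = u0 \<and> g (\<Psi> (u0, \<tau> z)) = h (u0, s0) + z0 ^ N" if z: "z \<in> Z" for z
    proof -
      have "\<Phi> (\<Psi> (u0, \<tau> z)) = (u0, \<tau> z)" "\<Psi> (u0, \<tau> z) \<in> V" using \<Phi>\<Psi>(2) \<tau>R(1)[OF z] by auto
      moreover have "h (u0, \<tau> z) - h (u0, s0) = z ^ N" using e(3)[OF \<tau>R(3)[OF z]] \<tau>(2)[OF z] by (simp add: \<theta>_def)
      ultimately show ?thesis using g[of "\<Psi> (u0, \<tau> z)"] z by (auto simp: \<Phi>_def Z_def algebra_simps)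
    qed
    have "\<Psi> (u0, \<tau> z0) \<noteq> w0"
    proof
      assume "\<Psi> (u0, \<tau> z0) = w0"
      then have "(u0, \<tau> z0) = (u0, s0)" using \<Phi>\<Psi>(2) \<tau>R(1)[OF Z(2)] p0 by metis
      then have "\<tau> z0 = s0" by simp
      with \<tau>(2)[OF Z(2)] have "z0 = 0" by (simp add: \<theta>_def)
      with z0 show False by simp
    qed
    then show "\<exists>w\<in>U - {w0}. \<exists>T\<subseteq>U. finite T \<and> card T = N \<and> (\<forall>x\<in>T. (f x, g x) = (f w, g w))"
      using \<tau>R(2) Z val finZ card_image[OF inj]
      by (intro bexI[of _ "\<Psi> (u0, \<tau> z0)"] exI[of _ T]) (auto simp: T_def)
  qed
qed

section \<open>The critical value curve over the complex numbers\<close>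

text \<open>Leibniz' rule for \<open>k\<close> times the derivative of \<open>S1\<close>, in which
  all derivatives of \<open>S1\<close> of positive order below \<open>n\<close> vanish. At order
  \<open>n\<close> only \<open>k 0\<close> times that of \<open>S1\<close> survives; at order
  \<open>n + 1\<close> there is in addition \<open>n\<close> times \<open>deriv k 0\<close> times
  the \<open>n\<close>-th derivative of \<open>S1\<close>. The multiples of \<open>k 0\<close>
  cancel in the determinant.\<close>

lemma higher_deriv_proportional:
  fixes S1 S2 k :: "complex \<Rightarrow> complex"
  assumes S1: "S1 holomorphic_on ball 0 r" and S2: "S2 holomorphic_on ball 0 r" and k: "k holomorphic_on ball 0 r" and r: "r > 0"
    and d: "\<And>t. t \<in> ball 0 r \<Longrightarrow> deriv S2 t = k t * deriv S1 t"
    and n: "n > 0" "\<And>i. 0 < i \<Longrightarrow> i < n \<Longrightarrow> (deriv ^^ i) S1 0 = 0"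
  shows "\<And>i. 0 < i \<Longrightarrow> i < n \<Longrightarrow> (deriv ^^ i) S2 0 = 0"
    and "(deriv ^^ n) S1 0 * (deriv ^^ (n + 1)) S2 0 - (deriv ^^ n) S2 0 * (deriv ^^ (n + 1)) S1 0
           = of_nat n * deriv k 0 * ((deriv ^^ n) S1 0)\<^sup>2"
proof -
  have "(deriv ^^ Suc m) S2 0 = (\<Sum>i = 0..m. of_nat (m choose i) * (deriv ^^ i) k 0 * (deriv ^^ Suc (m - i)) S1 0)" for m
  proof -
    have "(deriv ^^ Suc m) S2 0 = (deriv ^^ m) (deriv S2) 0" by (simp only: higher_deriv_Suc)
    also have "\<dots> = (deriv ^^ m) (\<lambda>t. k t * deriv S1 t) 0"
      by (rule higher_deriv_transform_within_open[where S = "ball 0 r"])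
         (use r d in \<open>auto intro!: holomorphic_intros holomorphic_deriv S1 S2 k\<close>)
    also have "\<dots> = (\<Sum>i = 0..m. of_nat (m choose i) * (deriv ^^ i) k 0 * (deriv ^^ (m - i)) (deriv S1) 0)"
      by (rule higher_deriv_mult[where S = "ball 0 r"]) (use r in \<open>auto intro!: holomorphic_deriv S1 k\<close>)
    finally show ?thesis by (simp only: higher_deriv_Suc)
  qed
  note F = this
  have zero: "(deriv ^^ Suc j) S1 0 = 0" if "Suc j < n" for j using n(2)[of "Suc j"] that by simp
  show "(deriv ^^ i) S2 0 = 0" if "0 < i" "i < n" for i
  proof -
    define m where "m = i - 1"
    have m: "i = Suc m" using that by (simp add: m_def)
    show ?thesis unfolding m F by (rule sum.neutral) (use zero that m in auto)
  qed
  define l where "l = n - 1"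
  have l: "n = Suc l" using n by (simp add: l_def)
  have "(deriv ^^ Suc l) S2 0 = k 0 * (deriv ^^ Suc l) S1 0"
  proof -
    have "(\<Sum>i = Suc 0..l. of_nat (l choose i) * (deriv ^^ i) k 0 * (deriv ^^ Suc (l - i)) S1 0) = 0"
      by (rule sum.neutral) (use zero l in \<open>auto simp del: funpow.simps\<close>)
    then show ?thesis unfolding F[of l] by (subst sum.atLeast_Suc_atMost) auto
  qed
  moreover have "(deriv ^^ Suc (Suc l)) S2 0 = k 0 * (deriv ^^ Suc (Suc l)) S1 0 + of_nat (Suc l) * deriv k 0 * (deriv ^^ Suc l) S1 0"
  proof -
    have "(\<Sum>i = Suc (Suc 0)..Suc l. of_nat (Suc l choose i) * (deriv ^^ i) k 0 * (deriv ^^ Suc (Suc l - i)) S1 0) = 0"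
      by (rule sum.neutral) (use zero l in \<open>auto simp del: funpow.simps\<close>)
    then show ?thesis unfolding F[of "Suc l"]
      by (subst sum.atLeast_Suc_atMost, simp, subst sum.atLeast_Suc_atMost, auto simp del: funpow.simps simp: funpow.simps(2)[of 0])
  qed
  ultimately show "(deriv ^^ n) S1 0 * (deriv ^^ (n + 1)) S2 0 - (deriv ^^ n) S2 0 * (deriv ^^ (n + 1)) S1 0
           = of_nat n * deriv k 0 * ((deriv ^^ n) S1 0)\<^sup>2"
    unfolding l by (simp add: algebra_simps power2_eq_square del: funpow.simps)
qed

lemma holo2_partial_derivs:
  assumes "holo2 f S" "p \<in> S"
  shows "((\<lambda>x. f (x, snd p)) has_field_derivative partial_x f p) (at (fst p))"
    and "((\<lambda>y. f (fst p, y)) has_field_derivative partial_y f p) (at (snd p))"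
  using assms unfolding holo2_def partial_x_def partial_y_def by (auto simp: DERIV_deriv_iff_field_differentiable)

text \<open>At a zero of \<open>f\<close> the quotient rule loses the term with the derivative of
  \<open>g\<close>. Thus the Jacobian determinant and its quotient by \<open>D\<close> have
  proportional gradients at a critical point.\<close>

lemma partial_quotient_zero:
  assumes "holo2 f S" "holo2 g S" "p \<in> S" "g p \<noteq> 0" "f p = 0"
  shows "partial_x (\<lambda>p. f p / g p) p = partial_x f p / g p" "partial_y (\<lambda>p. f p / g p) p = partial_y f p / g p"
proof -
  show "partial_x (\<lambda>p. f p / g p) p = partial_x f p / g p"
    unfolding partial_x_def[of "\<lambda>p. f p / g p"]
    by (rule DERIV_imp_deriv, rule DERIV_cong, rule DERIV_divide)
       (use assms holo2_partial_derivs[OF assms(1,3)] holo2_partial_derivs[OF assms(2,3)] in auto)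
  show "partial_y (\<lambda>p. f p / g p) p = partial_y f p / g p"
    unfolding partial_y_def[of "\<lambda>p. f p / g p"]
    by (rule DERIV_imp_deriv, rule DERIV_cong, rule DERIV_divide)
       (use assms holo2_partial_derivs[OF assms(1,3)] holo2_partial_derivs[OF assms(2,3)] in auto)
qed

lemma partial_cong_open:
  fixes f g :: "'k::real_normed_field \<times> 'k \<Rightarrow> 'k"
  assumes "open S" "p \<in> S" "\<And>q. q \<in> S \<Longrightarrow> f q = g q"
  shows "partial_x f p = partial_x g p" "partial_y f p = partial_y g p"
proof -
  have "isCont (\<lambda>x. (x, snd p)) (fst p)" "isCont (\<lambda>y. (fst p, y)) (snd p)" by (auto intro!: continuous_intros)
  then have "\<forall>\<^sub>F x in nhds (fst p). (x, snd p) \<in> S" "\<forall>\<^sub>F y in nhds (snd p). (fst p, y) \<in> S"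
    using assms(1,2) by (auto intro!: isCont_eventually_nhds)
  then show "partial_x f p = partial_x g p" "partial_y f p = partial_y g p"
    unfolding partial_x_def partial_y_def
    by (auto intro!: deriv_cong_ev elim!: eventually_mono simp: assms(3))
qed

text \<open>The factor \<open>c\<close> makes the lemma symmetric in the two components: exchanging
  them replaces \<open>J\<close> by \<open>- J\<close>, and the same curve solves the system with
  \<open>c = - 1\<close>. The conclusion about lower derivatives carries no condition on the
  \<open>n\<close>-th derivative of \<open>S1\<close>, so it can also be used beyond the order of
  \<open>S1\<close>.\<close>

lemma critical_value_core:
  fixes f g :: "complex \<times> complex \<Rightarrow> complex" and x y :: "complex \<Rightarrow> complex"
  defines "J \<equiv> \<lambda>p. partial_x f p * partial_y g p - partial_y f p * partial_x g p"
    and "S1 \<equiv> \<lambda>t. f (x t, y t)" and "S2 \<equiv> \<lambda>t. g (x t, y t)"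
  assumes f: "holo2 f W" and g: "holo2 g W" and w0: "w0 \<in> W" "J w0 = 0"
    and df: "(partial_x f w0, partial_y f w0) \<noteq> (0, 0)" and reg: "(partial_x J w0, partial_y J w0) \<noteq> (0, 0)"
    and r: "r > 0" and xy0: "(x 0, y 0) = w0" and "c \<noteq> 0"
    and ode: "\<And>t. t \<in> ball 0 r \<Longrightarrow> (x t, y t) \<in> W \<and>
        (x has_field_derivative - c * partial_y J (x t, y t)) (at t) \<and>
        (y has_field_derivative c * partial_x J (x t, y t)) (at t)"
    and n: "n > 0" "\<And>i. 0 < i \<Longrightarrow> i < n \<Longrightarrow> (deriv ^^ i) S1 0 = 0"
  shows "\<And>i. 0 < i \<Longrightarrow> i < n \<Longrightarrow> (deriv ^^ i) S2 0 = 0"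
    and "(deriv ^^ n) S1 0 \<noteq> 0 \<Longrightarrow> local_multiplicity (\<lambda>p. (f p, g p)) w0 (n + 1)"
    and "(deriv ^^ n) S1 0 \<noteq> 0 \<Longrightarrow> n > 1 \<Longrightarrow>
           (deriv ^^ n) S1 0 * (deriv ^^ (n + 1)) S2 0 - (deriv ^^ n) S2 0 * (deriv ^^ (n + 1)) S1 0 \<noteq> 0"
proof -
  obtain \<alpha> \<beta> :: complex where ab: "partial_x f w0 * \<beta> - partial_y f w0 * \<alpha> \<noteq> 0"
  proof (cases "partial_x f w0 = 0")
    case True then show ?thesis using that[of 0 1] df that[of 1 0] by auto
  next
    case False then show ?thesis using that[of 0 1] that[of 1 0] by auto
  qed
  define D where "D p = partial_x f p * \<beta> - partial_y f p * \<alpha>" for p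
  have D0: "D w0 \<noteq> 0" using ab by (simp add: D_def)
  note fx = holo2_partial_x[OF f] and fy = holo2_partial_y[OF f] and gx = holo2_partial_x[OF g] and gy = holo2_partial_y[OF g]
  obtain V B \<Psi> where V: "open V" "w0 \<in> V" "V \<subseteq> W" "open B"
    and hom: "homeomorphism V B (\<lambda>p. (f p, \<alpha> * fst p + \<beta> * snd p)) \<Psi>"
    and DV: "\<And>p. p \<in> V \<Longrightarrow> D p \<noteq> 0"
    and d\<Psi>0: "\<And>q. q \<in> B \<Longrightarrow> (\<Psi> has_derivative (\<lambda>h. ((\<beta> * fst h - partial_y f (\<Psi> q) * snd h) / D (\<Psi> q),
                                  (- \<alpha> * fst h + partial_x f (\<Psi> q) * snd h) / D (\<Psi> q)))) (at q)"
  proof (rule straightening[OF holo2_open[OF f] w0(1) has_derivative_partials[OF f] holo2_continuous[OF fx] holo2_continuous[OF fy] D_def D0])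
    fix V B \<Psi>
    assume "open V" "w0 \<in> V" "V \<subseteq> W" "open B"
      "homeomorphism V B (\<lambda>p. (f p, \<alpha> * fst p + \<beta> * snd p)) \<Psi>" "\<And>p. p \<in> V \<Longrightarrow> D p \<noteq> 0"
      "\<And>q. q \<in> B \<Longrightarrow> (\<Psi> has_derivative (\<lambda>h. ((\<beta> * fst h - partial_y f (\<Psi> q) * snd h) / D (\<Psi> q),
                                  (- \<alpha> * fst h + partial_x f (\<Psi> q) * snd h) / D (\<Psi> q)))) (at q)"
    then show ?thesis by (rule that)
  qed
  have d\<Psi>: "(\<Psi> has_derivative (\<lambda>h. ((\<beta> / D (\<Psi> q)) * fst h + (- partial_y f (\<Psi> q) / D (\<Psi> q)) * snd h,
                    (- \<alpha> / D (\<Psi> q)) * fst h + (partial_x f (\<Psi> q) / D (\<Psi> q)) * snd h))) (at q)" if "q \<in> B" for q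
    by (rule has_derivative_eq_rhs[OF d\<Psi>0[OF that]]) (simp add: fun_eq_iff diff_divide_distrib add_divide_distrib)
  define l where "l p = \<alpha> * fst p + \<beta> * snd p" for p :: "complex \<times> complex"
  have hom': "homeomorphism V B (\<lambda>p. (f p, l p)) \<Psi>" using hom by (simp add: l_def)
  have \<Phi>\<Psi>: "\<And>p. p \<in> V \<Longrightarrow> (f p, l p) \<in> B \<and> \<Psi> (f p, l p) = p" "\<And>q. q \<in> B \<Longrightarrow> \<Psi> q \<in> V"
    using hom' unfolding homeomorphism_def by auto
  have oW: "open W" by (rule holo2_open[OF f])
  have hJ: "holo2 J W" unfolding J_def by (intro holo2_diff holo2_mult fx fy gx gy)
  have hD: "holo2 D W" unfolding D_def by (intro holo2_diff holo2_mult fx fy holo2_const oW)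
  define K where "K p = J p / D p" for p
  have hK: "holo2 K V" unfolding K_def by (intro holo2_divide holo2_subset[OF hJ] holo2_subset[OF hD] V DV)
  define h where "h q = g (\<Psi> q)" for q
  have \<Psi>W: "\<Psi> q \<in> W" if "q \<in> B" for q using \<Phi>\<Psi>(2)[OF that] V by blast
  have h: "holo2 h B" unfolding h_def by (rule holo2_grad_comp(1)[OF g V(4) \<Psi>W d\<Psi>])
  have hu: "partial_x h q = (\<beta> * partial_x g (\<Psi> q) - \<alpha> * partial_y g (\<Psi> q)) / D (\<Psi> q)" if "q \<in> B" for q
  proof -
    have "partial_x h q = partial_x g (\<Psi> q) * (\<beta> / D (\<Psi> q)) + partial_y g (\<Psi> q) * (- \<alpha> / D (\<Psi> q))"
      unfolding h_def[abs_def] by (rule holo2_grad_comp(2)[OF g V(4) \<Psi>W d\<Psi> that])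
    then show ?thesis using DV[OF \<Phi>\<Psi>(2)[OF that]] by (simp add: field_simps)
  qed
  have hs: "partial_y h q = K (\<Psi> q)" if "q \<in> B" for q
  proof -
    have "partial_y h q = partial_x g (\<Psi> q) * (- partial_y f (\<Psi> q) / D (\<Psi> q)) + partial_y g (\<Psi> q) * (partial_x f (\<Psi> q) / D (\<Psi> q))"
      unfolding h_def[abs_def] by (rule holo2_grad_comp(3)[OF g V(4) \<Psi>W d\<Psi> that])
    then show ?thesis using DV[OF \<Phi>\<Psi>(2)[OF that]] by (simp add: K_def J_def field_simps)
  qed
  define u0 where "u0 = f w0"
  define s0 where "s0 = l w0"
  have p0: "(u0, s0) \<in> B" "\<Psi> (u0, s0) = w0" using \<Phi>\<Psi>(1)[OF V(2)] by (auto simp: u0_def s0_def)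
  have Hu: "partial_x (\<lambda>q. K (\<Psi> q)) (u0, s0) = partial_x K (\<Psi> (u0, s0)) * (\<beta> / D (\<Psi> (u0, s0))) + partial_y K (\<Psi> (u0, s0)) * (- \<alpha> / D (\<Psi> (u0, s0)))"
    by (rule holo2_grad_comp(2)[OF hK V(4) \<Phi>\<Psi>(2) d\<Psi> p0(1)])
  have Hs: "partial_y (\<lambda>q. K (\<Psi> q)) (u0, s0) = partial_x K (\<Psi> (u0, s0)) * (- partial_y f (\<Psi> (u0, s0)) / D (\<Psi> (u0, s0))) + partial_y K (\<Psi> (u0, s0)) * (partial_x f (\<Psi> (u0, s0)) / D (\<Psi> (u0, s0)))"
    by (rule holo2_grad_comp(3)[OF hK V(4) \<Phi>\<Psi>(2) d\<Psi> p0(1)])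
  have K0: "partial_x K w0 = partial_x J w0 / D w0" "partial_y K w0 = partial_y J w0 / D w0"
    unfolding K_def[abs_def] using partial_quotient_zero[OF hJ hD w0(1) D0 w0(2)] by auto
  have hsu: "partial_x (partial_y h) (u0, s0) = (\<beta> * partial_x J w0 - \<alpha> * partial_y J w0) / (D w0)\<^sup>2"
    using D0 partial_cong_open(1)[OF V(4) p0(1), of "partial_y h" "\<lambda>q. K (\<Psi> q)"] hs Hu
    unfolding p0(2) K0 by (simp add: field_simps power2_eq_square)
  have hss: "partial_y (partial_y h) (u0, s0) = (- partial_y f w0 * partial_x J w0 + partial_x f w0 * partial_y J w0) / (D w0)\<^sup>2"
    using D0 partial_cong_open(2)[OF V(4) p0(1), of "partial_y h" "\<lambda>q. K (\<Psi> q)"] hs Hs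
    unfolding p0(2) K0 by (simp add: field_simps power2_eq_square)

  have cx: "isCont x 0" "isCont y 0" using ode[of 0] r DERIV_isCont by auto
  then have "isCont (\<lambda>t. (x t, y t)) 0" by (intro continuous_intros)
  from isCont_eventually_nhds[OF this V(1)] have "\<forall>\<^sub>F t in nhds 0. (x t, y t) \<in> V" using V(2) xy0 by simp
  moreover have "\<forall>\<^sub>F t in nhds 0. t \<in> ball 0 r" by (rule eventually_nhds_in_open) (use r in auto)
  ultimately have "\<forall>\<^sub>F t in nhds 0. (x t, y t) \<in> V \<and> t \<in> ball 0 r" by eventually_elim auto
  then obtain \<rho> where \<rho>: "\<rho> > 0" "\<And>t. t \<in> ball 0 \<rho> \<Longrightarrow> (x t, y t) \<in> V \<and> t \<in> ball 0 r"
    unfolding eventually_nhds_metric by (auto simp: dist_commute)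
  have dx: "(x has_field_derivative - c * partial_y J (x t, y t)) (at t)"
    "(y has_field_derivative c * partial_x J (x t, y t)) (at t)" "(x t, y t) \<in> W" if "t \<in> ball 0 \<rho>" for t
    using ode \<rho>(2)[OF that] by auto
  have dcomp: "((\<lambda>t. q (x t, y t)) has_field_derivative
      c * (- partial_x q (x t, y t) * partial_y J (x t, y t) + partial_y q (x t, y t) * partial_x J (x t, y t))) (at t)"
    if "t \<in> ball 0 \<rho>" "holo2 q V" for t q
    using grad_curve[OF has_derivative_partials[OF that(2)] dx(1,2)[OF that(1)]] \<rho>(2)[OF that(1)]
    by (simp add: algebra_simps)
  have J0: "J (x t, y t) = 0" if "t \<in> ball 0 \<rho>" for t
  proof -
    have "\<exists>k. \<forall>t\<in>ball 0 \<rho>. J (x t, y t) = k"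
    proof (rule has_field_derivative_zero_constant[OF convex_ball])
      fix t :: complex assume t: "t \<in> ball 0 \<rho>"
      show "((\<lambda>t. J (x t, y t)) has_field_derivative 0) (at t within ball 0 \<rho>)"
        using dcomp[OF t holo2_subset[OF hJ V(1,3)]] by (simp add: mult.commute has_field_derivative_at_within)
    qed
    then show ?thesis using that \<rho>(1) xy0 w0(2) by (metis centre_in_ball)
  qed
  define a where "a = S1"
  define b where "b t = l (x t, y t)" for t
  have da: "(a has_field_derivative c * (- partial_x f (x t, y t) * partial_y J (x t, y t) + partial_y f (x t, y t) * partial_x J (x t, y t))) (at t)"
    if "t \<in> ball 0 \<rho>" for t
    unfolding a_def S1_def by (rule dcomp[OF that holo2_subset[OF f V(1,3)]])
  have dS2: "(S2 has_field_derivative c * (- partial_x g (x t, y t) * partial_y J (x t, y t) + partial_y g (x t, y t) * partial_x J (x t, y t))) (at t)"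
    if "t \<in> ball 0 \<rho>" for t
    unfolding S2_def by (rule dcomp[OF that holo2_subset[OF g V(1,3)]])
  have db: "(b has_field_derivative c * (\<beta> * partial_x J (x t, y t) - \<alpha> * partial_y J (x t, y t))) (at t)"
    if "t \<in> ball 0 \<rho>" for t
    unfolding b_def[abs_def] l_def fst_conv snd_conv
    by (rule DERIV_cong, (rule DERIV_add DERIV_cmult dx that)+) (simp add: algebra_simps)
  have ab0: "a 0 = u0" "b 0 = s0" by (simp_all add: a_def S1_def b_def u0_def s0_def xy0)
  have abB: "(a t, b t) \<in> B" "\<Psi> (a t, b t) = (x t, y t)" if "t \<in> ball 0 \<rho>" for t
    using \<Phi>\<Psi>(1)[of "(x t, y t)"] \<rho>(2)[OF that] by (auto simp: a_def S1_def b_def)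
  have hola: "a holomorphic_on ball 0 \<rho>" "b holomorphic_on ball 0 \<rho>" "S2 holomorphic_on ball 0 \<rho>"
    unfolding holomorphic_on_open[OF open_ball] using da db dS2 by (blast+)
  \<comment> \<open>\<open>S2 t\<close> is \<open>h (a t, b t)\<close>, and
    \<open>partial_y h\<close> vanishes on the critical curve, so the chain rule suggests that the
    derivative of \<open>S2\<close> is \<open>k\<close> times that of \<open>a\<close>; it is
    verified below from the explicit derivatives and \<open>J = 0\<close>.\<close>
  define k where "k t = partial_x h (a t, b t)" for t
  have dk: "(k has_field_derivative partial_x (partial_x h) (a t, b t) * deriv a t + partial_y (partial_x h) (a t, b t) * deriv b t) (at t)"
    if t: "t \<in> ball 0 \<rho>" for t
    unfolding k_def
    by (rule grad_curve[where g = "partial_x h" and x = a and y = b and t = t])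
       (use has_derivative_partials[OF holo2_partial_x[OF h] abB(1)[OF t]] hola t in \<open>auto intro!: holomorphic_derivI[OF _ open_ball]\<close>)
  have holk: "k holomorphic_on ball 0 \<rho>"
    unfolding holomorphic_on_open[OF open_ball] using dk by blast
  have S2k: "deriv S2 t = k t * deriv a t" if t: "t \<in> ball 0 \<rho>" for t
  proof -
    have "D (x t, y t) \<noteq> 0" using DV \<rho>(2)[OF t] by blast
    moreover have "partial_x f (x t, y t) * partial_y g (x t, y t) = partial_y f (x t, y t) * partial_x g (x t, y t)"
      using J0[OF t] by (simp add: J_def)
    ultimately show ?thesis
      unfolding DERIV_imp_deriv[OF dS2[OF t]] DERIV_imp_deriv[OF da[OF t]] k_def hu[OF abB(1)[OF t]] abB(2)[OF t]
      unfolding times_divide_eq_left eq_divide_eq D_def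
      by simp algebra
  qed
  have z0: "0 \<in> ball 0 \<rho>" using \<rho> by simp
  \<comment> \<open>Both quantities are nonzero multiples of
    \<open>\<beta> * partial_x J w0 - \<alpha> * partial_y J w0\<close>. If this vanished together
    with the derivative of \<open>a\<close>, the gradient of \<open>J\<close> would solve a
    homogeneous linear system with determinant \<open>D w0\<close>, hence be zero, against
    regularity.\<close>
  have b1: "deriv b 0 \<noteq> 0 \<and> partial_x (partial_y h) (u0, s0) \<noteq> 0" if a1: "deriv a 0 = 0"
  proof -
    have "- partial_x f w0 * partial_y J w0 + partial_y f w0 * partial_x J w0 = 0"
      using DERIV_imp_deriv[OF da[OF z0]] a1 \<open>c \<noteq> 0\<close> by (simp add: xy0)
    moreover have "\<beta> * partial_x J w0 - \<alpha> * partial_y J w0 \<noteq> 0"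
    proof
      assume 0: "\<beta> * partial_x J w0 - \<alpha> * partial_y J w0 = 0"
      have "D w0 * partial_x J w0 = 0" "D w0 * partial_y J w0 = 0"
        using calculation 0 unfolding D_def by (algebra+)
      then show False using D0 reg by simp
    qed
    ultimately show ?thesis using DERIV_imp_deriv[OF db[OF z0]] D0 \<open>c \<noteq> 0\<close> by (simp add: xy0 hsu)
  qed
  \<comment> \<open>The second derivative of \<open>h\<close> in \<open>s\<close> and the derivative
    of \<open>a\<close> at \<open>0\<close> are both multiples of the Jacobian determinant of
    \<open>f\<close> and \<open>J\<close> at \<open>w0\<close>, as \<open>hss\<close> shows.\<close>
  have a1: "partial_y (partial_y h) (u0, s0) \<noteq> 0" if "deriv a 0 \<noteq> 0"
    using DERIV_imp_deriv[OF da[OF z0]] that D0 \<open>c \<noteq> 0\<close> unfolding hss by (auto simp: xy0)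
  have n': "\<And>i. 0 < i \<Longrightarrow> i < n \<Longrightarrow> (deriv ^^ i) a 0 = 0" using n(2) by (simp add: a_def)
  note P = higher_deriv_proportional[OF hola(1,3) holk \<rho>(1) S2k n(1) n']
  show "\<And>i. 0 < i \<Longrightarrow> i < n \<Longrightarrow> (deriv ^^ i) S2 0 = 0" by (rule P(1))
  assume nz: "(deriv ^^ n) S1 0 \<noteq> 0"
  have one: "deriv a 0 \<noteq> 0" if "n = 1" using nz that by (simp add: a_def)
  have more: "deriv a 0 = 0" if "n \<noteq> 1" using n'[of 1] n(1) that by simp
  have hz: "partial_y h (a t, b t) = 0" if "t \<in> ball 0 \<rho>" for t
    using J0[OF that] by (simp add: hs[OF abB(1)[OF that]] abB(2)[OF that] K_def)
  note O = fibre_order[OF h p0(1) hola(1) ab0(1) hola(2) ab0(2) \<rho>(1) hz n(1) n' nz[folded a_def] a1[OF one] b1[OF more]]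
  show "local_multiplicity (\<lambda>p. (f p, g p)) w0 (n + 1)"
  proof (rule straightened_local_multiplicity[OF V(1,2,4) hom' h])
    show "g p = h (f p, l p)" if "p \<in> V" for p using \<Phi>\<Psi>(1)[OF that] by (simp add: h_def)
  qed (use O in \<open>auto simp: u0_def s0_def\<close>)
  assume "n > 1"
  then have "deriv a 0 = 0" using more by simp
  \<comment> \<open>The term with the derivative of \<open>a\<close> drops out, and the mixed
    partial derivatives of \<open>h\<close> commute.\<close>
  then have "deriv k 0 = partial_x (partial_y h) (u0, s0) * deriv b 0"
    using DERIV_imp_deriv[OF dk[OF z0]] ab0 partial_x_partial_y[OF h p0(1)] by simp
  then have "deriv k 0 \<noteq> 0" using b1[OF \<open>deriv a 0 = 0\<close>] by simp
  then show "(deriv ^^ n) S1 0 * (deriv ^^ (n + 1)) S2 0 - (deriv ^^ n) S2 0 * (deriv ^^ (n + 1)) S1 0 \<noteq> 0"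
    using P(2) nz n(1) by (simp add: a_def del: funpow.simps)
qed

section \<open>Order-pairs\<close>

lemma K_analytic1_id: "K_analytic1 (\<lambda>s. s) U"
  unfolding K_analytic1_def
proof
  fix w :: 'a
  have "(\<lambda>n. (if n = 0 then w else if n = 1 then 1 else 0) * (z - w) ^ n) sums z" for z
  proof -
    have "(\<lambda>n. (if n = 0 then w else if n = 1 then 1 else 0) * (z - w) ^ n) sums (\<Sum>n\<in>{0, 1}. (if n = 0 then w else if n = 1 then 1 else 0) * (z - w) ^ n)"
      by (rule sums_finite) auto
    then show ?thesis by simp
  qed
  then show "\<exists>a. \<exists>r>0. \<forall>z. norm (z - w) < r \<longrightarrow> (\<lambda>n. a n * (z - w) ^ n) sums z"
    by (intro exI[of _ "\<lambda>n. if n = 0 then w else if n = 1 then 1 else 0"] exI[of _ 1]) auto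
qed

lemma coordinate_change_id: "coordinate_change K_analytic1 0 (\<lambda>s::'k::real_normed_field. s)"
  unfolding coordinate_change_def by (intro exI[of _ UNIV] exI[of _ "\<lambda>s. s"]) (auto simp: K_analytic1_id)

lemma K_analytic2_linear: "K_analytic2 (\<lambda>w. A * fst w + B * snd w) U"
  unfolding K_analytic2_def
proof (clarify, goal_cases)
  case (1 x0 y0)
  define a where "a m n = (if m = 0 \<and> n = 0 then A * x0 + B * y0 else if m = 1 \<and> n = 0 then A else if m = 0 \<and> n = 1 then B else 0)" for m n :: nat
  have "((\<lambda>(m, n). a m n * (x - x0) ^ m * (y - y0) ^ n) has_sum (A * x + B * y)) UNIV" for x y
    by (rule has_sum_finite_neutralI[where B = "{(0, 0), (1, 0), (0, 1)}"])
       (auto simp: a_def algebra_simps split: if_splits)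
  then show ?case by (intro exI[of _ a] exI[of _ 1]) auto
qed

lemma coordinate_change_linear:
  fixes A B C D :: "'k::real_normed_field"
  assumes "A * D - B * C \<noteq> 0"
  shows "coordinate_change K_analytic_map p (\<lambda>w. (A * fst w + B * snd w, C * fst w + D * snd w))"
proof -
  define \<delta> where "\<delta> = A * D - B * C"
  let ?f = "\<lambda>w::'k \<times> 'k. (A * fst w + B * snd w, C * fst w + D * snd w)"
  let ?g = "\<lambda>w::'k \<times> 'k. ((D / \<delta>) * fst w + (- B / \<delta>) * snd w, (- C / \<delta>) * fst w + (A / \<delta>) * snd w)"
  have gf: "?g (?f w) = w" for w
  proof -
    have "D * (A * fst w + B * snd w) - B * (C * fst w + D * snd w) = \<delta> * fst w"
      "A * (C * fst w + D * snd w) - C * (A * fst w + B * snd w) = \<delta> * snd w"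
      by (simp_all add: \<delta>_def algebra_simps)
    then show ?thesis using assms unfolding \<delta>_def[symmetric]
      by (simp add: prod_eq_iff add_divide_distrib[symmetric] diff_divide_distrib[symmetric])
  qed
  have fg: "?f (?g w) = w" for w
  proof -
    have "A * (D * fst w - B * snd w) + B * (A * snd w - C * fst w) = \<delta> * fst w"
      "C * (D * fst w - B * snd w) + D * (A * snd w - C * fst w) = \<delta> * snd w"
      by (simp_all add: \<delta>_def algebra_simps)
    then show ?thesis using assms unfolding \<delta>_def[symmetric]
      by (simp add: prod_eq_iff add_divide_distrib[symmetric] diff_divide_distrib[symmetric])
  qed
  have "range ?f = UNIV" by (rule surjI[of ?f ?g]) (rule fg)
  moreover have "K_analytic_map ?f V" "K_analytic_map ?g V" for V
    unfolding K_analytic_map_def fst_conv snd_conv by (intro conjI K_analytic2_linear)+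
  ultimately show ?thesis
    unfolding coordinate_change_def using gf
    by (intro exI[of _ UNIV] exI[of _ ?g] conjI ballI) (simp_all only: open_UNIV UNIV_I)
qed

lemma has_lowest_power_series:
  fixes c :: "nat \<Rightarrow> 'k::real_normed_field"
  assumes r: "r > 0" and v: "\<And>s. norm s < r \<Longrightarrow> (\<lambda>i. c i * s ^ i) sums v s"
    and m: "m > 0" "\<And>i. 0 < i \<Longrightarrow> i < m \<Longrightarrow> c i = 0" "c m \<noteq> 0"
  shows "has_lowest_power (enat m) (\<lambda>s. v s - v 0)"
proof -
  define R where "R s = v s - v 0 - c m * s ^ m" for s
  define a where "a i = (if i \<le> m then 0 else c i)" for i
  have v0: "v 0 = c 0"
  proof -
    have "(\<lambda>i. c i * 0 ^ i) sums (\<Sum>i\<in>{0}. c i * 0 ^ i)" by (rule sums_finite) auto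
    then show ?thesis using v[of 0] r by (auto dest: sums_unique2)
  qed
  have "(\<lambda>i. a i * s ^ i) sums R s" if s: "norm s < r" for s
  proof -
    have "(\<lambda>i. (if i = 0 then c 0 else 0) + (if i = m then c m * s ^ m else 0)) sums (c 0 + c m * s ^ m)"
      using sums_add[OF sums_single[of 0 "\<lambda>_. c 0"] sums_single[of m "\<lambda>i. c m * s ^ m"]] by simp
    from sums_diff[OF v[OF s] this]
    have "(\<lambda>i. c i * s ^ i - ((if i = 0 then c 0 else 0) + (if i = m then c m * s ^ m else 0))) sums (R s)"
      by (simp add: R_def v0 algebra_simps)
    moreover have "c i * s ^ i - ((if i = 0 then c 0 else 0) + (if i = m then c m * s ^ m else 0)) = a i * s ^ i" for i
      using m by (cases "i = 0"; cases "i < m"; cases "i = m") (auto simp: a_def)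
    ultimately show ?thesis by simp
  qed
  then have "power_series_from (m + 1) R"
    unfolding power_series_from_def using r by (intro exI[of _ a] exI[of _ r]) (auto simp: a_def)
  then show ?thesis
    using m by (auto intro!: exI[of _ "c m"] exI[of _ R] simp: R_def)
qed

text \<open>A linear change in the range suffices. The second new coordinate annihilates the leading
  vector \<open>(p n, q n)\<close>, and its coefficient at \<open>n + 1\<close> is the determinant
  in \<open>det\<close>.\<close>

lemma has_order_pair_linear:
  fixes p q :: "nat \<Rightarrow> 'k::real_normed_field"
  assumes r: "r > 0" and n: "n > 0"
    and an: "K_analytic1 (\<lambda>s. fst (\<beta> s)) (ball 0 r)" "K_analytic1 (\<lambda>s. snd (\<beta> s)) (ball 0 r)"
    and p: "\<And>s. norm s < r \<Longrightarrow> (\<lambda>i. p i * s ^ i) sums fst (\<beta> s)"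
    and q: "\<And>s. norm s < r \<Longrightarrow> (\<lambda>i. q i * s ^ i) sums snd (\<beta> s)"
    and zero: "\<And>i. 0 < i \<Longrightarrow> i < n \<Longrightarrow> p i = 0 \<and> q i = 0"
    and det: "p n * q (n + 1) - q n * p (n + 1) \<noteq> 0"
  shows "has_order_pair \<beta> n (enat (n + 1))"
proof -
  \<comment> \<open>Any functional that is nonzero on the leading vector serves; the same number is
    the determinant of \<psi>, so \<psi> is invertible.\<close>
  obtain A B where AB: "A * p n + B * q n \<noteq> 0"
  proof (cases "p n = 0")
    case True
    then show ?thesis using that[of 0 1] det by auto
  next
    case False
    then show ?thesis using that[of 1 0] by auto
  qed
  define \<psi> where "\<psi> w = (A * fst w + B * snd w, (- q n) * fst w + p n * snd w)" for w :: "'k \<times> 'k"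
  have lin: "has_lowest_power (enat m) (\<lambda>s. (a * fst (\<beta> s) + b * snd (\<beta> s)) - (a * fst (\<beta> 0) + b * snd (\<beta> 0)))"
    if "m > 0" "\<And>i. 0 < i \<Longrightarrow> i < m \<Longrightarrow> a * p i + b * q i = 0" "a * p m + b * q m \<noteq> 0" for a b m
  proof (rule has_lowest_power_series[where r = r and c = "\<lambda>i. a * p i + b * q i" and v = "\<lambda>s. a * fst (\<beta> s) + b * snd (\<beta> s)"])
    show "r > 0" "m > 0" "\<And>i. 0 < i \<Longrightarrow> i < m \<Longrightarrow> a * p i + b * q i = 0" "a * p m + b * q m \<noteq> 0"
      using r that by auto
    fix s :: 'k assume "norm s < r"
    from sums_add[OF sums_mult[OF p[OF this], of a] sums_mult[OF q[OF this], of b]]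
    show "(\<lambda>i. (a * p i + b * q i) * s ^ i) sums (a * fst (\<beta> s) + b * snd (\<beta> s))"
      by (simp add: algebra_simps)
  qed
  have "coordinate_change K_analytic_map (\<beta> 0) \<psi>"
    unfolding \<psi>_def by (rule coordinate_change_linear) (use AB in \<open>simp add: algebra_simps\<close>)
  moreover have "has_lowest_power (enat n) (\<lambda>s. fst (\<psi> (\<beta> s) - \<psi> (\<beta> 0)))"
    unfolding \<psi>_def fst_diff fst_conv by (rule lin) (use n zero AB in auto)
  moreover have "has_lowest_power (enat (n + 1)) (\<lambda>s. snd (\<psi> (\<beta> s) - \<psi> (\<beta> 0)))"
    unfolding \<psi>_def snd_diff snd_conv
  proof (rule lin)
    show "- q n * p i + p n * q i = 0" if "0 < i" "i < n + 1" for i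
      using zero[of i] that by (cases "i = n") auto
    show "- q n * p (n + 1) + p n * q (n + 1) \<noteq> 0" using det by (simp add: algebra_simps)
  qed simp
  ultimately show ?thesis
    unfolding has_order_pair_def using n r an coordinate_change_id
    by (intro conjI exI[of _ r] exI[of _ "\<lambda>s. s"] exI[of _ \<psi>]) auto
qed

text \<open>The graph \<open>v = \<sigma> u\<close> is flattened by the shear \<open>(u, v) \<mapsto> (u, v - \<sigma> u)\<close>.\<close>

lemma has_order_pair_graph:
  fixes p :: "nat \<Rightarrow> 'k::real_normed_field"
  assumes r: "r > 0"
    and an: "K_analytic1 (\<lambda>s. fst (\<beta> s)) (ball 0 r)" "K_analytic1 (\<lambda>s. snd (\<beta> s)) (ball 0 r)"
    and p: "\<And>s. norm s < r \<Longrightarrow> (\<lambda>i. p i * s ^ i) sums fst (\<beta> s)" "p 1 \<noteq> 0"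
    and U: "open U" "fst (\<beta> 0) \<in> U"
    and \<sigma>: "K_analytic2 (\<lambda>w. snd w - \<sigma> (fst w)) (U \<times> UNIV)" "K_analytic2 (\<lambda>w. snd w + \<sigma> (fst w)) (U \<times> UNIV)"
    and graph: "\<forall>\<^sub>F s in nhds 0. snd (\<beta> s) = \<sigma> (fst (\<beta> s))"
  shows "has_order_pair \<beta> 1 \<infinity>"
proof -
  define \<psi> where "\<psi> w = (fst w, snd w - \<sigma> (fst w))" for w :: "'k \<times> 'k"
  have im: "\<psi> ` (U \<times> UNIV) = U \<times> UNIV"
  proof (intro equalityI subsetI)
    fix w :: "'k \<times> 'k" assume "w \<in> U \<times> UNIV"
    then show "w \<in> \<psi> ` (U \<times> UNIV)"
      by (intro image_eqI[of _ _ "(fst w, snd w + \<sigma> (fst w))"]) (auto simp: \<psi>_def)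
  qed (auto simp: \<psi>_def)
  have "K_analytic2 fst (V :: ('k \<times> 'k) set)" for V using K_analytic2_linear[of 1 0 V] by simp
  have "coordinate_change K_analytic_map (\<beta> 0) \<psi>"
    unfolding coordinate_change_def
  proof (intro exI[of _ "U \<times> UNIV"] exI[of _ "\<lambda>w. (fst w, snd w + \<sigma> (fst w))"] conjI ballI)
    show "open (U \<times> (UNIV :: 'k set))" "\<beta> 0 \<in> U \<times> UNIV" using U by (simp_all add: open_Times mem_Times_iff)
    then show "open (\<psi> ` (U \<times> UNIV))" by (simp only: im)
    show "K_analytic_map \<psi> (U \<times> UNIV)" "K_analytic_map (\<lambda>w. (fst w, snd w + \<sigma> (fst w))) (\<psi> ` (U \<times> UNIV))"
      unfolding im K_analytic_map_def \<psi>_def fst_conv snd_conv using \<sigma> \<open>\<And>V. K_analytic2 fst V\<close> by (blast+)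
    show "(fst (\<psi> w), snd (\<psi> w) + \<sigma> (fst (\<psi> w))) = w" for w by (simp add: \<psi>_def)
  qed
  moreover have "has_lowest_power (enat 1) (\<lambda>s. fst (\<psi> (\<beta> s) - \<psi> (\<beta> 0)))"
    unfolding \<psi>_def fst_diff fst_conv
    by (rule has_lowest_power_series[where r = r and c = p and v = "\<lambda>s. fst (\<beta> s)"]) (use r p in auto)
  moreover have "has_lowest_power \<infinity> (\<lambda>s. snd (\<psi> (\<beta> s) - \<psi> (\<beta> 0)))"
    using graph eventually_nhds_x_imp_x[OF graph] by (auto simp: \<psi>_def elim!: eventually_mono)
  ultimately show ?thesis
    unfolding has_order_pair_def using r an coordinate_change_id
    by (intro conjI exI[of _ r] exI[of _ "\<lambda>s. s"] exI[of _ \<psi>]) auto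
qed

lemma K_analytic2_swap:
  assumes "K_analytic2 f (prod.swap ` U)"
  shows "K_analytic2 (f \<circ> prod.swap) U"
  unfolding K_analytic2_def
proof
  fix p assume p: "p \<in> U"
  obtain x0 y0 where p': "p = (x0, y0)" by fastforce
  then have "(y0, x0) \<in> prod.swap ` U" using p by force
  from bspec[OF assms[unfolded K_analytic2_def] this, unfolded prod.case]
  obtain a r where r: "r > 0" and a: "\<And>x y. norm (x - y0) < r \<Longrightarrow> norm (y - x0) < r \<Longrightarrow>
       ((\<lambda>(m, n). a m n * (x - y0) ^ m * (y - x0) ^ n) has_sum f (x, y)) UNIV"
    by blast
  have "((\<lambda>(m, n). a n m * (x - x0) ^ m * (y - y0) ^ n) has_sum f (y, x)) UNIV"
    if "norm (x - x0) < r" "norm (y - y0) < r" for x y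
  proof -
    have "((\<lambda>(m, n). a m n * (y - y0) ^ m * (x - x0) ^ n) has_sum f (y, x)) (range prod.swap)"
      using a[OF that(2,1)] by simp
    then have "(((\<lambda>(m, n). a m n * (y - y0) ^ m * (x - x0) ^ n) \<circ> prod.swap) has_sum f (y, x)) UNIV"
      by (subst (asm) has_sum_reindex) auto
    then show ?thesis by (simp add: o_def case_prod_unfold mult_ac)
  qed
  then show "case p of (x0, y0) \<Rightarrow> \<exists>a r. r > 0 \<and> (\<forall>x y. norm (x - x0) < r \<and> norm (y - y0) < r \<longrightarrow>
        ((\<lambda>(m, n). a m n * (x - x0) ^ m * (y - y0) ^ n) has_sum (f \<circ> prod.swap) (x, y)) UNIV)"
    unfolding p' prod.case using r by (intro exI[of _ "\<lambda>m n. a n m"] exI[of _ r]) auto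
qed

text \<open>The swap can be absorbed into the coordinate change \<psi> of the range. This settles
  the case in which only the second component of the curve is a local parameter.\<close>

lemma has_order_pair_swap:
  assumes "has_order_pair (\<lambda>s. prod.swap (\<beta> s)) j k"
  shows "has_order_pair \<beta> j k"
proof -
  obtain \<phi> \<psi> where *: "coordinate_change K_analytic1 0 \<phi>" "\<phi> 0 = 0" "coordinate_change K_analytic_map (prod.swap (\<beta> 0)) \<psi>"
     "has_lowest_power (enat j) (\<lambda>s. fst (\<psi> (prod.swap (\<beta> (\<phi> s))) - \<psi> (prod.swap (\<beta> 0))))"
     "has_lowest_power k (\<lambda>s. snd (\<psi> (prod.swap (\<beta> (\<phi> s))) - \<psi> (prod.swap (\<beta> 0))))"
    using assms unfolding has_order_pair_def by auto
  from *(3) obtain U g where U: "open U" "prod.swap (\<beta> 0) \<in> U" "open (\<psi> ` U)" "K_analytic_map \<psi> U" "K_analytic_map g (\<psi> ` U)"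
     "\<And>u. u \<in> U \<Longrightarrow> g (\<psi> u) = u" unfolding coordinate_change_def by auto
  have "K_analytic_map (\<psi> \<circ> prod.swap) (prod.swap ` U)"
    using U(4) K_analytic2_swap[of "\<lambda>w. fst (\<psi> w)" "prod.swap ` U"] K_analytic2_swap[of "\<lambda>w. snd (\<psi> w)" "prod.swap ` U"]
    unfolding K_analytic_map_def by (simp add: image_image o_def)
  then have "coordinate_change K_analytic_map (\<beta> 0) (\<psi> \<circ> prod.swap)"
    unfolding coordinate_change_def
  proof (intro exI[of _ "prod.swap ` U"] exI[of _ "prod.swap \<circ> g"] conjI ballI)
    have im: "(\<psi> \<circ> prod.swap) ` prod.swap ` U = \<psi> ` U" by (simp add: image_image)
    show "open (prod.swap ` U)" by (rule open_swap_image[OF U(1)])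
    show "\<beta> 0 \<in> prod.swap ` U" using U(2) by (metis image_eqI swap_swap)
    show "open ((\<psi> \<circ> prod.swap) ` prod.swap ` U)" "K_analytic_map (prod.swap \<circ> g) ((\<psi> \<circ> prod.swap) ` prod.swap ` U)"
      unfolding im using U(3,5) by (simp_all add: K_analytic_map_def)
    show "(prod.swap \<circ> g) ((\<psi> \<circ> prod.swap) u) = u" if "u \<in> prod.swap ` U" for u
      using that U(6) by auto
  qed
  then show ?thesis
    using assms *(1,2,4,5) unfolding has_order_pair_def
    by (intro conjI exI[of _ \<phi>] exI[of _ "\<psi> \<circ> prod.swap"]) auto
qed

lemma holomorphic_imp_K_analytic1:
  assumes "f holomorphic_on S" "open S"
  shows "K_analytic1 f S"
  unfolding K_analytic1_def
proof
  fix w assume "w \<in> S"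
  then obtain r where r: "r > 0" "ball w r \<subseteq> S" using assms(2) open_contains_ball by blast
  show "\<exists>a. \<exists>r>0. \<forall>z. norm (z - w) < r \<longrightarrow> (\<lambda>n. a n * (z - w) ^ n) sums f z"
    using r holomorphic_power_series[OF holomorphic_on_subset[OF assms(1) r(2)]]
    by (intro exI[of _ "\<lambda>n. (deriv ^^ n) f w / fact n"] exI[of _ r]) (auto simp: dist_norm norm_minus_commute)
qed

text \<open>At real centre and real argument the powers are real, so the real part of the sum is the
  series of the real parts of the coefficients.\<close>

lemma K_analytic1_Re:
  assumes "K_analytic1 f S"
  shows "K_analytic1 (\<lambda>t. Re (f (of_real t))) {t. of_real t \<in> S}"
  unfolding K_analytic1_def
proof clarify
  fix w :: real assume "of_real w \<in> S"
  then obtain a r where r: "r > 0" "\<And>z. norm (z - of_real w) < r \<Longrightarrow> (\<lambda>n. a n * (z - of_real w) ^ n) sums f z"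
    using assms unfolding K_analytic1_def by meson
  have "(\<lambda>n. Re (a n) * (t - w) ^ n) sums Re (f (of_real t))" if "norm (t - w) < r" for t
  proof -
    have "norm (complex_of_real t - of_real w) < r" using that by (metis norm_of_real of_real_diff real_norm_def)
    from sums_Re[OF r(2)[OF this]] show ?thesis
      by (simp add: of_real_diff[symmetric] of_real_power[symmetric] del: of_real_diff of_real_power)
  qed
  then show "\<exists>a. \<exists>r>0. \<forall>z. norm (z - w) < r \<longrightarrow> (\<lambda>n. a n * (z - w) ^ n) sums Re (f (of_real z))"
    using r by (intro exI[of _ "\<lambda>n. Re (a n)"] exI[of _ r]) auto
qed

lemma K_analytic2_Re:
  assumes "K_analytic2 f S"
  shows "K_analytic2 (\<lambda>w. Re (f (complexify w))) {w. complexify w \<in> S}"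
  unfolding K_analytic2_def
proof clarify
  fix x0 y0 :: real assume "complexify (x0, y0) \<in> S"
  then have "(of_real x0, of_real y0) \<in> S" by (simp add: complexify_def)
  then obtain a r where r: "r > 0" and a: "\<And>x y. norm (x - of_real x0) < r \<Longrightarrow> norm (y - of_real y0) < r \<Longrightarrow>
       ((\<lambda>(m, n). a m n * (x - of_real x0) ^ m * (y - of_real y0) ^ n) has_sum f (x, y)) UNIV"
    using assms unfolding K_analytic2_def by fast
  have "((\<lambda>(m, n). Re (a m n) * (x - x0) ^ m * (y - y0) ^ n) has_sum Re (f (complexify (x, y)))) UNIV"
    if "norm (x - x0) < r" "norm (y - y0) < r" for x y
  proof -
    have "norm (complex_of_real x - of_real x0) < r" "norm (complex_of_real y - of_real y0) < r"
      using that by (metis norm_of_real of_real_diff real_norm_def)+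
    from has_sum_Re[OF a[OF this]]
    have "((\<lambda>mn. Re (a (fst mn) (snd mn) * of_real ((x - x0) ^ fst mn * (y - y0) ^ snd mn))) has_sum Re (f (complexify (x, y)))) UNIV"
      by (simp add: complexify_def case_prod_unfold mult.assoc)
    then show ?thesis unfolding Re_complex_of_real by (simp add: case_prod_unfold mult.assoc)
  qed
  then show "\<exists>a r. r > 0 \<and> (\<forall>x y. norm (x - x0) < r \<and> norm (y - y0) < r \<longrightarrow>
        ((\<lambda>(m, n). a m n * (x - x0) ^ m * (y - y0) ^ n) has_sum Re (f (complexify (x, y)))) UNIV)"
    using r by (intro exI[of _ "\<lambda>m n. Re (a m n)"] exI[of _ r]) auto
qed

lemma holo2_shear:
  assumes "\<sigma> holomorphic_on U" "open U"
  shows "holo2 (\<lambda>w. snd w + c * \<sigma> (fst w)) (U \<times> UNIV)"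
proof (rule holo2I)
  fix p :: "complex \<times> complex" assume "p \<in> U \<times> UNIV"
  then have "(\<sigma> has_field_derivative deriv \<sigma> (fst p)) (at (fst p))"
    using assms by (intro holomorphic_derivI) auto
  then have "((\<lambda>w. \<sigma> (fst w)) has_derivative (\<lambda>h. deriv \<sigma> (fst p) * fst h)) (at p)"
    unfolding has_field_derivative_def by (rule has_derivative_compose[rotated]) (auto intro!: derivative_eq_intros)
  then have "((\<lambda>w. snd w + c * \<sigma> (fst w)) has_derivative (\<lambda>h. (c * deriv \<sigma> (fst p)) * fst h + 1 * snd h)) (at p)"
    by (auto intro!: derivative_eq_intros)
  then show "\<exists>a b. ((\<lambda>w. snd w + c * \<sigma> (fst w)) has_derivative (\<lambda>h. a * fst h + b * snd h)) (at p)" by blast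
qed (use assms in \<open>auto simp: open_Times\<close>)

text \<open>\<open>S1\<close> is a local coordinate on the source; \<sigma> is \<open>S2\<close>
  composed with its inverse.\<close>

lemma holomorphic_graph:
  assumes S: "S1 holomorphic_on ball 0 r" "S2 holomorphic_on ball 0 r" "r > 0" and d: "deriv S1 0 \<noteq> 0"
  obtains U \<sigma> \<rho> where "open U" "S1 0 \<in> U" "\<sigma> holomorphic_on U" "\<rho> > 0" "\<And>t. t \<in> ball 0 \<rho> \<Longrightarrow> \<sigma> (S1 t) = S2 t"
proof -
  obtain \<rho> where \<rho>: "\<rho> > 0" "ball (0::complex) \<rho> \<subseteq> ball 0 r" "open (S1 ` ball 0 \<rho>)" "inj_on S1 (ball 0 \<rho>)"
    using has_complex_derivative_locally_invertible[OF S(1) _ open_ball d] S(3) by (metis centre_in_ball)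
  obtain \<tau> where \<tau>: "\<tau> holomorphic_on (S1 ` ball 0 \<rho>)" "\<And>z. z \<in> ball 0 \<rho> \<Longrightarrow> \<tau> (S1 z) = z"
    using holomorphic_has_inverse[OF holomorphic_on_subset[OF S(1) \<rho>(2)] open_ball \<rho>(4)] by metis
  have "\<tau> ` S1 ` ball 0 \<rho> \<subseteq> ball 0 r"
  proof
    fix z assume "z \<in> \<tau> ` S1 ` ball 0 \<rho>"
    then have "z \<in> ball 0 \<rho>" using \<tau>(2) by auto
    then show "z \<in> ball 0 r" using \<rho>(2) by blast
  qed
  then have "(S2 \<circ> \<tau>) holomorphic_on (S1 ` ball 0 \<rho>)"
    by (rule holomorphic_on_compose[OF \<tau>(1) holomorphic_on_subset[OF S(2)]])
  then show ?thesis
    by (rule that[of "S1 ` ball 0 \<rho>" "S2 \<circ> \<tau>" \<rho>, rotated 2]) (use \<rho> \<tau> in auto)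
qed

section \<open>Order, order-pair and multiplicity over the complex numbers\<close>

lemma curve_order_eq_enat_iff:
  "curve_order \<Sigma> = enat n \<longleftrightarrow> n \<ge> 1 \<and> ((deriv ^^ n) (\<lambda>t. fst (\<Sigma> t)) 0 \<noteq> 0 \<or> (deriv ^^ n) (\<lambda>t. snd (\<Sigma> t)) 0 \<noteq> 0) \<and>
     (\<forall>i. 0 < i \<longrightarrow> i < n \<longrightarrow> (deriv ^^ i) (\<lambda>t. fst (\<Sigma> t)) 0 = 0 \<and> (deriv ^^ i) (\<lambda>t. snd (\<Sigma> t)) 0 = 0)" (is ?A)
  and curve_order_eq_infinity_iff:
  "curve_order \<Sigma> = \<infinity> \<longleftrightarrow> (\<forall>i. 0 < i \<longrightarrow> (deriv ^^ i) (\<lambda>t. fst (\<Sigma> t)) 0 = 0 \<and> (deriv ^^ i) (\<lambda>t. snd (\<Sigma> t)) 0 = 0)" (is ?B)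
proof -
  define A where "A = {n. n \<ge> 1 \<and> ((deriv ^^ n) (\<lambda>t. fst (\<Sigma> t)) 0 \<noteq> 0 \<or> (deriv ^^ n) (\<lambda>t. snd (\<Sigma> t)) 0 \<noteq> 0)}"
  have c: "curve_order \<Sigma> = Inf (enat ` A)"
    unfolding curve_order_def A_def by (intro arg_cong[where f = Inf]) auto
  have least: "curve_order \<Sigma> = enat (LEAST n. n \<in> A)" if "k \<in> A" for k
  proof -
    have "(LEAST n. n \<in> A) \<in> A" "\<And>m. m \<in> A \<Longrightarrow> (LEAST n. n \<in> A) \<le> m"
      using that by (auto intro: LeastI Least_le)
    then show ?thesis unfolding c by (intro antisym Inf_lower Inf_greatest) auto
  qed
  have empty: "curve_order \<Sigma> = \<infinity>" if "A = {}" using that by (simp add: c Inf_enat_def)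
  have B: "curve_order \<Sigma> = \<infinity> \<longleftrightarrow> A = {}" using least empty by fastforce
  then show ?B by (auto simp: A_def)
  have "curve_order \<Sigma> = enat n \<longleftrightarrow> n \<in> A \<and> (\<forall>i<n. i \<notin> A)"
  proof
    assume e: "curve_order \<Sigma> = enat n"
    then obtain k where k: "k \<in> A" using empty by fastforce
    then have "n = (LEAST n. n \<in> A)" using least[OF k] e by simp
    then show "n \<in> A \<and> (\<forall>i<n. i \<notin> A)" using LeastI[of "\<lambda>n. n \<in> A", OF k] not_less_Least by blast
  next
    assume n: "n \<in> A \<and> (\<forall>i<n. i \<notin> A)"
    then have "(LEAST n. n \<in> A) = n" by (intro Least_equality) (auto simp: not_less[symmetric])
    then show "curve_order \<Sigma> = enat n" using least[of n] n by simp
  qed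
  then show ?A by (force simp: A_def)
qed

lemma holo2_jacobian:
  assumes "holo2 (\<lambda>p. fst (F p)) W" "holo2 (\<lambda>p. snd (F p)) W"
  shows "holo2 (jacobian F) W"
  unfolding jacobian_def[abs_def] using assms by (intro holo2_diff holo2_mult holo2_partial_x holo2_partial_y)

lemma K_analytic_map_imp_holo2:
  assumes "K_analytic_map F W" "open W"
  shows "holo2 (\<lambda>p. fst (F p)) W" "holo2 (\<lambda>p. snd (F p)) W"
  using assms by (auto simp: K_analytic_map_def intro: K_analytic2_imp_holo2)

text \<open>If all four first partial derivatives vanish, each term of the product rule for the
  gradient of the Jacobian contains a vanishing factor.\<close>

lemma regular_imp_gradient_nonzero:
  assumes f: "holo2 (\<lambda>p. fst (F p)) W" and g: "holo2 (\<lambda>p. snd (F p)) W" and reg: "regular_critical_point W F w0"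
  shows "(partial_x (\<lambda>p. fst (F p)) w0, partial_y (\<lambda>p. fst (F p)) w0) \<noteq> (0, 0) \<or>
         (partial_x (\<lambda>p. snd (F p)) w0, partial_y (\<lambda>p. snd (F p)) w0) \<noteq> (0, 0)"
proof (rule ccontr)
  assume "\<not> ?thesis"
  then have z: "partial_x (\<lambda>p. fst (F p)) w0 = 0" "partial_y (\<lambda>p. fst (F p)) w0 = 0"
    "partial_x (\<lambda>p. snd (F p)) w0 = 0" "partial_y (\<lambda>p. snd (F p)) w0 = 0" by auto
  have w0: "w0 \<in> W" using reg by (auto simp: regular_critical_point_def critical_set_def)
  note d = holo2_partial_derivs[OF holo2_partial_x[OF f] w0] holo2_partial_derivs[OF holo2_partial_y[OF f] w0]
    holo2_partial_derivs[OF holo2_partial_x[OF g] w0] holo2_partial_derivs[OF holo2_partial_y[OF g] w0]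
  have "((\<lambda>x. jacobian F (x, snd w0)) has_field_derivative 0) (at (fst w0))"
    unfolding jacobian_def by (rule DERIV_cong, (rule DERIV_diff DERIV_mult d)+) (simp add: z)
  moreover have "((\<lambda>y. jacobian F (fst w0, y)) has_field_derivative 0) (at (snd w0))"
    unfolding jacobian_def by (rule DERIV_cong, (rule DERIV_diff DERIV_mult d)+) (simp add: z)
  ultimately have "partial_x (jacobian F) w0 = 0" "partial_y (jacobian F) w0 = 0"
    unfolding partial_x_def[of "jacobian F"] partial_y_def[of "jacobian F"] by (auto intro: DERIV_imp_deriv)
  then show False using reg by (simp add: regular_critical_point_def)
qed

lemma partial_uminus:
  fixes f :: "complex \<times> complex \<Rightarrow> complex"
  assumes "holo2 f S" "p \<in> S"
  shows "partial_x (\<lambda>p. - f p) p = - partial_x f p" "partial_y (\<lambda>p. - f p) p = - partial_y f p"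
  unfolding partial_x_def[of "\<lambda>p. - f p"] partial_y_def[of "\<lambda>p. - f p"]
  by (auto intro!: DERIV_imp_deriv DERIV_minus holo2_partial_derivs assms)

lemma natural_parametrization_values_holomorphic:
  assumes f: "holo2 f W" and nat: "natural_parametrization W F w0 \<Gamma>"
  obtains r where "r > 0" "(\<lambda>t. f (\<Gamma> t)) holomorphic_on ball 0 r"
proof -
  obtain r where r: "r > 0" "\<And>t. t \<in> ball 0 r \<Longrightarrow> \<Gamma> t \<in> W \<and>
        ((\<lambda>s. fst (\<Gamma> s)) has_field_derivative - partial_y (jacobian F) (\<Gamma> t)) (at t) \<and>
        ((\<lambda>s. snd (\<Gamma> s)) has_field_derivative partial_x (jacobian F) (\<Gamma> t)) (at t)"
    using nat unfolding natural_parametrization_def by blast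
  have "(\<lambda>t. f (\<Gamma> t)) holomorphic_on ball 0 r"
    unfolding holomorphic_on_open[OF open_ball]
  proof
    fix t :: complex assume t: "t \<in> ball 0 r"
    show "\<exists>f'. ((\<lambda>t. f (\<Gamma> t)) has_field_derivative f') (at t)"
      using grad_curve[of f "partial_x f (\<Gamma> t)" "partial_y f (\<Gamma> t)" "\<lambda>s. fst (\<Gamma> s)" t "\<lambda>s. snd (\<Gamma> s)"]
        has_derivative_partials[OF f, of "\<Gamma> t"] r(2)[OF t] by auto
  qed
  with r(1) show ?thesis by (rule that)
qed

text \<open>Which component of \<open>F\<close> has nonzero gradient is unknown, so
  \<open>critical_value_core\<close> is applied to the components in both orders. The last two
  conclusions say that a component with nonzero gradient realizes the order of the whole critical
  value curve.\<close>

lemma critical_value_curve_complex: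
  fixes F :: "complex \<times> complex \<Rightarrow> complex \<times> complex"
  assumes W: "open W" "K_analytic_map F W" and reg: "regular_critical_point W F w0"
    and nat: "natural_parametrization W F w0 \<Gamma>" and ord: "curve_order (F \<circ> \<Gamma>) = enat n"
  defines "S1 \<equiv> \<lambda>t. fst (F (\<Gamma> t))" and "S2 \<equiv> \<lambda>t. snd (F (\<Gamma> t))"
  shows "local_multiplicity F w0 (n + 1)"
    and "n > 1 \<Longrightarrow> (deriv ^^ n) S1 0 * (deriv ^^ (n + 1)) S2 0 - (deriv ^^ n) S2 0 * (deriv ^^ (n + 1)) S1 0 \<noteq> 0"
    and "(partial_x (\<lambda>p. fst (F p)) w0, partial_y (\<lambda>p. fst (F p)) w0) \<noteq> (0, 0) \<Longrightarrow> (deriv ^^ n) S1 0 \<noteq> 0"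
    and "(partial_x (\<lambda>p. snd (F p)) w0, partial_y (\<lambda>p. snd (F p)) w0) \<noteq> (0, 0) \<Longrightarrow> (deriv ^^ n) S2 0 \<noteq> 0"
proof -
  let ?f = "\<lambda>p. fst (F p)" and ?g = "\<lambda>p. snd (F p)"
  note f = K_analytic_map_imp_holo2(1)[OF W(2,1)] and g = K_analytic_map_imp_holo2(2)[OF W(2,1)]
  have J: "holo2 (jacobian F) W" by (rule holo2_jacobian[OF f g])
  have w0: "w0 \<in> W" "jacobian F w0 = 0" and dJ: "(partial_x (jacobian F) w0, partial_y (jacobian F) w0) \<noteq> (0, 0)"
    using reg by (auto simp: regular_critical_point_def critical_set_def)
  obtain r where r: "r > 0" "\<And>t. t \<in> ball 0 r \<Longrightarrow> \<Gamma> t \<in> W \<and>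
        ((\<lambda>s. fst (\<Gamma> s)) has_field_derivative - partial_y (jacobian F) (\<Gamma> t)) (at t) \<and>
        ((\<lambda>s. snd (\<Gamma> s)) has_field_derivative partial_x (jacobian F) (\<Gamma> t)) (at t)" and \<Gamma>0: "\<Gamma> 0 = w0"
    using nat unfolding natural_parametrization_def by blast
  have n: "n > 0" "(deriv ^^ n) S1 0 \<noteq> 0 \<or> (deriv ^^ n) S2 0 \<noteq> 0"
    "\<And>i. 0 < i \<Longrightarrow> i < n \<Longrightarrow> (deriv ^^ i) S1 0 = 0" "\<And>i. 0 < i \<Longrightarrow> i < n \<Longrightarrow> (deriv ^^ i) S2 0 = 0"
    using ord unfolding curve_order_eq_enat_iff S1_def S2_def by auto
  have J': "(\<lambda>p. partial_x ?f p * partial_y ?g p - partial_y ?f p * partial_x ?g p) = jacobian F"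
    by (simp add: jacobian_def[abs_def])
  have J'': "(\<lambda>p. partial_x ?g p * partial_y ?f p - partial_y ?g p * partial_x ?f p) = (\<lambda>p. - jacobian F p)"
    by (simp add: jacobian_def[abs_def] algebra_simps)
  have core1: "(\<And>i. 0 < i \<Longrightarrow> i < m \<Longrightarrow> (deriv ^^ i) S2 0 = 0)"
      "(deriv ^^ m) S1 0 \<noteq> 0 \<Longrightarrow> local_multiplicity (\<lambda>p. (?f p, ?g p)) w0 (m + 1)"
      "(deriv ^^ m) S1 0 \<noteq> 0 \<Longrightarrow> m > 1 \<Longrightarrow>
           (deriv ^^ m) S1 0 * (deriv ^^ (m + 1)) S2 0 - (deriv ^^ m) S2 0 * (deriv ^^ (m + 1)) S1 0 \<noteq> 0"
    if df: "(partial_x ?f w0, partial_y ?f w0) \<noteq> (0, 0)" and m: "m > 0" "\<And>i. 0 < i \<Longrightarrow> i < m \<Longrightarrow> (deriv ^^ i) S1 0 = 0" for m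
  proof -
    have ode: "\<Gamma> t \<in> W \<and> ((\<lambda>s. fst (\<Gamma> s)) has_field_derivative - 1 * partial_y (jacobian F) (\<Gamma> t)) (at t) \<and>
        ((\<lambda>s. snd (\<Gamma> s)) has_field_derivative 1 * partial_x (jacobian F) (\<Gamma> t)) (at t)" if "t \<in> ball 0 r" for t
      using r(2)[OF that] by simp
    note C = critical_value_core[where x = "\<lambda>s. fst (\<Gamma> s)" and y = "\<lambda>s. snd (\<Gamma> s)" and c = 1 and f = ?f and g = ?g,
        unfolded J' prod.collapse, OF f g w0(1) w0(2)[unfolded jacobian_def] df dJ r(1) \<Gamma>0 one_neq_zero ode m(1) m(2)[unfolded S1_def], folded S1_def S2_def]
    show "(deriv ^^ i) S2 0 = 0" if "0 < i" "i < m" for i by (rule C(1)) (use that in auto)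
    show "local_multiplicity (\<lambda>p. (?f p, ?g p)) w0 (m + 1)" if "(deriv ^^ m) S1 0 \<noteq> 0"
      unfolding prod.collapse by (rule C(2)) (use that in auto)
    show "(deriv ^^ m) S1 0 * (deriv ^^ (m + 1)) S2 0 - (deriv ^^ m) S2 0 * (deriv ^^ (m + 1)) S1 0 \<noteq> 0"
      if "(deriv ^^ m) S1 0 \<noteq> 0" "m > 1"
      by (rule C(3)) (use that in auto)
  qed
  have core2: "(\<And>i. 0 < i \<Longrightarrow> i < m \<Longrightarrow> (deriv ^^ i) S1 0 = 0)"
      "(deriv ^^ m) S2 0 \<noteq> 0 \<Longrightarrow> local_multiplicity (\<lambda>p. (?g p, ?f p)) w0 (m + 1)"
      "(deriv ^^ m) S2 0 \<noteq> 0 \<Longrightarrow> m > 1 \<Longrightarrow>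
           (deriv ^^ m) S2 0 * (deriv ^^ (m + 1)) S1 0 - (deriv ^^ m) S1 0 * (deriv ^^ (m + 1)) S2 0 \<noteq> 0"
    if dg: "(partial_x ?g w0, partial_y ?g w0) \<noteq> (0, 0)" and m: "m > 0" "\<And>i. 0 < i \<Longrightarrow> i < m \<Longrightarrow> (deriv ^^ i) S2 0 = 0" for m
  proof -
    have ode: "\<Gamma> t \<in> W \<and> ((\<lambda>s. fst (\<Gamma> s)) has_field_derivative - (- 1) * partial_y (\<lambda>p. - jacobian F p) (\<Gamma> t)) (at t) \<and>
        ((\<lambda>s. snd (\<Gamma> s)) has_field_derivative (- 1) * partial_x (\<lambda>p. - jacobian F p) (\<Gamma> t)) (at t)" if "t \<in> ball 0 r" for t
      using r(2)[OF that] partial_uminus[OF J, of "\<Gamma> t"] by auto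
    have dJ': "(partial_x (\<lambda>p. - jacobian F p) w0, partial_y (\<lambda>p. - jacobian F p) w0) \<noteq> (0, 0)"
      using dJ partial_uminus[OF J w0(1)] by simp
    have J0: "partial_x ?g w0 * partial_y ?f w0 - partial_y ?g w0 * partial_x ?f w0 = 0"
      using w0(2) by (simp add: jacobian_def algebra_simps)
    have c: "- 1 \<noteq> (0::complex)" by simp
    note C = critical_value_core[where x = "\<lambda>s. fst (\<Gamma> s)" and y = "\<lambda>s. snd (\<Gamma> s)" and c = "- 1" and f = ?g and g = ?f,
        unfolded J'' prod.collapse, OF g f w0(1) J0 dg dJ' r(1) \<Gamma>0 c ode m(1) m(2)[unfolded S2_def], folded S1_def S2_def]
    show "(deriv ^^ i) S1 0 = 0" if "0 < i" "i < m" for i by (rule C(1)) (use that in auto)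
    show "local_multiplicity (\<lambda>p. (?g p, ?f p)) w0 (m + 1)" if "(deriv ^^ m) S2 0 \<noteq> 0"
      by (rule C(2)) (use that in auto)
    show "(deriv ^^ m) S2 0 * (deriv ^^ (m + 1)) S1 0 - (deriv ^^ m) S1 0 * (deriv ^^ (m + 1)) S2 0 \<noteq> 0"
      if "(deriv ^^ m) S2 0 \<noteq> 0" "m > 1"
      by (rule C(3)) (use that in auto)
  qed
  \<comment> \<open>Used with \<open>n + 1\<close>: were the \<open>n\<close>-th derivative of
    \<open>S1\<close> also zero, the derivatives of \<open>S2\<close> would vanish up to order
    \<open>n\<close>, and the curve would have order greater than \<open>n\<close>.\<close>
  have nz1: "(deriv ^^ n) S1 0 \<noteq> 0" if df: "(partial_x ?f w0, partial_y ?f w0) \<noteq> (0, 0)"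
  proof
    assume z: "(deriv ^^ n) S1 0 = 0"
    have "(deriv ^^ n) S2 0 = 0"
      by (rule core1(1)[OF df, of "n + 1"]) (use n z less_Suc_eq in auto)
    with n(2) z show False by simp
  qed
  have nz2: "(deriv ^^ n) S2 0 \<noteq> 0" if dg: "(partial_x ?g w0, partial_y ?g w0) \<noteq> (0, 0)"
  proof
    assume z: "(deriv ^^ n) S2 0 = 0"
    have "(deriv ^^ n) S1 0 = 0"
      by (rule core2(1)[OF dg, of "n + 1"]) (use n z less_Suc_eq in auto)
    with n(2) z show False by simp
  qed
  show "(partial_x ?f w0, partial_y ?f w0) \<noteq> (0, 0) \<Longrightarrow> (deriv ^^ n) S1 0 \<noteq> 0"
    "(partial_x ?g w0, partial_y ?g w0) \<noteq> (0, 0) \<Longrightarrow> (deriv ^^ n) S2 0 \<noteq> 0"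
    by (fact nz1, fact nz2)
  have lm: "local_multiplicity (\<lambda>p. (?f p, ?g p)) w0 (n + 1) \<and>
     (n > 1 \<longrightarrow> (deriv ^^ n) S1 0 * (deriv ^^ (n + 1)) S2 0 - (deriv ^^ n) S2 0 * (deriv ^^ (n + 1)) S1 0 \<noteq> 0)"
  proof (cases "(partial_x ?f w0, partial_y ?f w0) \<noteq> (0, 0)")
    case True
    show ?thesis using core1(2,3)[OF True n(1,3) nz1[OF True]] by blast
  next
    case False
    then have dg: "(partial_x ?g w0, partial_y ?g w0) \<noteq> (0, 0)" using regular_imp_gradient_nonzero[OF f g reg] by blast
    have "local_multiplicity (\<lambda>p. (?f p, ?g p)) w0 (n + 1)"
      by (subst local_multiplicity_swap) (rule core2(2)[OF dg n(1,4) nz2[OF dg]])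
    moreover have "(deriv ^^ n) S1 0 * (deriv ^^ (n + 1)) S2 0 - (deriv ^^ n) S2 0 * (deriv ^^ (n + 1)) S1 0 \<noteq> 0" if "n > 1"
      using core2(3)[OF dg n(1,4) nz2[OF dg] that] by (metis minus_diff_eq neg_equal_0_iff_equal)
    ultimately show ?thesis by blast
  qed
  then show "local_multiplicity F w0 (n + 1)" by simp
  show "n > 1 \<Longrightarrow> (deriv ^^ n) S1 0 * (deriv ^^ (n + 1)) S2 0 - (deriv ^^ n) S2 0 * (deriv ^^ (n + 1)) S1 0 \<noteq> 0"
    using lm by blast
qed

text \<open>Finite order is \<open>critical_value_curve_complex\<close>. For infinite order,
  \<open>F\<close> is constant along \<Gamma> by the identity theorem, and \<Gamma> leaves
  \<open>w0\<close> because its velocity there is the rotated gradient of the Jacobian; so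
  \<open>w0\<close> is not isolated in its fibre and both sides are infinite.\<close>

lemma critical_value_multiplicity_complex:
  fixes F :: "complex \<times> complex \<Rightarrow> complex \<times> complex"
  assumes W: "open W" "K_analytic_map F W" and reg: "regular_critical_point W F w0"
    and nat: "natural_parametrization W F w0 \<Gamma>"
  shows "map_multiplicity W F w0 = curve_order (F \<circ> \<Gamma>) + 1"
proof -
  note f = K_analytic_map_imp_holo2(1)[OF W(2,1)] and g = K_analytic_map_imp_holo2(2)[OF W(2,1)]
  have w0: "w0 \<in> W" and dJ: "(partial_x (jacobian F) w0, partial_y (jacobian F) w0) \<noteq> (0, 0)"
    using reg by (auto simp: regular_critical_point_def critical_set_def)
  show ?thesis
  proof (cases "curve_order (F \<circ> \<Gamma>)")
    case (enat n)
    have "continuous_on W (\<lambda>p. (fst (F p), snd (F p)))"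
      by (intro continuous_on_Pair holo2_continuous f g)
    then have "continuous_on W F" by simp
    from map_multiplicity_eq[OF critical_value_curve_complex(1)[OF W reg nat enat] this W(1) w0]
    show ?thesis using enat by (simp add: one_enat_def)
  next
    case infinity
    obtain r1 where r1: "r1 > 0" "(\<lambda>t. fst (F (\<Gamma> t))) holomorphic_on ball 0 r1"
      using natural_parametrization_values_holomorphic[OF f nat] by metis
    obtain r2 where r2: "r2 > 0" "(\<lambda>t. snd (F (\<Gamma> t))) holomorphic_on ball 0 r2"
      using natural_parametrization_values_holomorphic[OF g nat] by metis
    have z: "(deriv ^^ i) (\<lambda>t. fst (F (\<Gamma> t))) 0 = 0" "(deriv ^^ i) (\<lambda>t. snd (F (\<Gamma> t))) 0 = 0" if "0 < i" for i
      using infinity that unfolding curve_order_eq_infinity_iff by auto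
    obtain r where r: "r > 0" "\<And>t. t \<in> ball 0 r \<Longrightarrow>
        ((\<lambda>s. fst (\<Gamma> s)) has_field_derivative - partial_y (jacobian F) (\<Gamma> t)) (at t) \<and>
        ((\<lambda>s. snd (\<Gamma> s)) has_field_derivative partial_x (jacobian F) (\<Gamma> t)) (at t)" and \<Gamma>0: "\<Gamma> 0 = w0"
      using nat unfolding natural_parametrization_def by blast
    have const: "F (\<Gamma> t) = F w0" if "t \<in> ball 0 (min r1 r2)" for t
    proof -
      have "fst (F (\<Gamma> t)) = fst (F (\<Gamma> 0))"
        by (rule holomorphic_fun_eq_const_on_connected[OF r1(2) open_ball connected_ball]) (use z r1(1) that in auto)
      moreover have "snd (F (\<Gamma> t)) = snd (F (\<Gamma> 0))"
        by (rule holomorphic_fun_eq_const_on_connected[OF r2(2) open_ball connected_ball]) (use z r2(1) that in auto)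
      ultimately show ?thesis using \<Gamma>0 by (simp add: prod_eq_iff)
    qed
    have d0: "((\<lambda>s. fst (\<Gamma> s)) has_field_derivative - partial_y (jacobian F) w0) (at 0)"
      "((\<lambda>s. snd (\<Gamma> s)) has_field_derivative partial_x (jacobian F) w0) (at 0)"
      using r(2)[of 0] r(1) \<Gamma>0 by auto
    have ne: "\<forall>\<^sub>F t in at 0. \<Gamma> t \<noteq> w0"
    proof (cases "partial_x (jacobian F) w0 = 0")
      case True
      then have "partial_y (jacobian F) w0 \<noteq> 0" using dJ by simp
      moreover have L: "((\<lambda>t. (fst (\<Gamma> t) - fst w0) / t) \<longlongrightarrow> - partial_y (jacobian F) w0) (at 0)"
        using d0(1) \<Gamma>0 by (simp add: has_field_derivative_iff)
      ultimately have "\<forall>\<^sub>F t in at 0. (fst (\<Gamma> t) - fst w0) / t \<noteq> 0" by (intro tendsto_imp_eventually_ne[OF L]) simp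
      then show ?thesis by eventually_elim auto
    next
      case False
      moreover have "((\<lambda>t. (snd (\<Gamma> t) - snd w0) / t) \<longlongrightarrow> partial_x (jacobian F) w0) (at 0)"
        using d0(2) \<Gamma>0 by (simp add: has_field_derivative_iff)
      ultimately have "\<forall>\<^sub>F t in at 0. (snd (\<Gamma> t) - snd w0) / t \<noteq> 0" by (intro tendsto_imp_eventually_ne) auto
      then show ?thesis by eventually_elim auto
    qed
    have c: "isCont \<Gamma> 0"
      using isCont_Pair[OF DERIV_isCont[OF d0(1)] DERIV_isCont[OF d0(2)]] by simp
    have "map_multiplicity W F w0 = \<infinity>"
    proof (rule map_multiplicity_eq_infinity)
      fix U assume U: "open U" "w0 \<in> U"
      have "\<forall>\<^sub>F t in at 0. \<Gamma> t \<in> U"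
        using isCont_eventually_nhds[OF c U(1)] U(2) \<Gamma>0 by (auto simp: eventually_at_filter elim: eventually_mono)
      moreover have "\<forall>\<^sub>F t in at 0. t \<in> ball (0::complex) (min r1 r2)"
        by (intro eventually_at_in_open') (use r1 r2 in auto)
      ultimately have "\<forall>\<^sub>F t in at 0. \<Gamma> t \<in> U \<and> \<Gamma> t \<noteq> w0 \<and> F (\<Gamma> t) = F w0"
        using ne by eventually_elim (use const in auto)
      from eventually_happens[OF this] show "\<exists>x\<in>U. x \<noteq> w0 \<and> F x = F w0" by auto
    qed
    then show ?thesis using infinity by simp
  qed
qed

lemma natural_parametrization_exists_complex:
  fixes F :: "complex \<times> complex \<Rightarrow> complex \<times> complex"
  assumes W: "open W" "K_analytic_map F W" and reg: "regular_critical_point W F w0"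
  obtains \<Gamma> where "natural_parametrization W F w0 \<Gamma>"
    "\<And>(x :: real \<Rightarrow> complex) y e. e > 0 \<Longrightarrow> (x 0, y 0) = w0 \<Longrightarrow>
       (\<And>t. \<bar>t\<bar> < e \<Longrightarrow> (x t, y t) \<in> W \<and> (x has_vector_derivative - partial_y (jacobian F) (x t, y t)) (at t)
           \<and> (y has_vector_derivative partial_x (jacobian F) (x t, y t)) (at t)) \<Longrightarrow>
       \<forall>\<^sub>F t in nhds 0. (x t, y t) = \<Gamma> (of_real t)"
proof -
  note f = K_analytic_map_imp_holo2(1)[OF W(2,1)] and g = K_analytic_map_imp_holo2(2)[OF W(2,1)]
  have w0: "w0 \<in> W" "jacobian F w0 = 0" and dJ: "(partial_x (jacobian F) w0, partial_y (jacobian F) w0) \<noteq> (0, 0)"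
    using reg by (auto simp: regular_critical_point_def critical_set_def)
  show ?thesis
  proof (rule hamiltonian_curve[OF holo2_jacobian[OF f g] w0 dJ], goal_cases)
    case (1 \<Gamma> r)
    then have "natural_parametrization W F w0 \<Gamma>" unfolding natural_parametrization_def by blast
    then show ?thesis by (rule that) (use 1(4) in blast)
  qed
qed

text \<open>For \<open>n > 1\<close> the determinant of derivatives found before equals, up to
  factorials, the determinant of Taylor coefficients asked for by
  \<open>has_order_pair_linear\<close>. For \<open>n = 1\<close> some component is a local parameter
  and the curve is a graph over it.\<close>

lemma has_order_pair_complex:
  fixes F :: "complex \<times> complex \<Rightarrow> complex \<times> complex"
  assumes W: "open W" "K_analytic_map F W" and reg: "regular_critical_point W F w0"
    and nat: "natural_parametrization W F w0 \<Gamma>" and ord: "curve_order (F \<circ> \<Gamma>) = enat n"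
  shows "has_order_pair (F \<circ> \<Gamma>) n (if n = 1 then \<infinity> else enat (n + 1))"
proof -
  define S1 where "S1 t = fst (F (\<Gamma> t))" for t
  define S2 where "S2 t = snd (F (\<Gamma> t))" for t
  note f = K_analytic_map_imp_holo2(1)[OF W(2,1)] and g = K_analytic_map_imp_holo2(2)[OF W(2,1)]
  obtain r1 where r1: "r1 > 0" "S1 holomorphic_on ball 0 r1"
    using natural_parametrization_values_holomorphic[OF f nat] unfolding S1_def[abs_def] by metis
  obtain r2 where r2: "r2 > 0" "S2 holomorphic_on ball 0 r2"
    using natural_parametrization_values_holomorphic[OF g nat] unfolding S2_def[abs_def] by metis
  define r where "r = min r1 r2"
  have r: "r > 0" "S1 holomorphic_on ball 0 r" "S2 holomorphic_on ball 0 r"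
    using r1 r2 by (auto simp: r_def intro: holomorphic_on_subset)
  have an: "K_analytic1 S1 (ball 0 r)" "K_analytic1 S2 (ball 0 r)"
    using r by (auto intro: holomorphic_imp_K_analytic1)
  have ser: "(\<lambda>i. (deriv ^^ i) S 0 / fact i * s ^ i) sums S s" if "norm s < r" "S holomorphic_on ball 0 r" for s S
    using holomorphic_power_series[OF that(2), of s] that(1) by simp
  have n: "n > 0" "(deriv ^^ n) S1 0 \<noteq> 0 \<or> (deriv ^^ n) S2 0 \<noteq> 0"
    "\<And>i. 0 < i \<Longrightarrow> i < n \<Longrightarrow> (deriv ^^ i) S1 0 = 0" "\<And>i. 0 < i \<Longrightarrow> i < n \<Longrightarrow> (deriv ^^ i) S2 0 = 0"
    using ord unfolding curve_order_eq_enat_iff S1_def S2_def by auto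
  show ?thesis
  proof (cases "n = 1")
    case False
    then have det: "(deriv ^^ n) S1 0 * (deriv ^^ (n + 1)) S2 0 - (deriv ^^ n) S2 0 * (deriv ^^ (n + 1)) S1 0 \<noteq> 0"
      using critical_value_curve_complex(2)[OF W reg nat ord] n(1) by (simp add: S1_def[abs_def] S2_def[abs_def])
    have "(deriv ^^ n) S1 0 / fact n * ((deriv ^^ (n + 1)) S2 0 / fact (n + 1)) - (deriv ^^ n) S2 0 / fact n * ((deriv ^^ (n + 1)) S1 0 / fact (n + 1))
       = ((deriv ^^ n) S1 0 * (deriv ^^ (n + 1)) S2 0 - (deriv ^^ n) S2 0 * (deriv ^^ (n + 1)) S1 0) / (fact n * fact (n + 1))"
      by (simp add: diff_divide_distrib del: funpow.simps fact_Suc)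
    then have det': "(deriv ^^ n) S1 0 / fact n * ((deriv ^^ (n + 1)) S2 0 / fact (n + 1)) - (deriv ^^ n) S2 0 / fact n * ((deriv ^^ (n + 1)) S1 0 / fact (n + 1)) \<noteq> 0"
      using det by (simp del: funpow.simps fact_Suc)
    have "has_order_pair (F \<circ> \<Gamma>) n (enat (n + 1))"
      by (rule has_order_pair_linear[where r = r and p = "\<lambda>i. (deriv ^^ i) S1 0 / fact i" and q = "\<lambda>i. (deriv ^^ i) S2 0 / fact i", OF r(1) n(1) _ _ _ _ _ det'])
         (use an r ser n(3,4) in \<open>auto simp: S1_def[abs_def] S2_def[abs_def]\<close>)
    then show ?thesis using False by simp
  next
    case True
    have main: "has_order_pair \<beta> 1 \<infinity>"
      if \<beta>: "T1 holomorphic_on ball 0 r" "T2 holomorphic_on ball 0 r" "\<And>t. \<beta> t = (T1 t, T2 t)" and d: "deriv T1 0 \<noteq> 0"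
      for \<beta> T1 T2
    proof -
      from holomorphic_graph[OF \<beta>(1,2) r(1) d]
      obtain U \<sigma> \<rho> where U: "open U" "T1 0 \<in> U" "\<sigma> holomorphic_on U" "\<rho> > 0" "\<And>t. t \<in> ball 0 \<rho> \<Longrightarrow> \<sigma> (T1 t) = T2 t" by metis
      have "\<forall>\<^sub>F s in nhds 0. s \<in> ball (0::complex) \<rho>" by (intro eventually_nhds_in_open) (use U in auto)
      then have gr: "\<forall>\<^sub>F s in nhds 0. T2 s = \<sigma> (T1 s)" by eventually_elim (use U in auto)
      show ?thesis
      proof (rule has_order_pair_graph[where r = r and p = "\<lambda>i. (deriv ^^ i) T1 0 / fact i" and U = U and \<sigma> = \<sigma>])
        show "K_analytic1 (\<lambda>s. fst (\<beta> s)) (ball 0 r)" "K_analytic1 (\<lambda>s. snd (\<beta> s)) (ball 0 r)"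
          using \<beta>(1,2) by (simp_all add: \<beta>(3) holomorphic_imp_K_analytic1)
        show "(\<lambda>i. (deriv ^^ i) T1 0 / fact i * s ^ i) sums fst (\<beta> s)" if "norm s < r" for s
          using ser[OF that \<beta>(1)] by (simp add: \<beta>(3))
        show "K_analytic2 (\<lambda>w. snd w - \<sigma> (fst w)) (U \<times> UNIV)" "K_analytic2 (\<lambda>w. snd w + \<sigma> (fst w)) (U \<times> UNIV)"
          using holo2_imp_K_analytic2[OF holo2_shear[OF U(3,1), of 1]] holo2_imp_K_analytic2[OF holo2_shear[OF U(3,1), of "- 1"]]
          by simp_all
      qed (use r U d gr in \<open>simp_all add: \<beta>(3)\<close>)
    qed
    have "has_order_pair (F \<circ> \<Gamma>) 1 \<infinity>"
    proof (cases "deriv S1 0 = 0")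
      case False
      then show ?thesis by (intro main[OF r(2,3)]) (auto simp: S1_def S2_def)
    next
      case 0: True
      then have "deriv S2 0 \<noteq> 0" using n(2) True by simp
      then have "has_order_pair (\<lambda>s. prod.swap ((F \<circ> \<Gamma>) s)) 1 \<infinity>" by (intro main[OF r(3,2)]) (auto simp: S1_def S2_def prod.swap_def)
      then show ?thesis by (rule has_order_pair_swap)
    qed
    then show ?thesis using True by simp
  qed
qed

section \<open>Passing from the complex to the real case\<close>

text \<open>Along the real axis \<open>h\<close> is real, so the imaginary part of its derivative is
  the derivative of the zero function.\<close>

lemma real_derivative_transfer:
  assumes h: "(h has_field_derivative D) (at (complex_of_real x))" and f: "\<forall>\<^sub>F t in nhds x. h (of_real t) = of_real (f t)"
  shows "(f has_field_derivative Re D) (at x)" "D = of_real (Re D)"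
proof -
  have v: "((\<lambda>t. h (of_real t)) has_vector_derivative D) (at x)"
    by (rule has_vector_derivative_real_field[OF h])
  have f': "\<forall>\<^sub>F t in at x. h (of_real t) = of_real (f t)" using f by (auto simp: eventually_at_filter elim: eventually_mono)
  have "((\<lambda>t. complex_of_real (f t)) has_vector_derivative D) (at x)"
    using v unfolding has_vector_derivative_def
    by (rule has_derivative_transform_eventually[OF _ f']) (use eventually_nhds_x_imp_x[OF f] in auto)
  note v' = this
  have "((\<lambda>t. Re (complex_of_real (f t))) has_vector_derivative Re D) (at x)"
    by (rule bounded_linear.has_vector_derivative[OF bounded_linear_Re v'])
  then show "(f has_field_derivative Re D) (at x)" by (simp add: has_real_derivative_iff_has_vector_derivative)
  have "((\<lambda>t. Im (complex_of_real (f t))) has_vector_derivative Im D) (at x)"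
    by (rule bounded_linear.has_vector_derivative[OF bounded_linear_Im v'])
  then have "((\<lambda>t. 0::real) has_vector_derivative Im D) (at x)" by simp
  moreover have "((\<lambda>t. 0::real) has_vector_derivative 0) (at x)" by (rule has_vector_derivative_const)
  ultimately have "Im D = 0" by (rule vector_derivative_unique_at)
  then show "D = of_real (Re D)" by (simp add: complex_eq_iff)
qed

lemma higher_deriv_transfer:
  assumes h: "h holomorphic_on ball 0 r" and f: "\<And>t. \<bar>t\<bar> < r \<Longrightarrow> h (complex_of_real t) = of_real (f t)" and t: "\<bar>t\<bar> < r"
  shows "(deriv ^^ n) h (of_real t) = of_real ((deriv ^^ n) f t)"
  using t
proof (induction n arbitrary: t)
  case (Suc n)
  have "((deriv ^^ n) h has_field_derivative (deriv ^^ Suc n) h (of_real t)) (at (of_real t))"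
    using holomorphic_derivI[OF holomorphic_higher_deriv[OF h open_ball] open_ball] Suc.prems by simp
  moreover have "\<forall>\<^sub>F s in nhds t. s \<in> ball 0 r" by (rule eventually_nhds_in_open) (use Suc.prems in auto)
  then have "\<forall>\<^sub>F s in nhds t. (deriv ^^ n) h (of_real s) = of_real ((deriv ^^ n) f s)"
    by eventually_elim (use Suc.IH in auto)
  ultimately have "((deriv ^^ n) f has_field_derivative Re ((deriv ^^ Suc n) h (of_real t))) (at t)"
    "(deriv ^^ Suc n) h (of_real t) = of_real (Re ((deriv ^^ Suc n) h (of_real t)))"
    by (rule real_derivative_transfer)+
  then show ?case using DERIV_imp_deriv by fastforce
qed (use f in simp)

lemma complexify_has_derivative: "(complexify has_derivative complexify) (at w)"
  unfolding complexify_def[abs_def]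
  by (auto intro!: derivative_eq_intros)

lemma isCont_complexify: "isCont complexify w"
  using has_derivative_continuous[OF complexify_has_derivative] .

text \<open>The partial derivatives are real by \<open>real_derivative_transfer\<close>; composing
  the complex derivative with the real linear map \<open>complexify\<close> gives total
  differentiability of \<phi>.\<close>

lemma real_partials:
  fixes \<phi> :: "real \<times> real \<Rightarrow> real"
  assumes f: "holo2 f U" and S: "open S" "\<And>w. w \<in> S \<Longrightarrow> complexify w \<in> U" "\<And>w. w \<in> S \<Longrightarrow> f (complexify w) = of_real (\<phi> w)"
    and w: "w \<in> S"
  shows "partial_x f (complexify w) = of_real (partial_x \<phi> w)" "partial_y f (complexify w) = of_real (partial_y \<phi> w)"
    and "(\<phi> has_derivative (\<lambda>h. partial_x \<phi> w * fst h + partial_y \<phi> w * snd h)) (at w)"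
proof -
  obtain x y where xy: "w = (x, y)" by fastforce
  have "isCont (\<lambda>x. (x, y)) x" "isCont (\<lambda>y. (x, y)) y" by (auto intro!: continuous_intros)
  then have ev: "\<forall>\<^sub>F x in nhds x. (x, y) \<in> S" "\<forall>\<^sub>F y in nhds y. (x, y) \<in> S"
    using S(1) w xy by (auto intro!: isCont_eventually_nhds)
  have ex: "\<forall>\<^sub>F t in nhds x. f (of_real t, of_real y) = of_real (\<phi> (t, y))"
    using ev(1) by eventually_elim (use S(3) in \<open>auto simp: complexify_def\<close>)
  have ey: "\<forall>\<^sub>F t in nhds y. f (of_real x, of_real t) = of_real (\<phi> (x, t))"
    using ev(2) by eventually_elim (use S(3) in \<open>auto simp: complexify_def\<close>)
  note d = holo2_partial_derivs[OF f S(2)[OF w], unfolded xy complexify_def fst_conv snd_conv]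
  from real_derivative_transfer[OF d(1) ex] show px: "partial_x f (complexify w) = of_real (partial_x \<phi> w)"
    unfolding partial_x_def[of \<phi>] xy fst_conv snd_conv by (metis DERIV_imp_deriv complexify_def fst_conv snd_conv)
  from real_derivative_transfer[OF d(2) ey] show py: "partial_y f (complexify w) = of_real (partial_y \<phi> w)"
    unfolding partial_y_def[of \<phi>] xy fst_conv snd_conv by (metis DERIV_imp_deriv complexify_def fst_conv snd_conv)
  have "((\<lambda>w. f (complexify w)) has_derivative (\<lambda>h. of_real (partial_x \<phi> w) * fst (complexify h) + of_real (partial_y \<phi> w) * snd (complexify h))) (at w)"
    using has_derivative_compose[OF complexify_has_derivative has_derivative_partials[OF f S(2)[OF w]]] by (simp add: px py)
  then have "((\<lambda>w. Re (f (complexify w))) has_derivative (\<lambda>h. Re (of_real (partial_x \<phi> w) * fst (complexify h) + of_real (partial_y \<phi> w) * snd (complexify h)))) (at w)"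
    by (rule bounded_linear.has_derivative[OF bounded_linear_Re])
  then have "((\<lambda>w. Re (f (complexify w))) has_derivative (\<lambda>h. partial_x \<phi> w * fst h + partial_y \<phi> w * snd h)) (at w)"
    by (simp add: complexify_def)
  then show "(\<phi> has_derivative (\<lambda>h. partial_x \<phi> w * fst h + partial_y \<phi> w * snd h)) (at w)"
    by (rule has_derivative_transform_within_open[OF _ S(1) w]) (use S(3) in simp)
qed

lemma real_partials_continuous:
  fixes \<phi> :: "real \<times> real \<Rightarrow> real"
  assumes f: "holo2 f U" and S: "open S" "\<And>w. w \<in> S \<Longrightarrow> complexify w \<in> U" "\<And>w. w \<in> S \<Longrightarrow> f (complexify w) = of_real (\<phi> w)"
  shows "continuous_on S (partial_x \<phi>)" "continuous_on S (partial_y \<phi>)"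
proof -
  have c: "continuous_on S complexify" using isCont_complexify by (intro continuous_at_imp_continuous_on) auto
  have "continuous_on S (\<lambda>w. Re (partial_x f (complexify w)))" "continuous_on S (\<lambda>w. Re (partial_y f (complexify w)))"
    by (intro continuous_intros continuous_on_compose2[OF holo2_continuous[OF holo2_partial_x[OF f]] c]
      continuous_on_compose2[OF holo2_continuous[OF holo2_partial_y[OF f]] c]; use S(2) in blast)+
  then show "continuous_on S (partial_x \<phi>)" "continuous_on S (partial_y \<phi>)"
    using real_partials(1,2)[OF f S] by (auto cong: continuous_on_cong)
qed

text \<open>\<open>S\<close> is a real neighbourhood on which the extension identity holds. It may
  differ from the domain of \<open>F\<close>, since order, order-pair and multiplicity depend on
  germs only.\<close>

locale real_extension =
  fixes F :: "real \<times> real \<Rightarrow> real \<times> real" and G :: "complex \<times> complex \<Rightarrow> complex \<times> complex" and U S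
  assumes U: "open U" "K_analytic_map G U" and S: "open S"
    and ext: "\<And>w. w \<in> S \<Longrightarrow> complexify w \<in> U" "\<And>w. w \<in> S \<Longrightarrow> G (complexify w) = complexify (F w)"
begin

lemma holo: "holo2 (\<lambda>p. fst (G p)) U" "holo2 (\<lambda>p. snd (G p)) U" "holo2 (jacobian G) U"
  using K_analytic_map_imp_holo2[OF U(2,1)] holo2_jacobian by auto

lemma ext_comp: "w \<in> S \<Longrightarrow> fst (G (complexify w)) = of_real (fst (F w))"
  "w \<in> S \<Longrightarrow> snd (G (complexify w)) = of_real (snd (F w))"
  using ext(2)[of w] by (simp_all add: complexify_def)

lemma partials1:
  assumes "w \<in> S"
  shows "partial_x (\<lambda>p. fst (G p)) (complexify w) = of_real (partial_x (\<lambda>p. fst (F p)) w)" "partial_y (\<lambda>p. fst (G p)) (complexify w) = of_real (partial_y (\<lambda>p. fst (F p)) w)"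
    and "((\<lambda>p. fst (F p)) has_derivative (\<lambda>h. partial_x (\<lambda>p. fst (F p)) w * fst h + partial_y (\<lambda>p. fst (F p)) w * snd h)) (at w)"
  by (rule real_partials(1)[OF holo(1) S ext(1) ext_comp(1) assms] real_partials(2)[OF holo(1) S ext(1) ext_comp(1) assms]
      real_partials(3)[OF holo(1) S ext(1) ext_comp(1) assms], assumption, assumption)+

lemma partials2:
  assumes "w \<in> S"
  shows "partial_x (\<lambda>p. snd (G p)) (complexify w) = of_real (partial_x (\<lambda>p. snd (F p)) w)" "partial_y (\<lambda>p. snd (G p)) (complexify w) = of_real (partial_y (\<lambda>p. snd (F p)) w)"
    and "((\<lambda>p. snd (F p)) has_derivative (\<lambda>h. partial_x (\<lambda>p. snd (F p)) w * fst h + partial_y (\<lambda>p. snd (F p)) w * snd h)) (at w)"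
  by (rule real_partials(1)[OF holo(2) S ext(1) ext_comp(2) assms] real_partials(2)[OF holo(2) S ext(1) ext_comp(2) assms]
      real_partials(3)[OF holo(2) S ext(1) ext_comp(2) assms], assumption, assumption)+

lemma jacobian_ext: "w \<in> S \<Longrightarrow> jacobian G (complexify w) = of_real (jacobian F w)"
  by (simp add: jacobian_def partials1 partials2)

lemma partialsJ:
  assumes "w \<in> S"
  shows "partial_x (jacobian G) (complexify w) = of_real (partial_x (jacobian F) w)" "partial_y (jacobian G) (complexify w) = of_real (partial_y (jacobian F) w)"
    and "((jacobian F) has_derivative (\<lambda>h. partial_x (jacobian F) w * fst h + partial_y (jacobian F) w * snd h)) (at w)"
  by (rule real_partials(1)[OF holo(3) S ext(1) jacobian_ext assms] real_partials(2)[OF holo(3) S ext(1) jacobian_ext assms]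
      real_partials(3)[OF holo(3) S ext(1) jacobian_ext assms], assumption, assumption)+

lemma regular_ext:
  assumes "regular_critical_point W F w0" "w0 \<in> S"
  shows "regular_critical_point U G (complexify w0)"
  using assms ext(1)[OF assms(2)] jacobian_ext[OF assms(2)] partialsJ[OF assms(2)]
  by (auto simp: regular_critical_point_def critical_set_def)

text \<open>The real curve, read with complex coordinates, solves the complex system in real time;
  by uniqueness it is the restriction of the complex natural parametrization.\<close>

lemma natural_parametrization_ext:
  assumes reg: "regular_critical_point W F w0" "w0 \<in> S" and nat: "natural_parametrization W F w0 \<Gamma>"
  obtains \<Gamma>' where "natural_parametrization U G (complexify w0) \<Gamma>'"
    "\<forall>\<^sub>F t in nhds 0. \<Gamma>' (of_real t) = complexify (\<Gamma> t) \<and> \<Gamma> t \<in> S"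
proof -
  obtain \<Gamma>' where n: "natural_parametrization U G (complexify w0) \<Gamma>'"
    and uniq: "\<And>(x :: real \<Rightarrow> complex) y e. e > 0 \<Longrightarrow> (x 0, y 0) = complexify w0 \<Longrightarrow>
       (\<And>t. \<bar>t\<bar> < e \<Longrightarrow> (x t, y t) \<in> U \<and> (x has_vector_derivative - partial_y (jacobian G) (x t, y t)) (at t)
           \<and> (y has_vector_derivative partial_x (jacobian G) (x t, y t)) (at t)) \<Longrightarrow>
       \<forall>\<^sub>F t in nhds 0. (x t, y t) = \<Gamma>' (of_real t)"
  proof (rule natural_parametrization_exists_complex[OF U regular_ext[OF reg]])
    fix \<Gamma>' assume *: "natural_parametrization U G (complexify w0) \<Gamma>'"
     and **: "\<And>(x :: real \<Rightarrow> complex) y e. e > 0 \<Longrightarrow> (x 0, y 0) = complexify w0 \<Longrightarrow>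
       (\<And>t. \<bar>t\<bar> < e \<Longrightarrow> (x t, y t) \<in> U \<and> (x has_vector_derivative - partial_y (jacobian G) (x t, y t)) (at t)
           \<and> (y has_vector_derivative partial_x (jacobian G) (x t, y t)) (at t)) \<Longrightarrow>
       \<forall>\<^sub>F t in nhds 0. (x t, y t) = \<Gamma>' (of_real t)"
    show ?thesis by (rule that[OF *]) (use ** in blast)
  qed
  obtain r where r: "r > 0" "\<And>t. t \<in> ball 0 r \<Longrightarrow>
        ((\<lambda>s. fst (\<Gamma> s)) has_field_derivative - partial_y (jacobian F) (\<Gamma> t)) (at t) \<and>
        ((\<lambda>s. snd (\<Gamma> s)) has_field_derivative partial_x (jacobian F) (\<Gamma> t)) (at t)" and \<Gamma>0: "\<Gamma> 0 = w0"
    using nat unfolding natural_parametrization_def by blast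
  have "isCont (\<lambda>s. fst (\<Gamma> s)) 0" "isCont (\<lambda>s. snd (\<Gamma> s)) 0"
    using r(2)[of 0] r(1) DERIV_isCont by auto
  from isCont_Pair[OF this] have "isCont \<Gamma> 0" by simp
  from isCont_eventually_nhds[OF this S] have inS: "\<forall>\<^sub>F t in nhds 0. \<Gamma> t \<in> S" using reg \<Gamma>0 by simp
  moreover have "\<forall>\<^sub>F t in nhds 0. t \<in> ball 0 r" by (rule eventually_nhds_in_open) (use r in auto)
  ultimately have "\<forall>\<^sub>F t in nhds 0. \<Gamma> t \<in> S \<and> t \<in> ball 0 r" by eventually_elim auto
  then obtain e where e: "e > 0" "\<And>t. \<bar>t\<bar> < e \<Longrightarrow> \<Gamma> t \<in> S \<and> t \<in> ball 0 r"
    unfolding eventually_nhds_metric by (auto simp: dist_norm)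
  have "\<forall>\<^sub>F t in nhds 0. (of_real (fst (\<Gamma> t)), of_real (snd (\<Gamma> t))) = \<Gamma>' (of_real t)"
  proof (rule uniq[OF e(1)])
    show "(complex_of_real (fst (\<Gamma> 0)), complex_of_real (snd (\<Gamma> 0))) = complexify w0" by (simp add: complexify_def \<Gamma>0)
    fix t assume t: "\<bar>t\<bar> < e"
    have c: "(of_real (fst (\<Gamma> t)), of_real (snd (\<Gamma> t))) = complexify (\<Gamma> t)" by (simp add: complexify_def)
    have d: "((\<lambda>s. fst (\<Gamma> s)) has_vector_derivative - partial_y (jacobian F) (\<Gamma> t)) (at t)"
      "((\<lambda>s. snd (\<Gamma> s)) has_vector_derivative partial_x (jacobian F) (\<Gamma> t)) (at t)"
      using r(2) e(2)[OF t] by (auto simp: has_real_derivative_iff_has_vector_derivative)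
    have d': "((\<lambda>s. complex_of_real (fst (\<Gamma> s))) has_vector_derivative of_real (- partial_y (jacobian F) (\<Gamma> t))) (at t)"
      "((\<lambda>s. complex_of_real (snd (\<Gamma> s))) has_vector_derivative of_real (partial_x (jacobian F) (\<Gamma> t))) (at t)"
      by (rule bounded_linear.has_vector_derivative[OF bounded_linear_of_real d(1)],
          rule bounded_linear.has_vector_derivative[OF bounded_linear_of_real d(2)])
    show "(complex_of_real (fst (\<Gamma> t)), complex_of_real (snd (\<Gamma> t))) \<in> U \<and>
      ((\<lambda>t. complex_of_real (fst (\<Gamma> t))) has_vector_derivative - partial_y (jacobian G) (of_real (fst (\<Gamma> t)), of_real (snd (\<Gamma> t)))) (at t) \<and>
      ((\<lambda>t. complex_of_real (snd (\<Gamma> t))) has_vector_derivative partial_x (jacobian G) (of_real (fst (\<Gamma> t)), of_real (snd (\<Gamma> t)))) (at t)"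
      unfolding c using e(2)[OF t] d' ext(1)[of "\<Gamma> t"] partialsJ(1,2)[of "\<Gamma> t"] by simp
  qed
  then have "\<forall>\<^sub>F t in nhds 0. \<Gamma>' (of_real t) = complexify (\<Gamma> t) \<and> \<Gamma> t \<in> S"
    using inS by eventually_elim (simp add: complexify_def)
  with n show ?thesis by (rule that)
qed

lemma critical_value_curve_ext:
  assumes reg: "regular_critical_point W F w0" "w0 \<in> S" and nat: "natural_parametrization W F w0 \<Gamma>"
  obtains \<Gamma>' r where "natural_parametrization U G (complexify w0) \<Gamma>'" "r > 0"
    "(\<lambda>t. fst (G (\<Gamma>' t))) holomorphic_on ball 0 r" "(\<lambda>t. snd (G (\<Gamma>' t))) holomorphic_on ball 0 r"
    "\<forall>t. \<bar>t\<bar> < r \<longrightarrow> fst (G (\<Gamma>' (of_real t))) = of_real (fst (F (\<Gamma> t)))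
        \<and> snd (G (\<Gamma>' (of_real t))) = of_real (snd (F (\<Gamma> t)))"
    "curve_order (G \<circ> \<Gamma>') = curve_order (F \<circ> \<Gamma>)"
proof -
  obtain \<Gamma>' where n: "natural_parametrization U G (complexify w0) \<Gamma>'"
    and ev: "\<forall>\<^sub>F t in nhds 0. \<Gamma>' (of_real t) = complexify (\<Gamma> t) \<and> \<Gamma> t \<in> S"
    using natural_parametrization_ext[OF reg nat] by blast
  obtain r1 where r1: "r1 > 0" "(\<lambda>t. fst (G (\<Gamma>' t))) holomorphic_on ball 0 r1"
    using natural_parametrization_values_holomorphic[OF holo(1) n] by blast
  obtain r2 where r2: "r2 > 0" "(\<lambda>t. snd (G (\<Gamma>' t))) holomorphic_on ball 0 r2"
    using natural_parametrization_values_holomorphic[OF holo(2) n] by blast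
  obtain r3 where r3: "r3 > 0" "\<And>t. \<bar>t\<bar> < r3 \<Longrightarrow> \<Gamma>' (of_real t) = complexify (\<Gamma> t) \<and> \<Gamma> t \<in> S"
    using ev unfolding eventually_nhds_metric by (auto simp: dist_norm)
  define r where "r = min r1 (min r2 r3)"
  have r: "r > 0" "(\<lambda>t. fst (G (\<Gamma>' t))) holomorphic_on ball 0 r" "(\<lambda>t. snd (G (\<Gamma>' t))) holomorphic_on ball 0 r"
    using r1 r2 r3 by (auto simp: r_def intro: holomorphic_on_subset)
  have v: "fst (G (\<Gamma>' (of_real t))) = of_real (fst (F (\<Gamma> t)))" "snd (G (\<Gamma>' (of_real t))) = of_real (snd (F (\<Gamma> t)))" if "\<bar>t\<bar> < r" for t
    using r3(2)[of t] that ext_comp[of "\<Gamma> t"] by (auto simp: r_def)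
  have "(deriv ^^ i) (\<lambda>t. fst ((G \<circ> \<Gamma>') t)) 0 = of_real ((deriv ^^ i) (\<lambda>t. fst ((F \<circ> \<Gamma>) t)) 0)"
    "(deriv ^^ i) (\<lambda>t. snd ((G \<circ> \<Gamma>') t)) 0 = of_real ((deriv ^^ i) (\<lambda>t. snd ((F \<circ> \<Gamma>) t)) 0)" for i
    using higher_deriv_transfer[OF r(2) v(1), of 0 i] higher_deriv_transfer[OF r(3) v(2), of 0 i] r(1) by auto
  then have "curve_order (G \<circ> \<Gamma>') = curve_order (F \<circ> \<Gamma>)"
    unfolding curve_order_def by simp
  then show ?thesis using n r v by (intro that[of \<Gamma>' r]) auto
qed

lemma multiplicity_ext:
  assumes reg: "regular_critical_point W F w0" "w0 \<in> S" and nat: "natural_parametrization W F w0 \<Gamma>"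
  shows "map_multiplicity U G (complexify w0) = curve_order (F \<circ> \<Gamma>) + 1"
  using critical_value_curve_ext[OF reg nat] critical_value_multiplicity_complex[OF U regular_ext[OF reg]] by metis

text \<open>The complex argument repeated with real Taylor coefficients: the determinant is a real
  number whose complex image is nonzero, and for \<open>n = 1\<close> the function of the graph is
  obtained from the complex one by taking real parts.\<close>

lemma has_order_pair_ext:
  assumes reg: "regular_critical_point W F w0" "w0 \<in> S" and nat: "natural_parametrization W F w0 \<Gamma>"
    and ord: "curve_order (F \<circ> \<Gamma>) = enat n"
  shows "has_order_pair (F \<circ> \<Gamma>) n (if n = 1 then \<infinity> else enat (n + 1))"
proof -
  obtain \<Gamma>' r where n': "natural_parametrization U G (complexify w0) \<Gamma>'" and r: "r > 0"
    "(\<lambda>t. fst (G (\<Gamma>' t))) holomorphic_on ball 0 r" "(\<lambda>t. snd (G (\<Gamma>' t))) holomorphic_on ball 0 r"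
    and v: "\<forall>t. \<bar>t\<bar> < r \<longrightarrow> fst (G (\<Gamma>' (of_real t))) = of_real (fst (F (\<Gamma> t)))
        \<and> snd (G (\<Gamma>' (of_real t))) = of_real (snd (F (\<Gamma> t)))"
    and co: "curve_order (G \<circ> \<Gamma>') = curve_order (F \<circ> \<Gamma>)"
    using critical_value_curve_ext[OF reg nat] by blast
  have ord': "curve_order (G \<circ> \<Gamma>') = enat n" using co ord by simp
  define T1 where "T1 t = fst (G (\<Gamma>' t))" for t
  define T2 where "T2 t = snd (G (\<Gamma>' t))" for t
  define S1 where "S1 t = fst (F (\<Gamma> t))" for t
  define S2 where "S2 t = snd (F (\<Gamma> t))" for t
  have hT: "T1 holomorphic_on ball 0 r" "T2 holomorphic_on ball 0 r" using r by (simp_all add: T1_def[abs_def] T2_def[abs_def])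
  have vT: "T1 (of_real t) = of_real (S1 t)" "T2 (of_real t) = of_real (S2 t)" if "\<bar>t\<bar> < r" for t
    using v that by (simp_all add: T1_def T2_def S1_def S2_def)
  have dT: "(deriv ^^ i) T1 0 = of_real ((deriv ^^ i) S1 0)" "(deriv ^^ i) T2 0 = of_real ((deriv ^^ i) S2 0)" for i
    using higher_deriv_transfer[OF hT(1) vT(1), of 0 i] higher_deriv_transfer[OF hT(2) vT(2), of 0 i] r(1) by auto
  have n: "n > 0" "(deriv ^^ n) S1 0 \<noteq> 0 \<or> (deriv ^^ n) S2 0 \<noteq> 0"
    "\<And>i. 0 < i \<Longrightarrow> i < n \<Longrightarrow> (deriv ^^ i) S1 0 = 0 \<and> (deriv ^^ i) S2 0 = 0"
    using ord unfolding curve_order_eq_enat_iff S1_def S2_def by auto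
  have an: "K_analytic1 S (ball 0 r)" and ser: "\<And>s. norm s < r \<Longrightarrow> (\<lambda>i. (deriv ^^ i) S 0 / fact i * s ^ i) sums S s"
    if h: "T holomorphic_on ball 0 r" and vv: "\<And>t. \<bar>t\<bar> < r \<Longrightarrow> T (of_real t) = of_real (S t)"
      and dd: "\<And>i. (deriv ^^ i) T 0 = of_real ((deriv ^^ i) S 0)" for T S
  proof -
    show "(\<lambda>i. (deriv ^^ i) S 0 / fact i * s ^ i) sums S s" if s: "norm s < r" for s
    proof -
      have "(\<lambda>i. (deriv ^^ i) T 0 / fact i * (of_real s - 0) ^ i) sums T (of_real s)"
        by (rule holomorphic_power_series[OF h]) (use s in simp)
      then have "(\<lambda>i. complex_of_real ((deriv ^^ i) S 0 / fact i * s ^ i)) sums of_real (S s)"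
        using vv s by (simp add: dd)
      then show ?thesis by (simp only: sums_of_real_iff)
    qed
    have "{t. complex_of_real t \<in> ball 0 r} = ball 0 r" by auto
    then have K: "K_analytic1 (\<lambda>t. Re (T (of_real t))) (ball 0 r)"
      using K_analytic1_Re[OF holomorphic_imp_K_analytic1[OF h open_ball]] by simp
    show "K_analytic1 S (ball 0 r)"
      unfolding K_analytic1_def
    proof
      fix w :: real assume w: "w \<in> ball 0 r"
      then obtain a e where e: "e > 0" "\<And>z. norm (z - w) < e \<Longrightarrow> (\<lambda>n. a n * (z - w) ^ n) sums Re (T (of_real z))"
        using K unfolding K_analytic1_def by meson
      \<comment> \<open>\<open>S\<close> is known to agree with the real part of \<open>T\<close>
        inside radius \<open>r\<close> only, so the radius about \<open>w\<close> is cut down to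
        stay there.\<close>
      show "\<exists>a. \<exists>r>0. \<forall>z. norm (z - w) < r \<longrightarrow> (\<lambda>n. a n * (z - w) ^ n) sums S z"
      proof (intro exI[of _ a] exI[of _ "min e (r - \<bar>w\<bar>)"] conjI allI impI)
        fix z assume "norm (z - w) < min e (r - \<bar>w\<bar>)"
        then have "norm (z - w) < e" "\<bar>z\<bar> < r" by auto
        then show "(\<lambda>n. a n * (z - w) ^ n) sums S z" using e(2)[of z] vv[of z] by simp
      qed (use e w in auto)
    qed
  qed
  note an1 = an[OF hT(1) vT(1) dT(1)] and an2 = an[OF hT(2) vT(2) dT(2)]
  note ser1 = ser[OF hT(1) vT(1) dT(1)] and ser2 = ser[OF hT(2) vT(2) dT(2)]
  show ?thesis
  proof (cases "n = 1")
    case False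
    have "(deriv ^^ n) T1 0 * (deriv ^^ (n + 1)) T2 0 - (deriv ^^ n) T2 0 * (deriv ^^ (n + 1)) T1 0 \<noteq> 0"
      using critical_value_curve_complex(2)[OF U regular_ext[OF reg] n' ord'] n(1) False by (simp add: T1_def[abs_def] T2_def[abs_def])
    then have "of_real ((deriv ^^ n) S1 0 * (deriv ^^ (n + 1)) S2 0 - (deriv ^^ n) S2 0 * (deriv ^^ (n + 1)) S1 0) \<noteq> (0::complex)"
      by (simp only: dT of_real_mult of_real_diff not_False_eq_True)
    then have det: "(deriv ^^ n) S1 0 * (deriv ^^ (n + 1)) S2 0 - (deriv ^^ n) S2 0 * (deriv ^^ (n + 1)) S1 0 \<noteq> 0"
      by (simp only: of_real_eq_0_iff not_False_eq_True)
    have "(deriv ^^ n) S1 0 / fact n * ((deriv ^^ (n + 1)) S2 0 / fact (n + 1)) - (deriv ^^ n) S2 0 / fact n * ((deriv ^^ (n + 1)) S1 0 / fact (n + 1))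
       = ((deriv ^^ n) S1 0 * (deriv ^^ (n + 1)) S2 0 - (deriv ^^ n) S2 0 * (deriv ^^ (n + 1)) S1 0) / (fact n * fact (n + 1))"
      by (simp add: diff_divide_distrib del: funpow.simps fact_Suc)
    then have det': "(deriv ^^ n) S1 0 / fact n * ((deriv ^^ (n + 1)) S2 0 / fact (n + 1)) - (deriv ^^ n) S2 0 / fact n * ((deriv ^^ (n + 1)) S1 0 / fact (n + 1)) \<noteq> 0"
      using det by (simp del: funpow.simps fact_Suc)
    have "has_order_pair (F \<circ> \<Gamma>) n (enat (n + 1))"
    proof (rule has_order_pair_linear[where r = r and p = "\<lambda>i. (deriv ^^ i) S1 0 / fact i" and q = "\<lambda>i. (deriv ^^ i) S2 0 / fact i", OF r(1) n(1) _ _ _ _ _ det'])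
    qed (use an1 an2 ser1 ser2 n(3) in \<open>simp_all add: S1_def[abs_def] S2_def[abs_def]\<close>)
    then show ?thesis using False by simp
  next
    case True
    have main: "has_order_pair \<beta> 1 \<infinity>"
      if h: "X1 holomorphic_on ball 0 r" "X2 holomorphic_on ball 0 r"
        and vX: "\<And>t. \<bar>t\<bar> < r \<Longrightarrow> X1 (of_real t) = of_real (Y1 t)" "\<And>t. \<bar>t\<bar> < r \<Longrightarrow> X2 (of_real t) = of_real (Y2 t)"
        and dX: "\<And>i. (deriv ^^ i) X1 0 = of_real ((deriv ^^ i) Y1 0)" "\<And>i. (deriv ^^ i) X2 0 = of_real ((deriv ^^ i) Y2 0)"
        and \<beta>: "\<And>t. \<beta> t = (Y1 t, Y2 t)" and d: "deriv Y1 0 \<noteq> 0"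
      for \<beta> X1 X2 Y1 Y2
    proof -
      have d': "deriv X1 0 \<noteq> 0" using dX(1)[of 1] d by simp
      from holomorphic_graph[OF h r(1) d']
      obtain V \<sigma> \<rho> where V: "open V" "X1 0 \<in> V" "\<sigma> holomorphic_on V" "\<rho> > 0" "\<And>t. t \<in> ball 0 \<rho> \<Longrightarrow> \<sigma> (X1 t) = X2 t" by metis
      define VR where "VR = {u::real. of_real u \<in> V}"
      \<comment> \<open>At real parameters near \<open>0\<close>, \<sigma> maps the value of
        \<open>X1\<close> to the real value of \<open>X2\<close>, so taking the real part keeps the
        graph relation along the curve.\<close>
      define \<sigma>R where "\<sigma>R u = Re (\<sigma> (of_real u))" for u :: real
      have oV: "open VR"
        unfolding VR_def using open_vimage[OF V(1), of complex_of_real] by (simp add: vimage_def continuous_on_of_real_id)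
      have X0: "X1 0 = of_real (Y1 0)" using vX(1)[of 0] r(1) by simp
      have eq: "{w. complexify w \<in> V \<times> UNIV} = VR \<times> UNIV" by (auto simp: VR_def complexify_def)
      show ?thesis
      proof (rule has_order_pair_graph[where r = r and p = "\<lambda>i. (deriv ^^ i) Y1 0 / fact i" and U = VR and \<sigma> = \<sigma>R])
        show "K_analytic1 (\<lambda>s. fst (\<beta> s)) (ball 0 r)" "K_analytic1 (\<lambda>s. snd (\<beta> s)) (ball 0 r)"
          using an[OF h(1) vX(1) dX(1)] an[OF h(2) vX(2) dX(2)] by (simp_all add: \<beta>)
        show "(\<lambda>i. (deriv ^^ i) Y1 0 / fact i * s ^ i) sums fst (\<beta> s)" if "norm s < r" for s
          using ser[OF h(1) vX(1) dX(1) that] by (simp add: \<beta>)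
        show "fst (\<beta> 0) \<in> VR" using V(2) X0 by (simp add: \<beta> VR_def)
        show "K_analytic2 (\<lambda>w. snd w - \<sigma>R (fst w)) (VR \<times> UNIV)" "K_analytic2 (\<lambda>w. snd w + \<sigma>R (fst w)) (VR \<times> UNIV)"
          using K_analytic2_Re[OF holo2_imp_K_analytic2[OF holo2_shear[OF V(3,1), of 1]]]
            K_analytic2_Re[OF holo2_imp_K_analytic2[OF holo2_shear[OF V(3,1), of "- 1"]]]
          by (simp_all add: eq) (simp_all add: complexify_def \<sigma>R_def)
        have "\<forall>\<^sub>F s in nhds 0. s \<in> ball (0::real) (min r \<rho>)" by (intro eventually_nhds_in_open) (use V r in auto)
        then show "\<forall>\<^sub>F s in nhds 0. snd (\<beta> s) = \<sigma>R (fst (\<beta> s))"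
        proof eventually_elim
          case (elim s)
          then have "\<bar>s\<bar> < r" "\<sigma> (X1 (of_real s)) = X2 (of_real s)" by (auto intro!: V(5))
          then show ?case by (simp add: \<beta> \<sigma>R_def vX)
        qed
      qed (use r d oV in simp_all)
    qed
    have "has_order_pair (F \<circ> \<Gamma>) 1 \<infinity>"
    proof (cases "deriv S1 0 = 0")
      case False
      show ?thesis by (rule main[OF hT vT dT _ False]) (simp_all add: S1_def S2_def)
    next
      case 0: True
      then have S2': "deriv S2 0 \<noteq> 0" using n(2) True by simp
      have "has_order_pair (\<lambda>s. prod.swap ((F \<circ> \<Gamma>) s)) 1 \<infinity>"
        by (rule main[OF hT(2,1) vT(2,1) dT(2,1) _ S2']) (simp_all add: S1_def S2_def prod.swap_def)
      then show ?thesis by (rule has_order_pair_swap)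
    qed
    then show ?thesis using True by simp
  qed
qed

end

context real_extension begin

text \<open>This is the factorization of the derivative of the complex curve at a zero of order
  \<open>n - 1\<close>, restricted to the real axis. The factor \<open>E\<close> has constant sign
  near \<open>0\<close>, so the parity of \<open>n\<close> decides whether the velocity changes sign
  at \<open>0\<close>.\<close>

lemma leading_derivatives:
  assumes reg: "regular_critical_point W F w0" "w0 \<in> S" and nat: "natural_parametrization W F w0 \<Gamma>"
    and ord: "curve_order (F \<circ> \<Gamma>) = enat n"
  shows "(partial_x (\<lambda>p. fst (F p)) w0, partial_y (\<lambda>p. fst (F p)) w0) \<noteq> (0, 0) \<Longrightarrow>
      \<exists>E. isCont E 0 \<and> E 0 \<noteq> 0 \<and> (\<forall>\<^sub>F t in nhds 0. ((\<lambda>t. fst (F (\<Gamma> t))) has_field_derivative t ^ (n - 1) * E t) (at t))"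
    and "(partial_x (\<lambda>p. snd (F p)) w0, partial_y (\<lambda>p. snd (F p)) w0) \<noteq> (0, 0) \<Longrightarrow>
      \<exists>E. isCont E 0 \<and> E 0 \<noteq> 0 \<and> (\<forall>\<^sub>F t in nhds 0. ((\<lambda>t. snd (F (\<Gamma> t))) has_field_derivative t ^ (n - 1) * E t) (at t))"
proof -
  obtain \<Gamma>' r where n': "natural_parametrization U G (complexify w0) \<Gamma>'" and r: "r > 0"
    "(\<lambda>t. fst (G (\<Gamma>' t))) holomorphic_on ball 0 r" "(\<lambda>t. snd (G (\<Gamma>' t))) holomorphic_on ball 0 r"
    and v: "\<forall>t. \<bar>t\<bar> < r \<longrightarrow> fst (G (\<Gamma>' (of_real t))) = of_real (fst (F (\<Gamma> t)))
        \<and> snd (G (\<Gamma>' (of_real t))) = of_real (snd (F (\<Gamma> t)))"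
    and co: "curve_order (G \<circ> \<Gamma>') = curve_order (F \<circ> \<Gamma>)"
    using critical_value_curve_ext[OF reg nat] by blast
  have ord': "curve_order (G \<circ> \<Gamma>') = enat n" using co ord by simp
  have n: "n > 0" "\<And>i. 0 < i \<Longrightarrow> i < n \<Longrightarrow> (deriv ^^ i) (\<lambda>t. fst (G (\<Gamma>' t))) 0 = 0 \<and> (deriv ^^ i) (\<lambda>t. snd (G (\<Gamma>' t))) 0 = 0"
    using ord' unfolding curve_order_eq_enat_iff by auto
  have main: "\<exists>E. isCont E 0 \<and> E 0 \<noteq> 0 \<and> (\<forall>\<^sub>F t in nhds 0. (X has_field_derivative t ^ (n - 1) * E t) (at t))"
    if T: "T holomorphic_on ball 0 r" and TX: "\<And>t. \<bar>t\<bar> < r \<Longrightarrow> T (of_real t) = of_real (X t)"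
      and z: "\<And>i. 0 < i \<Longrightarrow> i < n \<Longrightarrow> (deriv ^^ i) T 0 = 0" and nz: "(deriv ^^ n) T 0 \<noteq> 0" for T :: "complex \<Rightarrow> complex" and X :: "real \<Rightarrow> real"
  proof -
    have "\<exists>g e. e > 0 \<and> g holomorphic_on ball 0 e \<and> (\<forall>w\<in>ball 0 e. deriv T w = w ^ (n - 1) * g w) \<and> g 0 \<noteq> 0"
    \<comment> \<open>The factorization lemma asks for a positive order, and the order here is
      \<open>n - 1\<close>; for \<open>n = 1\<close> nothing has to be split off.\<close>
    proof (cases "n = 1")
      case True
      have "deriv T holomorphic_on ball 0 r" by (intro holomorphic_deriv T open_ball)
      with True nz r(1) show ?thesis by (intro exI[of _ "deriv T"] exI[of _ r]) auto
    next
      case False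
      define m where "m = n - 1"
      have m: "n = Suc m" "m > 0" using n(1) False by (auto simp: m_def)
      have dz: "(deriv ^^ i) (deriv T) 0 = 0" if "0 < i" "i < m" for i
      proof -
        have "(deriv ^^ Suc i) T 0 = 0" by (rule z) (use that m in auto)
        then show ?thesis by (simp only: higher_deriv_Suc)
      qed
      have dnz: "(deriv ^^ m) (deriv T) 0 \<noteq> 0" using nz unfolding m(1) higher_deriv_Suc .
      obtain g e where g: "0 < e" "g holomorphic_on ball 0 e" "\<And>w. w \<in> ball 0 e \<Longrightarrow> deriv T w - deriv T 0 = (w - 0) ^ m * g w"
        "\<And>w. w \<in> ball 0 e \<Longrightarrow> g w \<noteq> 0"
        using holomorphic_factor_order_of_zero[OF holomorphic_deriv[OF T open_ball] open_ball _ m(2) dnz dz] r(1)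
        by (metis centre_in_ball)
      have "deriv T 0 = 0" using z[of 1] m by simp
      then show ?thesis using g by (intro exI[of _ g] exI[of _ e]) (auto simp: m_def)
    qed
    then obtain g e where g: "e > 0" "g holomorphic_on ball 0 e" "\<And>w. w \<in> ball 0 e \<Longrightarrow> deriv T w = w ^ (n - 1) * g w" "g 0 \<noteq> 0"
      by blast
    define E where "E t = Re (g (of_real t))" for t :: real
    have "isCont g 0"
      using g(1,2) holomorphic_on_imp_continuous_on continuous_on_eq_continuous_at by (metis centre_in_ball open_ball)
    then have cE: "isCont E 0"
      unfolding E_def[abs_def]
      by (intro isCont_o2[where f = of_real and g = "\<lambda>z. Re (g z)"]) (auto intro!: continuous_intros)
    define \<rho> where "\<rho> = min e r"
    have d: "(X has_field_derivative t ^ (n - 1) * E t) (at t) \<and> of_real t ^ (n - 1) * g (of_real t) = of_real (t ^ (n - 1) * E t)" if t: "\<bar>t\<bar> < \<rho>" for t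
    proof -
      have "(T has_field_derivative of_real t ^ (n - 1) * g (of_real t)) (at (of_real t))"
        using holomorphic_derivI[OF T open_ball, of "of_real t"] g(3)[of "of_real t"] t by (simp add: \<rho>_def)
      moreover have "\<forall>\<^sub>F s in nhds t. s \<in> ball 0 r" by (rule eventually_nhds_in_open) (use t in \<open>auto simp: \<rho>_def\<close>)
      then have "\<forall>\<^sub>F s in nhds t. T (of_real s) = of_real (X s)" by eventually_elim (use TX in auto)
      ultimately have D: "(X has_field_derivative Re (of_real t ^ (n - 1) * g (of_real t))) (at t)"
        "of_real t ^ (n - 1) * g (of_real t) = of_real (Re (of_real t ^ (n - 1) * g (of_real t)))"
        by (rule real_derivative_transfer)+
      have R: "Re (of_real t ^ (n - 1) * g (of_real t)) = t ^ (n - 1) * E t"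
        by (simp add: E_def of_real_power[symmetric] del: of_real_power)
      show ?thesis using D unfolding R by blast
    qed
    have "\<rho> > 0" using g(1) r(1) by (simp add: \<rho>_def)
    have "E 0 \<noteq> 0"
    proof
      assume "E 0 = 0"
      \<comment> \<open>\<open>g\<close> is real on the punctured real axis, hence at \<open>0\<close> by continuity.\<close>
      have "((\<lambda>t. Im (g (of_real t))) \<longlongrightarrow> Im (g 0)) (at (0::real))"
        using \<open>isCont g 0\<close> by (intro tendsto_Im isCont_tendsto_compose[of 0 g]) (auto intro!: tendsto_eq_intros)
      moreover have "\<forall>\<^sub>F t in at (0::real). t \<in> ball 0 \<rho> \<and> t \<noteq> 0"
        using \<open>\<rho> > 0\<close> by (auto simp: eventually_at intro!: exI[of _ \<rho>])
      then have "\<forall>\<^sub>F t in at (0::real). Im (g (of_real t)) = 0"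
      proof eventually_elim
        case (elim t)
        then have "of_real (t ^ (n - 1)) * g (of_real t) = of_real (t ^ (n - 1) * E t)" using d[of t] by simp
        then have "of_real (t ^ (n - 1)) * g (of_real t) = of_real (t ^ (n - 1)) * of_real (E t)" by simp
        then have "g (of_real t) = of_real (E t)" using elim by simp
        then show ?case by simp
      qed
      ultimately have "Im (g 0) = 0" using tendsto_eventually tendsto_unique trivial_limit_at by (metis LIM_unique)
      with \<open>E 0 = 0\<close> g(4) show False by (simp add: E_def complex_eq_iff)
    qed
    moreover have "\<forall>\<^sub>F t in nhds 0. t \<in> ball (0::real) \<rho>" by (rule eventually_nhds_in_open) (use \<open>\<rho> > 0\<close> in auto)
    then have "\<forall>\<^sub>F t in nhds 0. (X has_field_derivative t ^ (n - 1) * E t) (at t)"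
      by eventually_elim (use d in auto)
    ultimately show ?thesis using cE by blast
  qed
  note C = critical_value_curve_complex(3,4)[OF U regular_ext[OF reg] n' ord']
  note P = partials1(1,2)[OF reg(2)] partials2(1,2)[OF reg(2)]
  show "\<exists>E. isCont E 0 \<and> E 0 \<noteq> 0 \<and> (\<forall>\<^sub>F t in nhds 0. ((\<lambda>t. fst (F (\<Gamma> t))) has_field_derivative t ^ (n - 1) * E t) (at t))"
    if "(partial_x (\<lambda>p. fst (F p)) w0, partial_y (\<lambda>p. fst (F p)) w0) \<noteq> (0, 0)"
  proof (rule main[OF r(2)])
    show "fst (G (\<Gamma>' (of_real t))) = of_real (fst (F (\<Gamma> t)))" if "\<bar>t\<bar> < r" for t using v that by blast
    show "(deriv ^^ i) (\<lambda>t. fst (G (\<Gamma>' t))) 0 = 0" if "0 < i" "i < n" for i using n(2)[OF that] by blast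
    show "(deriv ^^ n) (\<lambda>t. fst (G (\<Gamma>' t))) 0 \<noteq> 0" by (rule C(1)) (use that P in simp)
  qed
  show "\<exists>E. isCont E 0 \<and> E 0 \<noteq> 0 \<and> (\<forall>\<^sub>F t in nhds 0. ((\<lambda>t. snd (F (\<Gamma> t))) has_field_derivative t ^ (n - 1) * E t) (at t))"
    if "(partial_x (\<lambda>p. snd (F p)) w0, partial_y (\<lambda>p. snd (F p)) w0) \<noteq> (0, 0)"
  proof (rule main[OF r(3)])
    show "snd (G (\<Gamma>' (of_real t))) = of_real (snd (F (\<Gamma> t)))" if "\<bar>t\<bar> < r" for t using v that by blast
    show "(deriv ^^ i) (\<lambda>t. snd (G (\<Gamma>' t))) 0 = 0" if "0 < i" "i < n" for i using n(2)[OF that] by blast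
    show "(deriv ^^ n) (\<lambda>t. snd (G (\<Gamma>' t))) 0 \<noteq> 0" by (rule C(2)) (use that P in simp)
  qed
qed

end

section \<open>Holomorphic extensions of real analytic maps\<close>

definition conj2 :: "complex \<times> complex \<Rightarrow> complex \<times> complex" where
  "conj2 p = (cnj (fst p), cnj (snd p))"

text \<open>The same real coefficients are summed at complex arguments. Real coefficients make the
  sum commute with complex conjugation.\<close>

lemma conj_symmetric_extension:
  fixes \<phi> :: "real \<times> real \<Rightarrow> real"
  assumes "K_analytic2 \<phi> W" "(x0, y0) \<in> W"
  obtains r f where "r > 0" "holo2 f (ball (of_real x0) r \<times> ball (of_real y0) r)"
    "\<And>w. complexify w \<in> ball (of_real x0) r \<times> ball (of_real y0) r \<Longrightarrow> f (complexify w) = of_real (\<phi> w)"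
    "\<And>p. p \<in> ball (of_real x0) r \<times> ball (of_real y0) r \<Longrightarrow> f (conj2 p) = cnj (f p)"
proof -
  from bspec[OF assms[unfolded K_analytic2_def], unfolded prod.case]
  obtain a where "\<exists>r>0. \<forall>x y. norm (x - x0) < r \<and> norm (y - y0) < r \<longrightarrow>
       ((\<lambda>(m, n). a m n * (x - x0) ^ m * (y - y0) ^ n) has_sum \<phi> (x, y)) UNIV" ..
  then obtain r where r: "r > 0" and a': "\<forall>x y. norm (x - x0) < r \<and> norm (y - y0) < r \<longrightarrow>
       ((\<lambda>(m, n). a m n * (x - x0) ^ m * (y - y0) ^ n) has_sum \<phi> (x, y)) UNIV" by (elim exE conjE) (rule that)
  have a: "((\<lambda>(m, n). a m n * (x - x0) ^ m * (y - y0) ^ n) has_sum \<phi> (x, y)) UNIV"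
    if "norm (x - x0) < r" "norm (y - y0) < r" for x y
    by (rule a'[rule_format]) (intro conjI that)
  define t where "t p = (\<lambda>(m, n). complex_of_real (a m n) * (fst p - of_real x0) ^ m * (snd p - of_real y0) ^ n)" for p
  define f where "f p = infsum (t p) UNIV" for p
  let ?U = "ball (complex_of_real x0) r \<times> ball (complex_of_real y0) r"
  have s: "(t p has_sum f p) UNIV" if p: "p \<in> ?U" for p
  proof -
    \<comment> \<open>A real point with the same distances from the centre: there the real series
      converges absolutely, and it dominates the complex series at \<open>p\<close> term by
      term.\<close>
    define x where "x = x0 + norm (fst p - of_real x0)"
    define y where "y = y0 + norm (snd p - of_real y0)"
    have "(\<lambda>(m, n). a m n * (x - x0) ^ m * (y - y0) ^ n) summable_on UNIV"
      using a[of x y] p by (auto simp: x_def y_def dist_norm norm_minus_commute summable_on_def)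
    then have "(\<lambda>mn. norm (case mn of (m, n) \<Rightarrow> a m n * (x - x0) ^ m * (y - y0) ^ n)) summable_on UNIV"
      by (rule summable_on_iff_abs_summable_on_real[THEN iffD1])
    then have "(\<lambda>mn. norm (t p mn)) summable_on UNIV"
      by (rule Infinite_Sum.abs_summable_on_comparison_test')
         (auto simp: t_def x_def y_def norm_mult norm_power)
    then show ?thesis unfolding f_def by (rule has_sum_infsum[OF abs_summable_summable])
  qed
  show ?thesis
  proof (rule that[OF r])
    show "holo2 f ?U"
      by (rule power_series2_holo2[where a = "\<lambda>m n. complex_of_real (a m n)"])
         (use s in \<open>auto simp: t_def dist_norm norm_minus_commute\<close>)
    show "f (complexify w) = of_real (\<phi> w)" if w: "complexify w \<in> ?U" for w
    proof -
      have "norm (of_real (fst w - x0) :: complex) < r" "norm (of_real (snd w - y0) :: complex) < r"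
        using w unfolding of_real_diff by (auto simp: complexify_def dist_norm norm_minus_commute)
      then have "norm (fst w - x0) < r" "norm (snd w - y0) < r" by (simp_all only: norm_of_real real_norm_def)
      from has_sum_of_real[OF a[OF this]]
      have "((\<lambda>mn. complex_of_real (case mn of (m, n) \<Rightarrow> a m n * (fst w - x0) ^ m * (snd w - y0) ^ n)) has_sum of_real (\<phi> (fst w, snd w))) UNIV" .
      then have "(t (complexify w) has_sum of_real (\<phi> w)) UNIV"
        by (simp add: t_def complexify_def case_prod_unfold)
      with s[OF w] show ?thesis by (rule has_sum_unique)
    qed
    show "f (conj2 p) = cnj (f p)" if p: "p \<in> ?U" for p
    proof -
      have "((\<lambda>mn. cnj (t p mn)) has_sum cnj (f p)) UNIV" using s[OF p] by simp
      moreover have "(\<lambda>mn. cnj (t p mn)) = t (conj2 p)" by (auto simp: t_def conj2_def fun_eq_iff)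
      moreover have "conj2 p \<in> ?U"
      proof -
        have "norm (cnj (of_real x0 - fst p)) < r" "norm (cnj (of_real y0 - snd p)) < r"
          using p unfolding complex_mod_cnj by (auto simp: dist_norm)
        then show ?thesis by (simp add: conj2_def dist_norm)
      qed
      ultimately show ?thesis using s[of "conj2 p"] has_sum_unique by metis
    qed
  qed
qed

lemma conj2_bidisc: "conj2 p \<in> ball (complex_of_real x0) r \<times> ball (complex_of_real y0) r \<longleftrightarrow> p \<in> ball (of_real x0) r \<times> ball (of_real y0) r"
proof -
  have "norm (of_real c - cnj z) = norm (of_real c - z)" for c z
    by (metis complex_cnj_complex_of_real complex_cnj_diff complex_mod_cnj)
  then show ?thesis by (cases p) (simp add: conj2_def dist_norm)
qed

text \<open>The symmetry under conjugation is recorded because it forces the complex natural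
  parametrization to be real at real times.\<close>

lemma real_extension_exists:
  fixes F :: "real \<times> real \<Rightarrow> real \<times> real"
  assumes W: "open W" "K_analytic_map F W" "w0 \<in> W"
  obtains U G S where "real_extension F G U S" "w0 \<in> S" "S \<subseteq> W"
    "\<forall>p\<in>U. conj2 p \<in> U \<and> G (conj2 p) = conj2 (G p)"
proof -
  obtain x0 y0 where w0: "w0 = (x0, y0)" by fastforce
  note K = W(2)[unfolded K_analytic_map_def]
  obtain r1 f where r1: "r1 > 0" "holo2 f (ball (of_real x0) r1 \<times> ball (of_real y0) r1)"
    "\<And>w. complexify w \<in> ball (of_real x0) r1 \<times> ball (of_real y0) r1 \<Longrightarrow> f (complexify w) = of_real (fst (F w))"
    "\<And>p. p \<in> ball (of_real x0) r1 \<times> ball (of_real y0) r1 \<Longrightarrow> f (conj2 p) = cnj (f p)"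
    using conj_symmetric_extension[OF conjunct1[OF K] W(3)[unfolded w0]] by metis
  obtain r2 g where r2: "r2 > 0" "holo2 g (ball (of_real x0) r2 \<times> ball (of_real y0) r2)"
    "\<And>w. complexify w \<in> ball (of_real x0) r2 \<times> ball (of_real y0) r2 \<Longrightarrow> g (complexify w) = of_real (snd (F w))"
    "\<And>p. p \<in> ball (of_real x0) r2 \<times> ball (of_real y0) r2 \<Longrightarrow> g (conj2 p) = cnj (g p)"
    using conj_symmetric_extension[OF conjunct2[OF K] W(3)[unfolded w0]] by metis
  define r where "r = min r1 r2"
  define U where "U = ball (complex_of_real x0) r \<times> ball (complex_of_real y0) r"
  define G where "G p = (f p, g p)" for p
  define S where "S = W \<inter> complexify -` U"
  have oU: "open U" by (simp add: U_def open_Times)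
  have sub: "U \<subseteq> ball (of_real x0) r1 \<times> ball (of_real y0) r1" "U \<subseteq> ball (of_real x0) r2 \<times> ball (of_real y0) r2"
    by (auto simp: U_def r_def)
  show ?thesis
  proof (rule that)
    show "real_extension F G U S"
    proof
      show "open U" by (rule oU)
      show "K_analytic_map G U"
        unfolding K_analytic_map_def G_def fst_conv snd_conv
        by (intro conjI holo2_imp_K_analytic2 holo2_subset[OF r1(2) oU sub(1)] holo2_subset[OF r2(2) oU sub(2)])
      show "open S" unfolding S_def
        using W(1) oU isCont_complexify by (intro open_Int open_vimage continuous_at_imp_continuous_on) auto
      show "complexify w \<in> U" if "w \<in> S" for w using that by (simp add: S_def)
      show "G (complexify w) = complexify (F w)" if "w \<in> S" for w
        using that r1(3)[of w] r2(3)[of w] sub unfolding S_def G_def complexify_def[of "F w"] by blast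
    qed
    show "w0 \<in> S" using W(3) r1(1) r2(1) by (simp add: S_def w0 U_def complexify_def r_def)
    show "S \<subseteq> W" by (auto simp: S_def)
    show "\<forall>p\<in>U. conj2 p \<in> U \<and> G (conj2 p) = conj2 (G p)"
    proof
      fix p assume p: "p \<in> U"
      then have "conj2 p \<in> U" unfolding U_def by (simp only: conj2_bidisc)
      moreover have "f (conj2 p) = cnj (f p)" "g (conj2 p) = cnj (g p)" using r1(4)[of p] r2(4)[of p] p sub by (blast+)
      ultimately show "conj2 p \<in> U \<and> G (conj2 p) = conj2 (G p)" by (simp add: G_def conj2_def)
    qed
  qed
qed

lemma conj_partials:
  assumes f: "holo2 f U" and sym: "\<And>p. p \<in> U \<Longrightarrow> conj2 p \<in> U \<and> f (conj2 p) = cnj (f p)" and p: "p \<in> U"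
  shows "partial_x f (conj2 p) = cnj (partial_x f p)" "partial_y f (conj2 p) = cnj (partial_y f p)"
proof -
  obtain x y where xy: "p = (x, y)" by fastforce
  have oU: "open U" by (rule holo2_open[OF f])
  have "isCont (\<lambda>z. (z, cnj y)) (cnj x)" "isCont (\<lambda>z. (cnj x, z)) (cnj y)" by (auto intro!: continuous_intros)
  moreover have c: "(cnj x, cnj y) \<in> U" using sym[OF p] by (simp add: conj2_def xy)
  ultimately have ev: "\<forall>\<^sub>F z in nhds (cnj x). (z, cnj y) \<in> U" "\<forall>\<^sub>F z in nhds (cnj y). (cnj x, z) \<in> U"
    using oU by (auto intro!: isCont_eventually_nhds)
  note d = holo2_partial_derivs[OF f p, unfolded xy fst_conv snd_conv]
  have "\<forall>\<^sub>F z in nhds (cnj x). (cnj \<circ> (\<lambda>x. f (x, y)) \<circ> cnj) z = f (z, cnj y)"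
    using ev(1) by eventually_elim (use sym in \<open>force simp: conj2_def\<close>)
  moreover have "((cnj \<circ> (\<lambda>x. f (x, y)) \<circ> cnj) has_field_derivative cnj (partial_x f (x, y))) (at (cnj x))"
    by (rule has_field_derivative_cnj_cnj) (use d in simp)
  ultimately have "((\<lambda>z. f (z, cnj y)) has_field_derivative cnj (partial_x f (x, y))) (at (cnj x))"
    by (subst (asm) DERIV_cong_ev) auto
  then show "partial_x f (conj2 p) = cnj (partial_x f p)"
    unfolding partial_x_def[of f "conj2 p"] by (auto simp: conj2_def xy intro!: DERIV_imp_deriv)
  have "\<forall>\<^sub>F z in nhds (cnj y). (cnj \<circ> (\<lambda>y. f (x, y)) \<circ> cnj) z = f (cnj x, z)"
    using ev(2) by eventually_elim (use sym in \<open>force simp: conj2_def\<close>)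
  moreover have "((cnj \<circ> (\<lambda>y. f (x, y)) \<circ> cnj) has_field_derivative cnj (partial_y f (x, y))) (at (cnj y))"
    by (rule has_field_derivative_cnj_cnj) (use d in simp)
  ultimately have "((\<lambda>z. f (cnj x, z)) has_field_derivative cnj (partial_y f (x, y))) (at (cnj y))"
    by (subst (asm) DERIV_cong_ev) auto
  then show "partial_y f (conj2 p) = cnj (partial_y f p)"
    unfolding partial_y_def[of f "conj2 p"] by (auto simp: conj2_def xy intro!: DERIV_imp_deriv)
qed

text \<open>Take the natural parametrization of the symmetric extension. On the real axis its
  complex conjugate solves the same system with the same initial value, so by uniqueness it is real
  there, and its real coordinates form the curve sought.\<close>

lemma natural_parametrization_exists_real:
  fixes F :: "real \<times> real \<Rightarrow> real \<times> real"
  assumes W: "open W" "K_analytic_map F W" and reg: "regular_critical_point W F w0"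
  shows "\<exists>\<Gamma>. natural_parametrization W F w0 \<Gamma>"
proof -
  have w0: "w0 \<in> W" using reg by (auto simp: regular_critical_point_def critical_set_def)
  obtain U G S where E: "real_extension F G U S" and Sw: "w0 \<in> S" "S \<subseteq> W"
    and sym: "\<forall>p\<in>U. conj2 p \<in> U \<and> G (conj2 p) = conj2 (G p)"
    by (rule real_extension_exists[OF W w0]) (rule that)
  interpret real_extension F G U S using E .
  have reg': "regular_critical_point U G (complexify w0)" by (rule regular_ext[OF reg Sw(1)])
  have symJ: "conj2 p \<in> U \<and> jacobian G (conj2 p) = cnj (jacobian G p)" if "p \<in> U" for p
  proof -
    have s1: "conj2 p \<in> U \<and> fst (G (conj2 p)) = cnj (fst (G p))" "conj2 p \<in> U \<and> snd (G (conj2 p)) = cnj (snd (G p))" if "p \<in> U" for p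
      using sym that by (auto simp: conj2_def)
    show ?thesis
      using conj_partials[OF holo(1) s1(1) that] conj_partials[OF holo(2) s1(2) that] sym that by (simp add: jacobian_def)
  qed
  have cp: "partial_x (jacobian G) (conj2 p) = cnj (partial_x (jacobian G) p)"
    "partial_y (jacobian G) (conj2 p) = cnj (partial_y (jacobian G) p)" if "p \<in> U" for p
    by (rule conj_partials(1)[OF holo(3) symJ that] conj_partials(2)[OF holo(3) symJ that], assumption)+
  obtain \<Gamma> where n: "natural_parametrization U G (complexify w0) \<Gamma>"
    and uniq: "\<And>(x :: real \<Rightarrow> complex) y e. e > 0 \<Longrightarrow> (x 0, y 0) = complexify w0 \<Longrightarrow>
       (\<And>t. \<bar>t\<bar> < e \<Longrightarrow> (x t, y t) \<in> U \<and> (x has_vector_derivative - partial_y (jacobian G) (x t, y t)) (at t)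
           \<and> (y has_vector_derivative partial_x (jacobian G) (x t, y t)) (at t)) \<Longrightarrow>
       \<forall>\<^sub>F t in nhds 0. (x t, y t) = \<Gamma> (of_real t)"
  proof (rule natural_parametrization_exists_complex[OF U reg'])
    fix \<Gamma> assume *: "natural_parametrization U G (complexify w0) \<Gamma>"
     and **: "\<And>(x :: real \<Rightarrow> complex) y e. e > 0 \<Longrightarrow> (x 0, y 0) = complexify w0 \<Longrightarrow>
       (\<And>t. \<bar>t\<bar> < e \<Longrightarrow> (x t, y t) \<in> U \<and> (x has_vector_derivative - partial_y (jacobian G) (x t, y t)) (at t)
           \<and> (y has_vector_derivative partial_x (jacobian G) (x t, y t)) (at t)) \<Longrightarrow>
       \<forall>\<^sub>F t in nhds 0. (x t, y t) = \<Gamma> (of_real t)"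
    show ?thesis by (rule that[OF *]) (use ** in blast)
  qed
  obtain r where r: "r > 0" "\<And>t. t \<in> ball 0 r \<Longrightarrow> \<Gamma> t \<in> U \<and>
        ((\<lambda>s. fst (\<Gamma> s)) has_field_derivative - partial_y (jacobian G) (\<Gamma> t)) (at t) \<and>
        ((\<lambda>s. snd (\<Gamma> s)) has_field_derivative partial_x (jacobian G) (\<Gamma> t)) (at t)" and \<Gamma>0: "\<Gamma> 0 = complexify w0"
    using n unfolding natural_parametrization_def by blast
  have "\<forall>\<^sub>F t in nhds 0. (cnj (fst (\<Gamma> (of_real t))), cnj (snd (\<Gamma> (of_real t)))) = \<Gamma> (of_real t)"
  proof (rule uniq[OF r(1)])
    show "(cnj (fst (\<Gamma> (of_real 0))), cnj (snd (\<Gamma> (of_real 0)))) = complexify w0" by (simp add: \<Gamma>0 complexify_def)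
    fix t :: real assume t: "\<bar>t\<bar> < r"
    have c: "(cnj (fst (\<Gamma> (of_real t))), cnj (snd (\<Gamma> (of_real t)))) = conj2 (\<Gamma> (of_real t))" by (simp add: conj2_def)
    have *: "\<Gamma> (of_real t) \<in> U" "((\<lambda>s. fst (\<Gamma> s)) has_field_derivative - partial_y (jacobian G) (\<Gamma> (of_real t))) (at (of_real t))"
        "((\<lambda>s. snd (\<Gamma> s)) has_field_derivative partial_x (jacobian G) (\<Gamma> (of_real t))) (at (of_real t))"
      using r(2)[of "of_real t"] t by auto
    have "((\<lambda>t. cnj (fst (\<Gamma> (of_real t)))) has_vector_derivative cnj (- partial_y (jacobian G) (\<Gamma> (of_real t)))) (at t)"
      "((\<lambda>t. cnj (snd (\<Gamma> (of_real t)))) has_vector_derivative cnj (partial_x (jacobian G) (\<Gamma> (of_real t)))) (at t)"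
      by (rule bounded_linear.has_vector_derivative[OF bounded_linear_cnj has_vector_derivative_real_field[OF *(2)]],
          rule bounded_linear.has_vector_derivative[OF bounded_linear_cnj has_vector_derivative_real_field[OF *(3)]])
    then show "(cnj (fst (\<Gamma> (of_real t))), cnj (snd (\<Gamma> (of_real t)))) \<in> U \<and>
       ((\<lambda>t. cnj (fst (\<Gamma> (of_real t)))) has_vector_derivative - partial_y (jacobian G) (cnj (fst (\<Gamma> (of_real t))), cnj (snd (\<Gamma> (of_real t))))) (at t) \<and>
       ((\<lambda>t. cnj (snd (\<Gamma> (of_real t)))) has_vector_derivative partial_x (jacobian G) (cnj (fst (\<Gamma> (of_real t))), cnj (snd (\<Gamma> (of_real t))))) (at t)"
      unfolding c using cp[OF *(1)] symJ[OF *(1)] by simp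
  qed
  define R where "R t = (Re (fst (\<Gamma> (of_real t))), Re (snd (\<Gamma> (of_real t))))" for t :: real
  have "\<forall>\<^sub>F t in nhds 0. \<Gamma> (of_real t) = complexify (R t)"
    using \<open>\<forall>\<^sub>F t in nhds 0. (cnj (fst (\<Gamma> (of_real t))), _) = _\<close>
  proof eventually_elim
    case (elim t)
    then have "cnj (fst (\<Gamma> (of_real t))) = fst (\<Gamma> (of_real t))" "cnj (snd (\<Gamma> (of_real t))) = snd (\<Gamma> (of_real t))"
      by (metis fst_conv, metis snd_conv)
    then show ?case by (simp add: R_def complexify_def prod_eq_iff complex_eq_iff)
  qed
  moreover have "\<forall>\<^sub>F t in nhds 0. R t \<in> S"
  proof (rule isCont_eventually_nhds[OF _ S])
    have z: "isCont (\<lambda>s. fst (\<Gamma> s)) (of_real 0)" "isCont (\<lambda>s. snd (\<Gamma> s)) (of_real 0)"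
      using r(2)[of 0] r(1) DERIV_isCont by auto
    show "isCont R 0"
    proof -
      have "isCont complex_of_real 0" by (auto intro!: continuous_intros)
      then have "isCont (\<lambda>t::real. fst (\<Gamma> (of_real t))) 0" "isCont (\<lambda>t::real. snd (\<Gamma> (of_real t))) 0"
        using isCont_o2[where f = of_real and g = "\<lambda>s. fst (\<Gamma> s)"] isCont_o2[where f = of_real and g = "\<lambda>s. snd (\<Gamma> s)"] z
        by (blast+)
      then show ?thesis unfolding R_def[abs_def] by (intro isCont_Pair isCont_Re)
    qed
    show "R 0 \<in> S" using Sw(1) by (simp add: R_def \<Gamma>0 complexify_def)
  qed
  moreover have "\<forall>\<^sub>F t in nhds 0. t \<in> ball 0 r" by (rule eventually_nhds_in_open) (use r in auto)
  ultimately have "\<forall>\<^sub>F t in nhds 0. \<Gamma> (of_real t) = complexify (R t) \<and> R t \<in> S \<and> t \<in> ball 0 r" by eventually_elim auto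
  then obtain e where e: "e > 0" "\<And>t. t \<in> ball 0 e \<Longrightarrow> \<Gamma> (of_real t) = complexify (R t) \<and> R t \<in> S \<and> t \<in> ball 0 r"
    unfolding eventually_nhds_metric by (auto simp: dist_norm)
  have "natural_parametrization W F w0 R"
    unfolding natural_parametrization_def
  proof (intro conjI exI[of _ e] ballI)
    show "R 0 = w0" by (simp add: R_def \<Gamma>0 complexify_def)
    fix t :: real assume t: "t \<in> ball 0 e"
    show "R t \<in> W" using e(2)[OF t] Sw(2) by blast
    have "\<forall>\<^sub>F s in nhds t. s \<in> ball 0 e" by (rule eventually_nhds_in_open) (use t in auto)
    then have ev: "\<forall>\<^sub>F s in nhds t. \<Gamma> (of_real s) = complexify (R s)" by eventually_elim (use e in blast)
    have ev1: "\<forall>\<^sub>F s in nhds t. fst (\<Gamma> (of_real s)) = of_real (fst (R s))" "\<forall>\<^sub>F s in nhds t. snd (\<Gamma> (of_real s)) = of_real (snd (R s))"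
      by (use ev in eventually_elim, simp add: complexify_def)+
    have d: "((\<lambda>s. fst (\<Gamma> s)) has_field_derivative of_real (- partial_y (jacobian F) (R t))) (at (of_real t))"
        "((\<lambda>s. snd (\<Gamma> s)) has_field_derivative of_real (partial_x (jacobian F) (R t))) (at (of_real t))"
      using r(2)[of "of_real t"] e(2)[OF t] partialsJ(1,2)[of "R t"] by auto
    show "((\<lambda>s. fst (R s)) has_field_derivative - partial_y (jacobian F) (R t)) (at t)"
      "((\<lambda>s. snd (R s)) has_field_derivative partial_x (jacobian F) (R t)) (at t)"
      using real_derivative_transfer(1)[OF d(1) ev1(1)] real_derivative_transfer(1)[OF d(2) ev1(2)] by simp_all
  qed (rule e(1))
  then show ?thesis by blast
qed

lemma holomorphic_extension_imp_real_extension: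
  assumes "holomorphic_extension F w0 U G"
  obtains S where "real_extension F G U S" "w0 \<in> S"
proof -
  have U: "open U" "complexify w0 \<in> U" "K_analytic_map G U" and ev: "\<forall>\<^sub>F w in nhds w0. G (complexify w) = complexify (F w)"
    using assms by (auto simp: holomorphic_extension_def)
  have "\<forall>\<^sub>F w in nhds w0. complexify w \<in> U" by (rule isCont_eventually_nhds[OF isCont_complexify U(1,2)])
  with ev have "\<forall>\<^sub>F w in nhds w0. G (complexify w) = complexify (F w) \<and> complexify w \<in> U" by eventually_elim auto
  then obtain S where "open S" "w0 \<in> S" "\<And>w. w \<in> S \<Longrightarrow> G (complexify w) = complexify (F w) \<and> complexify w \<in> U"
    by (auto simp: eventually_nhds)
  then show ?thesis using U by (intro that[of S]) (auto simp: real_extension_def)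
qed

text \<open>The defining description ranges over all holomorphic extensions. Each of them yields a
  \<open>real_extension\<close> on some neighbourhood and hence the same multiplicity, and at least
  one exists.\<close>

lemma real_map_multiplicity_eq:
  fixes F :: "real \<times> real \<Rightarrow> real \<times> real"
  assumes W: "open W" "K_analytic_map F W" and reg: "regular_critical_point W F w0"
    and nat: "natural_parametrization W F w0 \<Gamma>"
  shows "real_map_multiplicity F w0 = curve_order (F \<circ> \<Gamma>) + 1"
proof -
  have w0: "w0 \<in> W" using reg by (auto simp: regular_critical_point_def critical_set_def)
  have any: "map_multiplicity U G (complexify w0) = curve_order (F \<circ> \<Gamma>) + 1" if "holomorphic_extension F w0 U G" for U G
    using holomorphic_extension_imp_real_extension[OF that] real_extension.multiplicity_ext[OF _ reg _ nat] by metis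
  obtain U G S where E: "real_extension F G U S" and S: "w0 \<in> S" "S \<subseteq> W"
    by (rule real_extension_exists[OF W w0]) (rule that)
  have "\<forall>\<^sub>F w in nhds w0. w \<in> S" by (rule eventually_nhds_in_open) (use E S in \<open>auto simp: real_extension_def\<close>)
  then have "\<forall>\<^sub>F w in nhds w0. G (complexify w) = complexify (F w)"
    by eventually_elim (use E in \<open>auto simp: real_extension_def\<close>)
  then have "holomorphic_extension F w0 U G" using E S(1) unfolding holomorphic_extension_def real_extension_def by blast
  then show ?thesis unfolding real_map_multiplicity_def using any by (intro the_equality) (metis, blast)
qed

section \<open>Topological normal forms\<close>

text \<open>By invariance of domain it suffices to give continuous injective coordinates.\<close>

definition topological_chart ::
    "(real \<times> real) set \<Rightarrow> (real \<times> real \<Rightarrow> real \<times> real) \<Rightarrow> real \<times> real \<Rightarrow> (real \<times> real \<Rightarrow> real \<times> real) \<Rightarrow> bool" where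
  "topological_chart S F w0 G \<longleftrightarrow> open S \<and> w0 \<in> S \<and>
     (\<exists>k N H. continuous_on S k \<and> inj_on k S \<and> k w0 = (0, 0) \<and>
        open N \<and> F ` S \<subseteq> N \<and> continuous_on N H \<and> inj_on H N \<and> (\<forall>p\<in>S. H (F p) = G (k p)))"

lemma topological_chart_imp_model:
  assumes "topological_chart S F w0 G" "S \<subseteq> W"
  shows "topological_model W F w0 G"
proof -
  obtain k N H where S: "open S" "w0 \<in> S" and k: "continuous_on S k" "inj_on k S" "k w0 = (0, 0)"
    and N: "open N" "F ` S \<subseteq> N" "continuous_on N H" "inj_on H N" and eq: "\<And>p. p \<in> S \<Longrightarrow> H (F p) = G (k p)"
    using assms(1) unfolding topological_chart_def by blast
  obtain h where h: "homeomorphism S (k ` S) k h"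
    using invariance_of_domain_homeomorphism[OF S(1) k(1) _ k(2)] by auto
  obtain H' where H': "homeomorphism N (H ` N) H H'"
    using invariance_of_domain_homeomorphism[OF N(1) N(3) _ N(4)] by auto
  have im: "h ` k ` S = S" using h by (simp add: homeomorphism_image2)
  have hk: "\<And>p. p \<in> S \<Longrightarrow> h (k p) = p" using h by (simp add: homeomorphism_def)
  show ?thesis
    unfolding topological_model_def
  proof (intro exI conjI ballI)
    show "open (k ` S)" by (rule invariance_of_domain[OF k(1) S(1) k(2)])
    show "(0, 0) \<in> k ` S" using S(2) k(3) by (metis imageI)
    show "open (h ` k ` S)" "h ` k ` S \<subseteq> W" using im S(1) assms(2) by auto
    show "homeomorphism (k ` S) (h ` k ` S) h k" using h im by (simp add: homeomorphism_symD)
    show "h (0, 0) = w0" using hk[OF S(2)] k(3) by simp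
    show "open N" "F ` h ` k ` S \<subseteq> N" using N im by auto
    show "open (H ` N)" by (rule invariance_of_domain[OF N(3,1,4)])
    show "homeomorphism N (H ` N) H H'" by (rule H')
    show "H (F (h p)) = G p" if "p \<in> k ` S" for p using that hk eq by auto
  qed
qed

text \<open>Charts are pulled back along injective continuous maps in source and range. This serves
  to undo the straightening, the sign changes of the normalization, and the exchange of the two
  components.\<close>

lemma topological_chart_transport:
  assumes ch: "topological_chart S F p0 G" and V: "open V" "w0 \<in> V"
    and \<Phi>: "continuous_on V \<Phi>" "inj_on \<Phi> V" "\<Phi> w0 = p0" and L: "continuous_on UNIV L" "inj L"
    and eq: "\<And>p. p \<in> V \<Longrightarrow> \<Phi> p \<in> S \<Longrightarrow> L (F' p) = F (\<Phi> p)"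
  shows "topological_chart {p\<in>V. \<Phi> p \<in> S} F' w0 G"
proof -
  obtain k N H where S: "open S" "p0 \<in> S" and k: "continuous_on S k" "inj_on k S" "k p0 = (0, 0)"
    and N: "open N" "F ` S \<subseteq> N" "continuous_on N H" "inj_on H N" and eq': "\<And>p. p \<in> S \<Longrightarrow> H (F p) = G (k p)"
    using ch unfolding topological_chart_def by blast
  let ?S = "{p\<in>V. \<Phi> p \<in> S}"
  have oS: "open ?S" using continuous_open_preimage[OF \<Phi>(1) V(1) S(1)] by (simp add: vimage_def Int_def)
  show ?thesis unfolding topological_chart_def
  proof (intro conjI exI ballI)
    show "open ?S" by (rule oS)
    show "w0 \<in> ?S" using V S \<Phi>(3) by simp
    show "continuous_on ?S (k \<circ> \<Phi>)"
      by (intro continuous_on_compose continuous_on_subset[OF \<Phi>(1)] continuous_on_subset[OF k(1)]) auto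
    show "inj_on (k \<circ> \<Phi>) ?S"
      using \<Phi>(2) k(2) by (auto simp: inj_on_def)
    show "(k \<circ> \<Phi>) w0 = (0, 0)" using \<Phi>(3) k(3) by simp
    show "open (L -` N)" by (rule open_vimage[OF N(1) L(1)])
    show "F' ` ?S \<subseteq> L -` N" using eq N(2) by auto
    show "continuous_on (L -` N) (H \<circ> L)"
      by (intro continuous_on_compose continuous_on_subset[OF L(1)] continuous_on_subset[OF N(3)]) auto
    show "inj_on (H \<circ> L) (L -` N)" by (intro comp_inj_on inj_on_subset[OF L(2)] inj_on_subset[OF N(4)]) auto
    show "(H \<circ> L) (F' p) = G ((k \<circ> \<Phi>) p)" if "p \<in> ?S" for p using that eq eq' by auto
  qed
qed

text \<open>Positivity is asked strictly between the end points, so intervals that end at a critical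
  point are covered.\<close>

lemma strict_mono_of_deriv:
  fixes f :: "real \<Rightarrow> real"
  assumes "convex B" "s \<in> B" "s' \<in> B" "s < s'" and d: "\<And>x. x \<in> B \<Longrightarrow> (f has_real_derivative f' x) (at x)"
    and p: "\<And>x. s < x \<Longrightarrow> x < s' \<Longrightarrow> f' x > 0"
  shows "f s < f s'"
proof (rule DERIV_pos_imp_increasing_open[OF \<open>s < s'\<close>])
  have sub: "{s..s'} \<subseteq> B"
    using assms(1-3) by (metis closed_segment_eq_real_ivl closed_segment_subset \<open>s < s'\<close> less_imp_le)
  show "\<exists>y. (f has_real_derivative y) (at x) \<and> y > 0" if "s < x" "x < s'" for x
  proof -
    have "x \<in> B" using sub that by auto
    then show ?thesis using d[of x] p[OF that] by blast
  qed
  show "continuous_on {s..s'} f"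
    using d sub DERIV_isCont by (intro continuous_at_imp_continuous_on) blast
qed

text \<open>On each vertical line \<open>\<sigma> * h\<close> has a strict minimum at
  \<open>\<phi> u\<close>. The new vertical coordinate \<open>\<kappa>\<close> is the signed square
  root of the height above this minimum, and in the range the minimal value is subtracted, so that
  the second component becomes \<open>\<kappa>\<close> squared.\<close>

lemma fold_chart:
  fixes h M :: "real \<times> real \<Rightarrow> real"
  assumes I: "open I" "u0 \<in> I" and B: "open B" "convex B" and h: "continuous_on (I \<times> B) h"
    and d: "\<And>u s. u \<in> I \<Longrightarrow> s \<in> B \<Longrightarrow> ((\<lambda>s. h (u, s)) has_real_derivative M (u, s)) (at s)"
    and \<phi>: "continuous_on I \<phi>" "\<And>u. u \<in> I \<Longrightarrow> \<phi> u \<in> B"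
    and sg: "\<sigma> * \<sigma> = 1" "\<And>u s. u \<in> I \<Longrightarrow> s \<in> B \<Longrightarrow> s > \<phi> u \<Longrightarrow> \<sigma> * M (u, s) > 0"
      "\<And>u s. u \<in> I \<Longrightarrow> s \<in> B \<Longrightarrow> s < \<phi> u \<Longrightarrow> \<sigma> * M (u, s) < 0"
  shows "topological_chart (I \<times> B) (\<lambda>p. (fst p, h p)) (u0, \<phi> u0) fold_form"
proof -
  define X where "X p = \<sigma> * (h (fst p, snd p) - h (fst p, \<phi> (fst p)))" for p
  define \<kappa> where "\<kappa> p = (if \<phi> (fst p) \<le> snd p then sqrt (X p) else - sqrt (X p))" for p
  have \<sigma>0: "\<sigma> \<noteq> 0" using sg(1) by auto
  have up: "\<sigma> * h (u, s) < \<sigma> * h (u, s')" if "u \<in> I" "s \<in> B" "s' \<in> B" "\<phi> u \<le> s" "s < s'" for u s s'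
  proof (rule strict_mono_of_deriv[OF B(2) that(2,3,5), where f' = "\<lambda>s. \<sigma> * M (u, s)"])
    show "((\<lambda>s. \<sigma> * h (u, s)) has_real_derivative \<sigma> * M (u, x)) (at x)" if "x \<in> B" for x
      by (intro DERIV_cmult d that \<open>u \<in> I\<close>)
    fix x assume x: "s < x" "x < s'"
    have "x \<in> B" using closed_segment_subset[OF that(2,3) B(2)] x that(5) by (auto simp: closed_segment_eq_real_ivl)
    then show "0 < \<sigma> * M (u, x)" using sg(2)[of u x] that x by auto
  qed
  have down: "\<sigma> * h (u, s') < \<sigma> * h (u, s)" if "u \<in> I" "s \<in> B" "s' \<in> B" "s' \<le> \<phi> u" "s < s'" for u s s'
  proof -
    have "- (\<sigma> * h (u, s)) < - (\<sigma> * h (u, s'))"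
    proof (rule strict_mono_of_deriv[OF B(2) that(2,3,5), where f' = "\<lambda>s. - (\<sigma> * M (u, s))"])
      show "((\<lambda>s. - (\<sigma> * h (u, s))) has_real_derivative - (\<sigma> * M (u, x))) (at x)" if "x \<in> B" for x
        by (intro DERIV_minus DERIV_cmult d that \<open>u \<in> I\<close>)
      fix x assume x: "s < x" "x < s'"
      have "x \<in> B" using closed_segment_subset[OF that(2,3) B(2)] x that(5) by (auto simp: closed_segment_eq_real_ivl)
      then show "0 < - (\<sigma> * M (u, x))" using sg(3)[of u x] that x by auto
    qed
    then show ?thesis by simp
  qed
  have X0: "X p \<ge> 0" if "p \<in> I \<times> B" for p
  proof -
    have "fst p \<in> I" "snd p \<in> B" "\<phi> (fst p) \<in> B" using that \<phi>(2) by auto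
    then show ?thesis using up[of "fst p" "\<phi> (fst p)" "snd p"] down[of "fst p" "snd p" "\<phi> (fst p)"]
      unfolding X_def by (cases "snd p" "\<phi> (fst p)" rule: linorder_cases) (auto simp: algebra_simps)
  qed
  have cs: "continuous_on (I \<times> B) (\<lambda>p. \<phi> (fst p))"
    by (rule continuous_on_compose2[OF \<phi>(1)]) (auto intro!: continuous_intros)
  have ch: "continuous_on (I \<times> B) (\<lambda>p. h (fst p, \<phi> (fst p)))"
    by (rule continuous_on_compose2[OF h]) (use \<phi>(2) cs in \<open>auto intro!: continuous_intros\<close>)
  have cX: "continuous_on (I \<times> B) X" unfolding X_def prod.collapse by (intro continuous_intros h ch)
  have c\<kappa>: "continuous_on (I \<times> B) \<kappa>"
  proof -
    have "continuous_on ({p\<in>I \<times> B. \<phi> (fst p) \<le> snd p} \<union> {p\<in>I \<times> B. snd p \<le> \<phi> (fst p)}) \<kappa>"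
      unfolding \<kappa>_def
    proof (rule continuous_on_cases_local)
      have "{p\<in>I \<times> B. \<phi> (fst p) \<le> snd p} = (I \<times> B) \<inter> (\<lambda>p. snd p - \<phi> (fst p)) -` {0..}"
        "{p\<in>I \<times> B. snd p \<le> \<phi> (fst p)} = (I \<times> B) \<inter> (\<lambda>p. snd p - \<phi> (fst p)) -` {..0}" by auto
      moreover have c: "continuous_on (I \<times> B) (\<lambda>p. snd p - \<phi> (fst p))" by (intro continuous_intros cs)
      moreover have "{p\<in>I \<times> B. \<phi> (fst p) \<le> snd p} \<union> {p\<in>I \<times> B. snd p \<le> \<phi> (fst p)} = I \<times> B" by auto
      ultimately show "closedin (top_of_set ({p\<in>I \<times> B. \<phi> (fst p) \<le> snd p} \<union> {p\<in>I \<times> B. snd p \<le> \<phi> (fst p)})) {p\<in>I \<times> B. \<phi> (fst p) \<le> snd p}"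
        "closedin (top_of_set ({p\<in>I \<times> B. \<phi> (fst p) \<le> snd p} \<union> {p\<in>I \<times> B. snd p \<le> \<phi> (fst p)})) {p\<in>I \<times> B. snd p \<le> \<phi> (fst p)}"
        using continuous_closedin_preimage[OF c closed_atLeast, of 0] continuous_closedin_preimage[OF c closed_atMost, of 0] by auto
      show "sqrt (X p) = - sqrt (X p)"
        if "p \<in> {p\<in>I \<times> B. \<phi> (fst p) \<le> snd p} \<and> \<not> \<phi> (fst p) \<le> snd p \<or> p \<in> {p\<in>I \<times> B. snd p \<le> \<phi> (fst p)} \<and> \<phi> (fst p) \<le> snd p" for p
      proof -
        have "snd p = \<phi> (fst p)" using that by auto
        then have "X p = 0" by (simp add: X_def)
        then show ?thesis by simp
      qed
    qed (intro continuous_intros continuous_on_subset[OF cX]; auto)+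
    moreover have "{p\<in>I \<times> B. \<phi> (fst p) \<le> snd p} \<union> {p\<in>I \<times> B. snd p \<le> \<phi> (fst p)} = I \<times> B" by auto
    ultimately show ?thesis by simp
  qed
  have \<kappa>2: "\<kappa> p ^ 2 = X p" if "p \<in> I \<times> B" for p using X0[OF that] by (simp add: \<kappa>_def)
  have inj: "inj_on (\<lambda>p. (fst p - u0, \<kappa> p)) (I \<times> B)"
  proof (rule inj_onI)
    fix p q assume p: "p \<in> I \<times> B" and q: "q \<in> I \<times> B" and e: "(fst p - u0, \<kappa> p) = (fst q - u0, \<kappa> q)"
    then have f: "fst p = fst q" and k: "\<kappa> p = \<kappa> q" by auto
    have ne: "X r > 0" if "r \<in> I \<times> B" "snd r \<noteq> \<phi> (fst r)" for r
    proof -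
      have "fst r \<in> I" "snd r \<in> B" "\<phi> (fst r) \<in> B" using that \<phi>(2) by auto
      then show ?thesis using up[of "fst r" "\<phi> (fst r)" "snd r"] down[of "fst r" "snd r" "\<phi> (fst r)"] that(2)
        unfolding X_def by (cases "snd r" "\<phi> (fst r)" rule: linorder_cases) (auto simp: algebra_simps)
    qed
    have XX: "X p = X q" using k \<kappa>2[OF p] \<kappa>2[OF q] by simp
    then have hh': "\<sigma> * h (fst p, snd p) = \<sigma> * h (fst p, snd q)" using f by (simp add: X_def algebra_simps)
    have side: "(\<phi> (fst p) \<le> snd p \<and> \<phi> (fst p) \<le> snd q) \<or> (snd p \<le> \<phi> (fst p) \<and> snd q \<le> \<phi> (fst p))"
    proof (rule ccontr)
      assume "\<not> ?thesis"
      then have "(\<phi> (fst p) < snd p \<and> snd q < \<phi> (fst q)) \<or> (snd p < \<phi> (fst p) \<and> \<phi> (fst q) < snd q)" using f by auto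
      then show False
      proof
        assume a: "\<phi> (fst p) < snd p \<and> snd q < \<phi> (fst q)"
        then have "\<kappa> p > 0" "\<kappa> q < 0" using ne[OF p] ne[OF q] by (auto simp: \<kappa>_def)
        with k show False by simp
      next
        assume a: "snd p < \<phi> (fst p) \<and> \<phi> (fst q) < snd q"
        then have "\<kappa> p < 0" "\<kappa> q > 0" using ne[OF p] ne[OF q] by (auto simp: \<kappa>_def)
        with k show False by simp
      qed
    qed
    have "snd p = snd q"
    proof (rule ccontr)
      assume "snd p \<noteq> snd q"
      then consider "snd p < snd q" | "snd q < snd p" by linarith
      then show False
        using side up[of "fst p" "snd p" "snd q"] up[of "fst p" "snd q" "snd p"] down[of "fst p" "snd p" "snd q"] down[of "fst p" "snd q" "snd p"] hh' p q
        by cases auto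
    qed
    with f show "p = q" by (simp add: prod_eq_iff)
  qed
  show ?thesis unfolding topological_chart_def
  proof (intro conjI exI ballI)
    show "open (I \<times> B)" by (intro open_Times I B)
    show "(u0, \<phi> u0) \<in> I \<times> B" using I \<phi> by auto
    show "continuous_on (I \<times> B) (\<lambda>p. (fst p - u0, \<kappa> p))" by (intro continuous_intros c\<kappa>)
    show "inj_on (\<lambda>p. (fst p - u0, \<kappa> p)) (I \<times> B)" by (rule inj)
    show "(fst (u0, \<phi> u0) - u0, \<kappa> (u0, \<phi> u0)) = (0, 0)" by (simp add: \<kappa>_def X_def)
    show "open (I \<times> (UNIV :: real set))" by (intro open_Times I open_UNIV)
    show "(\<lambda>p. (fst p, h p)) ` (I \<times> B) \<subseteq> I \<times> UNIV" by auto
    show "continuous_on (I \<times> UNIV) (\<lambda>q. (fst q - u0, \<sigma> * (snd q - h (fst q, \<phi> (fst q)))))"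
      by (intro continuous_intros continuous_on_compose2[OF h] continuous_on_compose2[OF \<phi>(1)]) (use \<phi>(2) in auto)
    show "inj_on (\<lambda>q. (fst q - u0, \<sigma> * (snd q - h (fst q, \<phi> (fst q))))) (I \<times> UNIV)"
      using \<sigma>0 by (auto simp: inj_on_def)
    show "(fst (fst p, h p) - u0, \<sigma> * (snd (fst p, h p) - h (fst (fst p, h p), \<phi> (fst (fst p, h p))))) = fold_form (fst p - u0, \<kappa> p)"
      if "p \<in> I \<times> B" for p
      using \<kappa>2[OF that] by (simp add: fold_form_def X_def)
  qed
qed

text \<open>\<open>z1\<close> and \<open>z2\<close> each have three branches, separated by corners
  \<open>l1\<close>, \<open>r1\<close> and \<open>l2\<close>, \<open>r2\<close> of equal heights;
  \<open>x\<close> and \<open>y\<close> are partners of \<open>s\<close> on matching branches. Doubt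
  arises only when \<open>s\<close> is a corner and belongs to two branches; then the equal heights
  force the partner to be the matching corner. Applied in one direction this gives uniqueness of the
  new vertical coordinate, in the other direction its injectivity.\<close>

lemma zigzag_unique:
  fixes z1 z2 :: "real \<Rightarrow> real"
  assumes j1: "\<And>x y. x \<in> T \<Longrightarrow> y \<in> T \<Longrightarrow> x \<le> l2 \<Longrightarrow> y \<le> l2 \<Longrightarrow> z2 x = z2 y \<Longrightarrow> x = y"
    and j2: "\<And>x y. x \<in> T \<Longrightarrow> y \<in> T \<Longrightarrow> l2 \<le> x \<Longrightarrow> x \<le> r2 \<Longrightarrow> l2 \<le> y \<Longrightarrow> y \<le> r2 \<Longrightarrow> z2 x = z2 y \<Longrightarrow> x = y"
    and j3: "\<And>x y. x \<in> T \<Longrightarrow> y \<in> T \<Longrightarrow> r2 \<le> x \<Longrightarrow> r2 \<le> y \<Longrightarrow> z2 x = z2 y \<Longrightarrow> x = y"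
    and T: "l2 \<in> T" "r2 \<in> T" "x \<in> T" "y \<in> T" and le: "l1 \<le> r1" "l2 \<le> r2"
    and z: "z1 l1 = z2 l2" "z1 r1 = z2 r2"
    and x: "(s \<le> l1 \<and> x \<le> l2) \<or> (l1 \<le> s \<and> s \<le> r1 \<and> l2 \<le> x \<and> x \<le> r2) \<or> (r1 \<le> s \<and> r2 \<le> x)" "z2 x = z1 s"
    and y: "(s \<le> l1 \<and> y \<le> l2) \<or> (l1 \<le> s \<and> s \<le> r1 \<and> l2 \<le> y \<and> y \<le> r2) \<or> (r1 \<le> s \<and> r2 \<le> y)" "z2 y = z1 s"
  shows "x = y"
proof -
  have L: "x = l2" if "s = l1" "x \<in> T" "x \<le> r2" "z2 x = z1 s" for x
  proof -
    have e: "z2 x = z2 l2" using that(1,4) z(1) by simp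
    show ?thesis
    proof (cases "x \<le> l2")
      case True
      show ?thesis by (rule j1[OF that(2) T(1) True order_refl e])
    next
      case False
      then show ?thesis by (intro j2[OF that(2) T(1) _ that(3) order_refl le(2) e]) simp
    qed
  qed
  have R: "x = r2" if "s = r1" "x \<in> T" "l2 \<le> x" "z2 x = z1 s" for x
  proof -
    have e: "z2 x = z2 r2" using that(1,4) z(2) by simp
    show ?thesis
    proof (cases "x \<le> r2")
      case True
      show ?thesis by (rule j2[OF that(2) T(2) that(3) True le(2) order_refl e])
    next
      case False
      then show ?thesis by (intro j3[OF that(2) T(2) _ order_refl e]) simp
    qed
  qed
  \<comment> \<open>If the middle branch of \<open>z1\<close> shrinks to a point, so does that of
    \<open>z2\<close>.\<close>
  have LR: "l2 = r2" if "l1 = r1"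
    by (rule j2[OF T(1,2) order_refl le(2) le(2) order_refl]) (use z that in simp)
  have e: "z2 x = z2 y" using x(2) y(2) by simp
  consider "s < l1" | "s > r1" | "s = l1" | "s = r1" | "l1 < s" "s < r1" by linarith
  then show ?thesis
  proof cases
    case 1
    then have "x \<le> l2" "y \<le> l2" using x(1) y(1) le by auto
    from j1[OF T(3,4) this e] show ?thesis .
  next
    case 2
    then have "r2 \<le> x" "r2 \<le> y" using x(1) y(1) le by auto
    from j3[OF T(3,4) this e] show ?thesis .
  next
    case 3
    have *: "v = l2" if "v \<in> T" "z2 v = z1 s" "v \<le> r2 \<or> (s = r1 \<and> r2 \<le> v)" for v
      using L[OF 3 that(1) _ that(2)] R[OF _ that(1) _ that(2)] LR 3 le that(3) by (metis order_trans)
    show ?thesis using *[OF T(3) x(2)] *[OF T(4) y(2)] x(1) y(1) le 3 by (smt (verit))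
  next
    case 4
    have *: "v = r2" if "v \<in> T" "z2 v = z1 s" "l2 \<le> v \<or> (s = l1 \<and> v \<le> l2)" for v
      using R[OF 4 that(1) _ that(2)] L[OF _ that(1) _ that(2)] LR 4 le that(3) by (metis order_trans)
    show ?thesis using *[OF T(3) x(2)] *[OF T(4) y(2)] x(1) y(1) le 4 by (smt (verit))
  next
    case 5
    then have "l2 \<le> x" "x \<le> r2" "l2 \<le> y" "y \<le> r2" using x(1) y(1) by auto
    from j2[OF T(3,4) this e] show ?thesis .
  qed
qed

text \<open>Because \<open>m * q = 0\<close>, the linear coefficient is either
  \<open>- 3 * q\<^sup>2\<close>, with critical points \<open>- q\<close> and \<open>q\<close>, or
  the nonnegative \<open>m\<close>, with \<open>q = 0\<close> and a strictly increasing cubic. One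
  parametrization thus covers both sides of the cusp. The identity \<open>id\<close> writes the
  difference quotient as a sum whose signs are visible.\<close>

lemma cubic_monotone:
  fixes q m x y :: real
  assumes "q \<ge> 0" "m \<ge> 0" "m * q = 0" "x < y"
  shows "y \<le> - q \<or> q \<le> x \<Longrightarrow> (m - 3 * q\<^sup>2) * x + x ^ 3 < (m - 3 * q\<^sup>2) * y + y ^ 3"
    and "- q \<le> x \<and> y \<le> q \<Longrightarrow> (m - 3 * q\<^sup>2) * y + y ^ 3 < (m - 3 * q\<^sup>2) * x + x ^ 3"
proof -
  have id: "((m - 3 * q\<^sup>2) * y + y ^ 3) - ((m - 3 * q\<^sup>2) * x + x ^ 3) = (y - x) * (m + (x\<^sup>2 - q\<^sup>2) + (x * y - q\<^sup>2) + (y\<^sup>2 - q\<^sup>2))"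
    by (simp add: algebra_simps power2_eq_square power3_eq_cube)
  show "(m - 3 * q\<^sup>2) * x + x ^ 3 < (m - 3 * q\<^sup>2) * y + y ^ 3" if "y \<le> - q \<or> q \<le> x"
  proof -
    have "q * q \<le> x * x \<and> q * q \<le> x * y \<and> q * q \<le> y * y \<and> (q * q < x * x \<or> q * q < y * y)"
    proof (cases "q \<le> x")
      case True
      then have "q * q \<le> x * x" "q * q \<le> x * y" "q * q < y * y"
        using assms by (auto intro!: mult_mono mult_strict_mono')
      moreover have "q * q \<le> y * y" using calculation by simp
      ultimately show ?thesis by simp
    next
      case False
      then have y: "q \<le> - y" using that by auto
      have "q * q \<le> (- x) * (- x)" by (rule mult_mono) (use y assms in linarith)+
      moreover have "q * q \<le> (- x) * (- y)" by (rule mult_mono) (use y assms in linarith)+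
      moreover have "q * q \<le> (- y) * (- y)" by (rule mult_mono) (use y assms in linarith)+
      moreover have "q * q < (- x) * (- x)" by (rule mult_strict_mono') (use y assms in linarith)+
      ultimately show ?thesis by simp
    qed
    then have "0 < m + (x\<^sup>2 - q\<^sup>2) + (x * y - q\<^sup>2) + (y\<^sup>2 - q\<^sup>2)" using assms(2) unfolding power2_eq_square by (elim conjE disjE; linarith)
    then have "0 < (y - x) * (m + (x\<^sup>2 - q\<^sup>2) + (x * y - q\<^sup>2) + (y\<^sup>2 - q\<^sup>2))" using assms by simp
    then show ?thesis using id by linarith
  qed
  show "(m - 3 * q\<^sup>2) * y + y ^ 3 < (m - 3 * q\<^sup>2) * x + x ^ 3" if a: "- q \<le> x \<and> y \<le> q"
  proof -
    have "q > 0" using a assms by linarith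
    then have m: "m = 0" using assms by simp
    have "x\<^sup>2 \<le> q\<^sup>2" "y\<^sup>2 \<le> q\<^sup>2" using a assms by (auto intro!: power2_le_iff_abs_le[THEN iffD2])
    moreover have "x * y < q\<^sup>2"
    proof -
      have "0 < (y - x)\<^sup>2" using assms by simp
      then have "2 * (x * y) < x\<^sup>2 + y\<^sup>2" by (simp add: power2_diff algebra_simps)
      then show ?thesis using calculation by linarith
    qed
    ultimately have "m + (x\<^sup>2 - q\<^sup>2) + (x * y - q\<^sup>2) + (y\<^sup>2 - q\<^sup>2) < 0" using m by linarith
    then have "(y - x) * (m + (x\<^sup>2 - q\<^sup>2) + (x * y - q\<^sup>2) + (y\<^sup>2 - q\<^sup>2)) < 0" using assms by (simp add: mult_pos_neg)
    then show ?thesis using id by linarith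
  qed
qed

lemma continuous_on_inv_into_compose:
  fixes \<psi> :: "real \<Rightarrow> real"
  assumes "continuous_on K \<psi>" "compact K" "inj_on \<psi> K" "continuous_on I f" "f ` I \<subseteq> \<psi> ` K"
  shows "continuous_on I (\<lambda>u. inv_into K \<psi> (f u))"
proof (rule continuous_on_compose2[OF _ assms(4,5)])
  show "continuous_on (\<psi> ` K) (inv_into K \<psi>)"
    by (rule continuous_on_inv[OF assms(1,2)]) (use assms(3) in simp)
qed

text \<open>On each vertical line both \<open>h\<close> and the cusp are increasing, decreasing, increasing. The new
  horizontal coordinate \<open>\<xi>\<close> is chosen so that the two gaps between the critical values agree;
  then matching the three branches defines the new vertical coordinate, whose graph is closed.\<close>

lemma cusp_chart:
  fixes h M :: "real \<times> real \<Rightarrow> real"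
  assumes I: "open I" "0 \<in> I" and B: "open B" "convex B" "0 \<in> B" and h: "continuous_on (I \<times> B) h"
    and d: "\<And>u s. u \<in> I \<Longrightarrow> s \<in> B \<Longrightarrow> ((\<lambda>s. h (u, s)) has_real_derivative M (u, s)) (at s)"
    and \<psi>: "continuous_on B \<psi>" "\<psi> 0 = 0"
      "\<And>s s'. s \<in> B \<Longrightarrow> s' \<in> B \<Longrightarrow> s < s' \<Longrightarrow> s' \<le> 0 \<Longrightarrow> \<psi> s < \<psi> s'"
      "\<And>s s'. s \<in> B \<Longrightarrow> s' \<in> B \<Longrightarrow> 0 \<le> s \<Longrightarrow> s < s' \<Longrightarrow> \<psi> s' < \<psi> s"
    and sg: "\<And>u s. u \<in> I \<Longrightarrow> s \<in> B \<Longrightarrow> \<psi> s < u \<Longrightarrow> M (u, s) > 0"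
      "\<And>u s. u \<in> I \<Longrightarrow> s \<in> B \<Longrightarrow> u < \<psi> s \<Longrightarrow> M (u, s) < 0"
    and mono: "\<And>u u' s. u \<in> I \<Longrightarrow> u' \<in> I \<Longrightarrow> s \<in> B \<Longrightarrow> u < u' \<Longrightarrow> M (u, s) < M (u', s)"
  shows "\<exists>S\<subseteq>I \<times> B. topological_chart S (\<lambda>p. (fst p, h p)) (0, 0) cusp_form"
proof -
  obtain \<beta> where \<beta>: "\<beta> > 0" "cball 0 \<beta> \<subseteq> B" using B open_contains_cball by blast
  then have \<beta>B: "s \<in> B" if "- \<beta> \<le> s" "s \<le> \<beta>" for s using that by (auto simp: subset_iff dist_norm)
  \<comment> \<open>For \<open>\<bar>u\<bar> < \<alpha>\<close> the value \<open>min u 0\<close> is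
    taken by \<psi> on both sides of \<open>0\<close> within distance
    \<open>\<beta>\<close>.\<close>
  define \<alpha> where "\<alpha> = min (- \<psi> \<beta>) (- \<psi> (- \<beta>))"
  have \<alpha>: "\<alpha> > 0" using \<psi>(2) \<psi>(3)[of "- \<beta>" 0] \<psi>(4)[of 0 \<beta>] \<beta> \<beta>B B(3) by (auto simp: \<alpha>_def)
  define I' where "I' = {u\<in>I. - \<alpha> < u \<and> u < \<alpha>}"
  have I': "open I'" "0 \<in> I'" "I' \<subseteq> I"
  proof -
    have "I' = I \<inter> {- \<alpha><..<\<alpha>}" by (auto simp: I'_def)
    then show "open I'" using I by auto
  qed (use I \<alpha> in \<open>auto simp: I'_def\<close>)
  \<comment> \<open>For \<open>u < 0\<close> the two solutions of \<open>\<psi> s = u\<close>, at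
    which \<open>h (u, \<cdot>)\<close> turns from increasing to decreasing and back; for
    \<open>u \<ge> 0\<close> the truncation by \<open>min\<close> lets both merge at
    \<open>0\<close>.\<close>
  define sp where "sp u = inv_into {0..\<beta>} \<psi> (min u 0)" for u
  define sm where "sm u = inv_into {- \<beta>..0} \<psi> (min u 0)" for u
  have inp: "inj_on \<psi> {0..\<beta>}"
  proof (rule inj_onI)
    fix s s' assume "s \<in> {0..\<beta>}" "s' \<in> {0..\<beta>}" "\<psi> s = \<psi> s'"
    then show "s = s'" using \<psi>(4)[of s s'] \<psi>(4)[of s' s] \<beta>B \<beta> by (cases s s' rule: linorder_cases) auto
  qed
  have inm: "inj_on \<psi> {- \<beta>..0}"
  proof (rule inj_onI)
    fix s s' assume "s \<in> {- \<beta>..0}" "s' \<in> {- \<beta>..0}" "\<psi> s = \<psi> s'"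
    then show "s = s'" using \<psi>(3)[of s s'] \<psi>(3)[of s' s] \<beta>B \<beta> by (cases s s' rule: linorder_cases) auto
  qed
  have cp: "continuous_on {0..\<beta>} \<psi>" and cm: "continuous_on {- \<beta>..0} \<psi>"
    using \<beta>B \<beta> by (auto intro!: continuous_on_subset[OF \<psi>(1)])
  have rp: "min u 0 \<in> \<psi> ` {0..\<beta>}" and rm: "min u 0 \<in> \<psi> ` {- \<beta>..0}" if "u \<in> I'" for u
  proof -
    have "\<psi> \<beta> \<le> min u 0" "min u 0 \<le> \<psi> 0" "\<psi> (- \<beta>) \<le> min u 0"
      using that \<psi>(2) \<alpha> by (auto simp: I'_def \<alpha>_def min_def split: if_splits)
    then obtain x x' where "0 \<le> x" "x \<le> \<beta>" "\<psi> x = min u 0" "- \<beta> \<le> x'" "x' \<le> 0" "\<psi> x' = min u 0"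
      using IVT2'[of \<psi> \<beta> "min u 0" 0, OF _ _ _ cp] IVT'[of \<psi> "- \<beta>" "min u 0" 0, OF _ _ _ cm] \<psi>(2) \<beta>(1) by auto
    then show "min u 0 \<in> \<psi> ` {0..\<beta>}" "min u 0 \<in> \<psi> ` {- \<beta>..0}"
      by (metis atLeastAtMost_iff image_eqI)+
  qed
  have sp: "0 \<le> sp u" "sp u \<le> \<beta>" "\<psi> (sp u) = min u 0" "sp u \<in> B" if "u \<in> I'" for u
    using inv_into_into[OF rp[OF that]] f_inv_into_f[OF rp[OF that]] \<beta>B \<beta> by (auto simp: sp_def)
  have sm: "- \<beta> \<le> sm u" "sm u \<le> 0" "\<psi> (sm u) = min u 0" "sm u \<in> B" if "u \<in> I'" for u
    using inv_into_into[OF rm[OF that]] f_inv_into_f[OF rm[OF that]] \<beta>B \<beta> by (auto simp: sm_def)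
  have csp: "continuous_on I' sp" unfolding sp_def
    by (rule continuous_on_inv_into_compose[OF cp compact_Icc inp continuous_on_min[OF continuous_on_id continuous_on_const] image_subsetI]) (rule rp)
  have csm: "continuous_on I' sm" unfolding sm_def
    by (rule continuous_on_inv_into_compose[OF cm compact_Icc inm continuous_on_min[OF continuous_on_id continuous_on_const] image_subsetI]) (rule rm)
  have pos0: "sp u = 0 \<and> sm u = 0" if "u \<in> I'" "u \<ge> 0" for u
  proof -
    have "\<psi> (sp u) = \<psi> 0" "\<psi> (sm u) = \<psi> 0" using sp(3)[OF that(1)] sm(3)[OF that(1)] that(2) \<psi>(2) by auto
    then show ?thesis
      using inj_onD[OF inp, of "sp u" 0] inj_onD[OF inm, of "sm u" 0] sp(1,2)[OF that(1)] sm(1,2)[OF that(1)] \<beta>(1) by simp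
  qed

  \<comment> \<open>The monotone branches of \<open>h\<close> on a vertical line\<close>
  have between: "x \<in> B" if "s \<in> B" "s' \<in> B" "s < x" "x < s'" for s s' x
    using closed_segment_subset[OF that(1,2) B(2)] that(3,4) by (auto simp: closed_segment_eq_real_ivl)
  have Z1: "h (u, s) < h (u, s')" if u: "u \<in> I'" and s: "s \<in> B" "s' \<in> B" "s < s'" "s' \<le> sm u" for u s s'
  proof (rule strict_mono_of_deriv[OF B(2) s(1-3), where f' = "\<lambda>s. M (u, s)"])
    fix x assume x: "s < x" "x < s'"
    have "\<psi> x < \<psi> (sm u)" by (rule \<psi>(3)[OF between[OF s(1,2) x]]) (use x s sm[OF u] in auto)
    then show "0 < M (u, x)" using sg(1)[of u x] between[OF s(1,2) x] u sm(3)[OF u] I' by auto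
  qed (use d u I' in auto)
  have Z3: "h (u, s) < h (u, s')" if u: "u \<in> I'" and s: "s \<in> B" "s' \<in> B" "s < s'" "sp u \<le> s" for u s s'
  proof (rule strict_mono_of_deriv[OF B(2) s(1-3), where f' = "\<lambda>s. M (u, s)"])
    fix x assume x: "s < x" "x < s'"
    have "\<psi> x < \<psi> (sp u)" by (rule \<psi>(4)[OF _ between[OF s(1,2) x]]) (use x s sp[OF u] in auto)
    then show "0 < M (u, x)" using sg(1)[of u x] between[OF s(1,2) x] u sp(3)[OF u] I' by auto
  qed (use d u I' in auto)
  have Z2: "h (u, s') < h (u, s)" if u: "u \<in> I'" and s: "s \<in> B" "s' \<in> B" "s < s'" "sm u \<le> s" "s' \<le> sp u" for u s s'
  proof -
    have "- h (u, s) < - h (u, s')"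
    proof (rule strict_mono_of_deriv[OF B(2) s(1-3), where f' = "\<lambda>s. - M (u, s)"])
      fix x assume x: "s < x" "x < s'"
      have "u < 0" using pos0[OF u] s by force
      then have m: "min u 0 = u" by simp
      have xB: "x \<in> B" by (rule between[OF s(1,2) x])
      have "u < \<psi> x"
      proof (cases "x \<le> 0")
        case True
        then show ?thesis using \<psi>(3)[OF sm(4)[OF u] xB] x s sm(3)[OF u] m by simp
      next
        case False
        then show ?thesis using \<psi>(4)[OF xB sp(4)[OF u]] x s sp(3)[OF u] m by simp
      qed
      then show "0 < - M (u, x)" using sg(2)[of u x] xB u I' by auto
    qed (use d u I' in \<open>auto intro!: DERIV_minus\<close>)
    then show ?thesis by simp
  qed
  define gap where "gap u = h (u, sm u) - h (u, sp u)" for u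
  have gap0: "gap u = 0" if "u \<in> I'" "u \<ge> 0" for u using pos0[OF that] by (simp add: gap_def)
  have le: "sm u \<le> sp u" if "u \<in> I'" for u using sm[OF that] sp[OF that] by linarith
  have gap_nonneg: "gap u \<ge> 0" if "u \<in> I'" for u
    using Z2[OF that sm(4)[OF that] sp(4)[OF that]] le[OF that] by (cases "sm u = sp u") (auto simp: gap_def)
  \<comment> \<open>As \<open>u\<close> grows, the interval between the turning points shrinks,
    which lowers the fall of \<open>h (u, \<cdot>)\<close> over it; on the smaller interval the fall
    decreases further because \<open>M\<close> increases in \<open>u\<close>. The strict inequality
    makes \<open>\<xi>\<close> injective for negative \<open>u\<close>.\<close>
  have gap_less: "gap u' < gap u" if u: "u \<in> I'" "u' \<in> I'" "u < u'" "u' \<le> 0" for u u'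
  proof -
    have "sm u < sm u'"
    proof (rule ccontr)
      assume "\<not> ?thesis"
      then have "\<psi> (sm u') \<le> \<psi> (sm u)"
        using \<psi>(3)[OF sm(4)[OF u(2)] sm(4)[OF u(1)]] sm(2)[OF u(1)] by (cases "sm u' = sm u") auto
      then show False using sm(3)[OF u(1)] sm(3)[OF u(2)] u by simp
    qed
    have "sp u' < sp u"
    proof (rule ccontr)
      assume "\<not> ?thesis"
      then have "\<psi> (sp u') \<le> \<psi> (sp u)"
        using \<psi>(4)[OF sp(4)[OF u(1)] sp(4)[OF u(2)]] sp(1)[OF u(1)] by (cases "sp u' = sp u") auto
      then show False using sp(3)[OF u(1)] sp(3)[OF u(2)] u by simp
    qed
    have 1: "h (u, sm u') < h (u, sm u)"
      by (rule Z2[OF u(1) sm(4)[OF u(1)] sm(4)[OF u(2)] \<open>sm u < sm u'\<close>]) (use sm(2)[OF u(2)] sp(1)[OF u(1)] in auto)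
    have 2: "h (u, sp u) < h (u, sp u')"
      by (rule Z2[OF u(1) sp(4)[OF u(2)] sp(4)[OF u(1)] \<open>sp u' < sp u\<close>]) (use sm(2)[OF u(1)] sp(1)[OF u(2)] in auto)
    have 3: "h (u', sm u') - h (u, sm u') \<le> h (u', sp u') - h (u, sp u')"
    proof (cases "sm u' = sp u'")
      case False
      then have l: "sm u' < sp u'" using le[OF u(2)] by simp
      have "(\<lambda>s. h (u', s) - h (u, s)) (sm u') < (\<lambda>s. h (u', s) - h (u, s)) (sp u')"
      proof (rule strict_mono_of_deriv[OF B(2) sm(4)[OF u(2)] sp(4)[OF u(2)] l, where f' = "\<lambda>s. M (u', s) - M (u, s)"])
        show "0 < M (u', x) - M (u, x)" if "sm u' < x" "x < sp u'" for x
          using mono[of u u' x] between[OF sm(4)[OF u(2)] sp(4)[OF u(2)] that] u I' by auto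
      qed (use d u I' in \<open>auto intro!: DERIV_diff\<close>)
      then show ?thesis by simp
    qed simp
    show ?thesis using 1 2 3 by (simp add: gap_def)
  qed
  \<comment> \<open>With horizontal coordinate \<open>- 3 * q\<^sup>2\<close> the cusp has critical
    points \<open>- q\<close>, \<open>q\<close> and critical values \<open>2 * q ^ 3\<close>,
    \<open>- 2 * q ^ 3\<close>. Their gap is \<open>4 * q ^ 3\<close>, whence the cube root of a
    quarter. Since these values are opposite, \<open>mid\<close> is subtracted to centre those of
    \<open>h\<close>. For \<open>u \<ge> 0\<close> the gap is \<open>0\<close> and
    \<open>\<xi> u = u\<close>.\<close>
  define q where "q u = root 3 (gap u / 4)" for u
  define \<xi> where "\<xi> u = max 0 u - 3 * (q u)\<^sup>2" for u
  define mid where "mid u = (h (u, sm u) + h (u, sp u)) / 2" for u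
  define w where "w p = h p - mid (fst p)" for p
  define c where "c x y = x * y + y ^ 3" for x y :: real
  have q: "q u \<ge> 0" "q u ^ 3 = gap u / 4" "max 0 u * q u = 0" if "u \<in> I'" for u
    using gap_nonneg[OF that] gap0[OF that] by (auto simp: q_def max_def)
  have C: "y \<le> - q u \<or> q u \<le> x \<Longrightarrow> c (\<xi> u) x < c (\<xi> u) y" "- q u \<le> x \<and> y \<le> q u \<Longrightarrow> c (\<xi> u) y < c (\<xi> u) x"
    if "u \<in> I'" "x < y" for u x y
    using cubic_monotone[OF q(1)[OF that(1)] _ q(3)[OF that(1)] that(2)] by (auto simp: c_def \<xi>_def)
  have Cw: "c (\<xi> u) (- q u) = w (u, sm u)" "c (\<xi> u) (q u) = w (u, sp u)" if u: "u \<in> I'" for u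
  proof -
    have "c (\<xi> u) (q u) = max 0 u * q u - 2 * q u ^ 3" by (simp add: c_def \<xi>_def algebra_simps power2_eq_square power3_eq_cube)
    then have 1: "c (\<xi> u) (q u) = - gap u / 2" using q[OF u] by simp
    have "c (\<xi> u) (- q u) = - c (\<xi> u) (q u)" by (simp add: c_def)
    then show "c (\<xi> u) (- q u) = w (u, sm u)" "c (\<xi> u) (q u) = w (u, sp u)"
      using 1 by (simp_all add: w_def mid_def gap_def field_simps)
  qed
  have \<xi>_less: "\<xi> u < \<xi> u'" if u: "u \<in> I'" "u' \<in> I'" "u < u'" for u u'
  proof (cases "u' \<le> 0")
    case True
    then have "q u' < q u" using gap_less[OF u True] by (simp add: q_def)
    then have "(q u')\<^sup>2 < (q u)\<^sup>2" using q(1)[OF u(2)] by (intro power_strict_mono) auto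
    then show ?thesis using True u by (simp add: \<xi>_def)
  next
    case False
    then have "q u' = 0" using gap0[OF u(2)] by (simp add: q_def)
    then have "\<xi> u' = u'" using False by (simp add: \<xi>_def)
    moreover have "\<xi> u \<le> max 0 u" by (simp add: \<xi>_def)
    ultimately show ?thesis using False u by auto
  qed
  define B0 where "B0 = {- \<beta><..<\<beta>}"
  have B0: "open B0" "0 \<in> B0" "B0 \<subseteq> B" using \<beta> \<beta>B by (auto simp: B0_def)
  have hI: "continuous_on (I' \<times> B) h" by (rule continuous_on_subset[OF h]) (use I' in auto)
  have chs: "continuous_on I' (\<lambda>u. h (u, sm u))" "continuous_on I' (\<lambda>u. h (u, sp u))"
    by (intro continuous_on_compose2[OF hI] continuous_intros csm csp; use sm sp in auto)+
  have cq: "continuous_on I' q" unfolding q_def gap_def by (intro continuous_intros chs) simp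
  have c\<xi>: "continuous_on I' \<xi>" unfolding \<xi>_def by (intro continuous_intros cq)
  have cmid: "continuous_on I' mid" unfolding mid_def by (intro continuous_intros chs) simp
  have cfst: "continuous_on (I' \<times> T) (\<lambda>p. f (fst p))" if "continuous_on I' f" for f :: "real \<Rightarrow> real" and T :: "real set"
    by (rule continuous_on_compose2[OF that]) (auto intro!: continuous_intros)
  have cw: "continuous_on (I' \<times> B0) w"
    unfolding w_def by (intro continuous_intros cfst[OF cmid] continuous_on_subset[OF hI]) (use B0 in auto)
  \<comment> \<open>The bounds by \<open>1\<close> give \<open>q < 1\<close>, and they place
    \<open>w p\<close> between the values of the cusp at \<open>-2\<close> and \<open>2\<close>,
    which are below \<open>-6\<close> and above \<open>6\<close>; so the new coordinate is found in
    the compact interval \<open>{-2..2}\<close>.\<close>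
  define S where "S = (I' \<times> B0) \<inter> (\<lambda>p. (\<xi> (fst p), w p)) -` ({-1<..<1} \<times> {-1<..<1})"
  have oS: "open S" unfolding S_def
    by (rule continuous_open_preimage[OF continuous_on_Pair[OF cfst[OF c\<xi>] cw] open_Times[OF I'(1) B0(1)]])
      (intro open_Times open_greaterThanLessThan)
  have S: "fst p \<in> I'" "snd p \<in> B0" "snd p \<in> B" "\<bar>\<xi> (fst p)\<bar> < 1" "\<bar>w p\<bar> < 1" if "p \<in> S" for p
    using that B0 by (auto simp: S_def)
  have z0: "\<xi> 0 = 0" "w (0, 0) = 0"
    using gap0[OF I'(2)] pos0[OF I'(2)] by (simp_all add: \<xi>_def q_def w_def mid_def)
  have S0: "(0, 0) \<in> S" using I' B0 z0 by (simp add: S_def)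
  \<comment> \<open>Equal heights on matching branches. The inequalities are weak, so that the
    relation is closed; the overlaps at the corners are resolved by
    \<open>zigzag_unique\<close>.\<close>
  define P where "P p \<theta> \<longleftrightarrow> c (\<xi> (fst p)) \<theta> = w p \<and> ((snd p \<le> sm (fst p) \<and> \<theta> \<le> - q (fst p)) \<or>
      (sm (fst p) \<le> snd p \<and> snd p \<le> sp (fst p) \<and> - q (fst p) \<le> \<theta> \<and> \<theta> \<le> q (fst p)) \<or> (sp (fst p) \<le> snd p \<and> q (fst p) \<le> \<theta>))" for p \<theta>
  have q1: "q (fst p) < 1" if "p \<in> S" for p
  proof -
    have "3 * (q (fst p))\<^sup>2 < 1 \<or> q (fst p) = 0"
      using S(4)[OF that] gap0[OF S(1)[OF that]] by (auto simp: \<xi>_def q_def max_def split: if_splits)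
    then have "(q (fst p))\<^sup>2 < 1\<^sup>2" by auto
    then show ?thesis using power2_less_imp_less by fastforce
  qed
  have ex: "\<exists>\<theta>. \<theta> \<in> {-2..2} \<and> P p \<theta>" if p: "p \<in> S" for p
  proof -
    obtain u s where us: "p = (u, s)" by fastforce
    have u: "u \<in> I'" "s \<in> B" "\<bar>\<xi> u\<bar> < 1" "\<bar>w (u, s)\<bar> < 1" "q u < 1" using S[OF p] q1[OF p] by (auto simp: us)
    have cc: "continuous_on T (c (\<xi> u))" for T unfolding c_def by (intro continuous_intros)
    have ends: "c (\<xi> u) (-2) \<le> w (u, s)" "w (u, s) \<le> c (\<xi> u) 2" using u by (auto simp: c_def)
    have wle: "w (u, s) \<le> w (u, s') \<longleftrightarrow> h (u, s) \<le> h (u, s')" "w (u, s') \<le> w (u, s) \<longleftrightarrow> h (u, s') \<le> h (u, s)" for s' by (auto simp: w_def)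
    consider "s \<le> sm u" | "sm u \<le> s" "s \<le> sp u" | "sp u \<le> s" by linarith
    then show ?thesis
    proof cases
      case 1
      have "w (u, s) \<le> c (\<xi> u) (- q u)"
        unfolding Cw(1)[OF u(1)] wle using Z1[OF u(1,2) sm(4)[OF u(1)]] 1 by (cases "s = sm u") auto
      from IVT'[OF ends(1) this _ cc] u(5) obtain \<theta> where "- 2 \<le> \<theta>" "\<theta> \<le> - q u" "c (\<xi> u) \<theta> = w (u, s)" by auto
      then show ?thesis using q(1)[OF u(1)] 1 by (intro exI[of _ \<theta>]) (simp add: P_def us)
    next
      case 2
      have "w (u, s) \<le> c (\<xi> u) (- q u)"
        unfolding Cw(1)[OF u(1)] wle using Z2[OF u(1) sm(4)[OF u(1)] u(2)] 2 by (cases "s = sm u") auto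
      moreover have "c (\<xi> u) (q u) \<le> w (u, s)"
        unfolding Cw(2)[OF u(1)] wle using Z2[OF u(1,2) sp(4)[OF u(1)]] 2 by (cases "s = sp u") auto
      ultimately obtain \<theta> where "- q u \<le> \<theta>" "\<theta> \<le> q u" "c (\<xi> u) \<theta> = w (u, s)"
        using IVT2'[of "c (\<xi> u)" "q u" "w (u, s)" "- q u", OF _ _ _ cc] q(1)[OF u(1)] by auto
      then show ?thesis using u(5) 2 by (intro exI[of _ \<theta>]) (simp add: P_def us)
    next
      case 3
      have "c (\<xi> u) (q u) \<le> w (u, s)"
        unfolding Cw(2)[OF u(1)] wle using Z3[OF u(1) sp(4)[OF u(1)] u(2)] 3 by (cases "s = sp u") auto
      from IVT'[OF this ends(2) _ cc] u(5) obtain \<theta> where "q u \<le> \<theta>" "\<theta> \<le> 2" "c (\<xi> u) \<theta> = w (u, s)" by auto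
      then show ?thesis using q(1)[OF u(1)] 3 by (intro exI[of _ \<theta>]) (simp add: P_def us)
    qed
  qed
  have injc: "x = y" if "u \<in> I'" "c (\<xi> u) x = c (\<xi> u) y" "(x \<le> - q u \<and> y \<le> - q u) \<or> (- q u \<le> x \<and> x \<le> q u \<and> - q u \<le> y \<and> y \<le> q u) \<or> (q u \<le> x \<and> q u \<le> y)" for u x y
    using C[OF that(1), of x y] C[OF that(1), of y x] that(2,3) by (cases x y rule: linorder_cases) auto
  have injh: "x = y" if "u \<in> I'" "x \<in> B" "y \<in> B" "w (u, x) = w (u, y)" "(x \<le> sm u \<and> y \<le> sm u) \<or> (sm u \<le> x \<and> x \<le> sp u \<and> sm u \<le> y \<and> y \<le> sp u) \<or> (sp u \<le> x \<and> sp u \<le> y)" for u x y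
    using Z1[OF that(1), of x y] Z1[OF that(1), of y x] Z2[OF that(1), of x y] Z2[OF that(1), of y x] Z3[OF that(1), of x y] Z3[OF that(1), of y x] that(2-5)
    by (cases x y rule: linorder_cases) (auto simp: w_def)
  have uniq: "\<theta> = \<theta>'" if p: "p \<in> S" "P p \<theta>" "P p \<theta>'" for p \<theta> \<theta>'
  proof -
    note u = S(1)[OF p(1)]
    show ?thesis
      by (rule zigzag_unique[where T = UNIV and ?z1.0 = "\<lambda>s. w (fst p, s)" and ?z2.0 = "c (\<xi> (fst p))" and s = "snd p" and ?l1.0 = "sm (fst p)" and ?r1.0 = "sp (fst p)" and ?l2.0 = "- q (fst p)" and ?r2.0 = "q (fst p)"])
         (use injc[OF u] Cw[OF u] le[OF u] q(1)[OF u] p(2,3) in \<open>auto simp: P_def\<close>)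
  qed
  have uniq': "s = s'" if p: "(u, s) \<in> S" "(u, s') \<in> S" "P (u, s) \<theta>" "P (u, s') \<theta>" for u s s' \<theta>
  proof -
    have u: "u \<in> I'" "s \<in> B" "s' \<in> B" using S[OF p(1)] S[OF p(2)] by auto
    show ?thesis
      by (rule zigzag_unique[where T = B and ?z2.0 = "\<lambda>s. w (u, s)" and ?z1.0 = "c (\<xi> u)" and s = \<theta> and ?l2.0 = "sm u" and ?r2.0 = "sp u" and ?l1.0 = "- q u" and ?r1.0 = "q u"])
         (use injh[OF u(1)] Cw[OF u(1)] le[OF u(1)] q(1)[OF u(1)] sm(4)[OF u(1)] sp(4)[OF u(1)] u p(3,4) in \<open>auto simp: P_def\<close>)
  qed
  define \<theta> where "\<theta> p = (SOME y. y \<in> {-2..2} \<and> P p y)" for p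
  have \<theta>: "\<theta> p \<in> {-2..2}" "P p (\<theta> p)" if "p \<in> S" for p
    using someI_ex[OF ex[OF that]] by (auto simp: \<theta>_def)
  \<comment> \<open>Continuity from the closed graph: the values lie in a compact interval.\<close>
  have c\<theta>: "continuous_on S \<theta>"
  proof -
    let ?M = "S \<times> {-2..2::real}"
    have graph: "(\<lambda>p. (p, \<theta> p)) ` S = {r\<in>?M. P (fst r) (snd r)}"
    proof (intro equalityI subsetI)
      fix r assume "r \<in> {r\<in>?M. P (fst r) (snd r)}"
      then have "fst r \<in> S" "P (fst r) (snd r)" by auto
      then have "snd r = \<theta> (fst r)" using uniq \<theta> by blast
      then show "r \<in> (\<lambda>p. (p, \<theta> p)) ` S" using \<open>fst r \<in> S\<close> by (intro image_eqI[of _ _ "fst r"]) (auto simp: prod_eq_iff)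
    qed (use \<theta> in auto)
    have cle: "closedin (top_of_set ?M) {r\<in>?M. a r \<le> b r}" if "continuous_on ?M a" "continuous_on ?M b" for a b :: "(real \<times> real) \<times> real \<Rightarrow> real"
    proof -
      have "{r\<in>?M. a r \<le> b r} = ?M \<inter> (\<lambda>r. b r - a r) -` {0..}" by auto
      then show ?thesis using continuous_closedin_preimage[OF continuous_on_diff[OF that(2,1)] closed_atLeast] by simp
    qed
    have cS: "continuous_on ?M (\<lambda>r. f (fst r))" if "continuous_on S f" for f :: "real \<times> real \<Rightarrow> real"
      by (rule continuous_on_compose2[OF that]) (auto intro!: continuous_intros)
    have cSf: "continuous_on S (\<lambda>p. f (fst p))" if "continuous_on I' f" for f :: "real \<Rightarrow> real"
      by (rule continuous_on_subset[OF cfst[OF that, of B0]]) (auto simp: S_def)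
    have cwS: "continuous_on S w" by (rule continuous_on_subset[OF cw]) (auto simp: S_def)
    note cont = cS[OF cSf[OF csm]] cS[OF cSf[OF csp]] cS[OF cSf[OF cq]] cS[OF cwS] cS[OF cSf[OF c\<xi>]]
      cS[OF continuous_on_snd[OF continuous_on_id]] continuous_on_snd[OF continuous_on_id]
      continuous_on_minus[OF cS[OF cSf[OF cq]]]
    have cc: "continuous_on ?M (\<lambda>r. c (\<xi> (fst (fst r))) (snd r))"
      unfolding c_def by (intro continuous_intros cont)
    have "{r\<in>?M. P (fst r) (snd r)} =
       ({r\<in>?M. c (\<xi> (fst (fst r))) (snd r) \<le> w (fst r)} \<inter> {r\<in>?M. w (fst r) \<le> c (\<xi> (fst (fst r))) (snd r)}) \<inter>
       (({r\<in>?M. snd (fst r) \<le> sm (fst (fst r))} \<inter> {r\<in>?M. snd r \<le> - q (fst (fst r))}) \<union>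
       (({r\<in>?M. sm (fst (fst r)) \<le> snd (fst r)} \<inter> {r\<in>?M. snd (fst r) \<le> sp (fst (fst r))}) \<inter> ({r\<in>?M. - q (fst (fst r)) \<le> snd r} \<inter> {r\<in>?M. snd r \<le> q (fst (fst r))})) \<union>
       ({r\<in>?M. sp (fst (fst r)) \<le> snd (fst r)} \<inter> {r\<in>?M. q (fst (fst r)) \<le> snd r}))"
      unfolding P_def by (intro set_eqI) (auto intro: antisym)
    also have "closedin (top_of_set ?M) \<dots>"
      by (intro closedin_Int closedin_Un cle cont cc)
    finally have "closedin (top_of_set ?M) ((\<lambda>p. (p, \<theta> p)) ` S)" unfolding graph .
    moreover have "\<theta> \<in> S \<rightarrow> {-2..2}" using \<theta> by auto
    ultimately show ?thesis using continuous_closed_graph_eq[of "{-2..2::real}" \<theta> S] by simp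
  qed

  \<comment> \<open>Assembling the coordinates of the cusp\<close>
  have "topological_chart S (\<lambda>p. (fst p, h p)) (0, 0) cusp_form"
    unfolding topological_chart_def
  proof (intro conjI exI ballI)
    show "open S" "(0, 0) \<in> S" by (rule oS, rule S0)
    show "continuous_on S (\<lambda>p. (\<xi> (fst p), \<theta> p))"
      by (intro continuous_intros c\<theta> continuous_on_subset[OF cfst[OF c\<xi>, of B0]]) (auto simp: S_def)
    show "inj_on (\<lambda>p. (\<xi> (fst p), \<theta> p)) S"
    proof (rule inj_onI)
      fix p p' assume p: "p \<in> S" "p' \<in> S" and e: "(\<xi> (fst p), \<theta> p) = (\<xi> (fst p'), \<theta> p')"
      have f: "fst p = fst p'"
        using e \<xi>_less[OF S(1)[OF p(1)] S(1)[OF p(2)]] \<xi>_less[OF S(1)[OF p(2)] S(1)[OF p(1)]]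
        by (cases "fst p" "fst p'" rule: linorder_cases) auto
      have pe: "p = (fst p, snd p)" "p' = (fst p, snd p')" "\<theta> p' = \<theta> p" using f e by (auto simp: prod_eq_iff)
      have "snd p = snd p'"
        by (rule uniq'[of "fst p" _ _ "\<theta> p"]) (use p \<theta>(2)[OF p(1)] \<theta>(2)[OF p(2)] pe in metis)+
      with f show "p = p'" by (simp add: prod_eq_iff)
    qed
    have "P (0, 0) 0"
      using z0 pos0[OF I'(2)] gap0[OF I'(2)] by (simp add: P_def c_def q_def)
    then have "\<theta> (0, 0) = 0" using uniq[OF S0 \<theta>(2)[OF S0]] by simp
    then show "(\<xi> (fst (0, 0)), \<theta> (0, 0)) = (0, 0)" using z0 by simp
    show "open (I' \<times> (UNIV :: real set))" by (intro open_Times I' open_UNIV)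
    show "(\<lambda>p. (fst p, h p)) ` S \<subseteq> I' \<times> UNIV" using S by auto
    show "continuous_on (I' \<times> UNIV) (\<lambda>r. (\<xi> (fst r), snd r - mid (fst r)))"
      by (intro continuous_intros cfst[OF c\<xi>] cfst[OF cmid])
    show "inj_on (\<lambda>r. (\<xi> (fst r), snd r - mid (fst r))) (I' \<times> UNIV)"
    proof (rule inj_onI)
      fix r r' assume r: "r \<in> I' \<times> (UNIV :: real set)" "r' \<in> I' \<times> (UNIV :: real set)"
        and e: "(\<xi> (fst r), snd r - mid (fst r)) = (\<xi> (fst r'), snd r' - mid (fst r'))"
      have "fst r = fst r'"
        using e r \<xi>_less[of "fst r" "fst r'"] \<xi>_less[of "fst r'" "fst r"]
        by (cases "fst r" "fst r'" rule: linorder_cases) auto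
      then show "r = r'" using e by (simp add: prod_eq_iff)
    qed
    show "(\<xi> (fst (fst p, h p)), snd (fst p, h p) - mid (fst (fst p, h p))) = cusp_form (\<xi> (fst p), \<theta> p)" if "p \<in> S" for p
      using \<theta>(2)[OF that] by (simp add: P_def cusp_form_def c_def w_def)
  qed
  moreover have "S \<subseteq> I \<times> B" using I' B0 by (auto simp: S_def)
  ultimately show ?thesis by blast
qed

section \<open>From the shape of the critical curve to the normal form\<close>

lemma homeomorphism_real_interval:
  fixes f :: "real \<Rightarrow> real"
  assumes "\<rho> > 0" "continuous_on {- \<rho><..<\<rho>} f" "inj_on f {- \<rho><..<\<rho>}"
  obtains g where "homeomorphism {- \<rho><..<\<rho>} (f ` {- \<rho><..<\<rho>}) f g" "open (f ` {- \<rho><..<\<rho>})" "convex (f ` {- \<rho><..<\<rho>})"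
proof -
  obtain g where "homeomorphism {- \<rho><..<\<rho>} (f ` {- \<rho><..<\<rho>}) f g"
    using invariance_of_domain_homeomorphism[OF _ assms(2) _ assms(3)] by auto
  moreover have "open (f ` {- \<rho><..<\<rho>})" by (rule invariance_of_domain[OF assms(2) _ assms(3)]) simp
  moreover have "convex (f ` {- \<rho><..<\<rho>})"
    using connected_continuous_image[OF assms(2) connected_Ioo] by (simp add: is_interval_connected_1[symmetric] is_interval_convex)
  ultimately show ?thesis by (rule that)
qed

text \<open>For odd \<open>n\<close> and negative \<open>E\<close> the function \<open>a\<close> is
  strictly decreasing, so the critical curve is a graph over \<open>u\<close>. If
  \<open>n = 1\<close>, the sign of \<open>M\<close> off the curve comes from its monotonicity in
  \<open>s\<close>. If \<open>n > 1\<close>, a point \<open>(u, s)\<close> is compared with the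
  curve point at the same height \<open>s\<close>: since \<open>b\<close> increases and
  \<open>a\<close> decreases, a point above the graph lies to the right of the curve, where
  \<open>M\<close> is positive as it increases in \<open>u\<close>.\<close>

lemma fold_chart_normalized:
  fixes h M :: "real \<times> real \<Rightarrow> real" and a b b' E :: "real \<Rightarrow> real"
  assumes pos: "\<epsilon> > 0" "\<rho> > 0" and h: "continuous_on ({-\<epsilon><..<\<epsilon>} \<times> {-\<epsilon><..<\<epsilon>}) h"
    and d: "\<And>u s. \<bar>u\<bar> < \<epsilon> \<Longrightarrow> \<bar>s\<bar> < \<epsilon> \<Longrightarrow> ((\<lambda>s. h (u, s)) has_real_derivative M (u, s)) (at s)"
    and ab: "\<And>t. \<bar>t\<bar> < \<rho> \<Longrightarrow> \<bar>a t\<bar> < \<epsilon> \<and> \<bar>b t\<bar> < \<epsilon> \<and> M (a t, b t) = 0" "a 0 = 0" "b 0 = 0"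
    and da: "\<And>t. \<bar>t\<bar> < \<rho> \<Longrightarrow> (a has_real_derivative t ^ (n - 1) * E t) (at t)"
    and db: "\<And>t. \<bar>t\<bar> < \<rho> \<Longrightarrow> (b has_real_derivative b' t) (at t)"
    and E: "\<And>t. \<bar>t\<bar> < \<rho> \<Longrightarrow> E t < 0" and n: "odd n"
    and n1: "\<And>u s s'. n = 1 \<Longrightarrow> \<bar>u\<bar> < \<epsilon> \<Longrightarrow> \<bar>s\<bar> < \<epsilon> \<Longrightarrow> \<bar>s'\<bar> < \<epsilon> \<Longrightarrow> s < s' \<Longrightarrow> M (u, s) < M (u, s')"
    and n2: "\<And>u u' s. n > 1 \<Longrightarrow> \<bar>u\<bar> < \<epsilon> \<Longrightarrow> \<bar>u'\<bar> < \<epsilon> \<Longrightarrow> \<bar>s\<bar> < \<epsilon> \<Longrightarrow> u < u' \<Longrightarrow> M (u, s) < M (u', s)"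
      "\<And>t. n > 1 \<Longrightarrow> \<bar>t\<bar> < \<rho> \<Longrightarrow> b' t > 0"
  shows "\<exists>S\<subseteq>{-\<epsilon><..<\<epsilon>} \<times> {-\<epsilon><..<\<epsilon>}. topological_chart S (\<lambda>p. (fst p, h p)) (0, 0) fold_form"
proof -
  let ?T = "{- \<rho><..<\<rho>}" and ?P = "{-\<epsilon><..<\<epsilon>}"
  \<comment> \<open>The derivative of \<open>a\<close> may vanish at \<open>0\<close>, so the two
    sides are treated separately and joined at \<open>0\<close> in \<open>anti\<close>.\<close>
  have anti0: "a y < a x" if "x \<in> ?T" "y \<in> ?T" "x < y" "0 \<le> x \<or> y \<le> 0" for x y
  proof -
    have "- a x < - a y"
    proof (rule strict_mono_of_deriv[of ?T, OF _ that(1-3), where f' = "\<lambda>t. - (t ^ (n - 1) * E t)"])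
      show "0 < - (t ^ (n - 1) * E t)" if t: "x < t" "t < y" for t
      proof -
        have "t \<noteq> 0" using \<open>0 \<le> x \<or> y \<le> 0\<close> t by auto
        then have "0 < t ^ (n - 1)" using n by (simp add: zero_less_power_eq)
        moreover have "E t < 0" by (rule E) (use t \<open>x \<in> ?T\<close> \<open>y \<in> ?T\<close> in auto)
        ultimately show ?thesis by (simp add: mult_pos_neg)
      qed
    qed (use da in \<open>auto intro!: DERIV_minus\<close>)
    then show ?thesis by simp
  qed
  have anti: "a y < a x" if "x \<in> ?T" "y \<in> ?T" "x < y" for x y
  proof (cases "0 \<le> x \<or> y \<le> 0")
    case False
    then have "a y < a 0" "a 0 < a x" using anti0[of 0 y] anti0[of x 0] that pos by auto
    then show ?thesis by simp
  qed (use anti0 that in auto)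
  have inja: "inj_on a ?T"
  proof (rule inj_onI)
    fix x y assume "x \<in> ?T" "y \<in> ?T" "a x = a y"
    then show "x = y" using anti[of x y] anti[of y x] by (cases x y rule: linorder_cases) auto
  qed
  have cont: "continuous_on ?T a" "continuous_on ?T b"
    by (intro continuous_at_imp_continuous_on ballI; rule DERIV_isCont[OF da] DERIV_isCont[OF db]; simp add: abs_less_iff)+
  obtain g where g: "homeomorphism ?T (a ` ?T) a g" "open (a ` ?T)"
    by (rule homeomorphism_real_interval[OF pos(2) cont(1) inja]) (rule that)
  have ga: "g (a t) = t" if "t \<in> ?T" for t using g(1) that by (simp add: homeomorphism_def)
  have sub: "a ` ?T \<subseteq> ?P" "b ` ?T \<subseteq> ?P" using ab(1) by (fastforce simp: abs_less_iff)+
  have c\<phi>: "continuous_on (a ` ?T) (\<lambda>u. b (g u))"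
    by (rule continuous_on_compose2[OF cont(2)]) (use g(1) in \<open>auto simp: homeomorphism_def\<close>)
  have 0: "0 \<in> a ` ?T" using ab(2) pos by (intro image_eqI[of _ _ 0]) auto
  have bg0: "b (g 0) = 0" using ga[of 0] ab(2,3) pos by simp
  show ?thesis
  proof (cases "n = 1")
    case True
    have "topological_chart (a ` ?T \<times> ?P) (\<lambda>p. (fst p, h p)) (0, b (g 0)) fold_form"
    proof (rule fold_chart[where \<sigma> = 1 and M = M, OF g(2) 0 open_greaterThanLessThan convex_real_interval(8)])
      show "continuous_on (a ` ?T \<times> ?P) h" by (rule continuous_on_subset[OF h]) (use sub in auto)
      show "((\<lambda>s. h (u, s)) has_real_derivative M (u, s)) (at s)" if "u \<in> a ` ?T" "s \<in> ?P" for u s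
        by (rule d) (use that sub in force)+
      show "continuous_on (a ` ?T) (\<lambda>u. b (g u))" by (rule c\<phi>)
      show "b (g u) \<in> ?P" if "u \<in> a ` ?T" for u using that ga sub(2) by auto
      show "1 * M (u, s) > 0" if u: "u \<in> a ` ?T" and s: "s \<in> ?P" "s > b (g u)" for u s
      proof -
        obtain t where t: "t \<in> ?T" "u = a t" using u by blast
        show ?thesis using n1[OF True, of u "b t" s] ab(1)[of t] t ga[OF t(1)] s by (auto simp: abs_less_iff)
      qed
      show "1 * M (u, s) < 0" if u: "u \<in> a ` ?T" and s: "s \<in> ?P" "s < b (g u)" for u s
      proof -
        obtain t where t: "t \<in> ?T" "u = a t" using u by blast
        show ?thesis using n1[OF True, of u s "b t"] ab(1)[of t] t ga[OF t(1)] s by (auto simp: abs_less_iff)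
      qed
    qed simp
    then show ?thesis unfolding bg0 using sub(1) by (intro exI[of _ "a ` ?T \<times> ?P"]) auto
  next
    case False
    then have n': "n > 1" using n by (cases n) auto
    have bmono: "b x < b y" if "x \<in> ?T" "y \<in> ?T" "x < y" for x y
      by (rule strict_mono_of_deriv[of ?T, OF _ that, where f' = b']) (use db n2(2)[OF n'] that in auto)
    have injb: "inj_on b ?T"
    proof (rule inj_onI)
      fix x y assume "x \<in> ?T" "y \<in> ?T" "b x = b y"
      then show "x = y" using bmono[of x y] bmono[of y x] by (cases x y rule: linorder_cases) auto
    qed
    obtain gb where gb: "homeomorphism ?T (b ` ?T) b gb" "open (b ` ?T)" "convex (b ` ?T)"
      by (rule homeomorphism_real_interval[OF pos(2) cont(2) injb]) (rule that)
    have "topological_chart (a ` ?T \<times> b ` ?T) (\<lambda>p. (fst p, h p)) (0, b (g 0)) fold_form"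
    proof (rule fold_chart[where \<sigma> = 1 and M = M, OF g(2) 0 gb(2,3)])
      show "continuous_on (a ` ?T \<times> b ` ?T) h" by (rule continuous_on_subset[OF h]) (use sub in auto)
      show "((\<lambda>s. h (u, s)) has_real_derivative M (u, s)) (at s)" if "u \<in> a ` ?T" "s \<in> b ` ?T" for u s
        by (rule d) (use that sub in force)+
      show "continuous_on (a ` ?T) (\<lambda>u. b (g u))" by (rule c\<phi>)
      show "b (g u) \<in> b ` ?T" if "u \<in> a ` ?T" for u using that ga by auto
      have cmp: "b t < b t' \<longleftrightarrow> t < t'" "a t < a t' \<longleftrightarrow> t' < t" if "t \<in> ?T" "t' \<in> ?T" for t t'
        using bmono[of t t'] bmono[of t' t] anti[of t t'] anti[of t' t] that by (cases t t' rule: linorder_cases; force)+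
      show "1 * M (u, s) > 0" if u: "u \<in> a ` ?T" and s: "s \<in> b ` ?T" "s > b (g u)" for u s
      proof -
        obtain t t' where t: "t \<in> ?T" "u = a t" "t' \<in> ?T" "s = b t'" using u s by blast
        then have "a t' < a t" using s(2) cmp ga by auto
        then show ?thesis using n2(1)[OF n', of "a t'" "a t" s] ab(1)[of t] ab(1)[of t'] t by (auto simp: abs_less_iff)
      qed
      show "1 * M (u, s) < 0" if u: "u \<in> a ` ?T" and s: "s \<in> b ` ?T" "s < b (g u)" for u s
      proof -
        obtain t t' where t: "t \<in> ?T" "u = a t" "t' \<in> ?T" "s = b t'" using u s by blast
        then have "a t < a t'" using s(2) cmp ga by auto
        then show ?thesis using n2(1)[OF n', of "a t" "a t'" s] ab(1)[of t] ab(1)[of t'] t by (auto simp: abs_less_iff)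
      qed
    qed simp
    then show ?thesis unfolding bg0 using sub by (intro exI[of _ "a ` ?T \<times> b ` ?T"]) auto
  qed
qed

text \<open>For even \<open>n\<close> and negative \<open>E\<close> the velocity of \<open>a\<close>
  changes from positive to negative at \<open>0\<close>. As \<open>b\<close> increases, the critical
  curve is a graph \<open>u = \<psi> s\<close> with a strict maximum at \<open>0\<close>, and
  \<open>M\<close>, which increases in \<open>u\<close>, is positive to the right of it and negative
  to the left.\<close>

lemma cusp_chart_normalized:
  fixes h M :: "real \<times> real \<Rightarrow> real" and a b b' E :: "real \<Rightarrow> real"
  assumes pos: "\<epsilon> > 0" "\<rho> > 0" and h: "continuous_on ({-\<epsilon><..<\<epsilon>} \<times> {-\<epsilon><..<\<epsilon>}) h"
    and d: "\<And>u s. \<bar>u\<bar> < \<epsilon> \<Longrightarrow> \<bar>s\<bar> < \<epsilon> \<Longrightarrow> ((\<lambda>s. h (u, s)) has_real_derivative M (u, s)) (at s)"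
    and ab: "\<And>t. \<bar>t\<bar> < \<rho> \<Longrightarrow> \<bar>a t\<bar> < \<epsilon> \<and> \<bar>b t\<bar> < \<epsilon> \<and> M (a t, b t) = 0" "a 0 = 0" "b 0 = 0"
    and da: "\<And>t. \<bar>t\<bar> < \<rho> \<Longrightarrow> (a has_real_derivative t ^ (n - 1) * E t) (at t)"
    and db: "\<And>t. \<bar>t\<bar> < \<rho> \<Longrightarrow> (b has_real_derivative b' t) (at t)"
    and E: "\<And>t. \<bar>t\<bar> < \<rho> \<Longrightarrow> E t < 0" and n: "even n" "n > 0"
    and M: "\<And>u u' s. \<bar>u\<bar> < \<epsilon> \<Longrightarrow> \<bar>u'\<bar> < \<epsilon> \<Longrightarrow> \<bar>s\<bar> < \<epsilon> \<Longrightarrow> u < u' \<Longrightarrow> M (u, s) < M (u', s)"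
    and b': "\<And>t. \<bar>t\<bar> < \<rho> \<Longrightarrow> b' t > 0"
  shows "\<exists>S\<subseteq>{-\<epsilon><..<\<epsilon>} \<times> {-\<epsilon><..<\<epsilon>}. topological_chart S (\<lambda>p. (fst p, h p)) (0, 0) cusp_form"
proof -
  let ?T = "{- \<rho><..<\<rho>}" and ?P = "{-\<epsilon><..<\<epsilon>}"
  have odd: "odd (n - 1)" using n by simp
  have up: "a x < a y" if xy: "x \<in> ?T" "y \<in> ?T" "x < y" "y \<le> 0" for x y
  proof (rule strict_mono_of_deriv[of ?T, OF _ xy(1-3), where f' = "\<lambda>t. t ^ (n - 1) * E t"])
    show "0 < t ^ (n - 1) * E t" if t: "x < t" "t < y" for t
    proof -
      have "t ^ (n - 1) < 0" using odd t xy(4) by (simp add: power_less_zero_eq)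
      moreover have "E t < 0" by (rule E) (use t xy in auto)
      ultimately show ?thesis by (rule mult_neg_neg)
    qed
  qed (use da in auto)
  have down: "a y < a x" if xy: "x \<in> ?T" "y \<in> ?T" "x < y" "0 \<le> x" for x y
  proof -
    have "- a x < - a y"
    proof (rule strict_mono_of_deriv[of ?T, OF _ xy(1-3), where f' = "\<lambda>t. - (t ^ (n - 1) * E t)"])
      show "0 < - (t ^ (n - 1) * E t)" if t: "x < t" "t < y" for t
      proof -
        have "0 < t ^ (n - 1)" using t xy(4) by simp
        moreover have "E t < 0" by (rule E) (use t xy in auto)
        ultimately show ?thesis by (simp add: mult_pos_neg)
      qed
    qed (use da in \<open>auto intro!: DERIV_minus\<close>)
    then show ?thesis by simp
  qed
  have bmono: "b x < b y" if "x \<in> ?T" "y \<in> ?T" "x < y" for x y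
    by (rule strict_mono_of_deriv[of ?T, OF _ that, where f' = b']) (use db b' that in auto)
  have injb: "inj_on b ?T"
  proof (rule inj_onI)
    fix x y assume "x \<in> ?T" "y \<in> ?T" "b x = b y"
    then show "x = y" using bmono[of x y] bmono[of y x] by (cases x y rule: linorder_cases) auto
  qed
  have cont: "continuous_on ?T a" "continuous_on ?T b"
    by (intro continuous_at_imp_continuous_on ballI; rule DERIV_isCont[OF da] DERIV_isCont[OF db]; simp add: abs_less_iff)+
  obtain g where g: "homeomorphism ?T (b ` ?T) b g" "open (b ` ?T)" "convex (b ` ?T)"
    by (rule homeomorphism_real_interval[OF pos(2) cont(2) injb]) (rule that)
  have gb: "g (b t) = t" if "t \<in> ?T" for t using g(1) that by (simp add: homeomorphism_def)
  have bcmp: "b t < b t' \<longleftrightarrow> t < t'" if "t \<in> ?T" "t' \<in> ?T" for t t'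
    using bmono[of t t'] bmono[of t' t] that by (cases t t' rule: linorder_cases) (force+)
  have b0: "b t \<le> 0 \<longleftrightarrow> t \<le> 0" "0 \<le> b t \<longleftrightarrow> 0 \<le> t" if "t \<in> ?T" for t
    using bcmp[OF that, of 0] bcmp[OF _ that, of 0] ab(3) pos by auto
  have sub: "b ` ?T \<subseteq> ?P" using ab(1) by (fastforce simp: abs_less_iff)
  have "\<exists>S\<subseteq>?P \<times> b ` ?T. topological_chart S (\<lambda>p. (fst p, h p)) (0, 0) cusp_form"
  proof (rule cusp_chart[where \<psi> = "\<lambda>s. a (g s)" and M = M, OF open_greaterThanLessThan _ g(2,3)])
    show "0 \<in> ?P" using pos by simp
    show "0 \<in> b ` ?T" using ab(3) pos by (intro image_eqI[of _ _ 0]) auto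
    show "continuous_on (?P \<times> b ` ?T) h" by (rule continuous_on_subset[OF h]) (use sub in auto)
    show "((\<lambda>s. h (u, s)) has_real_derivative M (u, s)) (at s)" if "u \<in> ?P" "s \<in> b ` ?T" for u s
      by (rule d) (use that sub in force)+
    show "continuous_on (b ` ?T) (\<lambda>s. a (g s))"
      by (rule continuous_on_compose2[OF cont(1)]) (use g(1) in \<open>auto simp: homeomorphism_def\<close>)
    show "a (g 0) = 0" using gb[of 0] ab(2,3) pos by simp
    show "a (g s) < a (g s')" if s: "s \<in> b ` ?T" "s' \<in> b ` ?T" "s < s'" "s' \<le> 0" for s s'
    proof -
      obtain t t' where t: "t \<in> ?T" "s = b t" "t' \<in> ?T" "s' = b t'" using s by blast
      then show ?thesis using up[of t t'] gb bcmp[of t t'] b0[of t'] s by auto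
    qed
    show "a (g s') < a (g s)" if s: "s \<in> b ` ?T" "s' \<in> b ` ?T" "0 \<le> s" "s < s'" for s s'
    proof -
      obtain t t' where t: "t \<in> ?T" "s = b t" "t' \<in> ?T" "s' = b t'" using s by blast
      then show ?thesis using down[of t t'] gb bcmp[of t t'] b0[of t] s by auto
    qed
    show "M (u, s) > 0" if u: "u \<in> ?P" and s: "s \<in> b ` ?T" "a (g s) < u" for u s
    proof -
      obtain t where t: "t \<in> ?T" "s = b t" using s by blast
      then show ?thesis using M[of "a t" u s] ab(1)[of t] gb[OF t(1)] u s(2) by (auto simp: abs_less_iff)
    qed
    show "M (u, s) < 0" if u: "u \<in> ?P" and s: "s \<in> b ` ?T" "u < a (g s)" for u s
    proof -
      obtain t where t: "t \<in> ?T" "s = b t" using s by blast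
      then show ?thesis using M[of u "a t" s] ab(1)[of t] gb[OF t(1)] u s(2) by (auto simp: abs_less_iff)
    qed
    show "M (u, s) < M (u', s)" if "u \<in> ?P" "u' \<in> ?P" "s \<in> b ` ?T" "u < u'" for u u' s
      by (rule M) (use that sub in force)+
  qed
  then show ?thesis using sub by (meson Sigma_mono order_refl order_trans)
qed

text \<open>Three signs reduce to the normalized lemmas: \<open>et\<close> may reverse the parameter
  of the curve, \<open>eu\<close> may reflect \<open>u\<close>, and \<open>eh\<close> may reflect
  the second range coordinate. They are chosen so that, for \<open>n > 1\<close>, \<open>b\<close>
  increases; that \<open>E\<close> becomes negative; and that \<open>M\<close> increases in
  \<open>s\<close> if \<open>n = 1\<close> and in \<open>u\<close> if \<open>n > 1\<close>.\<close>

lemma straightened_chart: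
  fixes h M Mu Ms :: "real \<times> real \<Rightarrow> real" and a b b' E :: "real \<Rightarrow> real"
  assumes B: "open B" "(u0, s0) \<in> B" and h: "continuous_on B h"
    and d: "\<And>u s. (u, s) \<in> B \<Longrightarrow> ((\<lambda>s. h (u, s)) has_real_derivative M (u, s)) (at s)"
    and dMs: "\<And>u s. (u, s) \<in> B \<Longrightarrow> ((\<lambda>s. M (u, s)) has_real_derivative Ms (u, s)) (at s)"
    and dMu: "\<And>u s. (u, s) \<in> B \<Longrightarrow> ((\<lambda>u. M (u, s)) has_real_derivative Mu (u, s)) (at u)"
    and cM: "isCont Mu (u0, s0)" "isCont Ms (u0, s0)"
    and curve: "\<rho> > 0" "\<And>t. \<bar>t\<bar> < \<rho> \<Longrightarrow> (a t, b t) \<in> B \<and> M (a t, b t) = 0" "a 0 = u0" "b 0 = s0"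
    and da: "\<And>t. \<bar>t\<bar> < \<rho> \<Longrightarrow> (a has_real_derivative t ^ (n - 1) * E t) (at t)"
    and db: "\<And>t. \<bar>t\<bar> < \<rho> \<Longrightarrow> (b has_real_derivative b' t) (at t)"
    and c: "isCont E 0" "isCont b' 0" and E: "E 0 \<noteq> 0" and n: "n > 0"
    and n1: "n = 1 \<Longrightarrow> Ms (u0, s0) \<noteq> 0" and n2: "n > 1 \<Longrightarrow> Mu (u0, s0) \<noteq> 0 \<and> b' 0 \<noteq> 0"
  shows "\<exists>S\<subseteq>B. topological_chart S (\<lambda>p. (fst p, h p)) (u0, s0) (if odd n then fold_form else cusp_form)"
proof -
  define et where "et = (if b' 0 < 0 then -1 else 1 :: real)"
  \<comment> \<open>The rescaled curve has leading factor \<open>eu * et ^ n * E (et * t)\<close>,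
    where one power of \<open>et\<close> comes from the chain rule and the others from
    \<open>t ^ (n - 1)\<close>. This choice makes it negative at \<open>0\<close>.\<close>
  define eu where "eu = - sgn (E 0 * et ^ n)"
  \<comment> \<open>For \<open>n > 1\<close> the derivative of \<open>M'\<close> in \<open>u\<close>
    is \<open>eh * eu * Mu\<close>; the second factor \<open>eu\<close> enters so that the two signs
    cancel.\<close>
  define eh where "eh = (if n = 1 then sgn (Ms (u0, s0)) else eu * sgn (Mu (u0, s0)))"
  have et: "et * et = 1" "\<bar>et\<bar> = 1" "et \<noteq> 0" by (auto simp: et_def)
  have eu: "eu * eu = 1" "eu \<noteq> 0" "\<bar>eu\<bar> = 1" using E et by (auto simp: eu_def sgn_if)
  have eh: "eh \<noteq> 0" using n1 n2 n eu by (auto simp: eh_def sgn_if)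
  let ?q = "\<lambda>p. (u0 + eu * fst p, s0 + snd p)"
  define h' where "h' p = eh * h (?q p)" for p
  define M' where "M' p = eh * M (?q p)" for p
  define a' where "a' t = eu * (a (et * t) - u0)" for t
  define b1 where "b1 t = b (et * t) - s0" for t
  define E' where "E' t = eu * et ^ n * E (et * t)" for t
  let ?b' = "\<lambda>t. et * b' (et * t)"
  have q0: "?q (0, 0) = (u0, s0)" by simp
  have cq: "isCont ?q p" for p by (intro continuous_intros)
  have evB: "\<forall>\<^sub>F p in nhds (0, 0). ?q p \<in> B"
    by (rule isCont_eventually_nhds[OF cq B(1)]) (use B in simp)
  have cMq: "isCont (\<lambda>p. f (?q p)) (0, 0)" if "isCont f (u0, s0)" for f :: "real \<times> real \<Rightarrow> real"
    by (rule isCont_o2[where f = ?q, OF cq]) (use that in simp)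
  have evs: "\<forall>\<^sub>F p in nhds (0, 0). n = 1 \<longrightarrow> eh * Ms (?q p) > 0"
  proof (cases "n = 1")
    case True
    have "\<forall>\<^sub>F p in nhds (0, 0). eh * Ms (?q p) \<in> {0<..}"
      by (rule isCont_eventually_nhds[OF continuous_mult[OF continuous_const cMq[OF cM(2)]] open_greaterThan])
        (use n1[OF True] True in \<open>auto simp: eh_def sgn_if\<close>)
    then show ?thesis by (auto elim: eventually_mono)
  qed simp
  have evu: "\<forall>\<^sub>F p in nhds (0, 0). n > 1 \<longrightarrow> eh * eu * Mu (?q p) > 0"
  proof (cases "n > 1")
    case True
    have "\<forall>\<^sub>F p in nhds (0, 0). (eh * eu) * Mu (?q p) \<in> {0<..}"
      by (rule isCont_eventually_nhds[OF continuous_mult[OF continuous_const cMq[OF cM(1)]] open_greaterThan])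
        (use n2[OF True] True eu in \<open>auto simp: eh_def sgn_if eu_def\<close>)
    then show ?thesis by (auto elim: eventually_mono)
  qed simp
  obtain \<epsilon> where \<epsilon>: "\<epsilon> > 0" "\<And>x y. \<bar>x\<bar> < \<epsilon> \<Longrightarrow> \<bar>y\<bar> < \<epsilon> \<Longrightarrow> (u0 + eu * x, s0 + y) \<in> B \<and>
      (n = 1 \<longrightarrow> eh * Ms (u0 + eu * x, s0 + y) > 0) \<and> (n > 1 \<longrightarrow> eh * eu * Mu (u0 + eu * x, s0 + y) > 0)"
  proof -
    obtain V where V: "open V" "(0, 0) \<in> V" "\<And>p. p \<in> V \<Longrightarrow> ?q p \<in> B \<and> (n = 1 \<longrightarrow> eh * Ms (?q p) > 0) \<and> (n > 1 \<longrightarrow> eh * eu * Mu (?q p) > 0)"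
      using eventually_conj[OF evB eventually_conj[OF evs evu]] unfolding eventually_nhds by blast
    obtain r where r: "r > 0" "cball 0 r \<times> cball 0 r \<subseteq> V" by (rule open_bidisc[OF V(1,2)]) (rule that)
    show ?thesis using V(3) r by (intro that[of r]) (auto simp: subset_iff)
  qed
  obtain \<rho>' where \<rho>': "\<rho>' > 0" "\<And>t. \<bar>t\<bar> < \<rho>' \<Longrightarrow> \<bar>t\<bar> < \<rho> \<and> \<bar>a' t\<bar> < \<epsilon> \<and> \<bar>b1 t\<bar> < \<epsilon> \<and> E' t < 0 \<and> (n > 1 \<longrightarrow> ?b' t > 0)"
  proof -
    have ct: "isCont (\<lambda>t. f (et * t)) 0" if "isCont f 0" for f :: "real \<Rightarrow> real"
      by (rule isCont_o2[where f = "\<lambda>t. et * t"]) (use that in auto)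
    have ca: "isCont a 0" "isCont b 0" using DERIV_isCont[OF da[of 0]] DERIV_isCont[OF db[of 0]] curve by auto
    have cc: "isCont (\<lambda>t. \<bar>a' t\<bar>) 0" "isCont (\<lambda>t. \<bar>b1 t\<bar>) 0" "isCont E' 0" "isCont ?b' 0"
      unfolding a'_def b1_def E'_def by (intro continuous_intros ct ca c)+
    have lt: "\<forall>\<^sub>F t in nhds 0. f t < k" if "isCont f 0" "f 0 < k" for f :: "real \<Rightarrow> real" and k
      using isCont_eventually_nhds[OF that(1) open_lessThan, of k] that(2) by simp
    have "E' 0 = eu * (E 0 * et ^ n)" by (simp add: E'_def)
    also have "\<dots> = - \<bar>E 0 * et ^ n\<bar>" unfolding eu_def by (metis abs_sgn mult.commute mult_minus_left)
    also have "\<dots> < 0" using E et by simp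
    finally have "E' 0 < 0" .
    moreover have "\<forall>\<^sub>F t in nhds 0. n > 1 \<longrightarrow> ?b' t > 0"
    proof (cases "n > 1")
      case True
      then have "- ?b' 0 < 0" using n2 by (auto simp: et_def)
      from lt[of "\<lambda>t. - ?b' t", OF continuous_minus[OF cc(4)] this] show ?thesis by (auto elim: eventually_mono)
    qed simp
    ultimately have "\<forall>\<^sub>F t in nhds 0. \<bar>t\<bar> < \<rho> \<and> \<bar>a' t\<bar> < \<epsilon> \<and> \<bar>b1 t\<bar> < \<epsilon> \<and> E' t < 0 \<and> (n > 1 \<longrightarrow> ?b' t > 0)"
      using \<epsilon>(1) curve(1,3,4)
      by (intro eventually_conj lt cc continuous_rabs continuous_ident) (auto simp: a'_def b1_def)
    then show ?thesis unfolding eventually_nhds_metric dist_real_def by (auto intro: that)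
  qed
  have h': "continuous_on ({-\<epsilon><..<\<epsilon>} \<times> {-\<epsilon><..<\<epsilon>}) h'"
    unfolding h'_def
    by (intro continuous_intros continuous_on_compose2[OF h]) (use \<epsilon>(2) in \<open>auto simp: abs_less_iff\<close>)
  have d': "((\<lambda>s. h' (u, s)) has_real_derivative M' (u, s)) (at s)" if "\<bar>u\<bar> < \<epsilon>" "\<bar>s\<bar> < \<epsilon>" for u s
  proof -
    have "((\<lambda>s. h (u0 + eu * u, s0 + s)) has_real_derivative M (u0 + eu * u, s0 + s) * 1) (at s)"
      by (rule DERIV_chain2[where f = "\<lambda>s. h (u0 + eu * u, s)" and g = "\<lambda>s. s0 + s"])
        (use d \<epsilon>(2)[OF that] in \<open>auto intro!: derivative_eq_intros\<close>)
    from DERIV_cmult[OF this, of eh] show ?thesis by (simp add: h'_def M'_def)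
  qed
  have curve': "\<bar>a' t\<bar> < \<epsilon> \<and> \<bar>b1 t\<bar> < \<epsilon> \<and> M' (a' t, b1 t) = 0" if "\<bar>t\<bar> < \<rho>'" for t
  proof -
    have "\<bar>et * t\<bar> < \<rho>" using \<rho>'(2)[OF that] et by (simp add: abs_mult)
    moreover have "u0 + eu * a' t = a (et * t)" using eu(1) by (simp add: a'_def mult.assoc[symmetric])
    moreover have "s0 + b1 t = b (et * t)" by (simp add: b1_def)
    ultimately show ?thesis using curve(2)[of "et * t"] \<rho>'(2)[OF that] by (simp add: M'_def)
  qed
  have da': "(a' has_real_derivative t ^ (n - 1) * E' t) (at t)" if "\<bar>t\<bar> < \<rho>'" for t
  proof -
    have t: "\<bar>et * t\<bar> < \<rho>" using \<rho>'(2)[OF that] et by (simp add: abs_mult)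
    have "((\<lambda>t. a (et * t)) has_real_derivative (et * t) ^ (n - 1) * E (et * t) * et) (at t)"
      by (rule DERIV_chain2[where g = "\<lambda>t. et * t" and x = t, OF da[OF t]]) (auto intro!: derivative_eq_intros)
    from DERIV_cmult[OF DERIV_diff[OF this DERIV_const[of u0]], of eu]
    have "(a' has_real_derivative eu * ((et * t) ^ (n - 1) * E (et * t) * et - 0)) (at t)"
      unfolding a'_def .
    moreover have "et ^ n = et ^ (n - 1) * et" using n by (metis power_minus_mult)
    ultimately show ?thesis by (simp add: E'_def power_mult_distrib mult_ac)
  qed
  have db': "(b1 has_real_derivative ?b' t) (at t)" if "\<bar>t\<bar> < \<rho>'" for t
  proof -
    have t: "\<bar>et * t\<bar> < \<rho>" using \<rho>'(2)[OF that] et by (simp add: abs_mult)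
    have "((\<lambda>t. b (et * t)) has_real_derivative b' (et * t) * et) (at t)"
      by (rule DERIV_chain2[where g = "\<lambda>t. et * t" and x = t, OF db[OF t]]) (auto intro!: derivative_eq_intros)
    from DERIV_diff[OF this DERIV_const[of s0]] show ?thesis unfolding b1_def by (simp add: mult.commute)
  qed
  have E': "E' t < 0" if "\<bar>t\<bar> < \<rho>'" for t using \<rho>'(2)[OF that] by simp
  have pb: "?b' t > 0" if "n > 1" "\<bar>t\<bar> < \<rho>'" for t using \<rho>'(2)[OF that(2)] that(1) by simp
  have ab0: "a' 0 = 0" "b1 0 = 0" using curve(3,4) by (auto simp: a'_def b1_def)
  have cvx: "convex {-\<epsilon><..<\<epsilon>}" by simp
  have Ms: "M' (u, s) < M' (u, s')" if "n = 1" "\<bar>u\<bar> < \<epsilon>" "\<bar>s\<bar> < \<epsilon>" "\<bar>s'\<bar> < \<epsilon>" "s < s'" for u s s'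
  proof (rule strict_mono_of_deriv[OF cvx _ _ that(5), where f' = "\<lambda>s. eh * Ms (u0 + eu * u, s0 + s)"])
    show "((\<lambda>s. M' (u, s)) has_real_derivative eh * Ms (u0 + eu * u, s0 + x)) (at x)" if x: "x \<in> {-\<epsilon><..<\<epsilon>}" for x
    proof -
      have "((\<lambda>s. M (u0 + eu * u, s0 + s)) has_real_derivative Ms (u0 + eu * u, s0 + x) * 1) (at x)"
        by (rule DERIV_chain2[where f = "\<lambda>s. M (u0 + eu * u, s)" and g = "\<lambda>s. s0 + s"])
          (use dMs \<epsilon>(2)[OF \<open>\<bar>u\<bar> < \<epsilon>\<close>, of x] x in \<open>auto simp: abs_less_iff intro!: derivative_eq_intros\<close>)
      from DERIV_cmult[OF this, of eh] show ?thesis by (simp add: M'_def)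
    qed
    show "0 < eh * Ms (u0 + eu * u, s0 + x)" if "s < x" "x < s'" for x
      using \<epsilon>(2)[OF \<open>\<bar>u\<bar> < \<epsilon>\<close>, of x] that \<open>\<bar>s\<bar> < \<epsilon>\<close> \<open>\<bar>s'\<bar> < \<epsilon>\<close> \<open>n = 1\<close> by (simp add: abs_less_iff)
  qed (use that in \<open>auto simp: abs_less_iff\<close>)
  have Mu: "M' (u, s) < M' (u', s)" if "n > 1" "\<bar>u\<bar> < \<epsilon>" "\<bar>u'\<bar> < \<epsilon>" "\<bar>s\<bar> < \<epsilon>" "u < u'" for u u' s
  proof (rule strict_mono_of_deriv[OF cvx _ _ that(5), where f = "\<lambda>u. M' (u, s)" and f' = "\<lambda>u. eh * eu * Mu (u0 + eu * u, s0 + s)"])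
    show "((\<lambda>u. M' (u, s)) has_real_derivative eh * eu * Mu (u0 + eu * x, s0 + s)) (at x)" if x: "x \<in> {-\<epsilon><..<\<epsilon>}" for x
    proof -
      have "((\<lambda>u. M (u0 + eu * u, s0 + s)) has_real_derivative Mu (u0 + eu * x, s0 + s) * eu) (at x)"
        by (rule DERIV_chain2[where f = "\<lambda>u. M (u, s0 + s)" and g = "\<lambda>u. u0 + eu * u"])
          (use dMu \<epsilon>(2)[OF _ \<open>\<bar>s\<bar> < \<epsilon>\<close>, of x] x in \<open>auto simp: abs_less_iff intro!: derivative_eq_intros\<close>)
      from DERIV_cmult[OF this, of eh] show ?thesis by (simp add: M'_def mult_ac)
    qed
    show "0 < eh * eu * Mu (u0 + eu * x, s0 + s)" if "u < x" "x < u'" for x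
      using \<epsilon>(2)[OF _ \<open>\<bar>s\<bar> < \<epsilon>\<close>, of x] that \<open>\<bar>u\<bar> < \<epsilon>\<close> \<open>\<bar>u'\<bar> < \<epsilon>\<close> \<open>n > 1\<close> by (simp add: abs_less_iff)
  qed (use that in \<open>auto simp: abs_less_iff\<close>)
  have "\<exists>S. topological_chart S (\<lambda>p. (fst p, h' p)) (0, 0) (if odd n then fold_form else cusp_form)"
  proof (cases "odd n")
    case True
    have "\<exists>S\<subseteq>{-\<epsilon><..<\<epsilon>} \<times> {-\<epsilon><..<\<epsilon>}. topological_chart S (\<lambda>p. (fst p, h' p)) (0, 0) fold_form"
      by (rule fold_chart_normalized[OF \<epsilon>(1) \<rho>'(1) h' d' curve' ab0 da' db' E' True Ms Mu pb])
    then show ?thesis using True by auto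
  next
    case False
    then have n': "n > 1" using n by (cases "n = 1") auto
    have "\<exists>S\<subseteq>{-\<epsilon><..<\<epsilon>} \<times> {-\<epsilon><..<\<epsilon>}. topological_chart S (\<lambda>p. (fst p, h' p)) (0, 0) cusp_form"
      by (rule cusp_chart_normalized[OF \<epsilon>(1) \<rho>'(1) h' d' curve' ab0 da' db' E' _ n Mu[OF n'] pb[OF n']]) (use False in auto)
    then show ?thesis using False by auto
  qed
  then obtain S where S: "topological_chart S (\<lambda>p. (fst p, h' p)) (0, 0) (if odd n then fold_form else cusp_form)" by blast
  let ?\<Phi> = "\<lambda>p. (eu * (fst p - u0), snd p - s0)" and ?L = "\<lambda>r. (eu * (fst r - u0), eh * snd r)"
  have "topological_chart {p\<in>B. ?\<Phi> p \<in> S} (\<lambda>p. (fst p, h p)) (u0, s0) (if odd n then fold_form else cusp_form)"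
  proof (rule topological_chart_transport[OF S B, where L = ?L])
    show "continuous_on B ?\<Phi>" "continuous_on UNIV ?L" by (intro continuous_intros)+
    show "inj_on ?\<Phi> B" using eu by (auto simp: inj_on_def)
    show "inj ?L" using eu eh by (auto simp: inj_on_def)
    show "?\<Phi> (u0, s0) = (0, 0)" by simp
    show "?L (fst p, h p) = (fst (?\<Phi> p), h' (?\<Phi> p))" if "p \<in> B" "?\<Phi> p \<in> S" for p
      by (simp add: h'_def mult.assoc[symmetric] eu(1))
  qed
  then show ?thesis by (intro exI[of _ "{p\<in>B. ?\<Phi> p \<in> S}"]) auto
qed

lemma has_derivative_slices:
  fixes g :: "'k::real_normed_field \<times> 'k \<Rightarrow> 'k"
  assumes "(g has_derivative (\<lambda>h. a * fst h + b * snd h)) (at (u, s))"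
  shows "((\<lambda>u. g (u, s)) has_field_derivative a) (at u)" "((\<lambda>s. g (u, s)) has_field_derivative b) (at s)"
  using grad_curve[where x = "\<lambda>u. u" and y = "\<lambda>_. s" and t = u, OF assms DERIV_ident DERIV_const]
    grad_curve[where x = "\<lambda>_. u" and y = "\<lambda>s. s" and t = s, OF assms DERIV_const DERIV_ident] by simp_all

text \<open>In coordinates \<open>(f, \<alpha>x + \<beta>y)\<close> the map \<open>(f, g)\<close> becomes \<open>(u, s) \<mapsto> (u, h (u, s))\<close>, and
  \<open>\<partial>h/\<partial>s\<close> is the Jacobian determinant divided by \<open>D = \<beta> \<partial>\<^sub>x f - \<alpha> \<partial>\<^sub>y f\<close>.\<close>

lemma chart_of_component:
  fixes f g J :: "real \<times> real \<Rightarrow> real" and x y E :: "real \<Rightarrow> real"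
  assumes holo: "holo2 fC U" "holo2 gC U" "holo2 JC U" and S: "open S" "w0 \<in> S"
    and ext: "\<And>w. w \<in> S \<Longrightarrow> complexify w \<in> U" "\<And>w. w \<in> S \<Longrightarrow> fC (complexify w) = of_real (f w)"
      "\<And>w. w \<in> S \<Longrightarrow> gC (complexify w) = of_real (g w)" "\<And>w. w \<in> S \<Longrightarrow> JC (complexify w) = of_real (J w)"
    and J: "\<And>p. p \<in> S \<Longrightarrow> J p = c * (partial_x f p * partial_y g p - partial_y f p * partial_x g p)" and c: "c \<noteq> 0"
    and grad: "(partial_x f w0, partial_y f w0) \<noteq> (0, 0)" and regJ: "(partial_x J w0, partial_y J w0) \<noteq> (0, 0)"
    and curve: "\<rho> > 0" "(x 0, y 0) = w0" "\<And>t. \<bar>t\<bar> < \<rho> \<Longrightarrow> (x t, y t) \<in> S \<and> J (x t, y t) = 0 \<and>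
        (x has_real_derivative - partial_y J (x t, y t)) (at t) \<and> (y has_real_derivative partial_x J (x t, y t)) (at t)"
    and E: "isCont E 0" "E 0 \<noteq> 0" "\<forall>\<^sub>F t in nhds 0. ((\<lambda>t. f (x t, y t)) has_real_derivative t ^ (n - 1) * E t) (at t)"
    and n: "n > 0"
  shows "\<exists>S'\<subseteq>S. topological_chart S' (\<lambda>p. (f p, g p)) w0 (if odd n then fold_form else cusp_form)"
proof -
  \<comment> \<open>The gradient of the linear coordinate is that of \<open>f\<close> rotated by a
    right angle, so \<open>D w0\<close> is the squared length of the gradient of
    \<open>f\<close>.\<close>
  define \<alpha> where "\<alpha> = - partial_y f w0"
  define \<beta> where "\<beta> = partial_x f w0"
  define D where "D p = partial_x f p * \<beta> - partial_y f p * \<alpha>" for p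
  define DC where "DC p = partial_x fC p * of_real \<beta> - partial_y fC p * of_real \<alpha>" for p
  define K where "K p = J p / D p" for p
  note rf = real_partials[OF holo(1) S(1) ext(1,2)] and rg = real_partials[OF holo(2) S(1) ext(1,3)]
    and rJ = real_partials[OF holo(3) S(1) ext(1,4)]
  have D0: "D w0 \<noteq> 0"
  proof -
    have "D w0 = \<beta> * \<beta> + \<alpha> * \<alpha>" by (simp add: D_def \<alpha>_def \<beta>_def)
    moreover have "\<beta> \<noteq> 0 \<or> \<alpha> \<noteq> 0" using grad by (auto simp: \<alpha>_def \<beta>_def)
    ultimately show ?thesis by (metis add_nonneg_eq_0_iff mult_eq_0_iff zero_le_square)
  qed
  have U: "open U" by (rule holo2_open[OF holo(1)])
  have hDC: "holo2 DC U" unfolding DC_def[abs_def]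
    by (intro holo2_diff holo2_mult holo2_partial_x holo2_partial_y holo(1) holo2_const U)
  have DC: "DC (complexify w) = of_real (D w)" if "w \<in> S" for w
    using rf(1,2)[OF _ _ that] by (simp add: DC_def D_def)
  define U1 where "U1 = {p\<in>U. DC p \<noteq> 0}"
  have "U1 = U \<inter> DC -` (- {0})" by (auto simp: U1_def)
  then have U1: "open U1" "U1 \<subseteq> U"
    using continuous_open_preimage[OF holo2_continuous[OF hDC] U, of "- {0}"] by (auto simp: U1_def)
  have hK: "holo2 (\<lambda>p. JC p / DC p) U1"
    by (rule holo2_divide[OF holo2_subset[OF holo(3) U1] holo2_subset[OF hDC U1]]) (simp add: U1_def)
  have cf: "continuous_on S (partial_x f)" "continuous_on S (partial_y f)"
    using real_partials_continuous[OF holo(1) S(1) ext(1,2)] by auto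
  define S1 where "S1 = {p\<in>S. D p \<noteq> 0}"
  have "S1 = S \<inter> D -` (- {0})" by (auto simp: S1_def)
  moreover have "continuous_on S D" unfolding D_def[abs_def] by (intro continuous_intros cf)
  ultimately have S1: "open S1" "S1 \<subseteq> S" "w0 \<in> S1"
    using continuous_open_preimage[of S D "- {0}"] S D0 by (auto simp: S1_def)
  have KC: "complexify w \<in> U1" "JC (complexify w) / DC (complexify w) = of_real (K w)" if "w \<in> S1" for w
    using that ext(1,4)[of w] DC[of w] by (auto simp: S1_def U1_def K_def)
  note rK = real_partials[OF hK S1(1) KC]
  have K0: "partial_x K w0 = partial_x J w0 / D w0" "partial_y K w0 = partial_y J w0 / D w0"
  proof -
    have "J w0 = 0" using curve(3)[of 0] curve(1,2) by auto
    then have "JC (complexify w0) = 0" "DC (complexify w0) \<noteq> 0" using ext(4)[OF S(2)] DC[OF S(2)] D0 by auto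
    note q = partial_quotient_zero[OF holo(3) hDC ext(1)[OF S(2)] this(2,1)]
    have "complex_of_real (partial_x K w0) = of_real (partial_x J w0 / D w0)" "complex_of_real (partial_y K w0) = of_real (partial_y J w0 / D w0)"
      using q rK(1,2)[OF _ _ S1(3)] rJ(1,2)[OF _ _ S(2)] DC[OF S(2)] by simp_all
    then show "partial_x K w0 = partial_x J w0 / D w0" "partial_y K w0 = partial_y J w0 / D w0" by (simp_all only: of_real_eq_iff)
  qed
  have df: "(f has_derivative (\<lambda>h. partial_x f p * fst h + partial_y f p * snd h)) (at p)" if "p \<in> S" for p by (rule rf(3)[OF _ _ that])
  have dg: "(g has_derivative (\<lambda>h. partial_x g p * fst h + partial_y g p * snd h)) (at p)" if "p \<in> S" for p by (rule rg(3)[OF _ _ that])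
  have dK: "(K has_derivative (\<lambda>h. partial_x K p * fst h + partial_y K p * snd h)) (at p)" if "p \<in> S1" for p by (rule rK(3)[OF _ _ that])
  have cK: "continuous_on S1 (partial_x K)" "continuous_on S1 (partial_y K)"
    by (rule real_partials_continuous[OF hK S1(1) KC], assumption, assumption)+
  let ?l = "\<lambda>p. \<alpha> * fst p + \<beta> * snd p"
  obtain V B \<Psi> where V: "open V" "w0 \<in> V" "V \<subseteq> S1" "open B" "(f w0, ?l w0) \<in> B"
    and hom: "homeomorphism V B (\<lambda>p. (f p, ?l p)) \<Psi>" and DV: "\<And>p. p \<in> V \<Longrightarrow> D p \<noteq> 0"
    and d\<Psi>: "\<And>q. q \<in> B \<Longrightarrow> (\<Psi> has_derivative (\<lambda>h. ((\<beta> * fst h - partial_y f (\<Psi> q) * snd h) / D (\<Psi> q),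
                                  (- \<alpha> * fst h + partial_x f (\<Psi> q) * snd h) / D (\<Psi> q)))) (at q)"
    by (rule straightening[of S1 w0 f "partial_x f" "partial_y f" D \<beta> \<alpha>, OF S1(1,3) df _ _ D_def D0])
      (use S1(2) cf that in \<open>auto intro: continuous_on_subset\<close>)
  have \<Psi>V: "\<Psi> q \<in> V" if "q \<in> B" for q using hom that by (auto simp: homeomorphism_def)
  have \<Psi>p: "\<Psi> (f p, ?l p) = p" "(f p, ?l p) \<in> B" if "p \<in> V" for p using hom that by (auto simp: homeomorphism_def)
  have f\<Psi>: "f (\<Psi> q) = fst q" "?l (\<Psi> q) = snd q" if "q \<in> B" for q
    using homeomorphism_apply2[OF hom that] by (auto simp: prod_eq_iff)
  have VS: "p \<in> S" "p \<in> S1" if "p \<in> V" for p using that V(3) S1(2) by auto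
  define Mu where "Mu q = (\<beta> * partial_x K (\<Psi> q) - \<alpha> * partial_y K (\<Psi> q)) / D (\<Psi> q)" for q
  define Ms where "Ms q = (partial_x f (\<Psi> q) * partial_y K (\<Psi> q) - partial_y f (\<Psi> q) * partial_x K (\<Psi> q)) / D (\<Psi> q)" for q
  have d\<phi>: "((\<lambda>q. \<phi> (\<Psi> q)) has_derivative (\<lambda>h. (\<beta> * a - \<alpha> * b) / D (\<Psi> q) * fst h
      + (partial_x f (\<Psi> q) * b - partial_y f (\<Psi> q) * a) / D (\<Psi> q) * snd h)) (at q)"
    if "q \<in> B" "(\<phi> has_derivative (\<lambda>h. a * fst h + b * snd h)) (at (\<Psi> q))" for \<phi> :: "real \<times> real \<Rightarrow> real" and a b q
    by (rule has_derivative_eq_rhs[OF has_derivative_compose[OF d\<Psi>[OF that(1)] that(2)]])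
      (use DV[OF \<Psi>V[OF that(1)]] in \<open>simp add: fun_eq_iff field_simps\<close>)
  \<comment> \<open>With the factor \<open>c\<close> the derivative of \<open>h\<close> in
    \<open>s\<close> is exactly \<open>J / D\<close>, also when the components of the map have been
    exchanged and \<open>c\<close> is \<open>-1\<close>.\<close>
  define h where "h q = c * g (\<Psi> q)" for q
  have dh: "((\<lambda>s. h (u, s)) has_real_derivative K (\<Psi> (u, s))) (at s)" if q: "(u, s) \<in> B" for u s
  proof -
    note p = \<Psi>V[OF q]
    from DERIV_cmult[OF has_derivative_slices(2)[OF d\<phi>[OF q dg[OF VS(1)[OF p]]]], of c]
    show ?thesis by (simp add: h_def K_def J[OF VS(1)[OF p]])
  qed
  have dM: "((\<lambda>u. K (\<Psi> (u, s))) has_real_derivative Mu (u, s)) (at u)" "((\<lambda>s. K (\<Psi> (u, s))) has_real_derivative Ms (u, s)) (at s)"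
    if q: "(u, s) \<in> B" for u s
    using has_derivative_slices[OF d\<phi>[OF q dK[OF VS(2)[OF \<Psi>V[OF q]]]]] unfolding Mu_def Ms_def by auto
  have c\<Psi>: "continuous_on B \<Psi>" using hom by (simp add: homeomorphism_def)
  have im\<Psi>: "\<Psi> ` B \<subseteq> S1" "\<Psi> ` B \<subseteq> S" using \<Psi>V V(3) S1(2) by (blast+)
  have cg: "continuous_on S g" using dg by (auto intro!: continuous_at_imp_continuous_on has_derivative_continuous)
  have ch: "continuous_on B h" unfolding h_def by (intro continuous_intros continuous_on_compose2[OF cg c\<Psi> im\<Psi>(2)])
  have cD: "continuous_on S D" unfolding D_def[abs_def] by (intro continuous_intros cf)
  have cM: "continuous_on B Mu" "continuous_on B Ms" unfolding Mu_def Ms_def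
    by (intro continuous_intros continuous_on_compose2[OF cK(1) c\<Psi> im\<Psi>(1)] continuous_on_compose2[OF cK(2) c\<Psi> im\<Psi>(1)]
        continuous_on_compose2[OF cf(1) c\<Psi> im\<Psi>(2)] continuous_on_compose2[OF cf(2) c\<Psi> im\<Psi>(2)] continuous_on_compose2[OF cD c\<Psi> im\<Psi>(2)];
        use DV \<Psi>V in blast)+
  have cM0: "isCont Mu (f w0, ?l w0)" "isCont Ms (f w0, ?l w0)"
    using cM V(4,5) by (auto simp: continuous_on_eq_continuous_at)
  let ?x' = "\<lambda>t. - partial_y J (x t, y t)" and ?y' = "\<lambda>t. partial_x J (x t, y t)"
  have cxy: "isCont (\<lambda>t. (x t, y t)) 0"
    using curve(3)[of 0] curve(1) by (auto intro!: isCont_Pair DERIV_isCont)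
  have evV: "\<forall>\<^sub>F t in nhds 0. (x t, y t) \<in> V"
    by (rule isCont_eventually_nhds[OF cxy V(1)]) (use V(2) curve(2) in simp)
  have cJ: "isCont (partial_x J) w0" "isCont (partial_y J) w0"
    using real_partials_continuous[OF holo(3) S(1) ext(1,4)] S by (auto simp: continuous_on_eq_continuous_at)
  have cxy': "isCont ?x' 0" "isCont ?y' 0"
    using cJ curve(2) by (auto intro!: continuous_minus isCont_o2[where f = "\<lambda>t. (x t, y t)", OF cxy])
  obtain r where r: "r > 0" "\<And>t. \<bar>t\<bar> < r \<Longrightarrow> (x t, y t) \<in> V \<and> ((\<lambda>t. f (x t, y t)) has_real_derivative t ^ (n - 1) * E t) (at t)"
    using eventually_conj[OF evV E(3)] unfolding eventually_nhds_metric dist_real_def by auto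
  define r' where "r' = min r \<rho>"
  have r': "r' > 0" "\<And>t. \<bar>t\<bar> < r' \<Longrightarrow> \<bar>t\<bar> < r \<and> \<bar>t\<bar> < \<rho>" using r(1) curve(1) by (auto simp: r'_def)
  have s0: "t ^ (n - 1) * E t = partial_x f (x t, y t) * ?x' t + partial_y f (x t, y t) * ?y' t" if "\<bar>t\<bar> < r'" for t
  proof (rule DERIV_unique)
    show "((\<lambda>t. f (x t, y t)) has_real_derivative t ^ (n - 1) * E t) (at t)" using r r' that by blast
    show "((\<lambda>t. f (x t, y t)) has_real_derivative partial_x f (x t, y t) * ?x' t + partial_y f (x t, y t) * ?y' t) (at t)"
      by (rule grad_curve[OF df]) (use curve(3) r'(2)[OF that] in auto)
  qed
  \<comment> \<open>The factor \<open>0 ^ (n - 1)\<close> is \<open>1\<close> for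
    \<open>n = 1\<close> and \<open>0\<close> otherwise. In the first case the gradients of
    \<open>f\<close> and \<open>J\<close> at \<open>w0\<close> are independent, in the second they
    are dependent.\<close>
  have lead: "0 ^ (n - 1) * E 0 = partial_y f w0 * partial_x J w0 - partial_x f w0 * partial_y J w0"
    using s0[of 0] r'(1) curve(2) by simp
  have "\<exists>S'\<subseteq>B. topological_chart S' (\<lambda>p. (fst p, h p)) (f w0, ?l w0) (if odd n then fold_form else cusp_form)"
  proof (rule straightened_chart[where M = "\<lambda>q. K (\<Psi> q)" and a = "\<lambda>t. f (x t, y t)" and b = "\<lambda>t. ?l (x t, y t)"
        and b' = "\<lambda>t. \<alpha> * ?x' t + \<beta> * ?y' t" and E = E, OF V(4,5) ch dh dM(2,1) cM0 r'(1)])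
    show "(f (x t, y t), ?l (x t, y t)) \<in> B \<and> K (\<Psi> (f (x t, y t), ?l (x t, y t))) = 0" if "\<bar>t\<bar> < r'" for t
      using \<Psi>p[of "(x t, y t)"] r(2)[of t] r'(2)[OF that] curve(3)[of t] by (simp add: K_def)
    show "f (x 0, y 0) = f w0" "?l (x 0, y 0) = ?l w0" using curve(2) by auto
    show "((\<lambda>t. f (x t, y t)) has_real_derivative t ^ (n - 1) * E t) (at t)" if "\<bar>t\<bar> < r'" for t
      using r(2) r'(2)[OF that] by blast
    show "((\<lambda>t. ?l (x t, y t)) has_real_derivative \<alpha> * ?x' t + \<beta> * ?y' t) (at t)" if "\<bar>t\<bar> < r'" for t
      using curve(3)[of t] r'(2)[OF that] unfolding fst_conv snd_conv by (intro DERIV_add DERIV_cmult) auto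
    show "isCont E 0" "E 0 \<noteq> 0" "n > 0" by (fact E n)+
    show "isCont (\<lambda>t. \<alpha> * ?x' t + \<beta> * ?y' t) 0" by (intro continuous_intros cxy')
    show "Ms (f w0, ?l w0) \<noteq> 0" if "n = 1"
    proof -
      have "Ms (f w0, ?l w0) = - (partial_y f w0 * partial_x J w0 - partial_x f w0 * partial_y J w0) / D w0 / D w0"
        using D0 by (simp add: Ms_def \<Psi>p(1)[OF V(2)] K0 field_simps)
      also have "\<dots> \<noteq> 0" using lead that E(2) D0 by simp
      finally show ?thesis .
    qed
    show "Mu (f w0, ?l w0) \<noteq> 0 \<and> \<alpha> * ?x' 0 + \<beta> * ?y' 0 \<noteq> 0" if "n > 1"
    proof -
      \<comment> \<open>By the choice of \<alpha> and \<beta> this is the inner product of the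
        gradients of \<open>f\<close> and \<open>J\<close>. Both are nonzero and here they are
        parallel, so it does not vanish.\<close>
      let ?m = "\<beta> * partial_x J w0 - \<alpha> * partial_y J w0"
      have "partial_y f w0 * partial_x J w0 = partial_x f w0 * partial_y J w0" using lead that by (simp add: power_0_left)
      then have "\<beta> * partial_y J w0 = - (\<alpha> * partial_x J w0)" by (simp add: \<alpha>_def \<beta>_def)
      moreover have "\<alpha> * ?m = \<beta> * (\<alpha> * partial_x J w0) - \<alpha> * \<alpha> * partial_y J w0"
        "\<beta> * ?m = \<beta> * \<beta> * partial_x J w0 - \<alpha> * (\<beta> * partial_y J w0)" by (simp_all add: algebra_simps)
      ultimately have "\<alpha> * ?m = - (\<beta> * \<beta> + \<alpha> * \<alpha>) * partial_y J w0" "\<beta> * ?m = (\<beta> * \<beta> + \<alpha> * \<alpha>) * partial_x J w0"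
        by (simp_all add: algebra_simps)
      moreover have "\<beta> * \<beta> + \<alpha> * \<alpha> \<noteq> 0" using D0 by (simp add: D_def \<alpha>_def \<beta>_def)
      ultimately have m: "?m \<noteq> 0" using regJ by auto
      have "Mu (f w0, ?l w0) = ?m / D w0 / D w0"
        using D0 by (simp add: Mu_def \<Psi>p(1)[OF V(2)] K0 field_simps)
      then show ?thesis using m D0 curve(2) by simp
    qed
  qed
  then obtain S' where S': "S' \<subseteq> B" "topological_chart S' (\<lambda>p. (fst p, h p)) (f w0, ?l w0) (if odd n then fold_form else cusp_form)" by blast
  have "topological_chart {p\<in>V. (f p, ?l p) \<in> S'} (\<lambda>p. (f p, g p)) w0 (if odd n then fold_form else cusp_form)"
  proof (rule topological_chart_transport[OF S'(2) V(1,2), where L = "\<lambda>r. (fst r, c * snd r)"])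
    show "continuous_on V (\<lambda>p. (f p, ?l p))" using hom by (simp add: homeomorphism_def)
    show "inj_on (\<lambda>p. (f p, ?l p)) V" by (rule inj_on_inverseI[of _ \<Psi>]) (rule \<Psi>p(1))
    show "continuous_on UNIV (\<lambda>r. (fst r, c * snd r))" by (intro continuous_intros)
    show "inj (\<lambda>r. (fst r, c * snd r))" using c by (auto simp: inj_on_def)
  qed (auto simp: h_def \<Psi>p(1))
  moreover have "{p\<in>V. (f p, ?l p) \<in> S'} \<subseteq> S" using VS by auto
  ultimately show ?thesis by blast
qed

text \<open>The Jacobian is constant along its own Hamiltonian flow, hence zero on \<Gamma>, as
  \<open>chart_of_component\<close> demands. If the second component is the one with nonzero
  gradient, the components are exchanged with \<open>c = - 1\<close>, and the exchange is undone in
  the range by \<open>prod.swap\<close>.\<close>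

lemma real_topological_model:
  fixes F :: "real \<times> real \<Rightarrow> real \<times> real"
  assumes W: "open W" "K_analytic_map F W" and reg: "regular_critical_point W F w0"
    and nat: "natural_parametrization W F w0 \<Gamma>" and ord: "curve_order (F \<circ> \<Gamma>) = enat n"
  shows "topological_model W F w0 (if odd n then fold_form else cusp_form)"
proof -
  have w0: "w0 \<in> W" using reg by (auto simp: regular_critical_point_def critical_set_def)
  have n: "n > 0" using ord by (simp add: curve_order_eq_enat_iff)
  obtain U G S where X: "real_extension F G U S" and Sw: "w0 \<in> S" "S \<subseteq> W"
    by (rule real_extension_exists[OF W w0]) (rule that)
  interpret real_extension F G U S by (rule X)
  obtain r where r: "r > 0" and \<Gamma>0: "\<Gamma> 0 = w0" and ode: "\<And>t. \<bar>t\<bar> < r \<Longrightarrow>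
        ((\<lambda>s. fst (\<Gamma> s)) has_field_derivative - partial_y (jacobian F) (\<Gamma> t)) (at t) \<and>
        ((\<lambda>s. snd (\<Gamma> s)) has_field_derivative partial_x (jacobian F) (\<Gamma> t)) (at t)"
    using nat unfolding natural_parametrization_def by (auto simp: dist_norm)
  have "isCont (\<lambda>s. fst (\<Gamma> s)) 0" "isCont (\<lambda>s. snd (\<Gamma> s)) 0" using ode[of 0] r DERIV_isCont by auto
  from isCont_Pair[OF this] have "isCont \<Gamma> 0" by simp
  from isCont_eventually_nhds[OF this S] have inS: "\<forall>\<^sub>F t in nhds 0. \<Gamma> t \<in> S" using Sw \<Gamma>0 by simp
  then obtain r1 where r1: "r1 > 0" "\<And>t. \<bar>t\<bar> < r1 \<Longrightarrow> \<Gamma> t \<in> S"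
    unfolding eventually_nhds_metric dist_real_def by auto
  define \<rho> where "\<rho> = min r r1"
  have \<rho>: "\<rho> > 0" using r r1 by (simp add: \<rho>_def)
  have J0: "jacobian F w0 = 0" and regJ: "(partial_x (jacobian F) w0, partial_y (jacobian F) w0) \<noteq> (0, 0)"
    using reg by (auto simp: regular_critical_point_def critical_set_def)
  have dJ: "((\<lambda>t. jacobian F (fst (\<Gamma> t), snd (\<Gamma> t))) has_real_derivative 0) (at t)" if "\<bar>t\<bar> < \<rho>" for t
    using grad_curve[where x = "\<lambda>t. fst (\<Gamma> t)" and y = "\<lambda>t. snd (\<Gamma> t)" and t = t, of "jacobian F"]
      partialsJ(3)[of "\<Gamma> t"] ode[of t] r1(2)[of t] that by (fastforce simp: \<rho>_def)
  have J\<Gamma>: "jacobian F (\<Gamma> t) = 0" if t: "\<bar>t\<bar> < \<rho>" for t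
  proof -
    have "\<exists>c. \<forall>t\<in>{-\<rho><..<\<rho>}. jacobian F (fst (\<Gamma> t), snd (\<Gamma> t)) = c"
      by (rule has_field_derivative_zero_constant) (use dJ in \<open>auto intro: has_field_derivative_at_within\<close>)
    then obtain c where c: "\<And>t. t \<in> {-\<rho><..<\<rho>} \<Longrightarrow> jacobian F (fst (\<Gamma> t), snd (\<Gamma> t)) = c" by blast
    have "jacobian F (fst (\<Gamma> t), snd (\<Gamma> t)) = jacobian F (fst (\<Gamma> 0), snd (\<Gamma> 0))"
      using c[of t] c[of 0] t \<rho> by (simp add: abs_less_iff)
    then show ?thesis using J0 \<Gamma>0 by simp
  qed
  have curve: "(fst (\<Gamma> 0), snd (\<Gamma> 0)) = w0" "(fst (\<Gamma> t), snd (\<Gamma> t)) \<in> S \<and> jacobian F (fst (\<Gamma> t), snd (\<Gamma> t)) = 0 \<and>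
      ((\<lambda>t. fst (\<Gamma> t)) has_real_derivative - partial_y (jacobian F) (fst (\<Gamma> t), snd (\<Gamma> t))) (at t) \<and>
      ((\<lambda>t. snd (\<Gamma> t)) has_real_derivative partial_x (jacobian F) (fst (\<Gamma> t), snd (\<Gamma> t))) (at t)" if "\<bar>t\<bar> < \<rho>" for t
    using \<Gamma>0 J\<Gamma>[OF that] ode[of t] r1(2)[of t] that by (auto simp: \<rho>_def)
  note L = leading_derivatives[OF reg Sw(1) nat ord]
  have "(partial_x (\<lambda>p. fst (F p)) w0, partial_y (\<lambda>p. fst (F p)) w0) \<noteq> (0, 0) \<or>
        (partial_x (\<lambda>p. snd (F p)) w0, partial_y (\<lambda>p. snd (F p)) w0) \<noteq> (0, 0)"
    using regular_imp_gradient_nonzero[OF holo(1,2) regular_ext[OF reg Sw(1)]] partials1[OF Sw(1)] partials2[OF Sw(1)] by auto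
  then have "\<exists>S'\<subseteq>S. topological_chart S' F w0 (if odd n then fold_form else cusp_form)"
  proof
    assume g: "(partial_x (\<lambda>p. fst (F p)) w0, partial_y (\<lambda>p. fst (F p)) w0) \<noteq> (0, 0)"
    from L(1)[OF g] obtain E where E: "isCont E 0" "E 0 \<noteq> 0"
      "\<forall>\<^sub>F t in nhds 0. ((\<lambda>t. fst (F (\<Gamma> t))) has_field_derivative t ^ (n - 1) * E t) (at t)" by blast
    have "\<exists>S'\<subseteq>S. topological_chart S' (\<lambda>p. (fst (F p), snd (F p))) w0 (if odd n then fold_form else cusp_form)"
      by (rule chart_of_component[where J = "jacobian F" and c = 1, OF holo S Sw(1) ext(1) ext_comp jacobian_ext _ _ g regJ \<rho> curve(1)[of 0] curve(2) E(1,2) _ n])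
        (use E(3) \<rho> in \<open>auto simp: jacobian_def\<close>)
    then show ?thesis by simp
  next
    assume g: "(partial_x (\<lambda>p. snd (F p)) w0, partial_y (\<lambda>p. snd (F p)) w0) \<noteq> (0, 0)"
    from L(2)[OF g] obtain E where E: "isCont E 0" "E 0 \<noteq> 0"
      "\<forall>\<^sub>F t in nhds 0. ((\<lambda>t. snd (F (\<Gamma> t))) has_field_derivative t ^ (n - 1) * E t) (at t)" by blast
    have "\<exists>S'\<subseteq>S. topological_chart S' (\<lambda>p. (snd (F p), fst (F p))) w0 (if odd n then fold_form else cusp_form)"
      by (rule chart_of_component[where J = "jacobian F" and c = "-1", OF holo(2,1,3) S Sw(1) ext(1) ext_comp(2,1) jacobian_ext _ _ g regJ \<rho> curve(1)[of 0] curve(2) E(1,2) _ n])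
        (use E(3) \<rho> in \<open>auto simp: jacobian_def\<close>)
    then obtain S' where S': "S' \<subseteq> S" "topological_chart S' (\<lambda>p. (snd (F p), fst (F p))) w0 (if odd n then fold_form else cusp_form)" by blast
    have "topological_chart {p\<in>S. p \<in> S'} F w0 (if odd n then fold_form else cusp_form)"
      by (rule topological_chart_transport[OF S'(2) S Sw(1), where \<Phi> = "\<lambda>p. p" and L = prod.swap])
        (auto simp: prod.swap_def intro!: continuous_intros inj_onI)
    then show ?thesis by (intro exI[of _ "{p\<in>S. p \<in> S'}"]) simp
  qed
  then obtain S' where "S' \<subseteq> S" "topological_chart S' F w0 (if odd n then fold_form else cusp_form)" by blast
  then show ?thesis using topological_chart_imp_model[of S'] Sw(2) by (meson order_trans)
qed

text \<open>Its contrapositive recognizes critical points topologically: where \<open>F\<close> is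
  injective on no neighbourhood, the Jacobian vanishes.\<close>

lemma K_analytic_locally_injective:
  fixes F :: "real \<times> real \<Rightarrow> real \<times> real"
  assumes W: "open W" "K_analytic_map F W" and w: "w \<in> W" "jacobian F w \<noteq> 0"
  obtains V where "open V" "w \<in> V" "inj_on F V"
proof -
  obtain U G S where X: "real_extension F G U S" and Sw: "w \<in> S"
    by (rule real_extension_exists[OF W w(1)]) (rule that)
  interpret real_extension F G U S by (rule X)
  obtain V B \<Psi> where "open V" "w \<in> V" and hom: "homeomorphism V B (\<lambda>p. (fst (F p), snd (F p))) \<Psi>"
    by (rule local_diffeomorphism[OF S Sw partials1(3) partials2(3) real_partials_continuous[OF holo(1) S ext(1) ext_comp(1)]
        real_partials_continuous[OF holo(2) S ext(1) ext_comp(2)] jacobian_def w(2)]) (assumption | rule that)+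
  have "inj_on F V" by (rule inj_on_inverseI[of _ \<Psi>]) (use homeomorphism_apply1[OF hom] in simp)
  then show ?thesis using \<open>open V\<close> \<open>w \<in> V\<close> that by blast
qed

section \<open>Numbers of preimages in the models\<close>

lemma ecard_image: "inj_on f A \<Longrightarrow> ecard (f ` A) = ecard A"
  by (simp add: ecard_def card_image finite_image_iff)

text \<open>Homeomorphisms do not preserve the Jacobian, so the exceptional values of the model are
  described by failure of local injectivity, which they do preserve. By
  \<open>K_analytic_locally_injective\<close> such a failure can occur only over a critical value of
  \<open>F\<close>, and these values are excluded.\<close>

lemma model_imp_preimage_counts:
  fixes F G :: "real \<times> real \<Rightarrow> real \<times> real"
  assumes W: "open W" "K_analytic_map F W" and model: "topological_model W F w0 G" and G0: "G (0, 0) = (0, 0)"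
    and loc: "\<And>T. open T \<Longrightarrow> (0, 0) \<in> T \<Longrightarrow> \<exists>N M. open N \<and> (0, 0) \<in> N \<and> N \<subseteq> T \<and> open M \<and> (0, 0) \<in> M \<and>
       (\<forall>\<zeta>\<in>M. ecard {p\<in>N. G p = \<zeta>} \<in> C \<or> (\<exists>p\<in>N. G p = \<zeta> \<and> (\<forall>T'. open T' \<and> p \<in> T' \<longrightarrow> \<not> inj_on G T')))"
  shows "local_preimage_counts W F w0 C"
  unfolding local_preimage_counts_def
proof (intro allI impI)
  fix O' assume O': "open O' \<and> w0 \<in> O'"
  obtain U h h' NF H H' where U: "open U" "(0, 0) \<in> U" "h ` U \<subseteq> W" and h: "homeomorphism U (h ` U) h h'" "h (0, 0) = w0"
    and NF: "open NF" "F ` h ` U \<subseteq> NF" "homeomorphism NF (H ` NF) H H'" and HG: "\<And>p. p \<in> U \<Longrightarrow> H (F (h p)) = G p"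
    using model unfolding topological_model_def by metis
  have ch: "continuous_on U h" using h(1) by (simp add: homeomorphism_def)
  have injh: "inj_on h U" by (rule inj_on_inverseI[of _ h']) (use homeomorphism_apply1[OF h(1)] in simp)
  have injH: "inj_on H NF" by (rule inj_on_inverseI[of _ H']) (use homeomorphism_apply1[OF NF(3)] in simp)
  have cH: "continuous_on NF H" using NF(3) by (simp add: homeomorphism_def)
  have oU: "open (U \<inter> h -` O')" using continuous_open_preimage[OF ch U(1)] O' by blast
  have "(0, 0) \<in> U \<inter> h -` O'" using U(2) h(2) O' by simp
  from loc[OF oU this] obtain N M where N: "open N" "(0, 0) \<in> N" "N \<subseteq> U \<inter> h -` O'" and M: "open M" "(0, 0) \<in> M"
    and cnt: "\<And>\<zeta>. \<zeta> \<in> M \<Longrightarrow> ecard {p\<in>N. G p = \<zeta>} \<in> C \<or> (\<exists>p\<in>N. G p = \<zeta> \<and> (\<forall>T'. open T' \<and> p \<in> T' \<longrightarrow> \<not> inj_on G T'))"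
    by blast
  have NU: "N \<subseteq> U" using N(3) by blast
  show "\<exists>N M. open N \<and> w0 \<in> N \<and> N \<subseteq> W \<inter> O' \<and> open M \<and> F w0 \<in> M \<and>
           (\<forall>z\<in>M - F ` critical_set N F. ecard {w\<in>N. F w = z} \<in> C)"
  proof (intro exI conjI ballI)
    show "open (h ` N)"
      by (rule invariance_of_domain[OF continuous_on_subset[OF ch NU] N(1) inj_on_subset[OF injh NU]])
    show "w0 \<in> h ` N" using N(2) h(2) by (metis imageI)
    show "h ` N \<subseteq> W \<inter> O'" using N(3) U(3) by auto
    show "open (NF \<inter> H -` M)" by (rule continuous_open_preimage[OF cH NF(1) M(1)])
    show "F w0 \<in> NF \<inter> H -` M" using NF(2) U(2) h(2) HG[OF U(2)] G0 M(2) by auto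
    fix z assume z: "z \<in> NF \<inter> H -` M - F ` critical_set (h ` N) F"
    have Fz: "F (h p) = z \<longleftrightarrow> G p = H z" if "p \<in> N" for p
    proof -
      have "p \<in> U" "F (h p) \<in> NF" "z \<in> NF" using that NU NF(2) z by auto
      then show ?thesis using HG[of p] inj_onD[OF injH, of "F (h p)" z] by metis
    qed
    have eq: "{w\<in>h ` N. F w = z} = h ` {p\<in>N. G p = H z}" using Fz by blast
    have "\<not> (\<exists>p\<in>N. G p = H z \<and> (\<forall>T'. open T' \<and> p \<in> T' \<longrightarrow> \<not> inj_on G T'))"
    proof
      assume "\<exists>p\<in>N. G p = H z \<and> (\<forall>T'. open T' \<and> p \<in> T' \<longrightarrow> \<not> inj_on G T')"
      then obtain p where p: "p \<in> N" "G p = H z" and ninj: "\<And>T'. open T' \<Longrightarrow> p \<in> T' \<Longrightarrow> \<not> inj_on G T'" by blast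
      have "jacobian F (h p) = 0"
      proof (rule ccontr)
        assume J: "jacobian F (h p) \<noteq> 0"
        have "h p \<in> W" using p(1) NU U(3) by auto
        then obtain V where V: "open V" "h p \<in> V" "inj_on F V"
          by (rule K_analytic_locally_injective[OF W _ J]) (rule that)
        have "inj_on G (U \<inter> h -` V)"
        proof (rule inj_onI)
          fix a b assume ab: "a \<in> U \<inter> h -` V" "b \<in> U \<inter> h -` V" "G a = G b"
          then have "H (F (h a)) = H (F (h b))" using HG by simp
          then have "F (h a) = F (h b)" using inj_onD[OF injH] NF(2) ab by blast
          then have "h a = h b" using inj_onD[OF V(3)] ab by blast
          then show "a = b" using inj_onD[OF injh] ab by blast
        qed
        moreover have "open (U \<inter> h -` V)" by (rule continuous_open_preimage[OF ch U(1) V(1)])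
        moreover have "p \<in> U \<inter> h -` V" using p(1) NU V(2) by auto
        ultimately show False using ninj by blast
      qed
      then have "h p \<in> critical_set (h ` N) F" using p(1) by (simp add: critical_set_def)
      moreover have "F (h p) = z" using Fz[OF p(1)] p(2) by simp
      ultimately have "z \<in> F ` critical_set (h ` N) F" by blast
      then show False using z by blast
    qed
    then have "ecard {p\<in>N. G p = H z} \<in> C" using cnt[of "H z"] z by blast
    moreover have "inj_on h {p\<in>N. G p = H z}" by (rule inj_on_subset[OF injh]) (use NU in auto)
    ultimately show "ecard {w\<in>h ` N. F w = z} \<in> C"
      unfolding eq by (simp add: ecard_image)
  qed
qed

text \<open>The radius \<open>r\<^sup>2\<close> in the range fits the radius \<open>r\<close> in the
  source, so both square roots of a positive \<open>v\<close> lie in the box. Over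
  \<open>v = 0\<close> the points \<open>(u, e)\<close> and \<open>(u, - e)\<close> show that the
  fold is not locally injective.\<close>

lemma fold_preimage_counts:
  fixes F :: "real \<times> real \<Rightarrow> real \<times> real"
  assumes W: "open W" "K_analytic_map F W" and model: "topological_model W F w0 fold_form"
  shows "local_preimage_counts W F w0 {0, 2}"
proof (rule model_imp_preimage_counts[OF W model])
  fix T :: "(real \<times> real) set" assume T: "open T" "(0, 0) \<in> T"
  obtain r where r: "r > 0" "cball 0 r \<times> cball 0 r \<subseteq> T" by (rule open_bidisc[OF T]) (rule that)
  have cnt: "ecard {p\<in>ball 0 r \<times> ball 0 r. fold_form p = \<zeta>} \<in> {0, 2} \<or>
      (\<exists>p\<in>ball 0 r \<times> ball 0 r. fold_form p = \<zeta> \<and> (\<forall>T'. open T' \<and> p \<in> T' \<longrightarrow> \<not> inj_on fold_form T'))"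
    if \<zeta>: "\<zeta> \<in> ball 0 r \<times> ball 0 (r\<^sup>2)" for \<zeta>
  proof -
    obtain u v where uv: "\<zeta> = (u, v)" by fastforce
    have u: "\<bar>u\<bar> < r" "\<bar>v\<bar> < r\<^sup>2" using \<zeta> uv by auto
    consider "v < 0" | "v = 0" | "v > 0" by linarith
    then show ?thesis
    proof cases
      case 1
      have "v \<noteq> y\<^sup>2" for y using 1 by (metis not_less zero_le_power2)
      then have e: "{p\<in>ball 0 r \<times> ball 0 r. fold_form p = \<zeta>} = {}" by (auto simp: fold_form_def uv)
      show ?thesis unfolding e by (simp add: ecard_def zero_enat_def)
    next
      case 2
      have "\<not> inj_on fold_form T'" if T': "open T'" "(u, 0) \<in> T'" for T'
      proof
        assume inj: "inj_on fold_form T'"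
        obtain e where e: "e > 0" "cball u e \<times> cball 0 e \<subseteq> T'" by (rule open_bidisc[OF T']) (rule that)
        then have "(u, e) \<in> T'" "(u, - e) \<in> T'" by auto
        then show False using inj_onD[OF inj, of "(u, e)" "(u, - e)"] e(1) by (simp add: fold_form_def)
      qed
      moreover have "(u, 0) \<in> ball 0 r \<times> ball 0 r" "fold_form (u, 0) = \<zeta>" using u r(1) 2 by (auto simp: fold_form_def uv)
      ultimately show ?thesis by blast
    next
      case 3
      have "sqrt v < r" using u 3 r(1) by (intro real_less_lsqrt) auto
      then have lt: "\<bar>sqrt v\<bar> < r" using 3 by simp
      have sq: "(sqrt v)\<^sup>2 = v" using 3 by simp
      have "y\<^sup>2 = v \<longleftrightarrow> y = sqrt v \<or> y = - sqrt v" for y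
        by (subst sq[symmetric]) (rule power2_eq_iff)
      then have e: "{p\<in>ball 0 r \<times> ball 0 r. fold_form p = \<zeta>} = {(u, sqrt v), (u, - sqrt v)}"
        using u lt by (auto simp: fold_form_def uv)
      have "sqrt v \<noteq> - sqrt v" using 3 by simp
      then show ?thesis unfolding e by (simp add: ecard_def numeral_eq_enat)
    qed
  qed
  show "\<exists>N M. open N \<and> (0, 0) \<in> N \<and> N \<subseteq> T \<and> open M \<and> (0, 0) \<in> M \<and>
       (\<forall>\<zeta>\<in>M. ecard {p\<in>N. fold_form p = \<zeta>} \<in> {0, 2} \<or> (\<exists>p\<in>N. fold_form p = \<zeta> \<and> (\<forall>T'. open T' \<and> p \<in> T' \<longrightarrow> \<not> inj_on fold_form T')))"
    by (rule exI[of _ "ball 0 r \<times> ball 0 r"], rule exI[of _ "ball 0 r \<times> ball 0 (r\<^sup>2)"], intro conjI ballI open_Times open_ball cnt)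
      (use r in auto)
qed (simp add: fold_form_def)

text \<open>Splitting off the root \<open>y1\<close> leaves a quadratic which, after completing the
  square, reads \<open>(2 * y + y1)\<^sup>2 = \<Delta>\<close>. Whenever two of the three roots
  coincide, the derivative of the cubic vanishes there.\<close>

lemma cubic_root_count:
  fixes u v y1 :: real
  assumes y1: "u * y1 + y1 ^ 3 = v"
  shows "(\<exists>y. u * y + y ^ 3 = v \<and> u + 3 * y\<^sup>2 = 0) \<or> ecard {y. u * y + y ^ 3 = v} \<in> {1, 3}"
proof -
  define \<Delta> where "\<Delta> = - 3 * y1\<^sup>2 - 4 * u"
  have root: "u * y + y ^ 3 = v \<longleftrightarrow> y = y1 \<or> (2 * y + y1)\<^sup>2 = \<Delta>" for y
  proof -
    have "4 * (u * y + y ^ 3 - v) = (y - y1) * ((2 * y + y1)\<^sup>2 - \<Delta>)"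
      unfolding y1[symmetric] \<Delta>_def by (simp add: algebra_simps power2_eq_square power3_eq_cube)
    then show ?thesis by (metis eq_iff_diff_eq_0 mult_eq_0_iff zero_neq_numeral)
  qed
  consider "\<Delta> < 0" | "\<Delta> = 0" | "\<Delta> > 0" by linarith
  then show ?thesis
  proof cases
    case 1
    have "(2 * y + y1)\<^sup>2 \<noteq> \<Delta>" for y using 1 by (metis not_less zero_le_power2)
    then have "{y. u * y + y ^ 3 = v} = {y1}" unfolding root by auto
    then show ?thesis by (simp add: ecard_def one_enat_def)
  next
    case 2
    have "u * (- y1 / 2) + (- y1 / 2) ^ 3 = v" unfolding root using 2 by simp
    moreover have "u + 3 * (- y1 / 2)\<^sup>2 = 0" using 2 by (simp add: \<Delta>_def power2_eq_square)
    ultimately show ?thesis by blast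
  next
    case 3
    define y2 where "y2 = (- y1 + sqrt \<Delta>) / 2"
    define y3 where "y3 = (- y1 - sqrt \<Delta>) / 2"
    have sq: "(sqrt \<Delta>)\<^sup>2 = \<Delta>" using 3 by simp
    have q: "(2 * y + y1)\<^sup>2 = \<Delta> \<longleftrightarrow> y = y2 \<or> y = y3" for y
    proof -
      have "(2 * y + y1)\<^sup>2 = \<Delta> \<longleftrightarrow> 2 * y + y1 = sqrt \<Delta> \<or> 2 * y + y1 = - sqrt \<Delta>"
        by (subst sq[symmetric]) (rule power2_eq_iff)
      then show ?thesis by (auto simp: y2_def y3_def)
    qed
    have n23: "y2 \<noteq> y3" using 3 by (simp add: y2_def y3_def)
    show ?thesis
    proof (cases "y1 = y2 \<or> y1 = y3")
      case True
      then have "(2 * y1 + y1)\<^sup>2 = \<Delta>" using q by blast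
      then have "u + 3 * y1\<^sup>2 = 0" by (simp add: \<Delta>_def power2_eq_square)
      then show ?thesis using y1 by blast
    next
      case False
      have "{y. u * y + y ^ 3 = v} = {y1, y2, y3}" unfolding root q by auto
      then show ?thesis using False n23 by (simp add: ecard_def numeral_eq_enat)
    qed
  qed
qed

text \<open>Outside distance \<open>r\<close> the cubic term dominates, so for small
  \<open>u\<close> and \<open>v\<close> all roots lie within \<open>r\<close>; counting preimages in
  the box is then counting the roots of a cubic on the whole line.\<close>

lemma cusp_form_local:
  fixes T :: "(real \<times> real) set"
  assumes T: "open T" "(0, 0) \<in> T"
  obtains r \<delta> :: real where "r > 0" "\<delta> > 0" "ball 0 \<delta> \<times> ball 0 r \<subseteq> T"
    "\<And>u v y. \<bar>u\<bar> < \<delta> \<Longrightarrow> \<bar>v\<bar> < \<delta> \<Longrightarrow> u * y + y ^ 3 = v \<Longrightarrow> \<bar>y\<bar> < r"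
    "\<And>u v. \<bar>u\<bar> < \<delta> \<Longrightarrow> \<bar>v\<bar> < \<delta> \<Longrightarrow> \<exists>y. u * y + y ^ 3 = v"
proof -
  obtain r where r: "r > 0" "cball 0 r \<times> cball 0 r \<subseteq> T" by (rule open_bidisc[OF T]) (rule that)
  \<comment> \<open>The bound \<open>r\<close> keeps the box inside \<open>T\<close>;
    \<open>r\<^sup>2 / 2\<close> gives \<open>r\<^sup>2 / 2 \<le> u + y\<^sup>2\<close> for
    \<open>r \<le> y\<close>; and \<open>r ^ 3 / 2\<close> keeps \<open>v\<close> below the
    resulting value of the cubic.\<close>
  define \<delta> where "\<delta> = min r (min (r\<^sup>2 / 2) (r ^ 3 / 2))"
  have \<delta>: "\<delta> > 0" "\<delta> \<le> r" "\<delta> \<le> r\<^sup>2 / 2" "\<delta> \<le> r ^ 3 / 2" using r(1) by (auto simp: \<delta>_def)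
  have up: "v < u * y + y ^ 3" if "\<bar>u\<bar> < \<delta>" "\<bar>v\<bar> < \<delta>" "r \<le> y" for u v y
  proof -
    have "r\<^sup>2 \<le> y\<^sup>2" using that r(1) by (intro power_mono) auto
    then have "r\<^sup>2 / 2 \<le> u + y\<^sup>2" using that(1) \<delta>(3) unfolding abs_less_iff by linarith
    then have "r * (r\<^sup>2 / 2) \<le> y * (u + y\<^sup>2)" using that r(1) by (intro mult_mono) auto
    then have "r ^ 3 / 2 \<le> u * y + y ^ 3" by (simp add: algebra_simps power2_eq_square power3_eq_cube)
    then show ?thesis using that \<delta> by (simp add: abs_less_iff)
  qed
  have down: "u * y + y ^ 3 < v" if "\<bar>u\<bar> < \<delta>" "\<bar>v\<bar> < \<delta>" "y \<le> - r" for u v y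
    using up[of u "- v" "- y"] that by simp
  show ?thesis
  proof (rule that[OF r(1) \<delta>(1)])
    show "ball 0 \<delta> \<times> ball 0 r \<subseteq> T" using r(2) \<delta>(2) by (auto simp: subset_iff)
    show "\<bar>y\<bar> < r" if "\<bar>u\<bar> < \<delta>" "\<bar>v\<bar> < \<delta>" "u * y + y ^ 3 = v" for u v y
      using up[OF that(1,2), of y] down[OF that(1,2), of y] that(3) by (cases "r \<le> y"; cases "y \<le> - r") auto
    show "\<exists>y. u * y + y ^ 3 = v" if "\<bar>u\<bar> < \<delta>" "\<bar>v\<bar> < \<delta>" for u v
    proof -
      have "continuous_on {- r..r} (\<lambda>y. u * y + y ^ 3)" by (intro continuous_intros)
      from IVT'[OF _ _ _ this, of v] show ?thesis
        using up[OF that order_refl] down[OF that order_refl] r(1) by auto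
    qed
  qed
qed

lemma cusp_preimage_counts:
  fixes F :: "real \<times> real \<Rightarrow> real \<times> real"
  assumes W: "open W" "K_analytic_map F W" and model: "topological_model W F w0 cusp_form"
  shows "local_preimage_counts W F w0 {1, 3}"
proof (rule model_imp_preimage_counts[OF W model])
  fix T :: "(real \<times> real) set" assume T: "open T" "(0, 0) \<in> T"
  obtain r \<delta> :: real where r: "r > 0" "\<delta> > 0" "ball 0 \<delta> \<times> ball 0 r \<subseteq> T"
    and small: "\<And>u v y. \<bar>u\<bar> < \<delta> \<Longrightarrow> \<bar>v\<bar> < \<delta> \<Longrightarrow> u * y + y ^ 3 = v \<Longrightarrow> \<bar>y\<bar> < r"
    and ex: "\<And>u v. \<bar>u\<bar> < \<delta> \<Longrightarrow> \<bar>v\<bar> < \<delta> \<Longrightarrow> \<exists>y. u * y + y ^ 3 = v"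
  proof (rule cusp_form_local[OF T])
    fix r \<delta> :: real assume "r > 0" "\<delta> > 0" "ball 0 \<delta> \<times> ball 0 r \<subseteq> T"
    "\<And>u v y. \<bar>u\<bar> < \<delta> \<Longrightarrow> \<bar>v\<bar> < \<delta> \<Longrightarrow> u * y + y ^ 3 = v \<Longrightarrow> \<bar>y\<bar> < r"
    "\<And>u v. \<bar>u\<bar> < \<delta> \<Longrightarrow> \<bar>v\<bar> < \<delta> \<Longrightarrow> \<exists>y. u * y + y ^ 3 = v"
    then show ?thesis by (rule that)
  qed
  have cnt: "ecard {p\<in>ball 0 \<delta> \<times> ball 0 r. cusp_form p = \<zeta>} \<in> {1, 3} \<or>
      (\<exists>p\<in>ball 0 \<delta> \<times> ball 0 r. cusp_form p = \<zeta> \<and> (\<forall>T'. open T' \<and> p \<in> T' \<longrightarrow> \<not> inj_on cusp_form T'))"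
    if \<zeta>: "\<zeta> \<in> ball 0 \<delta> \<times> ball 0 \<delta>" for \<zeta>
  proof -
    obtain u v where uv: "\<zeta> = (u, v)" by fastforce
    have u: "\<bar>u\<bar> < \<delta>" "\<bar>v\<bar> < \<delta>" using \<zeta> uv by auto
    obtain y1 where "u * y1 + y1 ^ 3 = v" using ex[OF u] by blast
    from cubic_root_count[OF this] show ?thesis
    proof
      assume "\<exists>y. u * y + y ^ 3 = v \<and> u + 3 * y\<^sup>2 = 0"
      then obtain y where y: "u * y + y ^ 3 = v" "u + 3 * y\<^sup>2 = 0" by blast
      have "\<not> inj_on cusp_form T'" if T': "open T'" "(u, y) \<in> T'" for T'
      proof
        assume inj: "inj_on cusp_form T'"
        obtain e' where e': "e' > 0" "cball u e' \<times> cball y e' \<subseteq> T'" by (rule open_bidisc[OF T']) (rule that)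
        \<comment> \<open>The points \<open>(u - e\<^sup>2, y + e)\<close> and
          \<open>(u - e\<^sup>2, y - e)\<close> have the same image, since the part odd in
          \<open>e\<close> is \<open>e * (u + 3 * y\<^sup>2) = 0\<close>. Taking \<open>e\<close> at
          most \<open>1\<close> also bounds the horizontal displacement \<open>e\<^sup>2\<close> by
          \<open>e'\<close>.\<close>
        define e where "e = min 1 e'"
        have e: "e > 0" "e \<le> e'" "e\<^sup>2 \<le> e'" using e'(1) power_decreasing[of 1 2 e] by (auto simp: e_def)
        have "(u - e\<^sup>2, y + e) \<in> T'" "(u - e\<^sup>2, y - e) \<in> T'"
          using e e'(2) by (auto simp: subset_iff dist_real_def)
        moreover have "cusp_form (u - e\<^sup>2, y + e) = cusp_form (u - e\<^sup>2, y - e)"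
        proof -
          have "u = - 3 * y\<^sup>2" using y(2) by simp
          then show ?thesis by (simp add: cusp_form_def algebra_simps power2_eq_square power3_eq_cube)
        qed
        ultimately show False using inj_onD[OF inj, of "(u - e\<^sup>2, y + e)" "(u - e\<^sup>2, y - e)"] e(1) by simp
      qed
      moreover have "(u, y) \<in> ball 0 \<delta> \<times> ball 0 r" "cusp_form (u, y) = \<zeta>"
        using small[OF u y(1)] u y(1) by (auto simp: cusp_form_def uv)
      ultimately show ?thesis by blast
    next
      assume c: "ecard {y. u * y + y ^ 3 = v} \<in> {1, 3}"
      have "{p\<in>ball 0 \<delta> \<times> ball 0 r. cusp_form p = \<zeta>} = Pair u ` {y. u * y + y ^ 3 = v}"
        using u small[OF u] by (auto simp: cusp_form_def uv)
      moreover have "ecard (Pair u ` {y. u * y + y ^ 3 = v}) = ecard {y. u * y + y ^ 3 = v}"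
        by (rule ecard_image) (auto simp: inj_on_def)
      ultimately have "ecard {p\<in>ball 0 \<delta> \<times> ball 0 r. cusp_form p = \<zeta>} \<in> {1, 3}" using c by (simp only:)
      then show ?thesis ..
    qed
  qed
  show "\<exists>N M. open N \<and> (0, 0) \<in> N \<and> N \<subseteq> T \<and> open M \<and> (0, 0) \<in> M \<and>
       (\<forall>\<zeta>\<in>M. ecard {p\<in>N. cusp_form p = \<zeta>} \<in> {1, 3} \<or> (\<exists>p\<in>N. cusp_form p = \<zeta> \<and> (\<forall>T'. open T' \<and> p \<in> T' \<longrightarrow> \<not> inj_on cusp_form T')))"
    by (rule exI[of _ "ball 0 \<delta> \<times> ball 0 r"], rule exI[of _ "ball 0 \<delta> \<times> ball 0 \<delta>"], intro conjI ballI open_Times open_ball cnt)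
      (use r in auto)
qed (simp add: cusp_form_def)

text \<open>The cusp is open at the origin, the fold is not.\<close>

lemma not_fold_and_cusp_model:
  assumes "topological_model W F w0 fold_form" "topological_model W F w0 cusp_form"
  shows False
proof -
  obtain U1 h1 h1' N1 H1 H1' where 1: "open U1" "(0, 0) \<in> U1" "open (h1 ` U1)" "homeomorphism U1 (h1 ` U1) h1 h1'" "h1 (0, 0) = w0"
     "open N1" "F ` h1 ` U1 \<subseteq> N1" "open (H1 ` N1)" "homeomorphism N1 (H1 ` N1) H1 H1'" and G1: "\<And>p. p \<in> U1 \<Longrightarrow> H1 (F (h1 p)) = fold_form p"
    using assms(1) unfolding topological_model_def by metis
  obtain U2 h2 h2' N2 H2 H2' where 2: "open U2" "(0, 0) \<in> U2" "homeomorphism U2 (h2 ` U2) h2 h2'" "h2 (0, 0) = w0"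
     "open N2" "F ` h2 ` U2 \<subseteq> N2" "homeomorphism N2 (H2 ` N2) H2 H2'" and G2: "\<And>p. p \<in> U2 \<Longrightarrow> H2 (F (h2 p)) = cusp_form p"
    using assms(2) unfolding topological_model_def by metis
  have oV: "open (U2 \<inter> h2 -` (h1 ` U1))" using continuous_open_preimage[OF _ 2(1) 1(3)] 2(3) by (simp add: homeomorphism_def)
  have zV: "(0, 0) \<in> U2 \<inter> h2 -` (h1 ` U1)" using 1 2 by (metis IntI imageI vimageI2)
  obtain r \<delta> :: real where \<delta>: "r > 0" "\<delta> > 0" "ball 0 \<delta> \<times> ball 0 r \<subseteq> U2 \<inter> h2 -` (h1 ` U1)"
    and small: "\<And>u v y. \<bar>u\<bar> < \<delta> \<Longrightarrow> \<bar>v\<bar> < \<delta> \<Longrightarrow> u * y + y ^ 3 = v \<Longrightarrow> \<bar>y\<bar> < r"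
    and ex: "\<And>u v. \<bar>u\<bar> < \<delta> \<Longrightarrow> \<bar>v\<bar> < \<delta> \<Longrightarrow> \<exists>y. u * y + y ^ 3 = v"
  proof (rule cusp_form_local[OF oV zV])
    fix r \<delta> :: real assume "r > 0" "\<delta> > 0" "ball 0 \<delta> \<times> ball 0 r \<subseteq> U2 \<inter> h2 -` (h1 ` U1)"
      "\<And>u v y. \<bar>u\<bar> < \<delta> \<Longrightarrow> \<bar>v\<bar> < \<delta> \<Longrightarrow> u * y + y ^ 3 = v \<Longrightarrow> \<bar>y\<bar> < r"
      "\<And>u v. \<bar>u\<bar> < \<delta> \<Longrightarrow> \<bar>v\<bar> < \<delta> \<Longrightarrow> \<exists>y. u * y + y ^ 3 = v"
    then show ?thesis by (rule that)
  qed
  let ?Z = "N2 \<inter> H2 -` (ball 0 \<delta> \<times> ball 0 \<delta>)"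
  have "continuous_on N2 H2" using 2(7) by (simp add: homeomorphism_def)
  then have oZ: "open ?Z" by (rule continuous_open_preimage[OF _ 2(5) open_Times[OF open_ball open_ball]])
  have H20: "H2 (F w0) = (0, 0)" using G2[OF 2(2)] 2(4) by (simp add: cusp_form_def)
  have H10: "H1 (F w0) = (0, 0)" using G1[OF 1(2)] 1(5) by (simp add: fold_form_def)
  have "F (h1 (0, 0)) \<in> N1" "F (h2 (0, 0)) \<in> N2" using 1(2,7) 2(2,6) by (blast+)
  then have FN: "F w0 \<in> N1" "F w0 \<in> N2" unfolding 1(5) 2(4) .
  \<comment> \<open>Every cubic with small \<open>u\<close> and \<open>v\<close> has a real root, so
    through the cusp model every value near \<open>F w0\<close> is taken, and at a point covered by
    the fold chart.\<close>
  have ZF: "\<exists>p\<in>U1. z = F (h1 p)" if z: "z \<in> ?Z" for z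
  proof -
    obtain u v where uv: "H2 z = (u, v)" by fastforce
    have u: "\<bar>u\<bar> < \<delta>" "\<bar>v\<bar> < \<delta>" using z uv by auto
    obtain y where y: "u * y + y ^ 3 = v" using ex[OF u] by blast
    have "(u, y) \<in> ball 0 \<delta> \<times> ball 0 r" using u small[OF u y] by auto
    then have "(u, y) \<in> U2 \<inter> h2 -` (h1 ` U1)" using \<delta>(3) by blast
    then have p: "(u, y) \<in> U2" "h2 (u, y) \<in> h1 ` U1" by (blast+)
    have "H2 (F (h2 (u, y))) = H2 z" using G2[OF p(1)] y uv by (simp add: cusp_form_def)
    moreover have "F (h2 (u, y)) \<in> N2" using 2(6) p(1) by auto
    ultimately have "F (h2 (u, y)) = z" using z homeomorphism_apply1[OF 2(7)] by (metis IntD1)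
    then show ?thesis using p(2) by auto
  qed
  have inj1: "inj_on H1 (N1 \<inter> ?Z)"
    by (rule inj_on_inverseI[of _ H1']) (use homeomorphism_apply1[OF 1(9)] in simp)
  have "open (H1 ` (N1 \<inter> ?Z))"
    by (rule invariance_of_domain[OF _ open_Int[OF 1(6) oZ] inj1])
      (use 1(9) in \<open>auto simp: homeomorphism_def intro: continuous_on_subset\<close>)
  moreover have "(0, 0) \<in> H1 ` (N1 \<inter> ?Z)"
    using FN H20 H10 \<delta>(2) by (intro image_eqI[of _ _ "F w0"]) auto
  ultimately obtain e where e: "e > 0" "cball 0 e \<times> cball 0 e \<subseteq> H1 ` (N1 \<inter> ?Z)"
    by (rule open_bidisc) (rule that)
  have "(0, - e) \<in> H1 ` (N1 \<inter> ?Z)" by (rule subsetD[OF e(2)]) (use e(1) in simp)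
  then obtain z where "z \<in> N1 \<inter> ?Z" "(0, - e) = H1 z" by blast
  then have z: "z \<in> ?Z" "H1 z = (0, - e)" by (simp_all only: Int_iff)
  obtain p where "p \<in> U1" "z = F (h1 p)" using ZF[OF z(1)] by blast
  then have "fold_form p = (0, - e)" using G1 z(2) by simp
  then have "(snd p)\<^sup>2 = - e" by (simp add: fold_form_def split: prod.splits)
  then show False using e(1) by (metis neg_less_0_iff_less not_less zero_le_power2)
qed

theorem theoremA1:
  "(\<forall>(W :: (complex \<times> complex) set) F w0.
      open W \<and> w0 \<in> W \<and> K_analytic_map F W \<and> regular_critical_point W F w0 \<longrightarrow>
        (\<exists>\<Gamma>. natural_parametrization W F w0 \<Gamma>) \<and>
        (\<forall>\<Gamma> \<Sigma> j. natural_parametrization W F w0 \<Gamma> \<and> \<Sigma> = F \<circ> \<Gamma> \<and> j = curve_order \<Sigma> \<longrightarrow>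
           (j = 1 \<longrightarrow> has_order_pair \<Sigma> 1 \<infinity>) \<and>
           (\<forall>n. 1 < n \<and> j = enat n \<longrightarrow> has_order_pair \<Sigma> n (enat (n + 1))) \<and>
           j + 1 = map_multiplicity W F w0))
   \<and>
   (\<forall>(W :: (real \<times> real) set) F w0.
      open W \<and> w0 \<in> W \<and> K_analytic_map F W \<and> regular_critical_point W F w0 \<longrightarrow>
        (\<exists>\<Gamma>. natural_parametrization W F w0 \<Gamma>) \<and>
        (\<forall>\<Gamma> \<Sigma> j. natural_parametrization W F w0 \<Gamma> \<and> \<Sigma> = F \<circ> \<Gamma> \<and> j = curve_order \<Sigma> \<longrightarrow>
           (j = 1 \<longrightarrow> has_order_pair \<Sigma> 1 \<infinity>) \<and>
           (\<forall>n. 1 < n \<and> j = enat n \<longrightarrow> has_order_pair \<Sigma> n (enat (n + 1))) \<and>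
           j + 1 = real_map_multiplicity F w0) \<and>
        (\<forall>m. real_map_multiplicity F w0 = enat m \<longrightarrow>
           (even m \<longleftrightarrow> topological_model W F w0 fold_form) \<and>
           (odd m \<longleftrightarrow> topological_model W F w0 cusp_form) \<and>
           (even m \<longrightarrow> local_preimage_counts W F w0 {0, 2}) \<and>
           (odd m \<longrightarrow> local_preimage_counts W F w0 {1, 3})))"
proof (intro conjI allI impI; (elim conjE)?)
  fix W :: "(complex \<times> complex) set" and F w0
  assume W: "open W" "K_analytic_map F W" and reg: "regular_critical_point W F w0"
  show "\<exists>\<Gamma>. natural_parametrization W F w0 \<Gamma>"
    by (rule natural_parametrization_exists_complex[OF W reg]) blast
  fix \<Gamma> \<Sigma> j assume nat: "natural_parametrization W F w0 \<Gamma>" and \<Sigma>: "\<Sigma> = F \<circ> \<Gamma>" and j: "j = curve_order \<Sigma>"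
  show "has_order_pair \<Sigma> 1 \<infinity>" if "j = 1"
    using has_order_pair_complex[OF W reg nat, of 1] that \<Sigma> j by (simp add: one_enat_def)
  show "has_order_pair \<Sigma> n (enat (n + 1))" if "1 < n" "j = enat n" for n
    using has_order_pair_complex[OF W reg nat, of n] that \<Sigma> j by simp
  show "j + 1 = map_multiplicity W F w0"
    using critical_value_multiplicity_complex[OF W reg nat] \<Sigma> j by simp
next
  fix W :: "(real \<times> real) set" and F w0
  assume W: "open W" "K_analytic_map F W" and w0: "w0 \<in> W" and reg: "regular_critical_point W F w0"
  obtain \<Gamma> where nat: "natural_parametrization W F w0 \<Gamma>" using natural_parametrization_exists_real[OF W reg] by blast
  show "\<exists>\<Gamma>. natural_parametrization W F w0 \<Gamma>" using nat by blast
  obtain U G S where X: "real_extension F G U S" and S: "w0 \<in> S"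
    by (rule real_extension_exists[OF W w0]) (rule that)
  note pair = real_extension.has_order_pair_ext[OF X reg S]
  show "has_order_pair \<Sigma> 1 \<infinity>" if "natural_parametrization W F w0 \<Gamma>" "\<Sigma> = F \<circ> \<Gamma>" "j = curve_order \<Sigma>" "j = 1" for \<Gamma> \<Sigma> j
    using pair[of \<Gamma> 1] that by (simp add: one_enat_def)
  show "has_order_pair \<Sigma> n (enat (n + 1))" if "natural_parametrization W F w0 \<Gamma>" "\<Sigma> = F \<circ> \<Gamma>" "j = curve_order \<Sigma>" "1 < n" "j = enat n" for \<Gamma> \<Sigma> j n
    using pair[of \<Gamma> n] that by simp
  show "j + 1 = real_map_multiplicity F w0" if "natural_parametrization W F w0 \<Gamma>" "\<Sigma> = F \<circ> \<Gamma>" "j = curve_order \<Sigma>" for \<Gamma> \<Sigma> j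
    using real_map_multiplicity_eq[OF W reg, of \<Gamma>] that by simp
  fix m assume m: "real_map_multiplicity F w0 = enat m"
  then have "curve_order (F \<circ> \<Gamma>) + 1 = enat m" using real_map_multiplicity_eq[OF W reg nat] by simp
  then obtain n where n: "curve_order (F \<circ> \<Gamma>) = enat n" "m = n + 1"
    by (cases "curve_order (F \<circ> \<Gamma>)") (auto simp: one_enat_def)
  have model: "topological_model W F w0 (if odd n then fold_form else cusp_form)"
    by (rule real_topological_model[OF W reg nat n(1)])
  \<comment> \<open>The model just found gives one direction for each parity; the converse holds
    because fold and cusp models exclude each other.\<close>
  show iff: "even m \<longleftrightarrow> topological_model W F w0 fold_form" "odd m \<longleftrightarrow> topological_model W F w0 cusp_form"
    using model not_fold_and_cusp_model[of W F w0] n(2) by (auto split: if_splits)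
  show "local_preimage_counts W F w0 {0, 2}" if "even m"
    using fold_preimage_counts[OF W] iff(1) that by blast
  show "local_preimage_counts W F w0 {1, 3}" if "odd m"
    using cusp_preimage_counts[OF W] iff(2) that by blast
qed

end
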